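(* Let $C$ be a smooth projective algebraic curve of genus $g \geq 2$ over an algebraically closed field. Let $r \geq 2$ be an integer and let $\delta_1, \ldots, \delta_r, a_1, \ldots, a_{r-1}, b_1, \ldots, b_{r-1}$ be rational numbers such that (i) $1 = \delta_1 < \delta_2 < \cdots < \delta_r$; (ii) $0 < a_1 < \cdots < a_{r-1}$; (iii) $a_1 + b_1 = 1$; (iv) $a_i \delta_{i+1} + b_i = a_{i+1}\delta_{i+1} + b_{i+1}$ for $1 \leq i \leq r-2$. Suppose that for every semistable vector bundle $E$ on $C$, of any rank $n \geq 1$ and any degree $d$, with $h^0(E) = k \geq 1$, writing $\mu = \frac{d}{n}$, the following condition holds: for every $1 \leq i \leq r-1$, $$\delta_i \leq \mu \leq \delta_{i+1} \ \Longrightarrow\ k \leq (a_i \mu + b_i)\, n .$$ Then the same condition holds for every coherent system on $C$ which is $\alpha$-semistable for some $\alpha > 0$ and has at least one section; that is, if $(E,V)$ is a coherent system on $C$ of type $(n,d,k)$ with $k \geq 1$ which is $\alpha$-semistable for some real $\alpha > 0$, and $\mu = \frac{d}{n}$, then for every $1 \leq i \leq r-1$, $$\delta_i \leq \mu \leq \delta_{i+1} \ \Longrightarrow\ k \leq (a_i \mu + b_i)\, n .$$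
   Context: A coherent system on $C$ of type $(n,d,k)$ is a pair $(E,V)$, where $E$ is a vector bundle on $C$ of rank $n \geq 1$ and degree $d$, and $V \subseteq H^0(C,E)$ is a linear subspace of dimension $k$. A coherent subsystem of $(E,V)$ is a pair $(F,W)$ with $F \subseteq E$ a subbundle and $W \subseteq V \cap H^0(C,F)$ a linear subspace; it is called proper if $F \neq 0$ and $(F,W) \neq (E,V)$. For a real number $\alpha$, the $\alpha$-slope of a coherent system $(E,V)$ of type $(n,d,k)$ is $\mu_\alpha(E,V) = \frac{d}{n} + \alpha \frac{k}{n}$. The coherent system $(E,V)$ is $\alpha$-semistable if $\mu_\alpha(F,W) \leq \mu_\alpha(E,V)$ for every proper coherent subsystem $(F,W)$ of $(E,V)$. Here $h^0(E) = \dim H^0(C,E)$, and semistability of a vector bundle is the usual slope semistability. *)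

theory Defs
  imports
    "HOL-Analysis.Analysis"
    "HOL-Library.Function_Algebras"
    "HOL-Computational_Algebra.Computational_Algebra"
    "Jordan_Normal_Form.Determinant"
begin

hide_const (open) Determinants.det

section \<open>Vector spaces of functions\<close>

definition fscale :: "'k::field \<Rightarrow> ('a \<Rightarrow> 'k) \<Rightarrow> ('a \<Rightarrow> 'k)" where
  "fscale c f = (\<lambda>x. c * f x)"

definition fscale2 :: "'k::field \<Rightarrow> ('a \<Rightarrow> 'b \<Rightarrow> 'k) \<Rightarrow> ('a \<Rightarrow> 'b \<Rightarrow> 'k)" where
  "fscale2 c s = (\<lambda>x. fscale c (s x))"

global_interpretation fn: vector_space "fscale :: 'k::field \<Rightarrow> ('a \<Rightarrow> 'k) \<Rightarrow> ('a \<Rightarrow> 'k)"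
  by unfold_locales (auto simp: fscale_def fun_eq_iff algebra_simps)

global_interpretation fn2: vector_space
    "fscale2 :: 'k::field \<Rightarrow> ('a \<Rightarrow> 'b \<Rightarrow> 'k) \<Rightarrow> ('a \<Rightarrow> 'b \<Rightarrow> 'k)"
  by unfold_locales (auto simp: fscale2_def fscale_def fun_eq_iff algebra_simps)


section \<open>Projective space and the Zariski topology\<close>

text \<open>A vector is a family of elements of the ground field indexed by the natural numbers; the
  vectors of \<open>k\<^sup>N\<^sup>+\<^sup>1\<close> are those vanishing at all indices greater than \<open>N\<close>. A point of projective
  space is a line through the origin with the origin removed, i.e. the set of all its homogeneous
  coordinate vectors.\<close>

type_synonym 'k vec = "nat \<Rightarrow> 'k"
type_synonym 'k point = "(nat \<Rightarrow> 'k) set"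

definition proj_space :: "nat \<Rightarrow> 'k::field point set" where
  "proj_space N = {{fscale c v | c. c \<noteq> 0} | v. v \<noteq> 0 \<and> (\<forall>i>N. v i = 0)}"

text \<open>Homogeneous polynomials of degree \<open>d\<close> in \<open>x\<^sub>0, \<dots>, x\<^sub>N\<close>, as functions.\<close>

definition forms :: "nat \<Rightarrow> nat \<Rightarrow> ('k::field vec \<Rightarrow> 'k) set" where
  "forms N d = {(\<lambda>v. \<Sum>m \<in> {m. (\<forall>i>N. m i = 0) \<and> (\<Sum>i\<le>N. m i) = d}. c m * (\<Prod>i\<le>N. v i ^ m i))
                | c :: (nat \<Rightarrow> nat) \<Rightarrow> 'k. True}"

definition zariski_proj :: "nat \<Rightarrow> 'k::field point topology" where
  "zariski_proj N = topology_generated_by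
     {{x \<in> proj_space N. \<forall>v\<in>x. F v \<noteq> 0} | F. F \<in> (\<Union>d. forms N d)}"

abbreviation zariski :: "nat \<Rightarrow> 'k::field point set \<Rightarrow> 'k point topology" where
  "zariski N C \<equiv> subtopology (zariski_proj N) C"

definition irreducible_closed :: "'a topology \<Rightarrow> 'a set \<Rightarrow> bool" where
  "irreducible_closed X Z \<longleftrightarrow> closedin X Z \<and> Z \<noteq> {} \<and>
     (\<forall>A B. closedin X A \<and> closedin X B \<and> Z \<subseteq> A \<union> B \<longrightarrow> Z \<subseteq> A \<or> Z \<subseteq> B)"

definition irreducible_chain :: "'a topology \<Rightarrow> nat \<Rightarrow> (nat \<Rightarrow> 'a set) \<Rightarrow> bool" where
  "irreducible_chain X l Z \<longleftrightarrow> (\<forall>i\<le>l. irreducible_closed X (Z i)) \<and> (\<forall>i<l. Z i \<subset> Z (Suc i))"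

definition has_krull_dim :: "'a topology \<Rightarrow> nat \<Rightarrow> bool" where
  "has_krull_dim X r \<longleftrightarrow> (\<exists>Z. irreducible_chain X r Z) \<and> (\<forall>l Z. irreducible_chain X l Z \<longrightarrow> l \<le> r)"


section \<open>Regular functions, tangent spaces, smooth curves, genus\<close>

text \<open>Here \<open>U\<close> is meant to be open in \<open>C\<close>; the values of \<open>f\<close> outside \<open>U\<close> are irrelevant.\<close>

definition regular_on :: "nat \<Rightarrow> 'k::field point set \<Rightarrow> 'k point set \<Rightarrow> ('k point \<Rightarrow> 'k) \<Rightarrow> bool" where
  "regular_on N C U f \<longleftrightarrow>
     (\<forall>x\<in>U. \<exists>W d F G. openin (zariski N C) W \<and> x \<in> W \<and> W \<subseteq> U \<and>
        F \<in> forms N d \<and> G \<in> forms N d \<and> (\<forall>y\<in>W. \<forall>v\<in>y. G v \<noteq> 0 \<and> f y = F v / G v))"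

definition regular_near :: "nat \<Rightarrow> 'k::field point set \<Rightarrow> 'k point \<Rightarrow> ('k point \<Rightarrow> 'k) set" where
  "regular_near N C x = {f. \<exists>U. openin (zariski N C) U \<and> x \<in> U \<and> regular_on N C U f}"

text \<open>The Zariski tangent space of \<open>C\<close> at \<open>x\<close>: the \<open>k\<close>-linear derivations \<open>O\<^sub>x \<rightarrow> k\<close> of the local
  ring at \<open>x\<close>. They are represented on functions regular near \<open>x\<close>, invariantly under equality of
  germs, and extended by zero to all other functions.\<close>

definition tangent_space :: "nat \<Rightarrow> 'k::field point set \<Rightarrow> 'k point \<Rightarrow> (('k point \<Rightarrow> 'k) \<Rightarrow> 'k) set" where
  "tangent_space N C x = {D.
     (\<forall>f. f \<notin> regular_near N C x \<longrightarrow> D f = 0) \<and>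
     (\<forall>f\<in>regular_near N C x. \<forall>g\<in>regular_near N C x.
        D (\<lambda>y. f y + g y) = D f + D g \<and>
        D (\<lambda>y. f y * g y) = f x * D g + g x * D f \<and>
        ((\<exists>U. openin (zariski N C) U \<and> x \<in> U \<and> (\<forall>y\<in>U. f y = g y)) \<longrightarrow> D f = D g)) \<and>
     (\<forall>f\<in>regular_near N C x. \<forall>c. D (\<lambda>y. c * f y) = c * D f)}"

text \<open>Irreducible closed subvarieties of projective space of dimension 1, nonsingular in the sense
  that the tangent space at every point has dimension 1.\<close>

definition smooth_projective_curve :: "nat \<Rightarrow> 'k::field point set \<Rightarrow> bool" where
  "smooth_projective_curve N C \<longleftrightarrow>
     irreducible_closed (zariski_proj N) C \<and> has_krull_dim (zariski N C) 1 \<and>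
     (\<forall>x\<in>C. fn.dim (tangent_space N C x) = 1)"

text \<open>A global regular differential 1-form attaches to each point of \<open>C\<close> a linear form on the
  tangent space, locally of the shape \<open>\<Sum> f\<^sub>i dg\<^sub>i\<close> with \<open>f\<^sub>i\<close>, \<open>g\<^sub>i\<close> regular. The genus is the
  dimension of the space of these.\<close>

definition regular_differentials ::
    "nat \<Rightarrow> 'k::field point set \<Rightarrow> ('k point \<Rightarrow> (('k point \<Rightarrow> 'k) \<Rightarrow> 'k) \<Rightarrow> 'k) set" where
  "regular_differentials N C = {\<omega>.
     (\<forall>x D. x \<notin> C \<or> D \<notin> tangent_space N C x \<longrightarrow> \<omega> x D = 0) \<and>
     (\<forall>x\<in>C. \<exists>U l f g. openin (zariski N C) U \<and> x \<in> U \<and>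
        (\<forall>i<l. regular_on N C U (f i) \<and> regular_on N C U (g i)) \<and>
        (\<forall>y\<in>U. \<forall>D\<in>tangent_space N C y. \<omega> y D = (\<Sum>i<(l::nat). f i y * D (g i))))}"

definition genus :: "nat \<Rightarrow> 'k::field point set \<Rightarrow> nat" where
  "genus N C = fn2.dim (regular_differentials N C)"


section \<open>Vector bundles\<close>

text \<open>A vector bundle is a locally trivial family of vector spaces. The fibres are
  finite-dimensional subspaces of the space of all sequences; up to isomorphism this is no
  restriction, as the fibres of an arbitrary bundle of rank \<open>n\<close> can be identified linearly, point
  by point, with \<open>k\<^sup>n\<close>. The algebraic structure, which these identifications need not respect, is
  carried by the sheaf of regular sections. Sections over \<open>U\<close> are extended by zero outside \<open>U\<close>.\<close>

record 'k vbundle =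
  fibre :: "'k point \<Rightarrow> 'k vec set"
  sections :: "'k point set \<Rightarrow> ('k point \<Rightarrow> 'k vec) set"

definition restrict_section :: "'k point set \<Rightarrow> ('k point \<Rightarrow> 'k::field vec) \<Rightarrow> ('k point \<Rightarrow> 'k vec)" where
  "restrict_section W s = (\<lambda>x. if x \<in> W then s x else 0)"

text \<open>\<open>e\<^sub>0, \<dots>, e\<^sub>n\<^sub>-\<^sub>1\<close> is a frame over the open set \<open>U\<close>, i.e. a trivialisation of the bundle
  over \<open>U\<close>.\<close>

definition frame ::
    "nat \<Rightarrow> 'k::field point set \<Rightarrow> nat \<Rightarrow> 'k vbundle \<Rightarrow> 'k point set \<Rightarrow> (nat \<Rightarrow> 'k point \<Rightarrow> 'k vec) \<Rightarrow> bool" where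
  "frame N C n E U e \<longleftrightarrow> openin (zariski N C) U \<and>
     (\<forall>y\<in>U. inj_on (\<lambda>i. e i y) {..<n} \<and> fn.independent ((\<lambda>i. e i y) ` {..<n}) \<and>
        fn.span ((\<lambda>i. e i y) ` {..<n}) = fibre E y) \<and>
     (\<forall>W. openin (zariski N C) W \<and> W \<subseteq> U \<longrightarrow>
        sections E W = {restrict_section W (\<lambda>y. \<Sum>i<n. fscale (f i y) (e i y)) | f.
                          \<forall>i<n. regular_on N C W (f i)})"

definition vector_bundle :: "nat \<Rightarrow> 'k::field point set \<Rightarrow> nat \<Rightarrow> 'k vbundle \<Rightarrow> bool" where
  "vector_bundle N C n E \<longleftrightarrow>
     (\<forall>x. x \<notin> C \<longrightarrow> fibre E x = {}) \<and>
     (\<forall>U. \<not> openin (zariski N C) U \<longrightarrow> sections E U = {}) \<and>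
     (\<forall>U. \<forall>s\<in>sections E U. (\<forall>x\<in>U. s x \<in> fibre E x) \<and> (\<forall>x. x \<notin> U \<longrightarrow> s x = 0)) \<and>
     (\<forall>U W s. openin (zariski N C) U \<and> openin (zariski N C) W \<and> W \<subseteq> U \<and> s \<in> sections E U
        \<longrightarrow> restrict_section W s \<in> sections E W) \<and>
     (\<forall>U s. openin (zariski N C) U \<and> (\<forall>x. x \<notin> U \<longrightarrow> s x = 0) \<and>
        (\<forall>x\<in>U. \<exists>W. openin (zariski N C) W \<and> x \<in> W \<and> W \<subseteq> U \<and> restrict_section W s \<in> sections E W)
        \<longrightarrow> s \<in> sections E U) \<and>
     (\<forall>x\<in>C. \<exists>U e. x \<in> U \<and> frame N C n E U e)"

text \<open>\<open>F\<close> is a subbundle of \<open>E\<close>: fibrewise a linear subspace, with the induced regular sections.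
  When \<open>F\<close> and \<open>E\<close> are vector bundles, the quotient \<open>E/F\<close> is then locally free.\<close>

definition subbundle :: "'k::field vbundle \<Rightarrow> 'k vbundle \<Rightarrow> bool" where
  "subbundle F E \<longleftrightarrow> (\<forall>x. fibre F x \<subseteq> fibre E x) \<and>
     (\<forall>U. sections F U = {s \<in> sections E U. \<forall>x\<in>U. s x \<in> fibre F x})"

abbreviation H0 :: "'k::field point set \<Rightarrow> 'k vbundle \<Rightarrow> ('k point \<Rightarrow> 'k vec) set" where
  "H0 C E \<equiv> sections E C"

definition h0 :: "'k::field point set \<Rightarrow> 'k vbundle \<Rightarrow> nat" where
  "h0 C E = fn2.dim (H0 C E)"


section \<open>Degree\<close>

text \<open>\<open>h\<close> is a function defined on a punctured neighbourhood of \<open>x\<close>; it has order \<open>m\<close> at \<open>x\<close> if it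
  is a unit times the \<open>m\<close>-th power of a local parameter, that is, of a \<open>t\<close> with \<open>t(x) = 0\<close> and
  nonzero differential at \<open>x\<close>.\<close>

definition has_order :: "nat \<Rightarrow> 'k::field point set \<Rightarrow> 'k point \<Rightarrow> ('k point \<Rightarrow> 'k) \<Rightarrow> int \<Rightarrow> bool" where
  "has_order N C x h m \<longleftrightarrow> (\<exists>W t u. openin (zariski N C) W \<and> x \<in> W \<and>
     regular_on N C W t \<and> t x = 0 \<and> (\<exists>D\<in>tangent_space N C x. D t \<noteq> 0) \<and>
     regular_on N C W u \<and> u x \<noteq> 0 \<and> (\<forall>y\<in>W - {x}. h y = (t y powi m) * u y))"

text \<open>Let \<open>e\<close> be a frame of \<open>E\<close> over a nonempty open set \<open>U\<close>, so that \<open>e\<^sub>0 \<and> \<dots> \<and> e\<^sub>n\<^sub>-\<^sub>1\<close> is a nonzero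
  rational section of the determinant line bundle \<open>\<Lambda>\<^sup>n E\<close>. Its order at \<open>x\<close> is that of \<open>det A\<close>,
  where \<open>e\<^sub>j = \<Sum>\<^sub>i A\<^sub>i\<^sub>j f\<^sub>i\<close> for a frame \<open>f\<close> of \<open>E\<close> near \<open>x\<close>. The degree of \<open>E\<close> is the degree of
  its determinant line bundle, i.e. of the divisor of any such rational section.\<close>

definition det_order ::
    "nat \<Rightarrow> 'k::field point set \<Rightarrow> nat \<Rightarrow> 'k vbundle \<Rightarrow> 'k point set \<Rightarrow> (nat \<Rightarrow> 'k point \<Rightarrow> 'k vec)
      \<Rightarrow> 'k point \<Rightarrow> int" where
  "det_order N C n E U e x = (THE m. \<exists>W f A. frame N C n E W f \<and> x \<in> W \<and>
     (\<forall>y\<in>W \<inter> U. \<forall>j<n. e j y = (\<Sum>i<n. fscale (A y i j) (f i y))) \<and>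
     has_order N C x (\<lambda>y. det (mat n n (\<lambda>(i, j). A y i j))) m)"

definition degree_bundle :: "nat \<Rightarrow> 'k::field point set \<Rightarrow> nat \<Rightarrow> 'k vbundle \<Rightarrow> int" where
  "degree_bundle N C n E = (THE d. \<exists>U e. U \<noteq> {} \<and> frame N C n E U e \<and>
     d = (\<Sum>x \<in> {x \<in> C. det_order N C n E U e x \<noteq> 0}. det_order N C n E U e x))"


section \<open>Semistable bundles and coherent systems\<close>

definition slope :: "int \<Rightarrow> nat \<Rightarrow> rat" where
  "slope d n = of_int d / of_nat n"

definition semistable :: "nat \<Rightarrow> 'k::field point set \<Rightarrow> nat \<Rightarrow> 'k vbundle \<Rightarrow> bool" where
  "semistable N C n E \<longleftrightarrow> vector_bundle N C n E \<and>
     (\<forall>m F. m \<ge> 1 \<and> vector_bundle N C m F \<and> subbundle F E \<and> F \<noteq> E \<longrightarrow>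
        slope (degree_bundle N C m F) m \<le> slope (degree_bundle N C n E) n)"

text \<open>\<open>(E, V)\<close> is a coherent system of type \<open>(n, d, k)\<close>.\<close>

definition coherent_system ::
    "nat \<Rightarrow> 'k::field point set \<Rightarrow> nat \<times> int \<times> nat \<Rightarrow> 'k vbundle \<times> ('k point \<Rightarrow> 'k vec) set \<Rightarrow> bool" where
  "coherent_system N C = (\<lambda>(n, d, k) (E, V). n \<ge> 1 \<and> vector_bundle N C n E \<and>
     degree_bundle N C n E = d \<and> fn2.subspace V \<and> V \<subseteq> H0 C E \<and> fn2.dim V = k)"

definition alpha_slope :: "real \<Rightarrow> nat \<times> int \<times> nat \<Rightarrow> real" where
  "alpha_slope \<alpha> = (\<lambda>(n, d, k). of_int d / of_nat n + \<alpha> * (of_nat k / of_nat n))"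

text \<open>The condition that the subsystem be nonzero is the rank condition in
  \<^const>\<open>coherent_system\<close>.\<close>

definition proper_subsystem ::
    "nat \<Rightarrow> 'k::field point set \<Rightarrow> nat \<times> int \<times> nat \<Rightarrow> 'k vbundle \<times> ('k point \<Rightarrow> 'k vec) set
      \<Rightarrow> 'k vbundle \<times> ('k point \<Rightarrow> 'k vec) set \<Rightarrow> bool" where
  "proper_subsystem N C \<tau> = (\<lambda>(F, W) (E, V). coherent_system N C \<tau> (F, W) \<and> subbundle F E \<and>
     W \<subseteq> V \<inter> H0 C F \<and> (F, W) \<noteq> (E, V))"

definition alpha_semistable ::
    "nat \<Rightarrow> 'k::field point set \<Rightarrow> real \<Rightarrow> nat \<times> int \<times> nat
      \<Rightarrow> 'k vbundle \<times> ('k point \<Rightarrow> 'k vec) set \<Rightarrow> bool" where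
  "alpha_semistable N C \<alpha> \<tau> EV \<longleftrightarrow> coherent_system N C \<tau> EV \<and>
     (\<forall>\<tau>' FW. proper_subsystem N C \<tau>' FW EV \<longrightarrow> alpha_slope \<alpha> \<tau>' \<le> alpha_slope \<alpha> \<tau>)"

end

theory Submission
  imports Defs
begin

text \<open>An \<open>\<alpha>\<close>-semistable coherent system \<open>(E, V)\<close> is compared with a semistable bundle \<open>Q\<close> of slope at most \<open>\<mu>\<close>
  such that \<open>k/n \<le> h\<^sup>0(Q)/rk Q\<close>. If \<open>E\<close> is semistable, take \<open>Q = E\<close>. Otherwise let \<open>F\<close> be a subbundle of maximal
  rank among those of slope larger than \<open>\<mu>\<close> and \<open>Q = E/F\<close>. The subsystem \<open>(F, W)\<close> with \<open>W = V \<inter> H\<^sup>0(F)\<close> shows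
  that \<open>dim W / rk F < k/n\<close>, and \<open>k - dim W \<le> h\<^sup>0(Q)\<close>. If the slope of \<open>Q\<close> is at least 1, then the hypothesis
  on semistable bundles applies to \<open>Q\<close>, and the piecewise linear bound increases with the slope. If it is less than 1,
  then \<open>h\<^sup>0(Q) \<le> rk Q\<close>, because a nonzero section vanishing at a point would generate a line subbundle of
  positive degree, and the bound is at least 1.

  The additivity of the degree, the existence of quotients and the degree of the line subbundle generated
  by a section rest on the fact that the local rings are discrete valuation rings and on the vanishing
  of the degrees of principal divisors, which follows by counting forms that vanish on multiples of a divisor.\<close>

section \<open>Graded commutative algebra over homogeneous polynomial functions\<close>

section \<open>Forms\<close>

text \<open>For the subsystem \<open>(F, W)\<close> the degree part of the \<alpha>-slope already
  exceeds \<mu>, so the \<alpha>-slope inequality can only hold if its section part is smaller;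
  \<alpha> > 0 then cancels, which is why every positive \<alpha> gives the same bound. F maximises
  the rank because ranks are bounded by that of E. If G destabilises E/F, then (E/F)/G has slope
  below that of E/F, hence below \<mu>; so the preimage of G has slope above \<mu> and larger rank
  than F.

  The obstacle is that \<open>degree_bundle\<close> and \<open>det_order\<close> are definite
  descriptions: no degree can be computed before the sum of the orders is known to be independent of
  the frame, and two frames differ by a rational function. Hence principal divisors come before all
  statements on bundles. Points are lines and forms are functions of coordinate vectors, so the
  algebra behind this (chain condition, common zeros of ideals, Nakayama) is done for graded
  families of functions. Fibres carry no algebraic structure, so everything regular about a bundle
  is expressed through germs of sections.\<close>

lemma fun_sum_apply: "(\<Sum>i\<in>A. f i) x = (\<Sum>i\<in>A. f i x)"
  by (induction A rule: infinite_finite_induct) auto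

definition exps :: "nat \<Rightarrow> nat \<Rightarrow> (nat \<Rightarrow> nat) set" where
  "exps N d = {m. (\<forall>i>N. m i = 0) \<and> (\<Sum>i\<le>N. m i) = d}"

definition mon :: "nat \<Rightarrow> (nat \<Rightarrow> nat) \<Rightarrow> 'k::field vec \<Rightarrow> 'k" where
  "mon N m v = (\<Prod>i\<le>N. v i ^ m i)"

lemma finite_exps: "finite (exps N d)"
proof (rule finite_subset)
  show "exps N d \<subseteq> {m. \<forall>i. (i \<in> {..N} \<longrightarrow> m i \<in> {..d}) \<and> (i \<notin> {..N} \<longrightarrow> m i = 0)}"
    unfolding exps_def by (auto intro: member_le_sum)
  show "finite \<dots>" by (rule finite_set_of_finite_funs) auto
qed

text \<open>Turns the explicit coefficient description into a span of finitely many monomial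
  functions. Closure properties, finite dimension and the induction over terms all come from
  this.\<close>

lemma forms_eq_span: "(forms N d :: ('k::field vec \<Rightarrow> 'k) set) = fn.span (mon N ` exps N d)" (is "?L = ?R")
proof
  have *: "(forms N d :: ('k vec \<Rightarrow> 'k) set) = {(\<lambda>v. \<Sum>m\<in>exps N d. c m * mon N m v) | c. True}"
    unfolding forms_def exps_def mon_def by simp
  show "?L \<subseteq> ?R"
  proof
    fix F :: "'k vec \<Rightarrow> 'k" assume "F \<in> ?L"
    then obtain c where "F = (\<lambda>v. \<Sum>m\<in>exps N d. c m * mon N m v)" using * by auto
    then have "F = (\<Sum>m\<in>exps N d. fscale (c m) (mon N m))"
      by (auto simp: fscale_def fun_sum_apply intro!: ext)
    then show "F \<in> fn.span (mon N ` exps N d)"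
      by (simp add: fn.span_sum fn.span_scale fn.span_base)
  qed
  show "?R \<subseteq> ?L"
  proof
    fix F :: "'k vec \<Rightarrow> 'k" assume "F \<in> fn.span (mon N ` exps N d)"
    then show "F \<in> ?L"
    proof (rule fn.span_induct_alt[where h = "\<lambda>F. F \<in> ?L"])
      have "(0 :: 'k vec \<Rightarrow> 'k) = (\<lambda>v. \<Sum>m\<in>exps N d. 0 * mon N m v)" by (simp add: fun_eq_iff)
      then show "0 \<in> ?L" unfolding * mem_Collect_eq by (intro exI[of _ "\<lambda>_. 0"] conjI TrueI)
    next
      fix a and x y :: "'k vec \<Rightarrow> 'k"
      assume x: "x \<in> mon N ` exps N d" and y: "y \<in> ?L"
      obtain c where c: "y = (\<lambda>v. \<Sum>m\<in>exps N d. c m * mon N m v)" using y * by blast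
      obtain m where m: "m \<in> exps N d" "x = mon N m" using x by blast
      have "fscale a x + y = (\<lambda>v. \<Sum>m'\<in>exps N d. (c m' + (if m' = m then a else 0)) * mon N m' v)"
      proof
        fix v
        have "(\<Sum>m'\<in>exps N d. (if m' = m then a else 0) * mon N m' v) = (\<Sum>m'\<in>exps N d. if m' = m then a * mon N m' v else 0)"
          by (rule sum.cong) auto
        also have "\<dots> = a * mon N m v" using m finite_exps[of N d] by (simp add: sum.delta)
        finally show "(fscale a x + y) v = (\<Sum>m'\<in>exps N d. (c m' + (if m' = m then a else 0)) * mon N m' v)"
          by (simp add: c m fscale_def distrib_right sum.distrib)
      qed
      then show "fscale a x + y \<in> ?L" unfolding * mem_Collect_eq
        by (intro exI[of _ "\<lambda>m'. c m' + (if m' = m then a else 0)"] conjI TrueI)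
    qed
  qed
qed

lemma subspace_forms: "fn.subspace (forms N d)"
  unfolding forms_eq_span by (rule fn.subspace_span)

lemmas forms_add = fn.subspace_add[OF subspace_forms]
  and forms_diff = fn.subspace_diff[OF subspace_forms]
  and forms_scale = fn.subspace_scale[OF subspace_forms]
  and forms_zero = fn.subspace_0[OF subspace_forms]
  and forms_sum = fn.subspace_sum[OF subspace_forms]

lemma mon_in_forms: "m \<in> exps N d \<Longrightarrow> mon N m \<in> forms N d"
  unfolding forms_eq_span by (auto intro: fn.span_base)

lemma forms_induct:
  assumes "F \<in> forms N d" "P 0"
    and "\<And>c m G. m \<in> exps N d \<Longrightarrow> G \<in> forms N d \<Longrightarrow> P G \<Longrightarrow> P (fscale c (mon N m) + G)"
  shows "P F"
proof -
  have "F \<in> fn.span (mon N ` exps N d)" using assms(1) by (simp add: forms_eq_span)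
  then have "F \<in> forms N d \<and> P F"
  proof (rule fn.span_induct_alt[where h = "\<lambda>F. F \<in> forms N d \<and> P F"])
    show "0 \<in> forms N d \<and> P 0" using assms(2) forms_zero by blast
    show "fscale c x + y \<in> forms N d \<and> P (fscale c x + y)"
      if "x \<in> mon N ` exps N d" "y \<in> forms N d \<and> P y" for c x y
      using that assms(3) forms_add forms_scale mon_in_forms by blast
  qed
  then show ?thesis by blast
qed

lemma exps_add: "m \<in> exps N d \<Longrightarrow> m' \<in> exps N e \<Longrightarrow> (\<lambda>i. m i + m' i) \<in> exps N (d + e)"
  by (auto simp: exps_def sum.distrib)

lemma mon_add: "mon N (\<lambda>i. m i + m' i) = mon N m * mon N m'"
  by (auto simp: mon_def fun_eq_iff power_add prod.distrib)

lemma forms_mult: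
  fixes F :: "'k::field vec \<Rightarrow> 'k"
  assumes "F \<in> forms N d" "G \<in> forms N e"
  shows "F * G \<in> forms N (d + e)"
  using assms(1)
proof (rule forms_induct[where P = "\<lambda>F. F * G \<in> forms N (d + e)"])
  show "0 * G \<in> forms N (d + e)" by (simp only: mult_zero_left forms_zero)
next
  fix c m and F' :: "'k vec \<Rightarrow> 'k"
  assume m: "m \<in> exps N d" and F': "F' * G \<in> forms N (d + e)"
  have "mon N m * G \<in> forms N (d + e)" using assms(2)
  proof (rule forms_induct[where P = "\<lambda>G. mon N m * G \<in> forms N (d + e)"])
    show "mon N m * 0 \<in> forms N (d + e)" by (simp add: forms_zero)
  next
    fix c' m' and G' :: "'k vec \<Rightarrow> 'k"
    assume m': "m' \<in> exps N e" and G': "mon N m * G' \<in> forms N (d + e)"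
    have *: "mon N m * (fscale c' (mon N m') + G') = fscale c' (mon N (\<lambda>i. m i + m' i)) + mon N m * G'"
      by (simp add: mon_add fun_eq_iff fscale_def algebra_simps)
    show "mon N m * (fscale c' (mon N m') + G') \<in> forms N (d + e)"
      unfolding * using mon_in_forms[OF exps_add[OF m m']] G' by (intro forms_add forms_scale)
  qed
  moreover have *: "(fscale c (mon N m) + F') * G = fscale c (mon N m * G) + F' * G"
    by (simp add: fun_eq_iff fscale_def algebra_simps)
  ultimately show "(fscale c (mon N m) + F') * G \<in> forms N (d + e)"
    unfolding * using F' forms_add forms_scale by blast
qed

abbreviation (input) coord :: "nat \<Rightarrow> 'k::field vec \<Rightarrow> 'k" where
  "coord i \<equiv> (\<lambda>v. v i)"

lemma forms_coord:
  assumes "i \<le> N" shows "(coord i :: 'k::field vec \<Rightarrow> 'k) \<in> forms N 1"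
proof -
  have "(\<Prod>l\<le>N. v l ^ (if l = i then 1 else 0)) = v i" for v :: "'k vec"
  proof -
    have "(\<Prod>l\<le>N. v l ^ (if l = i then 1 else 0)) = (\<Prod>l\<le>N. if l = i then v l else 1)"
      by (rule prod.cong) auto
    then show ?thesis using assms by (simp add: prod.delta)
  qed
  then have "(coord i :: 'k vec \<Rightarrow> 'k) = mon N (\<lambda>j. if j = i then 1 else 0)"
    unfolding mon_def by (intro ext) metis
  moreover have "(\<lambda>j. if j = i then 1 else 0) \<in> exps N 1" using assms by (auto simp: exps_def)
  ultimately show ?thesis using mon_in_forms by metis
qed

lemma forms_one: "(1 :: 'k::field vec \<Rightarrow> 'k) \<in> forms N 0"
proof -
  have "(1 :: 'k vec \<Rightarrow> 'k) = mon N (\<lambda>_. 0)" by (auto simp: mon_def fun_eq_iff)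
  moreover have "(\<lambda>_. 0) \<in> exps N 0" by (auto simp: exps_def)
  ultimately show ?thesis using mon_in_forms by metis
qed

lemma forms_power: "F \<in> forms N d \<Longrightarrow> F ^ n \<in> forms N (n * d)"
  by (induction n) (auto simp: forms_one intro: forms_mult)

lemma forms_coord_power: "i \<le> N \<Longrightarrow> coord i ^ n \<in> forms N n"
  using forms_power[OF forms_coord[of i N], of n] by simp

lemma fun_power_apply: "((F :: 'a \<Rightarrow> 'b::comm_semiring_1) ^ n) v = F v ^ n"
  by (induction n) auto

lemma forms_0: 
  fixes F :: "'k::field vec \<Rightarrow> 'k"
  assumes "F \<in> forms N 0" shows "\<exists>c. F = fscale c 1"
proof -
  have 1: "exps N 0 = {\<lambda>_. 0}"
  proof -
    have "m = (\<lambda>_. 0)" if "m \<in> exps N 0" for m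
    proof
      fix i show "m i = 0" using that by (cases "i \<le> N") (auto simp: exps_def)
    qed
    moreover have "(\<lambda>_. 0) \<in> exps N 0" by (auto simp: exps_def)
    ultimately show ?thesis by blast
  qed
  have 2: "mon N (\<lambda>_. 0) = (1 :: 'k vec \<Rightarrow> 'k)" by (auto simp: mon_def fun_eq_iff)
  show ?thesis using assms
  proof (rule forms_induct[where P = "\<lambda>F. \<exists>c. F = fscale c 1"])
    have "0 = fscale 0 (1 :: 'k vec \<Rightarrow> 'k)" by (auto simp: fscale_def fun_eq_iff)
    then show "\<exists>c. (0 :: 'k vec \<Rightarrow> 'k) = fscale c 1" by (rule exI)
  next
    fix c m and G :: "'k vec \<Rightarrow> 'k"
    assume m: "m \<in> exps N 0" and "\<exists>c. G = fscale c 1"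
    then obtain b where "G = fscale b 1" by blast
    then have "fscale c (mon N m) + G = fscale (c + b) 1" using m 1 2 by (simp add: fn.scale_left_distrib)
    then show "\<exists>b. fscale c (mon N m) + G = fscale b 1" by (rule exI)
  qed
qed

lemma forms_homog:
  fixes F :: "'k::field vec \<Rightarrow> 'k"
  assumes "F \<in> forms N d" shows "F (fscale c v) = c ^ d * F v"
  using assms
proof (rule forms_induct[where P = "\<lambda>F. F (fscale c v) = c ^ d * F v"])
  fix b m and G :: "'k vec \<Rightarrow> 'k"
  assume m: "m \<in> exps N d" and G: "G (fscale c v) = c ^ d * G v"
  have "mon N m (fscale c v) = c ^ d * mon N m v"
    using m by (auto simp: mon_def fscale_def exps_def power_mult_distrib prod.distrib power_sum)
  then show "(fscale b (mon N m) + G) (fscale c v) = c ^ d * (fscale b (mon N m) + G) v"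
    using G by (simp add: fscale_def algebra_simps)
qed simp

text \<open>Every monomial of positive degree is divisible by a coordinate. Inductions on the degree
  of a form go through this decomposition.\<close>

lemma forms_Suc:
  fixes F :: "'k::field vec \<Rightarrow> 'k"
  assumes "F \<in> forms N (Suc d)"
  shows "\<exists>H. (\<forall>i\<le>N. H i \<in> forms N d) \<and> F = (\<Sum>i\<le>N. coord i * H i)"
  using assms
proof (rule forms_induct[where P = "\<lambda>F. \<exists>H. (\<forall>i\<le>N. H i \<in> forms N d) \<and> F = (\<Sum>i\<le>N. coord i * H i)"])
  have "(0 :: 'k vec \<Rightarrow> 'k) = (\<Sum>i\<le>N. coord i * 0)" by simp
  then show "\<exists>H. (\<forall>i\<le>N. H i \<in> forms N d) \<and> (0 :: 'k vec \<Rightarrow> 'k) = (\<Sum>i\<le>N. coord i * H i)"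
    using forms_zero by (intro exI[of _ "\<lambda>_. 0"] conjI) blast+
next
  fix c m and G :: "'k vec \<Rightarrow> 'k"
  assume m: "m \<in> exps N (Suc d)" and G: "\<exists>H. (\<forall>i\<le>N. H i \<in> forms N d) \<and> G = (\<Sum>i\<le>N. coord i * H i)"
  obtain H where H: "\<forall>i\<le>N. H i \<in> forms N d" "G = (\<Sum>i\<le>N. coord i * H i)" using G by blast
  have "\<exists>j\<le>N. m j \<noteq> 0"
  proof (rule ccontr)
    assume "\<not> (\<exists>j\<le>N. m j \<noteq> 0)"
    then have "(\<Sum>i\<le>N. m i) = 0" by (intro sum.neutral) auto
    then show False using m by (simp add: exps_def)
  qed
  then obtain j where j: "j \<le> N" "m j \<noteq> 0" by auto
  define m' where "m' = m(j := m j - 1)"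
  define e where "e = (\<lambda>i. if i = j then 1 else (0::nat))"
  have me: "m = (\<lambda>i. e i + m' i)" using j by (auto simp: m'_def e_def fun_eq_iff)
  have se: "(\<Sum>i\<le>N. e i) = 1" using j by (auto simp: e_def)
  have m': "m' \<in> exps N d"
  proof -
    have "(\<Sum>i\<le>N. m i) = 1 + (\<Sum>i\<le>N. m' i)" using se by (simp add: me sum.distrib)
    then show ?thesis using m j by (auto simp: exps_def m'_def)
  qed
  have "mon N e = (coord j :: 'k vec \<Rightarrow> 'k)"
  proof
    fix v :: "'k vec"
    have "mon N e v = (\<Prod>l\<le>N. if l = j then v l else 1)" unfolding mon_def
      by (rule prod.cong) (auto simp: e_def)
    then show "mon N e v = v j" using j by simp
  qed
  then have mj: "mon N m = (coord j :: 'k vec \<Rightarrow> 'k) * mon N m'" unfolding me mon_add by simp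
  define H' where "H' = H(j := H j + fscale c (mon N m'))"
  have "(\<Sum>i\<le>N. coord i * H' i) = (\<Sum>i\<le>N. coord i * H i + (if i = j then coord i * fscale c (mon N m') else 0))"
    by (rule sum.cong) (auto simp: H'_def algebra_simps)
  also have "\<dots> = G + coord j * fscale c (mon N m')"
    using j by (simp add: sum.distrib H(2))
  also have "\<dots> = fscale c (mon N m) + G" unfolding mj by (auto simp: fscale_def fun_eq_iff)
  finally have eq: "fscale c (mon N m) + G = (\<Sum>i\<le>N. coord i * H' i)" by (rule sym)
  have "H' i \<in> forms N d" if "i \<le> N" for i
  proof (cases "i = j")
    case True
    have "H j + fscale c (mon N m') \<in> forms N d" using H(1) m' j forms_add forms_scale mon_in_forms by blast
    then show ?thesis using True by (simp add: H'_def)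
  qed (use H(1) that in \<open>simp add: H'_def\<close>)
  then show "\<exists>H. (\<forall>i\<le>N. H i \<in> forms N d) \<and> fscale c (mon N m) + G = (\<Sum>i\<le>N. coord i * H i)"
    using eq by blast
qed

section \<open>Graded ideals and the ascending chain condition\<close>

text \<open>A homogeneous ideal is encoded as the family of its homogeneous pieces, so that
  inclusion of ideals is the pointwise order \<open>\<le>\<close> on functions.\<close>

definition graded_ideal :: "nat \<Rightarrow> (nat \<Rightarrow> ('k::field vec \<Rightarrow> 'k) set) \<Rightarrow> bool" where
  "graded_ideal N J \<longleftrightarrow> (\<forall>d. J d \<subseteq> forms N d \<and> fn.subspace (J d)) \<and>
     (\<forall>d F e G. F \<in> J d \<longrightarrow> G \<in> forms N e \<longrightarrow> G * F \<in> J (e + d))"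

lemma graded_idealD:
  assumes "graded_ideal N J"
  shows "F \<in> J d \<Longrightarrow> F \<in> forms N d" "fn.subspace (J d)"
    "F \<in> J d \<Longrightarrow> G \<in> forms N e \<Longrightarrow> G * F \<in> J (e + d)"
  using assms by (auto simp: graded_ideal_def)

text \<open>Forms of the next degree are generated by the coordinates over those of the present one.
  An ideal that is full in one degree is therefore full in all later ones, and
  \<open>J d \<noteq> forms N d\<close> for all \<open>d\<close> says that \<open>J\<close> contains
  no power of the ideal of the coordinates.\<close>

lemma graded_ideal_full:
  assumes "graded_ideal N J" "J d = forms N d"
  shows "J (d + e) = forms N (d + e)"
proof (induction e)
  case (Suc e)
  have "F \<in> J (d + Suc e)" if F: "F \<in> forms N (d + Suc e)" for F
  proof -
    obtain H where H: "\<forall>i\<le>N. H i \<in> forms N (d + e)" "F = (\<Sum>i\<le>N. coord i * H i)"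
      using forms_Suc[of F N "d + e"] F by auto
    have "coord i * H i \<in> J (1 + (d + e))" if "i \<le> N" for i
      using H(1) Suc that assms(1) forms_coord graded_idealD(3) by blast
    then show ?thesis unfolding H(2) by (auto intro!: fn.subspace_sum graded_idealD(2)[OF assms(1)])
  qed
  then show ?case using graded_idealD(1)[OF assms(1)] by auto
qed (use assms in auto)

text \<open>One coordinate at a time, each step passing to a monotone subsequence. A decreasing
  sequence of naturals is constant from some index on, so that after dropping a beginning every
  coordinate is increasing.\<close>

lemma dickson_aux:
  fixes m :: "nat \<Rightarrow> nat \<Rightarrow> nat"
  shows "\<exists>\<phi>. strict_mono \<phi> \<and> (\<forall>i<n. incseq (\<lambda>k. m (\<phi> k) i))"
proof (induction n)
  case 0 show ?case by (intro exI[of _ id]) (auto simp: strict_mono_def)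
next
  case (Suc n)
  then obtain \<phi> where \<phi>: "strict_mono \<phi>" "\<forall>i<n. incseq (\<lambda>k. m (\<phi> k) i)" by auto
  obtain \<psi> where \<psi>: "strict_mono \<psi>" "monoseq (\<lambda>k. m (\<phi> (\<psi> k)) n)"
    using seq_monosub[of "\<lambda>k. m (\<phi> k) n"] by auto
  show ?case
  proof (cases "incseq (\<lambda>k. m (\<phi> (\<psi> k)) n)")
    case True
    have "incseq (\<lambda>k. m (\<phi> (\<psi> k)) i)" if "i < n" for i
      using \<phi>(2) that \<psi>(1) unfolding incseq_def by (simp add: strict_mono_less_eq)
    then show ?thesis using True \<phi> \<psi>
      by (intro exI[of _ "\<phi> \<circ> \<psi>"]) (auto simp: less_Suc_eq strict_mono_def)
  next
    case False
    then have dec: "decseq (\<lambda>k. m (\<phi> (\<psi> k)) n)" using \<psi>(2) by (auto simp: monoseq_iff)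
    \<comment> \<open>The least value of the decreasing sequence; from the index \<open>k\<close>
      where it is attained the sequence stays there.\<close>
    define w where "w = (LEAST w. \<exists>k. m (\<phi> (\<psi> k)) n = w)"
    have "\<exists>k. m (\<phi> (\<psi> k)) n = w" unfolding w_def by (rule LeastI_ex) auto
    then obtain k where k: "m (\<phi> (\<psi> k)) n = w" by auto
    have c: "m (\<phi> (\<psi> l)) n = w" if "k \<le> l" for l
    proof (rule antisym)
      show "m (\<phi> (\<psi> l)) n \<le> w" using dec that k by (auto simp: decseq_def)
      show "w \<le> m (\<phi> (\<psi> l)) n" unfolding w_def by (rule Least_le) auto
    qed
    define g where "g = (\<lambda>l. \<phi> (\<psi> (k + l)))"
    have "strict_mono g" using \<phi>(1) \<psi>(1) by (auto simp: g_def strict_mono_def)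
    moreover have "incseq (\<lambda>l. m (g l) i)" if "i < n" for i
      using \<phi>(2) that \<psi>(1) unfolding incseq_def g_def by (simp add: strict_mono_less_eq)
    moreover have "incseq (\<lambda>l. m (g l) n)" using c by (auto simp: incseq_def g_def)
    ultimately show ?thesis by (intro exI[of _ g]) (auto simp: less_Suc_eq)
  qed
qed

lemma dickson:
  fixes m :: "nat \<Rightarrow> nat \<Rightarrow> nat"
  obtains k l where "k < l" "\<And>i. i \<le> N \<Longrightarrow> m k i \<le> m l i"
proof -
  obtain \<phi> where \<phi>: "strict_mono \<phi>" "\<forall>i<Suc N. incseq (\<lambda>k. m (\<phi> k) i)"
    using dickson_aux[of "Suc N" m] by auto
  have "m (\<phi> 0) i \<le> m (\<phi> 1) i" if "i \<le> N" for i
    using \<phi>(2) that by (auto simp: incseq_def)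
  moreover have "\<phi> 0 < \<phi> 1" using \<phi>(1) by (auto simp: strict_mono_def)
  ultimately show ?thesis using that by blast
qed

text \<open>Comparing exponents through this code, which is injective and multiplicative, gives a monomial order.\<close>

definition code :: "nat \<Rightarrow> (nat \<Rightarrow> nat) \<Rightarrow> nat" where
  "code N m = (\<Prod>i\<le>N. enumerate {p. prime p} i ^ m i)"

lemma prime_enumerate: "prime (enumerate {p::nat. prime p} i)"
  using enumerate_in_set[OF primes_infinite] by auto

lemma code_pos: "code N m > 0"
  unfolding code_def by (intro prod_pos) (use prime_enumerate prime_gt_0_nat in auto)

lemma code_add: "code N (\<lambda>i. m i + m' i) = code N m * code N m'"
  by (auto simp: code_def power_add prod.distrib)

text \<open>Unique factorisation: the exponent \<open>m i\<close> is the multiplicity of the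
  \<open>i\<close>-th prime in the code.\<close>

lemma code_inj:
  assumes "code N m = code N m'" "i \<le> N" shows "m i = m' i"
proof -
  let ?e = "enumerate {p::nat. prime p}"
  have inj: "inj ?e" using strict_mono_enumerate[OF primes_infinite] strict_mono_imp_inj_on by blast
  have *: "multiplicity (?e i) (code N m) = m i" for m
  proof -
    have "code N m = (\<Prod>p\<in>?e ` {..N}. p ^ m (inv_into UNIV ?e p))"
      unfolding code_def by (subst prod.reindex) (use inj in \<open>auto simp: inj_def inj_on_def\<close>)
    also have "multiplicity (?e i) \<dots> = m (inv_into UNIV ?e (?e i))"
      by (subst multiplicity_prod_prime_powers) (use assms(2) prime_enumerate in auto)
    finally show ?thesis using inj by simp
  qed
  show ?thesis using *[of m] *[of m'] assms(1) by simp
qed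

lemma code_inj_exps:
  assumes "m \<in> exps N d" "m' \<in> exps N d'" "code N m = code N m'" shows "m = m'"
proof
  fix i show "m i = m' i"
    using assms code_inj[of N m m' i] by (cases "i \<le> N") (auto simp: exps_def)
qed

text \<open>Plays the role of a bound on the leading monomial: forms in which only monomials with
  code below \<open>M\<close> occur.\<close>

definition lowspan :: "nat \<Rightarrow> nat \<Rightarrow> nat \<Rightarrow> ('k::field vec \<Rightarrow> 'k) set" where
  "lowspan N d M = fn.span (mon N ` {m \<in> exps N d. code N m < M})"

lemma forms_lowspan: "F \<in> forms N d \<Longrightarrow> \<exists>M. F \<in> lowspan N d M"
proof -
  assume F: "F \<in> forms N d"
  let ?M = "Suc (Max (code N ` exps N d))"
  have "{m \<in> exps N d. code N m < ?M} = exps N d"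
    using finite_exps[of N d] by (auto simp: less_Suc_eq_le)
  then show ?thesis using F unfolding lowspan_def forms_eq_span by metis
qed

text \<open>By injectivity of the code at most one monomial has code exactly \<open>M\<close>; the
  term split off is the leading term.\<close>

lemma lowspan_Suc:
  assumes "F \<in> lowspan N d (Suc M)" "F \<notin> lowspan N d M"
  obtains c m where "m \<in> exps N d" "code N m = M" "c \<noteq> 0" "F - fscale c (mon N m) \<in> lowspan N d M"
proof -
  have "\<exists>m. m \<in> exps N d \<and> code N m = M"
  proof (rule ccontr)
    assume "\<not> ?thesis"
    then have "{m \<in> exps N d. code N m < Suc M} = {m \<in> exps N d. code N m < M}" by (auto simp: less_Suc_eq)
    then show False using assms unfolding lowspan_def by (simp only:)
  qed
  then obtain m where m: "m \<in> exps N d" "code N m = M" by auto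
  have "{m \<in> exps N d. code N m < Suc M} = insert m {m \<in> exps N d. code N m < M}"
    using m code_inj_exps by (auto simp: less_Suc_eq)
  then have "F \<in> fn.span (insert (mon N m) (mon N ` {m \<in> exps N d. code N m < M}))"
    using assms(1) by (simp add: lowspan_def)
  then obtain c where c: "F - fscale c (mon N m) \<in> lowspan N d M"
    unfolding lowspan_def fn.span_insert by auto
  moreover have "c \<noteq> 0" using c assms(2) by auto
  ultimately show ?thesis using m that by blast
qed

text \<open>The order is compatible with multiplication by a monomial because codes multiply and are
  positive.\<close>

lemma lowspan_mult:
  fixes F :: "'k::field vec \<Rightarrow> 'k"
  assumes "F \<in> lowspan N d M" "e \<in> exps N a"
  shows "mon N e * F \<in> lowspan N (d + a) (M * code N e)"
proof -
  let ?A = "{m \<in> exps N d. code N m < M}"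
  let ?B = "fn.span (mon N ` {m \<in> exps N (d + a). code N m < M * code N e}) :: ('k vec \<Rightarrow> 'k) set"
  have "mon N e * F \<in> ?B" using assms(1)[unfolded lowspan_def]
  proof (rule fn.span_induct_alt[where h = "\<lambda>F. mon N e * F \<in> ?B"])
    show "mon N e * 0 \<in> ?B" by (simp add: fn.span_zero)
  next
    fix c and x y :: "'k vec \<Rightarrow> 'k"
    assume x: "x \<in> mon N ` ?A" and y: "mon N e * y \<in> ?B"
    obtain m where m: "m \<in> exps N d" "code N m < M" "x = mon N m" using x by blast
    have *: "mon N e * (fscale c x + y) = fscale c (mon N (\<lambda>i. m i + e i)) + mon N e * y"
      by (simp add: mon_add m fun_eq_iff fscale_def algebra_simps)
    have "code N (\<lambda>i. m i + e i) < M * code N e" using m code_pos[of N e] by (simp add: code_add)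
    then have "mon N (\<lambda>i. m i + e i) \<in> ?B" using m assms(2) exps_add by (intro fn.span_base) blast
    then show "mon N e * (fscale c x + y) \<in> ?B" unfolding * using y fn.span_add fn.span_scale by blast
  qed
  then show ?thesis unfolding lowspan_def .
qed

text \<open>The basis theorem by way of leading monomials. At each step \<open>k\<close> a form
  entering at that step is chosen with leading monomial of least code. By Dickson's lemma the
  leading monomial for some \<open>k\<close> divides the one for a later \<open>l\<close>; the
  leading term of the later form is cancelled by a multiple of the earlier form, which already lies
  in \<open>J l\<close>. What remains enters at step \<open>l\<close> too, but has a smaller leading
  monomial.\<close>

lemma graded_ideal_acc_seq:
  fixes J :: "nat \<Rightarrow> nat \<Rightarrow> ('k::field vec \<Rightarrow> 'k) set"
  assumes gi: "\<And>k. graded_ideal N (J k)" and mono: "\<And>k. J k < J (Suc k)"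
  shows False
proof -
  have le: "J k d \<subseteq> J l d" if "k \<le> l" for k l d
  proof -
    have "J k \<le> J (Suc k)" for k using mono[of k] by (rule less_imp_le)
    then have "J k \<le> J l" using that by (rule lift_Suc_mono_le)
    then show ?thesis by (rule le_funD)
  qed
  define Q where "Q k M \<longleftrightarrow> (\<exists>d F. F \<in> J (Suc k) d \<and> F \<notin> J k d \<and> F \<in> lowspan N d M)" for k M
  have exQ: "\<exists>M. Q k M" for k
  proof -
    obtain d F where F: "F \<in> J (Suc k) d" "F \<notin> J k d" using mono[of k] by (auto simp: less_le_not_le le_fun_def)
    then have "F \<in> forms N d" using graded_idealD(1)[OF gi] by blast
    then show ?thesis using forms_lowspan F unfolding Q_def by blast
  qed
  \<comment> \<open>The least bound for forms that lie in \<open>J (Suc k)\<close> but not in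
    \<open>J k\<close>. It is the successor of the code of a leading monomial, since
    \<open>lowspan\<close> uses a strict inequality.\<close>
  define L where "L k = (LEAST M. Q k M)" for k
  have QL: "Q k (L k)" for k unfolding L_def by (rule LeastI_ex[OF exQ])
  have QL': "\<not> Q k M" if "M < L k" for k M using that not_less_Least unfolding L_def by blast
  have "\<forall>k. \<exists>d F c m. F \<in> J (Suc k) d \<and> F \<notin> J k d \<and> m \<in> exps N d \<and> Suc (code N m) = L k \<and> c \<noteq> 0 \<and>
           F - fscale c (mon N m) \<in> lowspan N d (code N m)"
  proof
    fix k
    obtain d F where F: "F \<in> J (Suc k) d" "F \<notin> J k d" "F \<in> lowspan N d (L k)" using QL[of k] Q_def by auto
    have "L k \<noteq> 0"
    proof
      assume "L k = 0"
      then have "F = 0" using F(3) by (simp add: lowspan_def)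
      then show False using F(2) graded_idealD(2)[OF gi] fn.subspace_0 by blast
    qed
    then obtain M where M: "L k = Suc M" using not0_implies_Suc by blast
    have "F \<notin> lowspan N d M" using QL'[of M k] F M unfolding Q_def by auto
    then show "\<exists>d F c m. F \<in> J (Suc k) d \<and> F \<notin> J k d \<and> m \<in> exps N d \<and> Suc (code N m) = L k \<and> c \<noteq> 0 \<and>
           F - fscale c (mon N m) \<in> lowspan N d (code N m)"
      using F M by (metis lowspan_Suc)
  qed
  then obtain d F c m where X: "\<And>k. F k \<in> J (Suc k) (d k)" "\<And>k. F k \<notin> J k (d k)" "\<And>k. m k \<in> exps N (d k)"
    "\<And>k. Suc (code N (m k)) = L k" "\<And>k. c k \<noteq> (0::'k)"
    "\<And>k. F k - fscale (c k) (mon N (m k)) \<in> lowspan N (d k) (code N (m k))" by metis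
  obtain k l where kl: "k < l" "\<And>i. i \<le> N \<Longrightarrow> m k i \<le> m l i" using dickson by metis
  define e where "e = (\<lambda>i. m l i - m k i)"
  have me: "m l = (\<lambda>i. m k i + e i)"
  proof
    fix i show "m l i = m k i + e i"
      using kl(2)[of i] X(3)[of k] X(3)[of l] by (cases "i \<le> N") (auto simp: e_def exps_def)
  qed
  define a where "a = (\<Sum>i\<le>N. e i)"
  have e: "e \<in> exps N a" using X(3)[of l] unfolding a_def exps_def by (auto simp: e_def)
  have "m l \<in> exps N (d k + a)" using exps_add[OF X(3)[of k] e] me by simp
  then have dl: "d l = d k + a" using X(3)[of l] by (auto simp: exps_def)
  \<comment> \<open>The factor \<open>c l / c k\<close> makes the leading terms cancel;
    \<open>mon N e\<close> is the quotient of the two leading monomials.\<close>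
  define G where "G = F l - fscale (c l / c k) (mon N e * F k)"
  have "mon N e * F k \<in> J (Suc k) (a + d k)"
    using graded_idealD(3)[OF gi] X(1) mon_in_forms[OF e] by blast
  then have Fk: "mon N e * F k \<in> J l (d l)" using le[of "Suc k" l] kl(1) dl by (auto simp: add.commute)
  then have "fscale (c l / c k) (mon N e * F k) \<in> J l (d l)"
    using graded_idealD(2)[OF gi] fn.subspace_scale by blast
  moreover have "F l = G + fscale (c l / c k) (mon N e * F k)" unfolding G_def by (rule diff_add_cancel[symmetric])
  ultimately have G1: "G \<notin> J l (d l)" using X(2)[of l] graded_idealD(2)[OF gi, of l "d l"] fn.subspace_add by metis
  have "fscale (c l / c k) (mon N e * F k) \<in> J (Suc l) (d l)"
    using le[of l "Suc l" "d l"] \<open>fscale (c l / c k) (mon N e * F k) \<in> J l (d l)\<close> by auto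
  then have G2: "G \<in> J (Suc l) (d l)"
    unfolding G_def using X(1)[of l] graded_idealD(2)[OF gi, of "Suc l" "d l"] by (intro fn.subspace_diff)
  have "fscale (c l / c k) (mon N e * (F k - fscale (c k) (mon N (m k))))
      = fscale (c l / c k) (mon N e * F k) - fscale (c l) (mon N (m l))"
    using X(5)[of k] unfolding me mon_add by (intro ext) (simp add: fscale_def field_simps)
  then have "G = (F l - fscale (c l) (mon N (m l))) - fscale (c l / c k) (mon N e * (F k - fscale (c k) (mon N (m k))))"
    unfolding G_def by (simp only:) (simp add: algebra_simps)
  moreover have "mon N e * (F k - fscale (c k) (mon N (m k))) \<in> lowspan N (d l) (code N (m l))"
    using lowspan_mult[OF X(6)[of k] e] by (simp add: me[symmetric] dl code_add[symmetric])
  ultimately have "G \<in> lowspan N (d l) (code N (m l))"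
    using X(6)[of l] unfolding lowspan_def by (simp only: fn.span_diff fn.span_scale)
  then have "Q l (code N (m l))" using G1 G2 unfolding Q_def by blast
  then show False using QL'[of "code N (m l)" l] X(4)[of l] by auto
qed

text \<open>Without a maximal member, choosing a strictly larger member again and again would
  contradict the chain condition.\<close>

lemma graded_ideal_maximal:
  assumes "J \<in> \<J>" "\<And>J. J \<in> \<J> \<Longrightarrow> graded_ideal N J"
  obtains J where "J \<in> \<J>" "\<And>J'. J' \<in> \<J> \<Longrightarrow> J \<le> J' \<Longrightarrow> J' = J"
proof (rule ccontr)
  assume "\<not> thesis"
  then have "\<forall>J\<in>\<J>. \<exists>J'\<in>\<J>. J < J'" using that by (metis order_le_less)
  then obtain s where s: "\<And>J. J \<in> \<J> \<Longrightarrow> s J \<in> \<J> \<and> J < s J" by metis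
  define K where "K n = (s ^^ n) J" for n
  have "K n \<in> \<J>" for n by (induction n) (auto simp: K_def assms s)
  then show False using graded_ideal_acc_seq[of N K] assms(2) s by (auto simp: K_def)
qed

section \<open>The projective Nullstellensatz\<close>

text \<open>The degree \<open>d\<close> piece of the ideal generated by \<open>J\<close> and a form
  \<open>A\<close> of degree \<open>a\<close>. Below degree \<open>a\<close> the cofactor has to be
  0, because \<open>d - a\<close> is truncated there.\<close>

definition adjoin :: "nat \<Rightarrow> (nat \<Rightarrow> ('k::field vec \<Rightarrow> 'k) set) \<Rightarrow> nat \<Rightarrow> ('k vec \<Rightarrow> 'k) \<Rightarrow> nat \<Rightarrow> ('k vec \<Rightarrow> 'k) set" where
  "adjoin N J a A d = {F + H * A | F H. F \<in> J d \<and> (if a \<le> d then H \<in> forms N (d - a) else H = 0)}"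

lemma adjoin_ideal:
  fixes A :: "'k::field vec \<Rightarrow> 'k"
  assumes J: "graded_ideal N J" and A: "A \<in> forms N a"
  shows "graded_ideal N (adjoin N J a A)"
  unfolding graded_ideal_def
proof (intro conjI allI impI subsetI)
  note JD = graded_idealD[OF J]
  fix d
  show "F \<in> forms N d" if FA: "F \<in> adjoin N J a A d" for F :: "'k vec \<Rightarrow> 'k"
  proof -
    obtain F0 H where F: "F = F0 + H * A" "F0 \<in> J d" "if a \<le> d then H \<in> forms N (d - a) else H = 0"
      using FA unfolding adjoin_def by blast
    have "H * A \<in> forms N d"
    proof (cases "a \<le> d")
      case True then show ?thesis using F(3) forms_mult[OF _ A, of H "d - a"] by simp
    next
      case False then have "H = 0" using F(3) by simp
      then show ?thesis by (simp only: mult_zero_left forms_zero)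
    qed
    then show ?thesis unfolding F(1) using JD(1)[OF F(2)] by (intro forms_add)
  qed
  show "fn.subspace (adjoin N J a A d)"
  proof (rule fn.subspaceI)
    have "0 = 0 + 0 * A" by simp
    moreover have "if a \<le> d then 0 \<in> forms N (d - a) else (0 :: 'k vec \<Rightarrow> 'k) = 0" using forms_zero by metis
    ultimately show "0 \<in> adjoin N J a A d" unfolding adjoin_def using fn.subspace_0[OF JD(2)] by blast
  next
    fix x y assume "x \<in> adjoin N J a A d" "y \<in> adjoin N J a A d"
    then obtain F H F' H' where *: "x = F + H * A" "F \<in> J d" "if a \<le> d then H \<in> forms N (d - a) else H = 0"
      "y = F' + H' * A" "F' \<in> J d" "if a \<le> d then H' \<in> forms N (d - a) else H' = 0"
      unfolding adjoin_def by blast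
    have "x + y = (F + F') + (H + H') * A" unfolding * by (simp only: algebra_simps)
    moreover have "F + F' \<in> J d" using * JD(2) fn.subspace_add by blast
    moreover have "if a \<le> d then H + H' \<in> forms N (d - a) else H + H' = 0" using * forms_add by auto
    ultimately show "x + y \<in> adjoin N J a A d" unfolding adjoin_def by blast
  next
    fix c x assume "x \<in> adjoin N J a A d"
    then obtain F H where *: "x = F + H * A" "F \<in> J d" "if a \<le> d then H \<in> forms N (d - a) else H = 0"
      unfolding adjoin_def by blast
    have "fscale c x = fscale c F + fscale c H * A" unfolding * by (auto simp: fscale_def fun_eq_iff algebra_simps)
    moreover have "fscale c F \<in> J d" using * JD(2) fn.subspace_scale by blast
    moreover have "if a \<le> d then fscale c H \<in> forms N (d - a) else fscale c H = 0"
      using * forms_scale fn.scale_zero_right by (metis (full_types))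
    ultimately show "fscale c x \<in> adjoin N J a A d" unfolding adjoin_def by blast
  qed
next
  note JD = graded_idealD[OF J]
  fix d e and F G :: "'k vec \<Rightarrow> 'k" assume "F \<in> adjoin N J a A d" and G: "G \<in> forms N e"
  then obtain F0 H where F: "F = F0 + H * A" "F0 \<in> J d" "if a \<le> d then H \<in> forms N (d - a) else H = 0"
    unfolding adjoin_def by blast
  show "G * F \<in> adjoin N J a A (e + d)"
  proof (cases "a \<le> d")
    case True
    have "G * F = G * F0 + (G * H) * A" unfolding F(1) by (simp only: algebra_simps)
    moreover have "G * H \<in> forms N (e + d - a)" using F(3) True forms_mult[OF G, of H "d - a"] by simp
    ultimately show ?thesis unfolding adjoin_def using JD(3)[OF F(2) G] True by auto
  next
    case False
    then have "G * F = G * F0 + 0 * A" using F by simp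
    moreover have "if a \<le> e + d then 0 \<in> forms N (e + d - a) else (0 :: 'k vec \<Rightarrow> 'k) = 0" using forms_zero by metis
    ultimately show ?thesis unfolding adjoin_def using JD(3)[OF F(2) G] by blast
  qed
qed

lemma adjoin_ge:
  fixes A :: "'k::field vec \<Rightarrow> 'k"
  shows "J \<le> adjoin N J a A"
proof (rule le_funI, rule subsetI)
  fix d F assume "F \<in> J d"
  moreover have "F = F + 0 * A" by simp
  moreover have "if a \<le> d then 0 \<in> forms N (d - a) else (0 :: 'k vec \<Rightarrow> 'k) = 0" using forms_zero by metis
  ultimately show "F \<in> adjoin N J a A d" unfolding adjoin_def by blast
qed

lemma adjoin_self:
  fixes A :: "'k::field vec \<Rightarrow> 'k"
  assumes "graded_ideal N J" shows "A \<in> adjoin N J a A a"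
proof -
  have "A = 0 + 1 * A" by simp
  moreover have "if a \<le> a then (1 :: 'k vec \<Rightarrow> 'k) \<in> forms N (a - a) else 1 = (0 :: 'k vec \<Rightarrow> 'k)" using forms_one by simp
  ultimately show ?thesis unfolding adjoin_def using fn.subspace_0[OF graded_idealD(2)[OF assms]] by blast
qed

text \<open>Division by \<open>A\<close> is possible from degree \<open>d\<close> on, and is
  repeated until degree \<open>d - 1\<close> is reached. Modulo \<open>J\<close> all higher degrees
  thus come from one finite-dimensional space, which later forces linear relations.\<close>

lemma forms_mod_coord_power:
  assumes J: "graded_ideal N J" and A: "A \<in> forms N 1" and full: "adjoin N J 1 A d = forms N d" and d: "d \<ge> 1"
    and F: "F \<in> forms N (d - 1 + l)"
  shows "\<exists>H\<in>forms N (d - 1). F - A ^ l * H \<in> J (d - 1 + l)"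
  using F
proof (induction l arbitrary: F)
  case 0
  have "F - A ^ 0 * F = 0" by simp
  then have "F - A ^ 0 * F \<in> J (d - 1 + 0)" using fn.subspace_0[OF graded_idealD(2)[OF J]] by metis
  moreover have "F \<in> forms N (d - 1)" using 0 by (simp only: add_0_right)
  ultimately show ?case by (rule bexI)
next
  case (Suc l)
  have "adjoin N J 1 A (d + l) = forms N (d + l)"
    using graded_ideal_full[OF adjoin_ideal[OF J A] full] .
  moreover have e: "d + l = d - 1 + Suc l" using d by simp
  ultimately have "F \<in> adjoin N J 1 A (d + l)" using Suc.prems by metis
  then obtain F0 H where F: "F = F0 + H * A" "F0 \<in> J (d + l)" "H \<in> forms N (d + l - 1)"
    unfolding adjoin_def using d by auto
  have "d + l - 1 = d - 1 + l" using d by simp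
  then obtain H' where H': "H' \<in> forms N (d - 1)" "H - A ^ l * H' \<in> J (d - 1 + l)" using F(3) Suc.IH by metis
  have "A * (H - A ^ l * H') \<in> J (1 + (d - 1 + l))" using graded_idealD(3)[OF J H'(2) A] .
  then have "A * (H - A ^ l * H') \<in> J (d + l)" using d by simp
  then have "F0 + A * (H - A ^ l * H') \<in> J (d + l)" using F(2) graded_idealD(2)[OF J] fn.subspace_add by blast
  moreover have "F - A ^ Suc l * H' = F0 + A * (H - A ^ l * H')" unfolding F(1) by (simp add: algebra_simps)
  ultimately have "F - A ^ Suc l * H' \<in> J (d - 1 + Suc l)" using e by metis
  then show ?case using H'(1) by (rule bexI)
qed

lemma prime_ideal_power:
  fixes A :: "'k::field vec \<Rightarrow> 'k"
  assumes prime: "\<And>A B a b. A \<in> forms N a \<Longrightarrow> B \<in> forms N b \<Longrightarrow> A * B \<in> J (a + b) \<Longrightarrow> A \<in> J a \<or> B \<in> J b"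
    and A: "A \<in> forms N a" "A \<notin> J a" and one: "1 \<notin> J 0"
  shows "A ^ l \<notin> J (l * a)"
proof (induction l)
  case 0
  have "A ^ 0 = 1" "0 * a = 0" by simp_all
  then show ?case using one by metis
next
  case (Suc l)
  show ?case
  proof
    assume "A ^ Suc l \<in> J (Suc l * a)"
    then have "A * A ^ l \<in> J (a + l * a)" by (simp only: power_Suc mult_Suc)
    then show False using prime[OF A(1) forms_power[OF A(1)]] A(2) Suc by blast
  qed
qed

text \<open>The form is the homogenisation of \<open>p\<close> in \<open>x_j\<close> and
  \<open>x_i\<close>. A root \<open>r\<close> of \<open>p\<close>, which exists over an
  algebraically closed field, splits off the factor \<open>x_j - r x_i\<close>; by primality either
  this factor or the cofactor, of degree one less, lies in \<open>J\<close>.\<close>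

lemma binary_form_linear_factor:
  fixes J :: "nat \<Rightarrow> ('k::alg_closed_field vec \<Rightarrow> 'k) set"
  assumes J: "graded_ideal N J" and ij: "i \<le> N" "j \<le> N"
    and prime: "\<And>A B a b. A \<in> forms N a \<Longrightarrow> B \<in> forms N b \<Longrightarrow> A * B \<in> J (a + b) \<Longrightarrow> A \<in> J a \<or> B \<in> J b"
    and i: "coord i \<notin> J 1" and one: "1 \<notin> J 0"
    and p: "p \<noteq> 0" "degree p \<le> m" "(\<lambda>v. \<Sum>l\<le>m. coeff p l * (v j ^ l * v i ^ (m - l))) \<in> J m"
  shows "\<exists>c. coord j - fscale c (coord i) \<in> J 1"
  using p
proof (induction m arbitrary: p)
  case 0
  then obtain c where c: "p = [:c:]" using degree_eq_zeroE by auto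
  have "fscale (inverse c) (\<lambda>v. \<Sum>l\<le>0. coeff p l * (v j ^ l * v i ^ (0 - l))) \<in> J 0"
    using 0 graded_idealD(2)[OF J] fn.subspace_scale by blast
  moreover have "fscale (inverse c) (\<lambda>v. \<Sum>l\<le>0. coeff p l * (v j ^ l * v i ^ (0 - l))) = 1"
    using 0 c by (auto simp: fscale_def fun_eq_iff)
  ultimately show ?case using one by simp
next
  case (Suc m)
  show ?case
  proof (cases "degree p = 0")
    case True
    \<comment> \<open>Here the degree \<open>m\<close> exceeds that of \<open>p\<close>: a constant
      polynomial homogenises to a multiple of a power of \<open>x_i\<close>, which a prime ideal
      without \<open>x_i\<close> cannot contain.\<close>
    then obtain c where c: "p = [:c:]" using degree_eq_zeroE by auto
    have "(\<Sum>l\<le>Suc m. coeff p l * (v j ^ l * v i ^ (Suc m - l))) = c * v i ^ Suc m" for v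
    proof -
      have "(\<Sum>l\<le>Suc m. coeff p l * (v j ^ l * v i ^ (Suc m - l))) = (\<Sum>l\<le>Suc m. if l = 0 then c * v i ^ Suc m else 0)"
        by (rule sum.cong) (auto simp: c coeff_pCons split: nat.splits)
      then show ?thesis by simp
    qed
    then have "coord i ^ Suc m = fscale (inverse c) (\<lambda>v. \<Sum>l\<le>Suc m. coeff p l * (v j ^ l * v i ^ (Suc m - l)))"
      using Suc.prems c by (intro ext) (simp add: fscale_def fun_power_apply field_simps del: power_Suc sum.atMost_Suc)
    moreover have "fscale (inverse c) (\<lambda>v. \<Sum>l\<le>Suc m. coeff p l * (v j ^ l * v i ^ (Suc m - l))) \<in> J (Suc m)"
      using fn.subspace_scale[OF graded_idealD(2)[OF J] Suc.prems(3)] .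
    ultimately have *: "coord i ^ Suc m \<in> J (Suc m)" by (simp only:)
    have "coord i ^ Suc m \<notin> J (Suc m * 1)"
      using prime forms_coord[OF ij(1)] i one by (rule prime_ideal_power)
    then show ?thesis using * by simp
  next
    case False
    then obtain r where "poly p r = 0" using alg_closed_imp_poly_has_root[of p] by auto
    then obtain q where q: "p = [:-r, 1:] * q" by (meson dvdE poly_eq_0_iff_dvd)
    have q0: "q \<noteq> 0" using Suc.prems q by auto
    have "degree p = degree [:-r, 1:] + degree q" unfolding q by (rule degree_mult_eq) (use q0 in auto)
    then have dq: "degree q \<le> m" using Suc.prems by simp
    define Q where "Q = (\<lambda>v::'k vec. \<Sum>l\<le>m. coeff q l * (v j ^ l * v i ^ (m - l)))"
    have Qf: "Q \<in> forms N m"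
    proof -
      have "Q = (\<Sum>l\<le>m. fscale (coeff q l) (coord j ^ l * coord i ^ (m - l)))"
        unfolding Q_def by (intro ext) (simp add: fun_sum_apply fscale_def fun_power_apply)
      moreover have "coord j ^ l * coord i ^ (m - l) \<in> forms N m" if "l \<le> m" for l
        using forms_mult[OF forms_coord_power[OF ij(2), of l] forms_coord_power[OF ij(1), of "m - l"]] that by simp
      ultimately show ?thesis by (auto intro!: forms_sum forms_scale)
    qed
    have "(\<Sum>l\<le>Suc m. coeff p l * (v j ^ l * v i ^ (Suc m - l))) = (v j - r * v i) * Q v" for v
    proof -
      have cp: "coeff p l = (case l of 0 \<Rightarrow> 0 | Suc l' \<Rightarrow> coeff q l') - r * coeff q l" for l
        unfolding q by (simp add: coeff_pCons split: nat.splits)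
      have "(\<Sum>l\<le>Suc m. coeff p l * (v j ^ l * v i ^ (Suc m - l))) =
        (\<Sum>l\<le>Suc m. (case l of 0 \<Rightarrow> 0 | Suc l' \<Rightarrow> coeff q l') * (v j ^ l * v i ^ (Suc m - l))) -
        (\<Sum>l\<le>Suc m. r * coeff q l * (v j ^ l * v i ^ (Suc m - l)))"
        unfolding cp by (simp only: left_diff_distrib sum_subtractf)
      also have "(\<Sum>l\<le>Suc m. (case l of 0 \<Rightarrow> 0 | Suc l' \<Rightarrow> coeff q l') * (v j ^ l * v i ^ (Suc m - l))) = v j * Q v"
        unfolding Q_def by (simp only: sum.atMost_Suc_shift) (simp add: sum_distrib_left algebra_simps)
      also have "(\<Sum>l\<le>Suc m. r * coeff q l * (v j ^ l * v i ^ (Suc m - l))) = r * v i * Q v"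
      proof -
        have "coeff q (Suc m) = 0" using dq by (simp add: coeff_eq_0)
        moreover have "(\<Sum>l\<le>m. r * coeff q l * (v j ^ l * v i ^ (Suc m - l))) = (\<Sum>l\<le>m. r * v i * (coeff q l * (v j ^ l * v i ^ (m - l))))"
          by (rule sum.cong) (auto simp: Suc_diff_le)
        ultimately show ?thesis unfolding Q_def by (simp add: sum_distrib_left)
      qed
      finally show ?thesis by (simp add: algebra_simps)
    qed
    then have "(\<lambda>v. \<Sum>l\<le>Suc m. coeff p l * (v j ^ l * v i ^ (Suc m - l))) = (coord j - fscale r (coord i)) * Q"
      by (intro ext) (simp add: fscale_def)
    then have "(coord j - fscale r (coord i)) * Q \<in> J (1 + m)" using Suc.prems(3) by simp
    moreover have "coord j - fscale r (coord i) \<in> forms N 1"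
      using forms_coord ij by (intro forms_diff forms_scale) auto
    ultimately have "coord j - fscale r (coord i) \<in> J 1 \<or> Q \<in> J m" using prime Qf by blast
    then show ?thesis using Suc.IH[OF q0 dq] unfolding Q_def by blast
  qed
qed

text \<open>There are \<open>m + 1\<close> vectors, more than the spanning set has elements.
  Coefficients are attached to indices rather than to vectors, so a repetition
  \<open>h a = h b\<close> gives the relation with coefficients 1 and -1.\<close>

lemma dependent_sequence:
  fixes h :: "nat \<Rightarrow> 'a \<Rightarrow> 'k::field"
  assumes "finite B" "\<And>l. h l \<in> fn.span B" "m \<ge> card B"
  obtains c where "(\<Sum>l\<le>m. fscale (c l) (h l)) = 0" "\<exists>l\<le>m. c l \<noteq> 0"
proof (cases "inj_on h {..m}")
  case True
  have "fn.dependent (h ` {..m})"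
  proof (rule ccontr)
    assume "\<not> ?thesis"
    then have "card (h ` {..m}) \<le> card B"
      using fn.independent_span_bound[of B "h ` {..m}"] assms by blast
    then show False using True assms(3) by (simp add: card_image)
  qed
  then obtain u where u: "\<exists>v\<in>h ` {..m}. u v \<noteq> 0" "(\<Sum>v\<in>h ` {..m}. fscale (u v) v) = 0"
    using fn.dependent_finite[of "h ` {..m}"] by auto
  have "(\<Sum>l\<le>m. fscale (u (h l)) (h l)) = 0" using u(2) True by (simp add: sum.reindex)
  then show ?thesis using u(1) that[of "\<lambda>l. u (h l)"] by auto
next
  case False
  then obtain a b where ab: "a \<le> m" "b \<le> m" "a \<noteq> b" "h a = h b" by (auto simp: inj_on_def)
  define c where "c l = (if l = a then 1 else if l = b then -1 else (0::'k))" for l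
  have "(\<Sum>l\<le>m. fscale (c l) (h l)) = (\<Sum>l\<in>{a,b}. fscale (c l) (h l))"
    using ab by (intro sum.mono_neutral_right) (auto simp: c_def fn.scale_zero_left)
  also have "\<dots> = 0" using ab by (simp add: c_def fn.scale_minus_left)
  finally show ?thesis using that[of c] ab(1) by (metis c_def one_neq_zero)
qed

text \<open>A maximal proper graded ideal is prime and contains, with a coordinate \<open>x\<^sub>i\<close> outside it, a binary
  form in \<open>x\<^sub>i\<close> and \<open>x\<^sub>j\<close> for every \<open>j\<close>, hence a linear factor \<open>x\<^sub>j - c\<^sub>j x\<^sub>i\<close>.\<close>

theorem projective_nullstellensatz:
  fixes J :: "nat \<Rightarrow> ('k::alg_closed_field vec \<Rightarrow> 'k) set"
  assumes J: "graded_ideal N J" and proper: "\<And>d. J d \<noteq> forms N d"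
  obtains v where "v \<noteq> 0" "\<forall>i>N. v i = 0" "\<And>d F. F \<in> J d \<Longrightarrow> F v = 0"
proof -
  obtain K where K: "K \<in> {K. graded_ideal N K \<and> J \<le> K \<and> (\<forall>d. K d \<noteq> forms N d)}"
    and Kmax: "\<And>J'. J' \<in> {K. graded_ideal N K \<and> J \<le> K \<and> (\<forall>d. K d \<noteq> forms N d)} \<Longrightarrow> K \<le> J' \<Longrightarrow> J' = K"
    using graded_ideal_maximal[of J "{K. graded_ideal N K \<and> J \<le> K \<and> (\<forall>d. K d \<noteq> forms N d)}" N] J proper by blast
  then have Kg: "graded_ideal N K" and JK: "J \<le> K" and Kp: "\<And>d. K d \<noteq> forms N d" by auto
  note KD = graded_idealD[OF Kg]
  have full: "\<exists>d. adjoin N K a A d = forms N d" if A: "A \<in> forms N a" "A \<notin> K a" for A a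
  proof (rule ccontr)
    assume "\<not> ?thesis"
    moreover have "J \<le> adjoin N K a A" using JK adjoin_ge order_trans by blast
    ultimately have "adjoin N K a A = K" using adjoin_ideal[OF Kg A(1)] by (intro Kmax adjoin_ge) simp
    then show False using adjoin_self[OF Kg, of A a] A(2) by simp
  qed
  have prime: "A \<in> K a \<or> B \<in> K b" if A: "A \<in> forms N a" and B: "B \<in> forms N b" and AB: "A * B \<in> K (a + b)" for A B a b
  proof (rule ccontr)
    assume "\<not> ?thesis"
    then obtain d e where d: "adjoin N K a A d = forms N d" and e: "adjoin N K b B e = forms N e"
      using full A B by metis
    \<comment> \<open>In degree \<open>?M + b\<close> division by \<open>A\<close> leaves a cofactor
      of degree \<open>e + d + b\<close>, where division by \<open>B\<close> is possible as well and
      leaves one of degree \<open>e + d\<close>. So every form of this degree is an element of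
      \<open>K\<close> plus a multiple of \<open>A * B\<close>, that is, an element of
      \<open>K\<close>.\<close>
    let ?M = "d + (a + e)"
    have d': "adjoin N K a A ?M = forms N ?M" and e': "adjoin N K b B (e + d) = forms N (e + d)"
      using graded_ideal_full adjoin_ideal[OF Kg] A B d e by blast+
    have e'': "adjoin N K b B (e + d + b) = forms N (e + d + b)" using graded_ideal_full adjoin_ideal[OF Kg] B e' by blast
    have "F \<in> K (?M + b)" if F: "F \<in> forms N (?M + b)" for F
    proof -
      have "adjoin N K a A (?M + b) = forms N (?M + b)" using graded_ideal_full[OF adjoin_ideal[OF Kg A] d'] .
      then obtain F0 H where F0: "F = F0 + H * A" "F0 \<in> K (?M + b)" "H \<in> forms N (?M + b - a)"
      proof -
        have "F \<in> adjoin N K a A (?M + b)" using F \<open>adjoin N K a A (?M + b) = _\<close> by (simp only:)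
        then obtain F0 H where "F = F0 + H * A" "F0 \<in> K (?M + b)" "H \<in> forms N (?M + b - a)"
          unfolding adjoin_def by auto
        then show thesis using that by blast
      qed
      have "?M + b - a = e + d + b" by simp
      then have "H \<in> adjoin N K b B (e + d + b)" using F0(3) e'' by metis
      then obtain F1 H1 where F1: "H = F1 + H1 * B" "F1 \<in> K (e + d + b)" "H1 \<in> forms N (e + d)"
        unfolding adjoin_def by auto
      have "F = F0 + A * F1 + H1 * (A * B)" unfolding F0(1) F1(1) by (simp only: algebra_simps)
      moreover have "A * F1 \<in> K (?M + b)" using KD(3)[OF F1(2) A] by (simp add: ac_simps)
      moreover have "H1 * (A * B) \<in> K (?M + b)" using KD(3)[OF AB F1(3)] by (simp add: ac_simps)
      ultimately show ?thesis using F0(2) KD(2) fn.subspace_add by metis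
    qed
    then show False using Kp KD(1) by blast
  qed
  have one: "1 \<notin> K 0"
  proof
    assume 1: "1 \<in> K 0"
    have "F \<in> K 0" if F: "F \<in> forms N 0" for F
    proof -
      obtain c where "F = fscale c 1" using forms_0[OF F] by blast
      then show ?thesis using 1 KD(2) fn.subspace_scale by blast
    qed
    then show False using Kp KD(1) by blast
  qed
  have "\<exists>i\<le>N. coord i \<notin> K 1"
  proof (rule ccontr)
    assume *: "\<not> ?thesis"
    have "F \<in> K 1" if F: "F \<in> forms N 1" for F
    proof -
      obtain H where H: "\<forall>i\<le>N. H i \<in> forms N 0" "F = (\<Sum>i\<le>N. coord i * H i)"
        using forms_Suc[of F N 0] F by auto
      have "coord i * H i \<in> K 1" if "i \<le> N" for i
      proof -
        have "H i * coord i \<in> K (0 + 1)" using KD(3) * H(1) that by blast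
        then show ?thesis by (simp add: mult.commute)
      qed
      then show ?thesis unfolding H(2) using KD(2) by (intro fn.subspace_sum) auto
    qed
    then show False using Kp[of 1] KD(1) by blast
  qed
  then obtain i where i: "i \<le> N" "coord i \<notin> K 1" by blast
  have ci: "coord i \<in> forms N 1" using forms_coord[OF i(1)] .
  obtain d where "adjoin N K 1 (coord i) d = forms N d" using full[OF ci i(2)] by blast
  then have d: "adjoin N K 1 (coord i) (d + 1) = forms N (d + 1)" using graded_ideal_full adjoin_ideal[OF Kg ci] by blast
  have "\<exists>c. coord j - fscale c (coord i) \<in> K 1" if j: "j \<le> N" for j
  proof -
    define B where "B = (mon N ` exps N d :: ('k vec \<Rightarrow> 'k) set)"
    \<comment> \<open>Modulo \<open>K\<close> each product of degree \<open>m = d + l\<close> in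
      \<open>x_j\<close> and \<open>x_i\<close> becomes \<open>x_i ^ l\<close> times a form of
      degree \<open>d\<close>. There are \<open>m + 1\<close> such products and at most
      \<open>l\<close> dimensions, hence a relation, and its coefficients make up the polynomial
      \<open>p\<close>.\<close>
    define l where "l = card B"
    define m where "m = d + l"
    have "\<exists>h\<in>forms N d. coord j ^ a * coord i ^ (m - a) - coord i ^ l * h \<in> K m" if "a \<le> m" for a
    proof -
      have "coord j ^ a * coord i ^ (m - a) \<in> forms N m"
        using forms_mult[OF forms_coord_power[OF j, of a] forms_coord_power[OF i(1), of "m - a"]] that by simp
      then show ?thesis using forms_mod_coord_power[OF Kg ci d, of "coord j ^ a * coord i ^ (m - a)" l] unfolding m_def by simp
    qed
    then obtain h0 where h0: "\<And>a. a \<le> m \<Longrightarrow> h0 a \<in> forms N d" 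
      "\<And>a. a \<le> m \<Longrightarrow> coord j ^ a * coord i ^ (m - a) - coord i ^ l * h0 a \<in> K m" by metis
    define h where "h a = (if a \<le> m then h0 a else 0)" for a
    have h: "h a \<in> fn.span B" for a
      using h0(1)[of a] forms_zero unfolding h_def B_def forms_eq_span[symmetric] by metis
    have "finite B" unfolding B_def using finite_exps by blast
    then obtain c where c: "(\<Sum>a\<le>m. fscale (c a) (h a)) = 0" "\<exists>a\<le>m. c a \<noteq> 0"
      using dependent_sequence[of B h m] h unfolding m_def l_def by auto
    define p where "p = (\<Sum>a\<le>m. monom (c a) a)"
    have cp: "coeff p a = (if a \<le> m then c a else 0)" for a
      unfolding p_def by (simp add: coeff_sum)
    have "p \<noteq> 0" using c(2) cp by (metis coeff_0)
    moreover have "degree p \<le> m" by (rule degree_le) (simp add: cp)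
    moreover have "(\<lambda>v. \<Sum>a\<le>m. coeff p a * (v j ^ a * v i ^ (m - a))) \<in> K m"
    proof -
      have "(\<lambda>v. \<Sum>a\<le>m. coeff p a * (v j ^ a * v i ^ (m - a)))
         = (\<Sum>a\<le>m. fscale (c a) (coord j ^ a * coord i ^ (m - a)))"
        by (intro ext) (simp add: cp fun_sum_apply fscale_def fun_power_apply)
      also have "\<dots> = (\<Sum>a\<le>m. fscale (c a) (coord j ^ a * coord i ^ (m - a) - coord i ^ l * h0 a))
           + coord i ^ l * (\<Sum>a\<le>m. fscale (c a) (h a))"
        by (intro ext) (simp add: fun_sum_apply fscale_def fun_power_apply sum_distrib_left sum.distrib[symmetric] h_def algebra_simps)
      also have "\<dots> = (\<Sum>a\<le>m. fscale (c a) (coord j ^ a * coord i ^ (m - a) - coord i ^ l * h0 a))"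
        unfolding c(1) by simp
      also have "\<dots> \<in> K m" using h0(2) KD(2) by (intro fn.subspace_sum fn.subspace_scale) auto
      finally show ?thesis .
    qed
    ultimately show ?thesis using binary_form_linear_factor[OF Kg i(1) j prime i(2) one] by blast
  qed
  then obtain c where c: "\<And>j. j \<le> N \<Longrightarrow> coord j - fscale (c j) (coord i) \<in> K 1" by metis
  \<comment> \<open>The coordinates are the ratios \<open>x_j / x_i\<close> modulo \<open>K\<close>;
    the entry at \<open>i\<close> is normalised to 1, so that \<open>v\<close> is not zero.\<close>
  define v where "v j = (if j = i then 1 else if j \<le> N then c j else 0)" for j
  have v: "coord j - fscale (v j) (coord i) \<in> K 1" if "j \<le> N" for j
  proof (cases "j = i")
    case True
    then have "coord j - fscale (v j) (coord i) = 0" by (simp add: v_def)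
    then show ?thesis using fn.subspace_0[OF KD(2)] by metis
  qed (use c that in \<open>simp add: v_def\<close>)
  \<comment> \<open>Modulo \<open>K\<close> a form equals its value at \<open>v\<close> times a
    power of \<open>x_i\<close>. Since no power of \<open>x_i\<close> lies in \<open>K\<close>, a
    form in \<open>K\<close> must vanish at \<open>v\<close>.\<close>
  have ev: "F - fscale (F v) (coord i ^ d) \<in> K d" if "F \<in> forms N d" for F d
    using that
  proof (induction d arbitrary: F)
    case 0
    then obtain b where "F = fscale b 1" using forms_0 by blast
    then have "F - fscale (F v) (coord i ^ 0) = 0" by (simp add: fscale_def fun_eq_iff)
    then show ?case using fn.subspace_0[OF KD(2)] by metis
  next
    case (Suc d)
    obtain H where H: "\<forall>j\<le>N. H j \<in> forms N d" "F = (\<Sum>j\<le>N. coord j * H j)" using forms_Suc[OF Suc.prems] by blast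
    have "F - fscale (F v) (coord i ^ Suc d) = (\<Sum>j\<le>N. coord j * (H j - fscale (H j v) (coord i ^ d))
        + fscale (H j v) (coord i ^ d * (coord j - fscale (v j) (coord i))))"
      unfolding H(2) by (intro ext) (simp add: fun_sum_apply fscale_def fun_power_apply sum_distrib_left sum_distrib_right
          sum_subtractf[symmetric] algebra_simps)
    moreover have "coord j * (H j - fscale (H j v) (coord i ^ d)) \<in> K (Suc d)" if "j \<le> N" for j
      using KD(3)[OF Suc.IH forms_coord[OF that]] H(1) that by (metis plus_1_eq_Suc)
    moreover have "coord i ^ d * (coord j - fscale (v j) (coord i)) \<in> K (Suc d)" if "j \<le> N" for j
      using KD(3)[OF v[OF that] forms_coord_power[OF i(1), of d]] by simp
    ultimately show ?case using KD(2)[of "Suc d"]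
      by (simp only:) (intro fn.subspace_sum fn.subspace_add fn.subspace_scale, auto)
  qed
  show thesis
  proof
    show "v \<noteq> 0" 
    proof
      assume "v = 0"
      then have "v i = 0" by simp
      then show False by (simp add: v_def)
    qed
    show "\<forall>j>N. v j = 0" using i(1) unfolding v_def by auto
    fix d F assume "F \<in> J d"
    then have F: "F \<in> K d" using JK by (auto simp: le_fun_def)
    have "F - (F - fscale (F v) (coord i ^ d)) \<in> K d"
      using fn.subspace_diff[OF KD(2) F ev[OF KD(1)[OF F]]] .
    then have *: "fscale (F v) (coord i ^ d) \<in> K d" by simp
    show "F v = 0"
    proof (rule ccontr)
      assume "F v \<noteq> 0"
      then have "coord i ^ d = fscale (inverse (F v)) (fscale (F v) (coord i ^ d))" by simp
      then have "coord i ^ d \<in> K (d * 1)" using * KD(2) fn.subspace_scale by (metis mult.right_neutral)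
      moreover have "coord i ^ d \<notin> K (d * 1)" using prime ci i(2) one by (rule prime_ideal_power)
      ultimately show False by blast
    qed
  qed
qed

section \<open>Topology and function theory of the curve\<close>

section \<open>The Zariski topology of a curve\<close>

text \<open>A chosen coordinate vector of the point. By homogeneity neither the vanishing of a form
  nor a quotient of two forms of equal degree depends on the choice.\<close>

definition rep :: "'k point \<Rightarrow> 'k vec" where
  "rep x = (SOME v. v \<in> x)"

lemma proj_space_rep:
  assumes "x \<in> proj_space N"
  shows "rep x \<in> x" "rep x \<noteq> 0" "\<And>i. i > N \<Longrightarrow> rep x i = 0" "x = {fscale c (rep x) | c. c \<noteq> 0}"
proof -
  obtain v where v: "x = {fscale c v | c. c \<noteq> 0}" "v \<noteq> 0" "\<forall>i>N. v i = 0"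
    using assms unfolding proj_space_def by blast
  have "fscale 1 v \<in> x" unfolding v(1) by (metis (mono_tags, lifting) mem_Collect_eq one_neq_zero)
  then show *: "rep x \<in> x" unfolding rep_def by (rule someI[of "\<lambda>v. v \<in> x"])
  then obtain b where b: "rep x = fscale b v" "b \<noteq> 0" unfolding v(1) by blast
  show "rep x \<noteq> 0" using b v(2) fn.scale_eq_0_iff by metis
  show "rep x i = 0" if "i > N" for i using b v(3) that by (simp add: fscale_def)
  define r where "r = rep x"
  have r: "r = fscale b v" using b by (simp add: r_def)
  have "{fscale c v | c. c \<noteq> 0} = {fscale c r | c. c \<noteq> 0}"
    unfolding r
  proof (intro equalityI subsetI, goal_cases)
    case (1 w)
    then obtain c where c: "w = fscale c v" "c \<noteq> 0" by blast
    then have "w = fscale (c / b) (fscale b v)" "c / b \<noteq> 0" using b by auto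
    then show ?case by blast
  next
    case (2 w)
    then obtain c where c: "w = fscale c (fscale b v)" "c \<noteq> 0" by blast
    then have "w = fscale (c * b) v" "c * b \<noteq> 0" using b by auto
    then show ?case by blast
  qed
  then show "x = {fscale c (rep x) | c. c \<noteq> 0}" using v(1) by (simp only: r_def)
qed

lemma point_mem:
  assumes "x \<in> proj_space N" "v \<in> x"
  obtains c where "c \<noteq> 0" "v = fscale c (rep x)"
  using proj_space_rep(4)[OF assms(1)] assms(2) by blast

lemma form_nonzero_rep:
  assumes "x \<in> proj_space N" "F \<in> forms N d"
  shows "(\<forall>v\<in>x. F v \<noteq> 0) \<longleftrightarrow> F (rep x) \<noteq> 0"
proof
  assume "F (rep x) \<noteq> 0"
  then show "\<forall>v\<in>x. F v \<noteq> 0" using forms_homog[OF assms(2)] point_mem[OF assms(1)] by (metis mult_eq_0_iff power_not_zero)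
qed (use proj_space_rep(1)[OF assms(1)] in blast)

lemma form_quotient_rep:
  assumes "x \<in> proj_space N" "F \<in> forms N d" "G \<in> forms N d" "v \<in> x"
  shows "F v / G v = F (rep x) / G (rep x)"
proof -
  obtain c where "c \<noteq> 0" "v = fscale c (rep x)" using point_mem assms by metis
  then show ?thesis using forms_homog[OF assms(2)] forms_homog[OF assms(3)] by simp
qed

definition basic_open :: "nat \<Rightarrow> ('k::field vec \<Rightarrow> 'k) \<Rightarrow> 'k point set" where
  "basic_open N F = {x \<in> proj_space N. F (rep x) \<noteq> 0}"

text \<open>The generating sets are closed under intersection, because the product of two forms is
  nonzero exactly where both are; they form a base and not just a subbase.\<close>

lemma openin_zariski_proj:
  fixes U :: "'k::field point set"
  shows "openin (zariski_proj N) U \<longleftrightarrow>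
    (\<forall>x\<in>U. \<exists>d F. F \<in> forms N d \<and> x \<in> basic_open N F \<and> basic_open N F \<subseteq> U)"
proof -
  define S where "S = {{x \<in> proj_space N. \<forall>v\<in>x. F v \<noteq> 0} | F::'k vec \<Rightarrow> 'k. F \<in> (\<Union>d. forms N d)}"
  have S: "S = {basic_open N F | F. F \<in> (\<Union>d. forms N d)}"
  proof -
    have "{x \<in> proj_space N. \<forall>v\<in>x. F v \<noteq> 0} = basic_open N F" if "F \<in> (\<Union>d. forms N d)" for F :: "'k vec \<Rightarrow> 'k"
      using that form_nonzero_rep unfolding basic_open_def by blast
    then show ?thesis unfolding S_def by blast
  qed
  have open_iff: "openin (zariski_proj N) U \<longleftrightarrow> generate_topology_on S U" for U
    unfolding zariski_proj_def S_def[symmetric] by (rule openin_topology_generated_by_iff)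
  have 1: "\<forall>x\<in>U. \<exists>d F. F \<in> forms N d \<and> x \<in> basic_open N F \<and> basic_open N F \<subseteq> U" if "generate_topology_on S U"
    using that
  proof (induction rule: generate_topology_on.induct)
    case (Int a b)
    show ?case
    proof
      fix x assume "x \<in> a \<inter> b"
      then obtain d F e G where *: "F \<in> forms N d" "x \<in> basic_open N F" "basic_open N F \<subseteq> a"
        "G \<in> forms N e" "x \<in> basic_open N G" "basic_open N G \<subseteq> b" using Int.IH by blast
      have "basic_open N (F * G) = basic_open N F \<inter> basic_open N G" by (auto simp: basic_open_def)
      then show "\<exists>d F. F \<in> forms N d \<and> x \<in> basic_open N F \<and> basic_open N F \<subseteq> a \<inter> b"
        using * forms_mult[of F N d G e] by blast
    qed
  next
    case (UN K)
    show ?case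
    proof
      fix x assume "x \<in> \<Union>K"
      then obtain k where k: "k \<in> K" "x \<in> k" by blast
      then obtain d F where "F \<in> forms N d" "x \<in> basic_open N F" "basic_open N F \<subseteq> k" using UN.IH by blast
      then show "\<exists>d F. F \<in> forms N d \<and> x \<in> basic_open N F \<and> basic_open N F \<subseteq> \<Union>K" using k by blast
    qed
  next
    case (Basis s) then show ?case unfolding S by blast
  qed simp
  show ?thesis
  proof
    assume "\<forall>x\<in>U. \<exists>d F. F \<in> forms N d \<and> x \<in> basic_open N F \<and> basic_open N F \<subseteq> U"
    moreover have "openin (zariski_proj N) (basic_open N F)" if "F \<in> forms N d" for d and F :: "'k vec \<Rightarrow> 'k"
    proof -
      have "basic_open N F \<in> S" unfolding S using that by blast
      then show ?thesis unfolding open_iff by (rule generate_topology_on.Basis)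
    qed
    ultimately have "\<forall>x\<in>U. \<exists>T. openin (zariski_proj N) T \<and> x \<in> T \<and> T \<subseteq> U" by meson
    then show "openin (zariski_proj N) U" by (subst openin_subopen) blast
  qed (use 1 open_iff in blast)
qed

lemma topspace_zariski_proj: "topspace (zariski_proj N) = (proj_space N :: 'k::field point set)"
proof
  show "topspace (zariski_proj N) \<subseteq> (proj_space N :: 'k point set)"
  proof
    fix x :: "'k point" assume "x \<in> topspace (zariski_proj N)"
    then have "openin (zariski_proj N) (topspace (zariski_proj N)) \<and> x \<in> topspace (zariski_proj N)" by blast
    then show "x \<in> proj_space N" unfolding openin_zariski_proj basic_open_def by blast
  qed
  have "basic_open N 1 = (proj_space N :: 'k point set)" by (simp add: basic_open_def)
  then have "openin (zariski_proj N) (proj_space N :: 'k point set)"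
    unfolding openin_zariski_proj using forms_one by blast
  then show "proj_space N \<subseteq> topspace (zariski_proj N :: 'k point topology)" by (rule openin_subset)
qed

lemma closedin_zariski_proj:
  "closedin (zariski_proj N) (Z :: 'k::field point set) \<longleftrightarrow> Z \<subseteq> proj_space N \<and>
    (\<forall>x\<in>proj_space N - Z. \<exists>d F. F \<in> forms N d \<and> F (rep x) \<noteq> 0 \<and> (\<forall>y\<in>Z. F (rep y) = 0))"
  unfolding closedin_def topspace_zariski_proj openin_zariski_proj basic_open_def by blast

lemma closedin_zero_set: "F \<in> forms N d \<Longrightarrow> closedin (zariski_proj N) {x \<in> proj_space N. F (rep x) = 0}"
  unfolding closedin_zariski_proj by blast

text \<open>Two coordinate vectors are proportional if all their 2 by 2 minors vanish. A nonzero
  minor, with one of its vectors made variable, is the linear form.\<close>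

lemma points_separated_by_form:
  assumes "x \<in> proj_space N" "y \<in> proj_space N" "x \<noteq> (y :: 'k::field point)"
  obtains F where "F \<in> forms N 1" "F (rep x) = 0" "F (rep y) \<noteq> 0"
proof -
  have "\<exists>i\<le>N. \<exists>j\<le>N. rep y i * rep x j \<noteq> rep y j * rep x i"
  proof (rule ccontr)
    assume "\<not> ?thesis"
    then have eq: "rep y i * rep x j = rep y j * rep x i" for i j
      using proj_space_rep(3)[OF assms(1)] proj_space_rep(3)[OF assms(2)] by (metis mult_zero_left mult_zero_right not_le)
    obtain i where i: "rep x i \<noteq> 0" using proj_space_rep(2)[OF assms(1)] by (auto simp: fun_eq_iff)
    define c where "c = rep y i / rep x i"
    have c: "rep y = fscale c (rep x)"
    proof
      fix j show "rep y j = fscale c (rep x) j" using eq[of i j] i by (simp add: fscale_def c_def field_simps)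
    qed
    then have "c \<noteq> 0" using proj_space_rep(2)[OF assms(2)] by auto
    have "y = x"
    proof (subst proj_space_rep(4)[OF assms(1)], subst proj_space_rep(4)[OF assms(2)], intro equalityI subsetI, goal_cases)
      case (1 w)
      then obtain b where b: "w = fscale b (rep y)" "b \<noteq> 0" by blast
      then have "w = fscale (b * c) (rep x)" "b * c \<noteq> 0" using c \<open>c \<noteq> 0\<close> by auto
      then show ?case by blast
    next
      case (2 w)
      then obtain b where b: "w = fscale b (rep x)" "b \<noteq> 0" by blast
      then have "w = fscale (b / c) (rep y)" "b / c \<noteq> 0" using c \<open>c \<noteq> 0\<close> by auto
      then show ?case by blast
    qed
    then show False using assms by simp
  qed
  then obtain i j where ij: "i \<le> N" "j \<le> N" "rep y i * rep x j \<noteq> rep y j * rep x i" by blast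
  let ?F = "fscale (rep x j) (coord i) - fscale (rep x i) (coord j)"
  have "?F \<in> forms N 1" using forms_coord ij by (intro forms_diff forms_scale) auto
  moreover have "?F (rep x) = 0" "?F (rep y) \<noteq> 0" using ij(3) by (auto simp: fscale_def mult.commute)
  ultimately show thesis using that by blast
qed

lemma closedin_point: "x \<in> proj_space N \<Longrightarrow> closedin (zariski_proj N) {x}"
  unfolding closedin_zariski_proj using points_separated_by_form by blast

definition vanishing_ideal :: "nat \<Rightarrow> 'k::field point set \<Rightarrow> nat \<Rightarrow> ('k vec \<Rightarrow> 'k) set" where
  "vanishing_ideal N Z d = {F \<in> forms N d. \<forall>x\<in>Z. F (rep x) = 0}"

lemma vanishing_ideal: "graded_ideal N (vanishing_ideal N (Z :: 'a::field point set))"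
  unfolding graded_ideal_def
proof (intro conjI allI impI)
  fix d
  show "vanishing_ideal N Z d \<subseteq> forms N d" by (auto simp: vanishing_ideal_def)
  show "fn.subspace (vanishing_ideal N Z d)"
  proof (rule fn.subspaceI)
    show "fscale c x \<in> vanishing_ideal N Z d" if "x \<in> vanishing_ideal N Z d" for c x
    proof -
      have "fscale c x (rep z) = c * x (rep z)" for z by (simp add: fscale_def)
      then show ?thesis using that forms_scale unfolding vanishing_ideal_def by auto
    qed
  qed (auto simp: vanishing_ideal_def intro: forms_zero forms_add)
next
  fix d e and F G :: "'a vec \<Rightarrow> 'a" assume *: "F \<in> vanishing_ideal N Z d" "G \<in> forms N e"
  then have "G * F \<in> forms N (e + d)" unfolding vanishing_ideal_def by (intro forms_mult) auto
  then show "G * F \<in> vanishing_ideal N Z (e + d)" using * unfolding vanishing_ideal_def by simp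
qed

locale curve =
  fixes N :: nat and C :: "'k::alg_closed_field point set"
  assumes curve: "smooth_projective_curve N C"
begin

lemma closedin_C: "closedin (zariski_proj N) C"
  and C_nonempty: "C \<noteq> {}"
  and C_irred: "\<And>A B. closedin (zariski_proj N) A \<Longrightarrow> closedin (zariski_proj N) B \<Longrightarrow> C \<subseteq> A \<union> B \<Longrightarrow> C \<subseteq> A \<or> C \<subseteq> B"
  using curve unfolding smooth_projective_curve_def irreducible_closed_def by blast+

lemma C_proj: "x \<in> C \<Longrightarrow> x \<in> proj_space N"
  using closedin_subset[OF closedin_C] by (auto simp: topspace_zariski_proj)

lemma closedin_zariski: "closedin (zariski N C) A \<longleftrightarrow> closedin (zariski_proj N) A \<and> A \<subseteq> C"
  using closedin_closed_subtopology[OF closedin_C] by blast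

lemma topspace_zariski: "topspace (zariski N C) = C"
  using closedin_subset[OF closedin_C] by (simp only: topspace_subtopology) (rule Int_absorb1)

lemma irreducible_closed_point: "x \<in> C \<Longrightarrow> irreducible_closed (zariski N C) {x}"
  using closedin_point[OF C_proj] by (auto simp: irreducible_closed_def closedin_zariski)

lemma irreducible_closed_C: "irreducible_closed (zariski N C) C"
  unfolding irreducible_closed_def closedin_zariski using closedin_C C_nonempty C_irred by blast

text \<open>Among the infinite proper closed subsets, one with maximal vanishing ideal is contained
  in every closed set that meets it in infinitely many points. It is therefore irreducible, and with
  one of its points below it and \<open>C\<close> above it there would be a chain of length 2 in a
  space of dimension 1.\<close>

lemma finite_closed:
  assumes A: "closedin (zariski_proj N) A" "A \<subseteq> C" "A \<noteq> C"
  shows "finite A"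
proof (rule ccontr)
  assume "infinite A"
  define \<A> where "\<A> = {A. closedin (zariski_proj N) A \<and> A \<subset> C \<and> infinite A}"
  have "vanishing_ideal N A \<in> vanishing_ideal N ` \<A>" using A \<open>infinite A\<close> by (auto simp: \<A>_def)
  then obtain J where J: "J \<in> vanishing_ideal N ` \<A>"
      and max: "\<And>J'. J' \<in> vanishing_ideal N ` \<A> \<Longrightarrow> J \<le> J' \<Longrightarrow> J' = J"
    using graded_ideal_maximal[of _ "vanishing_ideal N ` \<A>" N] vanishing_ideal by blast
  then obtain B where B: "closedin (zariski_proj N) B" "B \<subset> C" "infinite B" "J = vanishing_ideal N B"
    by (auto simp: \<A>_def)
  have *: "B \<subseteq> D" if D: "closedin (zariski_proj N) D" "infinite (B \<inter> D)" for D
  proof -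
    have cl: "closedin (zariski_proj N) (B \<inter> D)" using B(1) D(1) by blast
    then have "B \<inter> D \<in> \<A>" using B D by (auto simp: \<A>_def)
    moreover have "vanishing_ideal N B \<le> vanishing_ideal N (B \<inter> D)" by (auto simp: vanishing_ideal_def le_fun_def)
    ultimately have eq: "vanishing_ideal N (B \<inter> D) = vanishing_ideal N B" using max B(4) by blast
    show "B \<subseteq> D"
    proof (rule ccontr)
      assume "\<not> B \<subseteq> D"
      then obtain x where x: "x \<in> B" "x \<notin> B \<inter> D" by blast
      then have "x \<in> proj_space N - B \<inter> D" using B(2) C_proj by blast
      then obtain d F where F: "F \<in> forms N d" "F (rep x) \<noteq> 0" "\<forall>y\<in>B \<inter> D. F (rep y) = 0"
        using cl unfolding closedin_zariski_proj by blast
      then have "F \<in> vanishing_ideal N B d" unfolding eq[symmetric] vanishing_ideal_def by blast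
      then show False using F(2) x(1) by (auto simp: vanishing_ideal_def)
    qed
  qed
  have "irreducible_closed (zariski N C) B"
    unfolding irreducible_closed_def closedin_zariski
  proof (intro conjI allI impI)
    fix D E assume DE: "(closedin (zariski_proj N) D \<and> D \<subseteq> C) \<and> (closedin (zariski_proj N) E \<and> E \<subseteq> C) \<and> B \<subseteq> D \<union> E"
    then have "B = (B \<inter> D) \<union> (B \<inter> E)" by blast
    then have "infinite (B \<inter> D) \<or> infinite (B \<inter> E)" using B(3) by (metis finite_Un)
    then show "B \<subseteq> D \<or> B \<subseteq> E" using * DE by blast
  qed (use B in auto)
  moreover obtain x where x: "x \<in> B" using B(3) by fastforce
  ultimately have "irreducible_chain (zariski N C) 2 (\<lambda>i. if i = 0 then {x} else if i = 1 then B else C)"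
    using irreducible_closed_point[of x] irreducible_closed_C B
    by (auto simp: irreducible_chain_def less_Suc_eq numeral_2_eq_2)
  then show False using curve by (fastforce simp: smooth_projective_curve_def has_krull_dim_def)
qed

text \<open>In a finite \<open>C\<close> every subset would be closed, so that irreducible closed
  sets would be single points and the dimension would be 0.\<close>

lemma infinite_C: "infinite C"
proof
  assume fin: "finite C"
  obtain Z where Z: "irreducible_chain (zariski N C) 1 Z"
    using curve by (auto simp: smooth_projective_curve_def has_krull_dim_def)
  then have Z0: "irreducible_closed (zariski N C) (Z 0)" "irreducible_closed (zariski N C) (Z 1)" "Z 0 \<subset> Z 1"
    by (auto simp: irreducible_chain_def)
  then obtain x where x: "x \<in> Z 0" by (auto simp: irreducible_closed_def)
  have sub: "Z 1 \<subseteq> C" using Z0(2) closedin_zariski by (auto simp: irreducible_closed_def)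
  have cl: "closedin (zariski N C) A" if "A \<subseteq> C" for A
  proof -
    have "finite A" using fin that finite_subset by blast
    then have "closedin (zariski_proj N) (\<Union>x\<in>A. {x})" using that C_proj closedin_point by (intro closedin_Union) auto
    then show ?thesis using that by (simp add: closedin_zariski)
  qed
  have "Z 1 \<subseteq> {x} \<or> Z 1 \<subseteq> Z 1 - {x}"
    using Z0(2) cl[of "{x}"] cl[of "Z 1 - {x}"] sub x Z0(3) unfolding irreducible_closed_def by blast
  then show False using x Z0(3) by blast
qed

text \<open>The filter of nonempty open subsets of the curve, that is, of cofinite ones. Identities
  between rational functions are stated as properties that hold eventually along it.\<close>

definition cof :: "'k point filter" where
  "cof = inf cofinite (principal C)"

lemma eventually_cof: "eventually P cof \<longleftrightarrow> finite {x \<in> C. \<not> P x}"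
  by (simp add: cof_def eventually_inf_principal eventually_cofinite conj_commute)

lemma cof_neq_bot: "cof \<noteq> bot"
  using infinite_C by (simp add: trivial_limit_def eventually_cof)

lemma eventually_cof_C: "eventually (\<lambda>x. x \<in> C) cof"
  by (simp add: eventually_cof)

lemma eventually_cof_neq: "eventually (\<lambda>y. y \<noteq> x) cof"
  by (simp add: eventually_cof)

lemma eventually_cof_obtain:
  assumes "eventually P cof" obtains x where "x \<in> C" "P x"
  using eventually_happens'[OF cof_neq_bot eventually_conj[OF assms eventually_cof_C]] by blast

lemma openin_zariski: "openin (zariski N C) U \<longleftrightarrow> U = {} \<or> U \<subseteq> C \<and> finite (C - U)"
proof
  assume U: "openin (zariski N C) U"
  then have "U \<subseteq> C" using openin_subset topspace_zariski by metis
  moreover have "closedin (zariski N C) (C - U)" using U topspace_zariski by (metis openin_closedin_eq)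
  ultimately show "U = {} \<or> U \<subseteq> C \<and> finite (C - U)" using finite_closed[of "C - U"] closedin_zariski by blast
next
  assume U: "U = {} \<or> U \<subseteq> C \<and> finite (C - U)"
  show "openin (zariski N C) U"
  proof (cases "U = {}")
    case False
    then have U: "U \<subseteq> C" "finite (C - U)" using U by auto
    have "closedin (zariski_proj N) (\<Union>x\<in>C - U. {x})" using U(2) C_proj closedin_point by (intro closedin_Union) auto
    then have "closedin (zariski N C) (C - U)" by (simp add: closedin_zariski)
    then show ?thesis using U(1) topspace_zariski by (metis openin_closedin_eq)
  qed simp
qed

lemma openin_cofinite: "x \<in> C \<Longrightarrow> P x \<Longrightarrow> eventually P cof \<Longrightarrow> openin (zariski N C) {y \<in> C. P y}"
proof -
  assume "x \<in> C" "P x" "eventually P cof"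
  moreover have "C - {y \<in> C. P y} = {y \<in> C. \<not> P y}" by blast
  ultimately show ?thesis unfolding openin_zariski eventually_cof by auto
qed

lemma openin_eventually: "openin (zariski N C) U \<Longrightarrow> x \<in> U \<Longrightarrow> eventually (\<lambda>y. y \<in> U) cof"
  by (auto simp: openin_zariski eventually_cof set_diff_eq)

lemma openin_sub_C: "openin (zariski N C) U \<Longrightarrow> x \<in> U \<Longrightarrow> x \<in> C"
  by (auto simp: openin_zariski)

lemma form_eventually_nonzero:
  assumes "F \<in> forms N d" "x \<in> C" "F (rep x) \<noteq> 0"
  shows "eventually (\<lambda>y. F (rep y) \<noteq> 0) cof"
proof -
  have "closedin (zariski_proj N) ({x \<in> proj_space N. F (rep x) = 0} \<inter> C)"
    using closedin_zero_set[OF assms(1)] closedin_C by blast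
  then have "finite ({x \<in> proj_space N. F (rep x) = 0} \<inter> C)" using finite_closed assms by blast
  then show ?thesis unfolding eventually_cof by (rule rev_finite_subset) (use C_proj in auto)
qed

lemma form_eventually_zero:
  assumes "F \<in> forms N d" "eventually (\<lambda>y. F (rep y) = 0) cof" "x \<in> C"
  shows "F (rep x) = 0"
proof (rule ccontr)
  assume "F (rep x) \<noteq> 0"
  then have "eventually (\<lambda>y. F (rep y) \<noteq> 0) cof" using form_eventually_nonzero assms by blast
  then have "eventually (\<lambda>y. False) cof" using assms(2) by eventually_elim simp
  then show False using cof_neq_bot by (simp add: trivial_limit_def)
qed

section \<open>Regular functions\<close>

text \<open>Membership in the local ring at \<open>x\<close>, for a function on points: one quotient
  of forms gives its value at \<open>x\<close> and almost all its other values. Finitely many values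
  away from \<open>x\<close> are left arbitrary, so the condition depends on the germ only.\<close>

definition reg :: "'k point \<Rightarrow> ('k point \<Rightarrow> 'k) \<Rightarrow> bool" where
  "reg x f \<longleftrightarrow> x \<in> C \<and> (\<exists>d F G. F \<in> forms N d \<and> G \<in> forms N d \<and> G (rep x) \<noteq> 0 \<and> f x = F (rep x) / G (rep x) \<and>
     eventually (\<lambda>y. f y = F (rep y) / G (rep y)) cof)"

lemma reg_C: "reg x f \<Longrightarrow> x \<in> C"
  by (simp add: reg_def)

lemma regE:
  assumes "reg x f"
  obtains d F G where "F \<in> forms N d" "G \<in> forms N d" "G (rep x) \<noteq> 0" "f x = F (rep x) / G (rep x)"
    "eventually (\<lambda>y. f y = F (rep y) / G (rep y)) cof" "eventually (\<lambda>y. G (rep y) \<noteq> 0) cof"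
proof -
  obtain d F G where *: "F \<in> forms N d" "G \<in> forms N d" "G (rep x) \<noteq> 0" "f x = F (rep x) / G (rep x)"
    "eventually (\<lambda>y. f y = F (rep y) / G (rep y)) cof" "x \<in> C" using assms unfolding reg_def by blast
  then show thesis using that form_eventually_nonzero[OF *(2,6,3)] by blast
qed

lemma regI:
  assumes "x \<in> C" "F \<in> forms N d" "G \<in> forms N d" "G (rep x) \<noteq> 0" "f x = F (rep x) / G (rep x)"
    "eventually (\<lambda>y. f y = F (rep y) / G (rep y)) cof"
  shows "reg x f"
  using assms unfolding reg_def by blast

lemma regular_on_imp_reg:
  assumes "regular_on N C U f" "x \<in> U"
  shows "reg x f"
proof -
  obtain W d F G where *: "openin (zariski N C) W" "x \<in> W" "F \<in> forms N d" "G \<in> forms N d"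
    "\<forall>y\<in>W. \<forall>v\<in>y. G v \<noteq> 0 \<and> f y = F v / G v" using assms unfolding regular_on_def by meson
  have W: "y \<in> W \<Longrightarrow> G (rep y) \<noteq> 0 \<and> f y = F (rep y) / G (rep y)" for y
    using *(5) proj_space_rep(1) C_proj openin_sub_C[OF *(1)] by blast
  have "eventually (\<lambda>y. f y = F (rep y) / G (rep y)) cof"
    using openin_eventually[OF *(1,2)] by eventually_elim (use W in blast)
  then show ?thesis using * W openin_sub_C by (intro regI[of x F d G]) blast+
qed

lemma reg_near:
  assumes "reg x f"
  obtains U F G d where "openin (zariski N C) U" "x \<in> U" "F \<in> forms N d" "G \<in> forms N d" 
    "\<And>y. y \<in> U \<Longrightarrow> G (rep y) \<noteq> 0 \<and> f y = F (rep y) / G (rep y)"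
proof -
  obtain d F G where *: "F \<in> forms N d" "G \<in> forms N d" "G (rep x) \<noteq> 0" "f x = F (rep x) / G (rep x)"
    "eventually (\<lambda>y. f y = F (rep y) / G (rep y)) cof" "eventually (\<lambda>y. G (rep y) \<noteq> 0) cof"
    using assms by (rule regE)
  let ?U = "{y \<in> C. G (rep y) \<noteq> 0 \<and> f y = F (rep y) / G (rep y)}"
  have "openin (zariski N C) ?U" using * reg_C[OF assms] by (intro openin_cofinite[of x] eventually_conj) auto
  then show thesis using that[of ?U F d G] * reg_C[OF assms] by blast
qed

lemma regular_on_iff:
  assumes "openin (zariski N C) U"
  shows "regular_on N C U f \<longleftrightarrow> (\<forall>x\<in>U. reg x f)"
proof
  assume R: "\<forall>x\<in>U. reg x f"
  show "regular_on N C U f"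
    unfolding regular_on_def
  proof
    fix x assume x: "x \<in> U"
    then have "reg x f" using R by blast
    then obtain V F G d where *: "openin (zariski N C) V" "x \<in> V" "F \<in> forms N d" "G \<in> forms N d" 
      "\<And>y. y \<in> V \<Longrightarrow> G (rep y) \<noteq> 0 \<and> f y = F (rep y) / G (rep y)" by (rule reg_near) blast
    have "G v \<noteq> 0 \<and> f y = F v / G v" if "y \<in> V" "v \<in> y" for y v
    proof -
      have y: "y \<in> proj_space N" using C_proj openin_sub_C[OF *(1)] that by blast
      show ?thesis using *(5)[OF that(1)] form_nonzero_rep[OF y *(4)] form_quotient_rep[OF y *(3,4) that(2)] that(2) by metis
    qed
    moreover have "openin (zariski N C) (U \<inter> V)" using assms *(1) by blast
    ultimately show "\<exists>W d F G. openin (zariski N C) W \<and> x \<in> W \<and> W \<subseteq> U \<and> F \<in> forms N d \<and> G \<in> forms N d \<and>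
        (\<forall>y\<in>W. \<forall>v\<in>y. G v \<noteq> 0 \<and> f y = F v / G v)"
      using *(2,3,4) x by (intro exI[of _ "U \<inter> V"] exI[of _ d] exI[of _ F] exI[of _ G] conjI ballI) auto
  qed
qed (use regular_on_imp_reg in blast)

lemma reg_eventually_reg:
  assumes "reg x f" shows "eventually (\<lambda>y. reg y f) cof"
proof -
  obtain V F G d where *: "openin (zariski N C) V" "x \<in> V" "F \<in> forms N d" "G \<in> forms N d" 
      "\<And>y. y \<in> V \<Longrightarrow> G (rep y) \<noteq> 0 \<and> f y = F (rep y) / G (rep y)" using assms by (rule reg_near) blast
  have "eventually (\<lambda>y. f y = F (rep y) / G (rep y)) cof"
    using openin_eventually[OF *(1,2)] by eventually_elim (use * in blast)
  note ev = this
  show ?thesis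
    using openin_eventually[OF *(1,2)] by eventually_elim (use * ev openin_sub_C[OF *(1)] regI in blast)
qed

lemma regular_near_iff:
  assumes "x \<in> C" shows "f \<in> regular_near N C x \<longleftrightarrow> reg x f"
proof
  assume R: "reg x f"
  have "openin (zariski N C) {y \<in> C. reg y f}" using assms R reg_eventually_reg by (intro openin_cofinite[of x]) auto
  moreover from this have "regular_on N C {y \<in> C. reg y f} f" by (subst regular_on_iff) auto
  ultimately show "f \<in> regular_near N C x" using R assms unfolding regular_near_def by blast
qed (auto simp: regular_near_def intro: regular_on_imp_reg)

lemma reg_cong:
  assumes "reg x f" "f x = g x" "eventually (\<lambda>y. f y = g y) cof"
  shows "reg x g"
proof -
  obtain d F G where *: "F \<in> forms N d" "G \<in> forms N d" "G (rep x) \<noteq> 0" "f x = F (rep x) / G (rep x)"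
    "eventually (\<lambda>y. f y = F (rep y) / G (rep y)) cof" "eventually (\<lambda>y. G (rep y) \<noteq> 0) cof"
    using assms(1) by (rule regE)
  have "eventually (\<lambda>y. g y = F (rep y) / G (rep y)) cof" using *(5) assms(3) by eventually_elim simp
  then show ?thesis using * assms reg_C[OF assms(1)] by (intro regI[of x F d G]) auto
qed

lemma reg_form_quotient:
  assumes "x \<in> C" "F \<in> forms N d" "G \<in> forms N d" "G (rep x) \<noteq> 0"
  shows "reg x (\<lambda>y. F (rep y) / G (rep y))"
  using assms by (intro regI[of x F d G]) auto

lemma reg_const: "x \<in> C \<Longrightarrow> reg x (\<lambda>_. c)"
  by (rule regI[of x "fscale c 1" 0 1, OF _ forms_scale[OF forms_one] forms_one]) (simp_all add: fscale_def)

lemma reg_add: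
  assumes "reg x f" "reg x g" shows "reg x (\<lambda>y. f y + g y)"
proof -
  obtain d F G where *: "F \<in> forms N d" "G \<in> forms N d" "G (rep x) \<noteq> 0" "f x = F (rep x) / G (rep x)"
    "eventually (\<lambda>y. f y = F (rep y) / G (rep y)) cof" "eventually (\<lambda>y. G (rep y) \<noteq> 0) cof"
    using assms(1) by (rule regE)
  obtain d' F' G' where 1: "F' \<in> forms N d'" "G' \<in> forms N d'" "G' (rep x) \<noteq> 0" "g x = F' (rep x) / G' (rep x)"
    "eventually (\<lambda>y. g y = F' (rep y) / G' (rep y)) cof" "eventually (\<lambda>y. G' (rep y) \<noteq> 0) cof"
    using assms(2) by (rule regE)
  have "F * G' + G * F' \<in> forms N (d + d')" "G * G' \<in> forms N (d + d')"
    using * 1 forms_mult by (blast intro: forms_add)+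
  moreover have "eventually (\<lambda>y. f y + g y = (F * G' + G * F') (rep y) / (G * G') (rep y)) cof"
    using *(5,6) 1(5,6) by eventually_elim (simp add: field_simps)
  ultimately show ?thesis using * 1 reg_C[OF assms(1)]
    by (intro regI[of x "F * G' + G * F'" "d + d'" "G * G'"]) (auto simp: field_simps)
qed

lemma reg_mult:
  assumes "reg x f" "reg x g" shows "reg x (\<lambda>y. f y * g y)"
proof -
  obtain d F G where *: "F \<in> forms N d" "G \<in> forms N d" "G (rep x) \<noteq> 0" "f x = F (rep x) / G (rep x)"
    "eventually (\<lambda>y. f y = F (rep y) / G (rep y)) cof" "eventually (\<lambda>y. G (rep y) \<noteq> 0) cof"
    using assms(1) by (rule regE)
  obtain d' F' G' where 1: "F' \<in> forms N d'" "G' \<in> forms N d'" "G' (rep x) \<noteq> 0" "g x = F' (rep x) / G' (rep x)"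
    "eventually (\<lambda>y. g y = F' (rep y) / G' (rep y)) cof" "eventually (\<lambda>y. G' (rep y) \<noteq> 0) cof"
    using assms(2) by (rule regE)
  have "F * F' \<in> forms N (d + d')" "G * G' \<in> forms N (d + d')" using * 1 forms_mult by blast+
  moreover have "eventually (\<lambda>y. f y * g y = (F * F') (rep y) / (G * G') (rep y)) cof"
    using *(5,6) 1(5,6) by eventually_elim simp
  ultimately show ?thesis using * 1 reg_C[OF assms(1)]
    by (intro regI[of x "F * F'" "d + d'" "G * G'"]) auto
qed

lemma reg_inverse:
  assumes "reg x f" "f x \<noteq> 0" shows "reg x (\<lambda>y. inverse (f y))"
proof -
  obtain d F G where *: "F \<in> forms N d" "G \<in> forms N d" "G (rep x) \<noteq> 0" "f x = F (rep x) / G (rep x)"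
    "eventually (\<lambda>y. f y = F (rep y) / G (rep y)) cof" "eventually (\<lambda>y. G (rep y) \<noteq> 0) cof"
    using assms(1) by (rule regE)
  have "eventually (\<lambda>y. inverse (f y) = G (rep y) / F (rep y)) cof"
    using *(5) by eventually_elim simp
  then show ?thesis using * assms(2) reg_C[OF assms(1)] by (intro regI[of x G d F]) auto
qed

lemma reg_uminus: "reg x f \<Longrightarrow> reg x (\<lambda>y. - f y)"
  using reg_mult[OF reg_const[of x "-1"], of f] reg_C by simp

lemma reg_diff: "reg x f \<Longrightarrow> reg x g \<Longrightarrow> reg x (\<lambda>y. f y - g y)"
  using reg_add[OF _ reg_uminus, of x f g] by simp

lemma reg_divide: "reg x f \<Longrightarrow> reg x g \<Longrightarrow> g x \<noteq> 0 \<Longrightarrow> reg x (\<lambda>y. f y / g y)"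
  using reg_mult[OF _ reg_inverse, of x f g] by (simp add: divide_inverse)

lemma reg_sum: "x \<in> C \<Longrightarrow> (\<And>i. i \<in> A \<Longrightarrow> reg x (f i)) \<Longrightarrow> reg x (\<lambda>y. \<Sum>i\<in>A. f i y)"
  by (induction A rule: infinite_finite_induct) (auto intro: reg_const reg_add)

lemma reg_prod: "x \<in> C \<Longrightarrow> (\<And>i. i \<in> A \<Longrightarrow> reg x (f i)) \<Longrightarrow> reg x (\<lambda>y. \<Prod>i\<in>A. f i y)"
  by (induction A rule: infinite_finite_induct) (auto intro: reg_const reg_mult)

lemma reg_power: "reg x f \<Longrightarrow> reg x (\<lambda>y. f y ^ n)"
  by (induction n) (auto intro: reg_const reg_mult dest: reg_C)

lemma reg_eventually_nonzero:
  assumes "reg x f" "f x \<noteq> 0" shows "eventually (\<lambda>y. f y \<noteq> 0) cof"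
proof -
  obtain d F G where *: "F \<in> forms N d" "G \<in> forms N d" "G (rep x) \<noteq> 0" "f x = F (rep x) / G (rep x)"
    "eventually (\<lambda>y. f y = F (rep y) / G (rep y)) cof" "eventually (\<lambda>y. G (rep y) \<noteq> 0) cof"
    using assms(1) by (rule regE)
  then have "eventually (\<lambda>y. F (rep y) \<noteq> 0) cof" using form_eventually_nonzero assms reg_C by fastforce
  then show ?thesis using *(5,6) by eventually_elim simp
qed

text \<open>The form of irreducibility used for functions: a numerator that is nonzero at one point
  of the curve has only finitely many zeros on it.\<close>

lemma reg_zero_or_nonzero:
  assumes "reg x f"
  shows "eventually (\<lambda>y. f y \<noteq> 0) cof \<or> eventually (\<lambda>y. f y = 0) cof"
proof -
  obtain d F G where *: "F \<in> forms N d" "G \<in> forms N d" "G (rep x) \<noteq> 0" "f x = F (rep x) / G (rep x)"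
    "eventually (\<lambda>y. f y = F (rep y) / G (rep y)) cof" "eventually (\<lambda>y. G (rep y) \<noteq> 0) cof"
    using assms(1) by (rule regE)
  show ?thesis
  proof (cases "\<exists>x\<in>C. F (rep x) \<noteq> 0")
    case True
    then have "eventually (\<lambda>y. F (rep y) \<noteq> 0) cof" using form_eventually_nonzero * by blast
    then have "eventually (\<lambda>y. f y \<noteq> 0) cof" using *(5,6) by eventually_elim simp
    then show ?thesis by blast
  next
    case False
    have "eventually (\<lambda>y. f y = 0) cof" using *(5) eventually_cof_C by eventually_elim (use False in auto)
    then show ?thesis by blast
  qed
qed

text \<open>If the difference were nonzero at \<open>x\<close>, it would be nonzero at almost all
  points. Generic identities thus extend to every point at which both sides are regular.\<close>

lemma reg_eventually_eq:
  assumes "reg x f" "reg x g" "eventually (\<lambda>y. f y = g y) cof" shows "f x = g x"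
proof (rule ccontr)
  assume "f x \<noteq> g x"
  then have "eventually (\<lambda>y. f y - g y \<noteq> 0) cof" by (intro reg_eventually_nonzero[of x] reg_diff assms) auto
  then have "eventually (\<lambda>_. False) cof" using assms(3) by eventually_elim simp
  then show False using cof_neq_bot by (simp add: trivial_limit_def)
qed

end

context curve
begin

section \<open>Local rings are discrete valuation rings\<close>

text \<open>The proper closed subsets of the curve are finite, so that a neighbourhood of \<open>x\<close> is any set
  containing \<open>x\<close> and almost all points.\<close>

definition near :: "'k point \<Rightarrow> ('k point \<Rightarrow> bool) \<Rightarrow> bool" where
  "near x P \<longleftrightarrow> P x \<and> eventually P cof"

lemma near_mono: "near x P \<Longrightarrow> (\<And>y. P y \<Longrightarrow> Q y) \<Longrightarrow> near x Q"
  by (auto simp: near_def elim: eventually_mono)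

lemma near_conj: "near x P \<Longrightarrow> near x Q \<Longrightarrow> near x (\<lambda>y. P y \<and> Q y)"
  by (auto simp: near_def eventually_conj)

lemma near_ball: "finite A \<Longrightarrow> (\<And>i. i \<in> A \<Longrightarrow> near x (P i)) \<Longrightarrow> near x (\<lambda>y. \<forall>i\<in>A. P i y)"
  by (auto simp: near_def eventually_ball_finite)

lemma near_open:
  assumes "x \<in> C"
  shows "near x P \<longleftrightarrow> (\<exists>U. openin (zariski N C) U \<and> x \<in> U \<and> (\<forall>y\<in>U. P y))"
proof
  assume "near x P"
  then have "openin (zariski N C) {y \<in> C. P y}" using assms by (intro openin_cofinite[of x]) (auto simp: near_def)
  then show "\<exists>U. openin (zariski N C) U \<and> x \<in> U \<and> (\<forall>y\<in>U. P y)" using assms \<open>near x P\<close> by (auto simp: near_def)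
next
  assume "\<exists>U. openin (zariski N C) U \<and> x \<in> U \<and> (\<forall>y\<in>U. P y)"
  then obtain U where U: "openin (zariski N C) U" "x \<in> U" "\<forall>y\<in>U. P y" by blast
  have "eventually P cof" using openin_eventually[OF U(1,2)] by eventually_elim (use U in blast)
  then show "near x P" using U by (auto simp: near_def)
qed

lemma reg_near_cong: "reg x f \<Longrightarrow> near x (\<lambda>y. f y = g y) \<Longrightarrow> reg x g"
  unfolding near_def by (metis reg_cong)

section \<open>Derivations, local parameters and the maximal ideal\<close>

definition local_param :: "'k point \<Rightarrow> ('k point \<Rightarrow> 'k) \<Rightarrow> bool" where
  "local_param x t \<longleftrightarrow> reg x t \<and> t x = 0 \<and> (\<exists>D\<in>tangent_space N C x. D t \<noteq> 0)"

lemma tangent_spaceD: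
  assumes "D \<in> tangent_space N C x" "x \<in> C"
  shows "\<not> reg x f \<Longrightarrow> D f = 0"
    "reg x f \<Longrightarrow> reg x g \<Longrightarrow> D (\<lambda>y. f y + g y) = D f + D g"
    "reg x f \<Longrightarrow> reg x g \<Longrightarrow> D (\<lambda>y. f y * g y) = f x * D g + g x * D f"
    "reg x f \<Longrightarrow> reg x g \<Longrightarrow> near x (\<lambda>y. f y = g y) \<Longrightarrow> D f = D g"
    "reg x f \<Longrightarrow> D (\<lambda>y. c * f y) = c * D f"
  using assms unfolding tangent_space_def by (auto simp: regular_near_iff near_open)

lemma tangent_spaceI:
  assumes "x \<in> C" "\<And>f. \<not> reg x f \<Longrightarrow> D f = 0"
    "\<And>f g. reg x f \<Longrightarrow> reg x g \<Longrightarrow> D (\<lambda>y. f y + g y) = D f + D g"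
    "\<And>f g. reg x f \<Longrightarrow> reg x g \<Longrightarrow> D (\<lambda>y. f y * g y) = f x * D g + g x * D f"
    "\<And>f g. reg x f \<Longrightarrow> reg x g \<Longrightarrow> near x (\<lambda>y. f y = g y) \<Longrightarrow> D f = D g"
    "\<And>f c. reg x f \<Longrightarrow> D (\<lambda>y. c * f y) = c * D f"
  shows "D \<in> tangent_space N C x"
  using assms unfolding tangent_space_def by (simp add: regular_near_iff near_open[symmetric])

lemma tangent_const:
  assumes "D \<in> tangent_space N C x" "x \<in> C" shows "D (\<lambda>_. c) = 0"
proof -
  note T = tangent_spaceD[OF assms]
  have "D (\<lambda>_. 1 * 1) = 1 * D (\<lambda>_. 1) + 1 * D (\<lambda>_. 1)"
    using T(3)[OF reg_const[OF assms(2)] reg_const[OF assms(2)], of 1 1] by simp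
  then have "D (\<lambda>_. 1) = D (\<lambda>_. 1) + D (\<lambda>_. 1)" by (simp only: mult_1)
  then have "D (\<lambda>_. 1) = 0" by (metis add_cancel_right_right)
  then show ?thesis using T(5)[OF reg_const[OF assms(2)], of c 1] by simp
qed

lemma tangent_generator:
  assumes "x \<in> C"
  obtains D where "D \<in> tangent_space N C x" "D \<noteq> 0" "\<And>D'. D' \<in> tangent_space N C x \<Longrightarrow> \<exists>c. D' = fscale c D"
proof -
  have "fn.dim (tangent_space N C x) = 1" using curve assms by (auto simp: smooth_projective_curve_def)
  then obtain B where B: "B \<subseteq> tangent_space N C x" "fn.independent B" "tangent_space N C x \<subseteq> fn.span B" "card B = 1"
    using fn.basis_exists by metis
  then obtain D where D: "B = {D}" by (auto simp: card_1_singleton_iff)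
  have "D \<noteq> 0" using B(2) D fn.dependent_zero by blast
  moreover have "\<exists>c. D' = fscale c D" if "D' \<in> tangent_space N C x" for D'
    using that B(3) D fn.span_singleton[of D] by blast
  ultimately show thesis using that B(1) D by blast
qed

lemma local_param_exists:
  assumes "x \<in> C" obtains t where "local_param x t"
proof -
  obtain D where D: "D \<in> tangent_space N C x" "D \<noteq> 0" using tangent_generator[OF assms] by metis
  then obtain f where f: "D f \<noteq> 0" by (auto simp: fun_eq_iff)
  note T = tangent_spaceD[OF D(1) assms]
  have "reg x f" using T(1) f by blast
  then have t: "reg x (\<lambda>y. f y + - f x)" using assms reg_add reg_const by blast
  have "D (\<lambda>y. f y + - f x) = D f"
    using T(2)[OF \<open>reg x f\<close> reg_const[OF assms, of "- f x"]] tangent_const[OF D(1) assms] by simp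
  then have "D (\<lambda>y. f y + - f x) \<noteq> 0" using f by (simp only: not_False_eq_True)
  then have "local_param x (\<lambda>y. f y + - f x)" using t D(1) unfolding local_param_def by (metis right_minus)
  then show thesis by (rule that)
qed

lemma linear_functional_separating:
  fixes f :: "'a \<Rightarrow> 'k"
  assumes "fn.subspace W" "f \<notin> W"
  obtains \<phi> where "\<And>g h. \<phi> (g + h) = \<phi> g + \<phi> h" "\<And>c g. \<phi> (fscale c g) = c * \<phi> g" "\<And>g. g \<in> W \<Longrightarrow> \<phi> g = 0" "\<phi> f = 1"
proof -
  interpret vs: vector_space_pair "fscale :: 'k \<Rightarrow> ('a \<Rightarrow> 'k) \<Rightarrow> ('a \<Rightarrow> 'k)" "(*) :: 'k \<Rightarrow> 'k \<Rightarrow> 'k"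
    by unfold_locales (auto simp: fscale_def fun_eq_iff algebra_simps)
  obtain B where B: "B \<subseteq> W" "fn.independent B" "fn.span B = W"
    using fn.basis_exists[of W] assms(1) fn.span_minimal by (metis subset_antisym)
  have ind: "fn.independent (insert f B)" using B assms(2) by (simp add: fn.independent_insert)
  obtain \<phi> where \<phi>: "Vector_Spaces.linear fscale (*) \<phi>" "\<forall>v\<in>insert f B. \<phi> v = (if v = f then 1 else 0)"
    using vs.linear_independent_extend[OF ind, of "\<lambda>v. if v = f then 1 else 0"] by blast
  have add: "\<phi> (g + h) = \<phi> g + \<phi> h" and scale: "\<phi> (fscale c g) = c * \<phi> g" for g h c
    using \<phi>(1) by (simp_all add: Vector_Spaces.linear_iff)
  have zero: "\<phi> 0 = 0" using scale[of 0 0] by simp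
  have "\<phi> g = 0" if "g \<in> W" for g
    using that unfolding B(3)[symmetric]
  proof (rule fn.span_induct_alt[where h = "\<lambda>g. \<phi> g = 0"])
    show "\<phi> 0 = 0" by (rule zero)
    fix c u v assume u: "u \<in> B" and v: "\<phi> v = 0"
    have "u \<noteq> f" using u B(1) assms(2) by blast
    then have "\<phi> u = 0" using \<phi>(2) u by simp
    then show "\<phi> (fscale c u + v) = 0" using v by (simp only: add scale) simp
  qed
  then show thesis using that[of \<phi>] add scale \<phi>(2) by simp
qed

text \<open>A linear functional on germs that kills the squares of the maximal ideal gives a derivation; as the
  tangent space is a line, the maximal ideal is generated by \<open>t\<close> modulo its square.\<close>

lemma cotangent_generator:
  assumes "local_param x t" "reg x f" "f x = 0"
  obtains a n g h where "\<And>i::nat. i < n \<Longrightarrow> reg x (g i) \<and> g i x = 0 \<and> reg x (h i) \<and> h i x = 0"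
    "near x (\<lambda>y. f y = a * t y + (\<Sum>i<n. g i y * h i y))"
proof -
  have x: "x \<in> C" using assms(2) reg_C by blast
  \<comment> \<open>The space spanned by \<open>t\<close> and the square of the maximal ideal,
    closed under equality near \<open>x\<close>.\<close>
  define W where "W = {f. \<exists>a n g h. (\<forall>i<(n::nat). reg x (g i) \<and> g i x = 0 \<and> reg x (h i) \<and> h i x = 0) \<and>
     near x (\<lambda>y. f y = a * t y + (\<Sum>i<n. g i y * h i y))}"
  have WI: "f \<in> W" if "\<And>i. i < n \<Longrightarrow> reg x (g i) \<and> g i x = 0 \<and> reg x (h i) \<and> h i x = 0"
     "near x (\<lambda>y. f y = a * t y + (\<Sum>i<n. g i y * h i y))" for f a g h and n :: nat
    using that unfolding W_def by blast
  have sub: "fn.subspace W"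
  proof (rule fn.subspaceI)
    show "0 \<in> W" by (rule WI[of 0 _ _ _ 0]) (auto simp: near_def)
  next
    fix p q assume "p \<in> W" "q \<in> W"
    then obtain a n g h a' n' g' h' where 
      p: "\<And>i. i < (n::nat) \<Longrightarrow> reg x (g i) \<and> g i x = 0 \<and> reg x (h i) \<and> h i x = 0" "near x (\<lambda>y. p y = a * t y + (\<Sum>i<n. g i y * h i y))"
      and q: "\<And>i. i < (n'::nat) \<Longrightarrow> reg x (g' i) \<and> g' i x = 0 \<and> reg x (h' i) \<and> h' i x = 0" "near x (\<lambda>y. q y = a' * t y + (\<Sum>i<n'. g' i y * h' i y))"
      unfolding W_def by blast
    define G where "G i = (if i < n then g i else g' (i - n))" for i
    define H where "H i = (if i < n then h i else h' (i - n))" for i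
    have s: "(\<Sum>i<n+n'. G i y * H i y) = (\<Sum>i<n. g i y * h i y) + (\<Sum>i<n'. g' i y * h' i y)" for y
    proof -
      have "{..<n+n'} = {..<n} \<union> (\<lambda>i. i + n) ` {..<n'}" 
      proof (intro equalityI subsetI)
        fix i assume "i \<in> {..<n+n'}"
        then show "i \<in> {..<n} \<union> (\<lambda>i. i + n) ` {..<n'}" by (cases "i < n") (auto simp: image_iff intro!: bexI[of _ "i - n"])
      qed auto
      then have "(\<Sum>i<n+n'. G i y * H i y) = (\<Sum>i<n. G i y * H i y) + (\<Sum>i\<in>(\<lambda>i. i + n) ` {..<n'}. G i y * H i y)"
        by (simp only:) (rule sum.union_disjoint, auto)
      also have "(\<Sum>i\<in>(\<lambda>i. i + n) ` {..<n'}. G i y * H i y) = (\<Sum>i<n'. g' i y * h' i y)"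
        by (subst sum.reindex) (auto simp: inj_on_def G_def H_def)
      finally show ?thesis by (simp add: G_def H_def)
    qed
    show "p + q \<in> W"
    proof (rule WI)
      show "near x (\<lambda>y. (p + q) y = (a + a') * t y + (\<Sum>i<n+n'. G i y * H i y))"
        unfolding s by (rule near_mono[OF near_conj[OF p(2) q(2)]]) (simp add: algebra_simps)
      fix i assume "i < n + n'"
      then show "reg x (G i) \<and> G i x = 0 \<and> reg x (H i) \<and> H i x = 0"
        using p(1)[of i] q(1)[of "i - n"] by (cases "i < n") (simp_all add: G_def H_def)
    qed
  next
    fix c p assume "p \<in> W"
    then obtain a n g h where 
      p: "\<And>i. i < (n::nat) \<Longrightarrow> reg x (g i) \<and> g i x = 0 \<and> reg x (h i) \<and> h i x = 0" "near x (\<lambda>y. p y = a * t y + (\<Sum>i<n. g i y * h i y))"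
      unfolding W_def by blast
    show "fscale c p \<in> W"
    proof (rule WI)
      show "near x (\<lambda>y. fscale c p y = (c * a) * t y + (\<Sum>i<n. (\<lambda>y. c * g i y) y * h i y))"
        by (rule near_mono[OF p(2)]) (simp add: fscale_def algebra_simps sum_distrib_left)
      fix i assume "i < n"
      then show "reg x (\<lambda>y. c * g i y) \<and> c * g i x = 0 \<and> reg x (h i) \<and> h i x = 0"
        using p(1) reg_mult[OF reg_const[OF x, of c]] by simp
    qed
  qed
  have "f \<in> W"
  proof (rule ccontr)
    assume "f \<notin> W"
    then obtain \<phi> where \<phi>: "\<And>g h. \<phi> (g + h) = \<phi> g + \<phi> h" "\<And>c g. \<phi> (fscale c g) = c * \<phi> g" "\<And>g. g \<in> W \<Longrightarrow> \<phi> g = 0" "\<phi> f = 1"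
      using linear_functional_separating[OF sub] by metis
    have \<phi>_diff: "\<phi> g = \<phi> h" if "near x (\<lambda>y. g y = h y)" for g h
    proof -
      have "g - h \<in> W" by (rule WI[of 0 _ _ _ 0]) (use that in \<open>auto simp: near_def\<close>)
      then have "\<phi> (h + (g - h)) = \<phi> h" using \<phi>(1)[of h "g - h"] \<phi>(3)[of "g - h"] by simp
      then show ?thesis by simp
    qed
    \<comment> \<open>Subtracting \<open>g x\<close> projects to the maximal ideal. The Leibniz rule
      holds because \<phi> kills products of two germs vanishing at \<open>x\<close>. Since
      \<open>D t = 0\<close> and \<open>D f = 1\<close>, \<open>D\<close> is not proportional to a
      derivation that is nonzero on \<open>t\<close>, contrary to the tangent space being a
      line.\<close>
    define D where "D g = (if reg x g then \<phi> (\<lambda>y. g y - g x) else 0)" for g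
    have "D \<in> tangent_space N C x"
    proof (rule tangent_spaceI[OF x])
      fix g h assume gh: "reg x g" "reg x h"
      have "(\<lambda>y. g y + h y - (g x + h x)) = (\<lambda>y. g y - g x) + (\<lambda>y. h y - h x)" by (auto simp: fun_eq_iff)
      then show "D (\<lambda>y. g y + h y) = D g + D h" using gh reg_add by (simp add: D_def \<phi>)
      have "(\<lambda>y. (g y - g x) * (h y - h x)) \<in> W"
        by (rule WI[of 1 "\<lambda>_ y. g y - g x" "\<lambda>_ y. h y - h x" _ 0])
           (use gh x in \<open>auto simp: near_def intro!: reg_diff reg_const\<close>)
      then have 0: "\<phi> (\<lambda>y. (g y - g x) * (h y - h x)) = 0" by (rule \<phi>(3))
      have "(\<lambda>y. g y * h y - g x * h x) = (\<lambda>y. (g y - g x) * (h y - h x)) + (fscale (g x) (\<lambda>y. h y - h x) + fscale (h x) (\<lambda>y. g y - g x))"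
        by (auto simp: fun_eq_iff fscale_def algebra_simps)
      then have "\<phi> (\<lambda>y. g y * h y - g x * h x) = 0 + (g x * \<phi> (\<lambda>y. h y - h x) + h x * \<phi> (\<lambda>y. g y - g x))"
        by (simp only: \<phi>(1,2) 0)
      then show "D (\<lambda>y. g y * h y) = g x * D h + h x * D g" using gh reg_mult by (simp add: D_def)
      show "D g = D h" if n: "near x (\<lambda>y. g y = h y)"
      proof -
        have "\<phi> (\<lambda>y. g y - g x) = \<phi> (\<lambda>y. h y - h x)" by (rule \<phi>_diff) (use n in \<open>auto simp: near_def elim: eventually_mono\<close>)
        then show ?thesis using gh by (simp add: D_def)
      qed
    next
      fix g c assume g: "reg x g"
      have "(\<lambda>y. c * g y - c * g x) = fscale c (\<lambda>y. g y - g x)" by (auto simp: fscale_def fun_eq_iff algebra_simps)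
      then show "D (\<lambda>y. c * g y) = c * D g" using g reg_mult[OF reg_const[OF x, of c] g] by (simp add: D_def \<phi>)
    qed (simp add: D_def)
    obtain D0 where D0: "D0 \<in> tangent_space N C x" "D0 \<noteq> 0" "\<And>D'. D' \<in> tangent_space N C x \<Longrightarrow> \<exists>c. D' = fscale c D0"
      using tangent_generator[OF x] by metis
    obtain c where c: "D = fscale c D0" using D0(3) \<open>D \<in> tangent_space N C x\<close> by blast
    obtain D1 where D1: "D1 \<in> tangent_space N C x" "D1 t \<noteq> 0" using assms(1) by (auto simp: local_param_def)
    then obtain c1 where "D1 = fscale c1 D0" using D0(3) by blast
    then have "D0 t \<noteq> 0" using D1(2) by (auto simp: fscale_def)
    moreover have "D t = 0"
    proof -
      have "t \<in> W" by (rule WI[of 0 _ _ _ 1]) (auto simp: near_def)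
      then show ?thesis using assms(1) \<phi>(3) by (auto simp: D_def local_param_def)
    qed
    ultimately have "c = 0" using c by (simp add: fscale_def)
    moreover have "D f = 1" using assms(2,3) \<phi>(4) by (simp add: D_def)
    ultimately show False using c by (simp add: fscale_def)
  qed
  then show thesis using that unfolding W_def by blast
qed

text \<open>Selects an affine chart around \<open>x\<close>. The same index is kept when functions
  are evaluated at nearby points.\<close>

definition chart_index :: "'k point \<Rightarrow> nat" where
  "chart_index x = (SOME i. i \<le> N \<and> rep x i \<noteq> 0)"

lemma chart_index: assumes "x \<in> C" shows "chart_index x \<le> N" "rep x (chart_index x) \<noteq> 0"
proof -
  have "\<exists>i. i \<le> N \<and> rep x i \<noteq> 0"
    using proj_space_rep(2,3)[OF C_proj[OF assms]] by (metis fun_eq_iff not_le zero_fun_apply)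
  then have "chart_index x \<le> N \<and> rep x (chart_index x) \<noteq> 0" unfolding chart_index_def by (rule someI_ex)
  then show "chart_index x \<le> N" "rep x (chart_index x) \<noteq> 0" by auto
qed

lemma chart_index_form: "x \<in> C \<Longrightarrow> coord (chart_index x) ^ d \<in> forms N d"
  using forms_coord_power chart_index by blast

lemma chart_index_eventually: assumes "x \<in> C" shows "near x (\<lambda>y. rep y (chart_index x) \<noteq> 0)"
  using form_eventually_nonzero[OF forms_coord[OF chart_index(1)[OF assms]] assms chart_index(2)[OF assms]] chart_index(2)[OF assms]
  by (simp add: near_def)

definition dehom :: "'k point \<Rightarrow> nat \<Rightarrow> ('k vec \<Rightarrow> 'k) \<Rightarrow> 'k point \<Rightarrow> 'k" where
  "dehom x d F = (\<lambda>y. F (rep y) / rep y (chart_index x) ^ d)"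

lemma reg_dehom: "x \<in> C \<Longrightarrow> F \<in> forms N d \<Longrightarrow> reg x (dehom x d F)"
  using reg_form_quotient[where F = F, OF _ _ chart_index_form[of x d]] chart_index by (simp add: dehom_def fun_power_apply)

lemma reg_dehomE:
  assumes "reg x f"
  obtains d F G where "F \<in> forms N d" "G \<in> forms N d" "dehom x d G x \<noteq> 0" "near x (\<lambda>y. f y = dehom x d F y / dehom x d G y)"
proof -
  obtain d F G where *: "F \<in> forms N d" "G \<in> forms N d" "G (rep x) \<noteq> 0" "f x = F (rep x) / G (rep x)"
    "eventually (\<lambda>y. f y = F (rep y) / G (rep y)) cof" using assms by (rule regE)
  have "near x (\<lambda>y. f y = F (rep y) / G (rep y))" using * by (simp add: near_def)
  from near_conj[OF this chart_index_eventually[OF reg_C[OF assms]]] have "near x (\<lambda>y. f y = dehom x d F y / dehom x d G y)"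
    by (rule near_mono) (auto simp: dehom_def)
  moreover have "dehom x d G x \<noteq> 0" using *(3) chart_index(2)[OF reg_C[OF assms]] by (simp add: dehom_def)
  ultimately show thesis using that * by blast
qed

definition chart_coord :: "'k point \<Rightarrow> nat \<Rightarrow> 'k point \<Rightarrow> 'k" where
  "chart_coord x j = (\<lambda>y. rep y j / rep y (chart_index x) - rep x j / rep x (chart_index x))"

lemma reg_chart_coord: "x \<in> C \<Longrightarrow> j \<le> N \<Longrightarrow> reg x (chart_coord x j)"
  unfolding chart_coord_def
  using reg_form_quotient[OF _ forms_coord[of j] forms_coord[OF chart_index(1)] chart_index(2)] by (intro reg_diff reg_const) blast+

text \<open>Says that \<open>f - f x\<close> lies in the ideal generated by the affine coordinates
  centred at \<open>x\<close>. Its closure under sums, products and quotients shows that the maximal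
  ideal is finitely generated, as Nakayama's lemma requires.\<close>

definition coord_expandable :: "'k point \<Rightarrow> ('k point \<Rightarrow> 'k) \<Rightarrow> bool" where
  "coord_expandable x f \<longleftrightarrow> (\<exists>r. (\<forall>j\<le>N. reg x (r j)) \<and> near x (\<lambda>y. f y = f x + (\<Sum>j\<le>N. r j y * chart_coord x j y)))"

lemma coord_expandable_add: assumes "coord_expandable x f" "coord_expandable x g" shows "coord_expandable x (\<lambda>y. f y + g y)"
proof -
  obtain r s where *: "\<forall>j\<le>N. reg x (r j)" "near x (\<lambda>y. f y = f x + (\<Sum>j\<le>N. r j y * chart_coord x j y))"
    "\<forall>j\<le>N. reg x (s j)" "near x (\<lambda>y. g y = g x + (\<Sum>j\<le>N. s j y * chart_coord x j y))"
    using assms unfolding coord_expandable_def by blast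
  have "near x (\<lambda>y. f y + g y = f x + g x + (\<Sum>j\<le>N. (r j y + s j y) * chart_coord x j y))"
    by (rule near_mono[OF near_conj[OF *(2,4)]]) (simp add: algebra_simps sum.distrib)
  then show ?thesis unfolding coord_expandable_def using * reg_add by (intro exI[of _ "\<lambda>j y. r j y + s j y"]) blast
qed

lemma coord_expandable_mult: assumes "coord_expandable x f" "coord_expandable x g" "reg x f" shows "coord_expandable x (\<lambda>y. f y * g y)"
proof -
  obtain r s where *: "\<forall>j\<le>N. reg x (r j)" "near x (\<lambda>y. f y = f x + (\<Sum>j\<le>N. r j y * chart_coord x j y))"
    "\<forall>j\<le>N. reg x (s j)" "near x (\<lambda>y. g y = g x + (\<Sum>j\<le>N. s j y * chart_coord x j y))"
    using assms unfolding coord_expandable_def by blast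
  have x: "x \<in> C" using assms(3) reg_C by blast
  have "near x (\<lambda>y. f y * g y = f x * g x + (\<Sum>j\<le>N. (g x * r j y + f y * s j y) * chart_coord x j y))"
  proof (rule near_mono[OF near_conj[OF *(2,4)]])
    fix y assume y: "f y = f x + (\<Sum>j\<le>N. r j y * chart_coord x j y) \<and> g y = g x + (\<Sum>j\<le>N. s j y * chart_coord x j y)"
    have "f y * g y = f y * g x + f y * (\<Sum>j\<le>N. s j y * chart_coord x j y)" using y by (simp add: algebra_simps)
    also have "f y * g x = f x * g x + (\<Sum>j\<le>N. r j y * chart_coord x j y) * g x" using y by (simp add: algebra_simps)
    finally show "f y * g y = f x * g x + (\<Sum>j\<le>N. (g x * r j y + f y * s j y) * chart_coord x j y)"
      by (simp add: algebra_simps sum.distrib sum_distrib_left)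
  qed
  moreover have "\<forall>j\<le>N. reg x (\<lambda>y. g x * r j y + f y * s j y)"
    using * assms(3) reg_const[OF x] by (auto intro!: reg_add reg_mult)
  ultimately show ?thesis unfolding coord_expandable_def by (intro exI[of _ "\<lambda>j y. g x * r j y + f y * s j y"]) blast
qed

lemma coord_expandable_const: "x \<in> C \<Longrightarrow> coord_expandable x (\<lambda>_. c)"
  unfolding coord_expandable_def by (intro exI[of _ "\<lambda>_ _. 0"]) (auto simp: near_def intro: reg_const)

lemma coord_expandable_cong: "coord_expandable x f \<Longrightarrow> near x (\<lambda>y. f y = g y) \<Longrightarrow> coord_expandable x g"
proof -
  assume *: "coord_expandable x f" and n: "near x (\<lambda>y. f y = g y)"
  then obtain r where r: "\<forall>j\<le>N. reg x (r j)" "near x (\<lambda>y. f y = f x + (\<Sum>j\<le>N. r j y * chart_coord x j y))" unfolding coord_expandable_def by blast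
  have "near x (\<lambda>y. g y = g x + (\<Sum>j\<le>N. r j y * chart_coord x j y))"
    by (rule near_mono[OF near_conj[OF r(2) n]]) (use n in \<open>auto simp: near_def\<close>)
  then show ?thesis using r unfolding coord_expandable_def by blast
qed

lemma coord_expandable_coord:
  assumes "x \<in> C" "j \<le> N" shows "coord_expandable x (\<lambda>y. rep y j / rep y (chart_index x))"
  unfolding coord_expandable_def
proof (intro exI[of _ "\<lambda>l _. if l = j then 1 else 0"] conjI allI impI)
  show "reg x (\<lambda>_. if l = j then 1 else 0)" for l using reg_const[OF assms(1)] .
  have "(\<Sum>l\<le>N. (if l = j then 1 else 0) * chart_coord x l y) = chart_coord x j y" for y
  proof -
    have "(\<Sum>l\<le>N. (if l = j then 1 else 0) * chart_coord x l y) = (\<Sum>l\<le>N. if l = j then chart_coord x l y else 0)" by (rule sum.cong) auto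
    then show ?thesis using assms by simp
  qed
  then show "near x (\<lambda>y. rep y j / rep y (chart_index x) = rep x j / rep x (chart_index x) + (\<Sum>l\<le>N. (if l = j then 1 else 0) * chart_coord x l y))"
    by (simp add: near_def chart_coord_def)
qed

lemma coord_expandable_dehom:
  assumes "x \<in> C" "F \<in> forms N d" shows "coord_expandable x (dehom x d F)"
  using assms(2)
proof (induction d arbitrary: F)
  case 0
  then obtain c where "F = fscale c 1" using forms_0 by blast
  then have "dehom x 0 F = (\<lambda>_. c)" by (simp add: dehom_def fscale_def)
  then show ?case using coord_expandable_const[OF assms(1)] by simp
next
  case (Suc d)
  obtain H where H: "\<forall>i\<le>N. H i \<in> forms N d" "F = (\<Sum>i\<le>N. coord i * H i)" using forms_Suc[OF Suc.prems] by blast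
  have s: "coord_expandable x (\<lambda>y. \<Sum>i\<in>A. rep y i / rep y (chart_index x) * dehom x d (H i) y)" if "finite A" "A \<subseteq> {..N}" for A
    using that
  proof (induction A rule: finite_induct)
    case (insert i A)
    then have i: "i \<le> N" by simp
    have "coord_expandable x (\<lambda>y. rep y i / rep y (chart_index x) * dehom x d (H i) y)"
      using Suc.IH H(1) i coord_expandable_coord[OF assms(1) i] reg_form_quotient[OF assms(1) forms_coord[OF i] forms_coord[OF chart_index(1)] chart_index(2)] assms(1)
      by (intro coord_expandable_mult) blast+
    then show ?case using insert coord_expandable_add by simp
  qed (simp add: coord_expandable_const assms)
  have "dehom x (Suc d) F = (\<lambda>y. \<Sum>i\<le>N. rep y i / rep y (chart_index x) * dehom x d (H i) y)"
    unfolding H(2) by (auto simp: dehom_def fun_sum_apply sum_divide_distrib)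
  then show ?case using s[of "{..N}"] by simp
qed

text \<open>Numerator and denominator are expandable as forms. The inverse is handled by
  \<open>1/G - 1/b = - (G - b) / (G b)\<close>, where \<open>b\<close> is the value of
  \<open>G\<close> at \<open>x\<close>.\<close>

lemma coord_expandable_reg:
  assumes "reg x f" shows "coord_expandable x f"
proof -
  have x: "x \<in> C" using assms reg_C by blast
  obtain d F G where *: "F \<in> forms N d" "G \<in> forms N d" "dehom x d G x \<noteq> 0" "near x (\<lambda>y. f y = dehom x d F y / dehom x d G y)"
    using assms by (rule reg_dehomE)
  let ?G = "dehom x d G"
  have G: "reg x ?G" "coord_expandable x ?G" using reg_dehom[OF x *(2)] coord_expandable_dehom[OF x *(2)] by auto
  then obtain r where r: "\<forall>j\<le>N. reg x (r j)" "near x (\<lambda>y. ?G y = ?G x + (\<Sum>j\<le>N. r j y * chart_coord x j y))" unfolding coord_expandable_def by blast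
  define b where "b = ?G x"
  have b: "b \<noteq> 0" using *(3) by (simp add: b_def)
  have nz: "near x (\<lambda>y. ?G y \<noteq> 0)" using reg_eventually_nonzero[OF G(1) *(3)] *(3) by (simp add: near_def)
  have "coord_expandable x (\<lambda>y. inverse (?G y))"
    unfolding coord_expandable_def
  proof (intro exI[of _ "\<lambda>j y. - r j y * inverse (?G y * b)"] conjI allI impI)
    show "reg x (\<lambda>y. - r j y * inverse (?G y * b))" if "j \<le> N" for j
      using r(1) that G(1) *(3) b by (intro reg_mult reg_uminus reg_inverse reg_const x) auto
    show "near x (\<lambda>y. inverse (?G y) = inverse (?G x) + (\<Sum>j\<le>N. - r j y * inverse (?G y * b) * chart_coord x j y))"
    proof (rule near_mono[OF near_conj[OF r(2) nz]])
      fix y assume y: "?G y = ?G x + (\<Sum>j\<le>N. r j y * chart_coord x j y) \<and> ?G y \<noteq> 0"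
      have "(\<Sum>j\<le>N. - r j y * inverse (?G y * b) * chart_coord x j y) = - inverse (?G y * b) * (\<Sum>j\<le>N. r j y * chart_coord x j y)"
        by (simp add: sum_distrib_left algebra_simps sum_negf)
      also have "(\<Sum>j\<le>N. r j y * chart_coord x j y) = ?G y - b" using y by (simp add: b_def)
      finally have "(\<Sum>j\<le>N. - r j y * inverse (?G y * b) * chart_coord x j y) = - inverse (?G y * b) * (?G y - b)" .
      moreover have "inverse g = inverse b + - inverse (g * b) * (g - b)" if "g \<noteq> 0" for g
        using that b by (simp add: field_simps)
      ultimately show "inverse (?G y) = inverse (?G x) + (\<Sum>j\<le>N. - r j y * inverse (?G y * b) * chart_coord x j y)"
        using y b_def by metis
    qed
  qed
  then have "coord_expandable x (\<lambda>y. dehom x d F y * inverse (?G y))"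
    using coord_expandable_dehom[OF x *(1)] reg_dehom[OF x *(1)] by (intro coord_expandable_mult)
  then show ?thesis by (rule coord_expandable_cong) (use *(4) in \<open>auto simp: near_def divide_inverse elim: eventually_mono\<close>)
qed

lemma max_ideal_generated:
  assumes "reg x f" "f x = 0"
  obtains r where "\<And>j. j \<le> N \<Longrightarrow> reg x (r j)" "near x (\<lambda>y. f y = (\<Sum>j\<le>N. r j y * chart_coord x j y))"
  using coord_expandable_reg[OF assms(1)] assms(2) unfolding coord_expandable_def by auto

end

context curve
begin

text \<open>One step of Nakayama's lemma. As \<open>b n n\<close> vanishes at \<open>x\<close>,
  \<open>1 - b n n\<close> is a unit; the relation for \<open>u n\<close> is solved for
  \<open>u n\<close> and substituted into the others, whose new coefficients vanish at
  \<open>x\<close> again.\<close>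

lemma elimination_step:
  assumes x: "x \<in> C" and n: "n \<le> N"
    and c: "\<And>j. j \<le> N \<Longrightarrow> reg x (c j)" and b: "\<And>j k. j \<le> N \<Longrightarrow> k < Suc n \<Longrightarrow> reg x (b j k) \<and> b j k x = 0"
    and eq: "\<And>j. j \<le> N \<Longrightarrow> near x (\<lambda>y. u j y = c j y * t y + (\<Sum>k<Suc n. b j k y * u k y))"
  shows "\<exists>c' b'. (\<forall>j\<le>N. reg x (c' j)) \<and> (\<forall>j\<le>N. \<forall>k<n. reg x (b' j k) \<and> b' j k x = 0) \<and>
    (\<forall>j\<le>N. near x (\<lambda>y. u j y = c' j y * t y + (\<Sum>k<n. b' j k y * u k y)))"
proof -
  define w where "w = (\<lambda>y. inverse (1 - b n n y))"
  have d: "reg x (\<lambda>y. 1 - b n n y)" using b[of n n] n by (intro reg_diff reg_const x) auto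
  have w: "reg x w" unfolding w_def using b[of n n] n by (intro reg_inverse d) auto
  have "near x (\<lambda>y. 1 - b n n y \<noteq> 0)" using reg_eventually_nonzero[OF d] b[of n n] n by (simp add: near_def)
  then have wn: "near x (\<lambda>y. w y * (1 - b n n y) = 1)" by (rule near_mono) (simp add: w_def)
  have un: "near x (\<lambda>y. u n y = w y * c n y * t y + (\<Sum>k<n. w y * b n k y * u k y))"
  proof (rule near_mono[OF near_conj[OF wn eq[OF n]]])
    fix y assume *: "w y * (1 - b n n y) = 1 \<and> u n y = c n y * t y + (\<Sum>k<Suc n. b n k y * u k y)"
    then have "(1 - b n n y) * u n y = c n y * t y + (\<Sum>k<n. b n k y * u k y)" by (simp add: algebra_simps)
    then have "w y * ((1 - b n n y) * u n y) = w y * (c n y * t y + (\<Sum>k<n. b n k y * u k y))" by simp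
    moreover have "w y * ((1 - b n n y) * u n y) = u n y" using * by (metis mult.assoc mult_1)
    ultimately show "u n y = w y * c n y * t y + (\<Sum>k<n. w y * b n k y * u k y)"
      by (simp add: distrib_left sum_distrib_left mult.assoc)
  qed
  let ?c = "\<lambda>j y. c j y + b j n y * (w y * c n y)"
  let ?b = "\<lambda>j k y. b j k y + b j n y * (w y * b n k y)"
  have "near x (\<lambda>y. u j y = ?c j y * t y + (\<Sum>k<n. ?b j k y * u k y))" if j: "j \<le> N" for j
  proof (rule near_mono[OF near_conj[OF un eq[OF j]]])
    fix y assume *: "u n y = w y * c n y * t y + (\<Sum>k<n. w y * b n k y * u k y) \<and> u j y = c j y * t y + (\<Sum>k<Suc n. b j k y * u k y)"
    then have "u j y = c j y * t y + (\<Sum>k<n. b j k y * u k y) + b j n y * u n y" by simp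
    also have "b j n y * u n y = b j n y * (w y * c n y) * t y + (\<Sum>k<n. b j n y * (w y * b n k y) * u k y)"
      using * by (simp add: distrib_left sum_distrib_left mult.assoc)
    finally show "u j y = ?c j y * t y + (\<Sum>k<n. ?b j k y * u k y)"
      by (simp add: distrib_right sum.distrib)
  qed
  moreover have "reg x (?c j)" if "j \<le> N" for j using c b w n that by (intro reg_add reg_mult) auto
  moreover have "reg x (?b j k) \<and> ?b j k x = 0" if "j \<le> N" "k < n" for j k
    using b[of j k] b[of j n] b[of n k] w n that by (auto intro!: reg_add reg_mult)
  ultimately show ?thesis by (intro exI[of _ ?c] exI[of _ ?b]) blast
qed

text \<open>Each centred coordinate is a multiple of \<open>t\<close> plus a sum of products of
  germs vanishing at \<open>x\<close>. Expanding one factor of each product in the coordinates gives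
  a linear system with coefficients in the maximal ideal, and eliminating all coordinates on the
  right leaves multiples of \<open>t\<close>.\<close>

lemma uniformizer_generates:
  assumes t: "local_param x t" and f: "reg x f" "f x = 0"
  obtains g where "reg x g" "near x (\<lambda>y. f y = t y * g y)"
proof -
  have x: "x \<in> C" using f reg_C by blast
  let ?u = "chart_coord x"
  have u: "reg x (?u j)" "?u j x = 0" if "j \<le> N" for j using reg_chart_coord[OF x that] by (auto simp: chart_coord_def)
  have "\<exists>c b. reg x c \<and> (\<forall>k\<le>N. reg x (b k) \<and> b k x = 0) \<and> near x (\<lambda>y. ?u j y = c y * t y + (\<Sum>k\<le>N. b k y * ?u k y))"
    if j: "j \<le> N" for j
  proof -
    obtain a n g h where gh: "\<And>i::nat. i < n \<Longrightarrow> reg x (g i) \<and> g i x = 0 \<and> reg x (h i) \<and> h i x = 0"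
      "near x (\<lambda>y. ?u j y = a * t y + (\<Sum>i<n. g i y * h i y))"
      by (rule cotangent_generator[OF t u[OF j]]) blast
    have "\<exists>r. (\<forall>k\<le>N. reg x (r k)) \<and> near x (\<lambda>y. h i y = (\<Sum>k\<le>N. r k y * ?u k y))" if i: "i < n" for i
    proof -
      obtain r where "\<And>j. j \<le> N \<Longrightarrow> reg x (r j)" "near x (\<lambda>y. h i y = (\<Sum>k\<le>N. r k y * ?u k y))"
        using max_ideal_generated[of x "h i"] gh(1)[OF i] by blast
      then show ?thesis by blast
    qed
    then have "\<forall>i. \<exists>r. i < n \<longrightarrow> (\<forall>k\<le>N. reg x (r k)) \<and> near x (\<lambda>y. h i y = (\<Sum>k\<le>N. r k y * ?u k y))" by blast
    from choice[OF this] obtain r where r: "\<And>i k. i < n \<Longrightarrow> k \<le> N \<Longrightarrow> reg x (r i k)"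
      "\<And>i. i < n \<Longrightarrow> near x (\<lambda>y. h i y = (\<Sum>k\<le>N. r i k y * ?u k y))" by blast
    have rr: "near x (\<lambda>y. \<forall>i\<in>{..<n}. h i y = (\<Sum>k\<le>N. r i k y * ?u k y))" using r(2) by (intro near_ball) auto
    have "near x (\<lambda>y. ?u j y = a * t y + (\<Sum>k\<le>N. (\<Sum>i<n. g i y * r i k y) * ?u k y))"
    proof (rule near_mono[OF near_conj[OF gh(2) rr]])
      fix y assume *: "?u j y = a * t y + (\<Sum>i<n. g i y * h i y) \<and> (\<forall>i\<in>{..<n}. h i y = (\<Sum>k\<le>N. r i k y * ?u k y))"
      have "(\<Sum>i<n. g i y * h i y) = (\<Sum>i<n. \<Sum>k\<le>N. g i y * r i k y * ?u k y)"
        using * by (intro sum.cong) (auto simp: sum_distrib_left mult.assoc)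
      also have "\<dots> = (\<Sum>k\<le>N. (\<Sum>i<n. g i y * r i k y) * ?u k y)"
        by (subst sum.swap) (simp add: sum_distrib_right)
      finally show "?u j y = a * t y + (\<Sum>k\<le>N. (\<Sum>i<n. g i y * r i k y) * ?u k y)" using * by simp
    qed
    moreover have "reg x (\<lambda>y. \<Sum>i<n. g i y * r i k y) \<and> (\<Sum>i<n. g i x * r i k x) = 0" if "k \<le> N" for k
      using gh(1) r(1) that x by (auto intro!: reg_sum reg_mult sum.neutral)
    ultimately show ?thesis using reg_const[OF x, of a]
      by (intro exI[of _ "\<lambda>_. a"] exI[of _ "\<lambda>k y. \<Sum>i<n. g i y * r i k y"]) blast
  qed
  then have "\<forall>j. \<exists>c b. j \<le> N \<longrightarrow> reg x c \<and> (\<forall>k\<le>N. reg x (b k) \<and> b k x = 0) \<and> near x (\<lambda>y. ?u j y = c y * t y + (\<Sum>k\<le>N. b k y * ?u k y))"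
    by blast
  from choice[OF this] obtain c where "\<forall>j. \<exists>b. j \<le> N \<longrightarrow> reg x (c j) \<and> (\<forall>k\<le>N. reg x (b k) \<and> b k x = 0) \<and> near x (\<lambda>y. ?u j y = c j y * t y + (\<Sum>k\<le>N. b k y * ?u k y))"
    by (rule exE)
  from choice[OF this] obtain b where cb: "\<And>j. j \<le> N \<Longrightarrow> reg x (c j)" "\<And>j k. j \<le> N \<Longrightarrow> k \<le> N \<Longrightarrow> reg x (b j k) \<and> b j k x = 0"
    "\<And>j. j \<le> N \<Longrightarrow> near x (\<lambda>y. ?u j y = c j y * t y + (\<Sum>k\<le>N. b j k y * ?u k y))" by blast
  \<comment> \<open>Here \<open>m\<close> counts the coordinates eliminated so far; for
    \<open>m = Suc N\<close> the sum on the right is empty.\<close>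
  have "\<exists>c b. (\<forall>j\<le>N. reg x (c j)) \<and> (\<forall>j\<le>N. \<forall>k<Suc N - m. reg x (b j k) \<and> b j k x = 0) \<and>
    (\<forall>j\<le>N. near x (\<lambda>y. ?u j y = c j y * t y + (\<Sum>k<Suc N - m. b j k y * ?u k y)))" if "m \<le> Suc N" for m
    using that
  proof (induction m)
    case 0
    show ?case using cb by (intro exI[of _ c] exI[of _ b]) (auto simp: lessThan_Suc_atMost)
  next
    case (Suc m)
    then have m: "Suc N - m = Suc (N - m)" "Suc N - Suc m = N - m" by auto
    obtain c b where IH: "\<And>j. j \<le> N \<Longrightarrow> reg x (c j)" "\<And>j k. j \<le> N \<Longrightarrow> k < Suc (N - m) \<Longrightarrow> reg x (b j k) \<and> b j k x = 0"
     "\<And>j. j \<le> N \<Longrightarrow> near x (\<lambda>y. ?u j y = c j y * t y + (\<Sum>k<Suc (N - m). b j k y * ?u k y))"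
    proof -
      have "m \<le> Suc N" using Suc.prems by simp
      from Suc.IH[OF this] show thesis unfolding m(1) using that by blast
    qed
    show ?case unfolding m(2) by (rule elimination_step[OF x _ IH]) auto
  qed
  from this[of "Suc N"] obtain c where c: "\<And>j. j \<le> N \<Longrightarrow> reg x (c j)" "\<And>j. j \<le> N \<Longrightarrow> near x (\<lambda>y. ?u j y = c j y * t y)"
    by auto
  obtain r where r: "\<And>j. j \<le> N \<Longrightarrow> reg x (r j)" "near x (\<lambda>y. f y = (\<Sum>j\<le>N. r j y * ?u j y))"
    using max_ideal_generated[OF f] by blast
  have cc: "near x (\<lambda>y. \<forall>j\<in>{..N}. ?u j y = c j y * t y)" using c(2) by (intro near_ball) auto
  have "near x (\<lambda>y. f y = t y * (\<Sum>j\<le>N. r j y * c j y))"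
    by (rule near_mono[OF near_conj[OF r(2) cc]]) (simp add: sum_distrib_left algebra_simps)
  moreover have "reg x (\<lambda>y. \<Sum>j\<le>N. r j y * c j y)" using r(1) c(1) by (intro reg_sum reg_mult x) auto
  ultimately show thesis using that by blast
qed

lemma local_param_eventually_nonzero:
  assumes "local_param x t" shows "eventually (\<lambda>y. t y \<noteq> 0) cof"
proof (rule ccontr)
  assume "\<not> ?thesis"
  then have "eventually (\<lambda>y. t y = 0) cof" using reg_zero_or_nonzero assms by (auto simp: local_param_def)
  then have n: "near x (\<lambda>y. t y = 0)" using assms by (simp add: near_def local_param_def)
  obtain D where D: "D \<in> tangent_space N C x" "D t \<noteq> 0" using assms by (auto simp: local_param_def)
  have x: "x \<in> C" using assms reg_C by (auto simp: local_param_def)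
  have "D t = D (\<lambda>_. 0)" using tangent_spaceD(4)[OF D(1) x _ reg_const[OF x] n] assms by (auto simp: local_param_def)
  then show False using tangent_const[OF D(1) x] D(2) by simp
qed

definition uniformizer :: "'k point \<Rightarrow> 'k point \<Rightarrow> 'k" where
  "uniformizer x = (SOME t. local_param x t)"

lemma uniformizer: "x \<in> C \<Longrightarrow> local_param x (uniformizer x)"
  unfolding uniformizer_def using local_param_exists by (metis someI)

lemma reg_uniformizer: "x \<in> C \<Longrightarrow> reg x (uniformizer x)" "x \<in> C \<Longrightarrow> uniformizer x x = 0"
  "x \<in> C \<Longrightarrow> eventually (\<lambda>y. uniformizer x y \<noteq> 0) cof"
  using uniformizer local_param_eventually_nonzero by (auto simp: local_param_def)

text \<open>An element of infinite order would be divisible by all powers of \<open>t\<close>, which contradicts the ascending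
  chain condition for the ideals of forms whose dehomogenisations are multiples of its quotients by \<open>t\<^sup>n\<close>.\<close>

lemma unit_factorization:
  assumes "reg x f" "eventually (\<lambda>y. f y \<noteq> 0) cof"
  obtains n u where "reg x u" "u x \<noteq> 0" "near x (\<lambda>y. f y = uniformizer x y ^ n * u y)"
proof (rule ccontr)
  assume "\<not> thesis"
  then have no: "\<not> (\<exists>n u. reg x u \<and> u x \<noteq> 0 \<and> near x (\<lambda>y. f y = uniformizer x y ^ n * u y))" using that by blast
  have x: "x \<in> C" using assms reg_C by blast
  let ?t = "uniformizer x"
  \<comment> \<open>The forms whose dehomogenisation lies in the principal ideal generated by
    \<open>f\<close> in the local ring. Dividing \<open>f\<close> by the uniformizer enlarges this
    ideal.\<close>
  define J where "J f d = {F \<in> forms N d. \<exists>r. reg x r \<and> near x (\<lambda>y. dehom x d F y = r y * f y)}" for f d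
  have J: "graded_ideal N (J f)" for f
    unfolding graded_ideal_def
  proof (intro conjI allI impI)
    fix d
    show "J f d \<subseteq> forms N d" by (auto simp: J_def)
    show "fn.subspace (J f d)"
    proof (rule fn.subspaceI)
      show "0 \<in> J f d" unfolding J_def using reg_const[OF x, of 0]
        by (auto intro!: forms_zero exI[of _ "\<lambda>_. 0"] simp: near_def dehom_def)
    next
      fix F G assume "F \<in> J f d" "G \<in> J f d"
      then obtain r s where *: "F \<in> forms N d" "G \<in> forms N d" "reg x r" "near x (\<lambda>y. dehom x d F y = r y * f y)"
        "reg x s" "near x (\<lambda>y. dehom x d G y = s y * f y)" unfolding J_def by blast
      have "near x (\<lambda>y. dehom x d (F + G) y = (r y + s y) * f y)"
        by (rule near_mono[OF near_conj[OF *(4,6)]]) (simp add: dehom_def add_divide_distrib algebra_simps)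
      then show "F + G \<in> J f d" unfolding J_def using forms_add[OF *(1,2)] reg_add[OF *(3,5)] by blast
    next
      fix c F assume "F \<in> J f d"
      then obtain r where *: "F \<in> forms N d" "reg x r" "near x (\<lambda>y. dehom x d F y = r y * f y)" unfolding J_def by blast
      have "near x (\<lambda>y. dehom x d (fscale c F) y = (c * r y) * f y)"
        by (rule near_mono[OF *(3)]) (simp add: dehom_def fscale_def mult.assoc flip: times_divide_eq_right)
      then show "fscale c F \<in> J f d" unfolding J_def using forms_scale[OF *(1)] reg_mult[OF reg_const[OF x, of c] *(2)] by blast
    qed
  next
    fix d e and F G :: "'k vec \<Rightarrow> 'k" assume F: "F \<in> J f d" and G: "G \<in> forms N e"
    then obtain r where *: "F \<in> forms N d" "reg x r" "near x (\<lambda>y. dehom x d F y = r y * f y)" unfolding J_def by blast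
    have "near x (\<lambda>y. dehom x (e + d) (G * F) y = (dehom x e G y * r y) * f y)"
    proof (rule near_mono[OF *(3)])
      fix y assume "dehom x d F y = r y * f y"
      moreover have "dehom x (e + d) (G * F) y = dehom x e G y * dehom x d F y" by (simp add: dehom_def power_add)
      ultimately show "dehom x (e + d) (G * F) y = (dehom x e G y * r y) * f y" by simp
    qed
    then show "G * F \<in> J f (e + d)" unfolding J_def using forms_mult[OF G *(1)] reg_mult[OF reg_dehom[OF x G] *(2)] by blast
  qed
  define Bad where "Bad = {f. reg x f \<and> eventually (\<lambda>y. f y \<noteq> 0) cof \<and>
     \<not> (\<exists>n u. reg x u \<and> u x \<noteq> 0 \<and> near x (\<lambda>y. f y = ?t y ^ n * u y))}"
  have "J f \<in> J ` Bad" using assms no by (auto simp: Bad_def)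
  then obtain K where K: "K \<in> J ` Bad" and maxK: "\<And>J'. J' \<in> J ` Bad \<Longrightarrow> K \<le> J' \<Longrightarrow> J' = K"
  proof (rule graded_ideal_maximal)
    show "graded_ideal N J'" if "J' \<in> J ` Bad" for J' using that J by blast
  qed blast
  obtain h where h: "h \<in> Bad" "K = J h" using K by blast
  note max = maxK[unfolded h(2)]
  have hB: "reg x h" "eventually (\<lambda>y. h y \<noteq> 0) cof" "\<And>n u. reg x u \<Longrightarrow> u x \<noteq> 0 \<Longrightarrow> \<not> near x (\<lambda>y. h y = ?t y ^ n * u y)"
    using h(1) unfolding Bad_def by blast+
  have "h x = 0" using hB(3)[OF hB(1), of 0] by (auto simp: near_def)
  then obtain g where g: "reg x g" "near x (\<lambda>y. h y = ?t y * g y)" using uniformizer_generates[OF uniformizer[OF x] hB(1)] by blast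
  have gev: "eventually (\<lambda>y. h y = ?t y * g y) cof" using g(2) by (simp add: near_def)
  then have gn: "eventually (\<lambda>y. g y \<noteq> 0) cof" using hB(2) by eventually_elim auto
  have "g \<in> Bad"
  proof -
    have False if "reg x u" "u x \<noteq> 0" "near x (\<lambda>y. g y = ?t y ^ n * u y)" for n u
    proof -
      have "near x (\<lambda>y. h y = ?t y ^ Suc n * u y)" by (rule near_mono[OF near_conj[OF g(2) that(3)]]) simp
      then show False using hB(3) that by blast
    qed
    then show ?thesis using g(1) gn unfolding Bad_def by blast
  qed
  moreover have "J h \<le> J g"
  proof (rule le_funI, rule subsetI)
    fix d F assume "F \<in> J h d"
    then obtain r where *: "F \<in> forms N d" "reg x r" "near x (\<lambda>y. dehom x d F y = r y * h y)" unfolding J_def by blast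
    have "near x (\<lambda>y. dehom x d F y = (r y * ?t y) * g y)"
      by (rule near_mono[OF near_conj[OF *(3) g(2)]]) simp
    then show "F \<in> J g d" unfolding J_def using * reg_mult[OF *(2) reg_uniformizer(1)[OF x]] by blast
  qed
  \<comment> \<open>The numerator \<open>F\<close> of \<open>g = F / G\<close> lies in
    \<open>J g\<close>, hence in \<open>J h\<close>, so that \<open>F = r h = r t g\<close>
    generically, where \<open>t\<close> is the uniformizer. Cancelling \<open>g\<close> gives
    \<open>G = r t\<close>, although \<open>G\<close> is nonzero at \<open>x\<close> and
    \<open>t\<close> is not.\<close>
  ultimately have eq: "J g = J h" using max by blast
  obtain d F G where *: "F \<in> forms N d" "G \<in> forms N d" "dehom x d G x \<noteq> 0" "near x (\<lambda>y. g y = dehom x d F y / dehom x d G y)"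
    using g(1) by (rule reg_dehomE)
  have Gnz: "near x (\<lambda>y. dehom x d G y \<noteq> 0)"
    using reg_eventually_nonzero[OF reg_dehom[OF x *(2)] *(3)] *(3) by (simp add: near_def)
  have "near x (\<lambda>y. dehom x d F y = dehom x d G y * g y)"
    by (rule near_mono[OF near_conj[OF *(4) Gnz]]) simp
  then have "F \<in> J g d" unfolding J_def using * reg_dehom[OF x *(2)] by blast
  then obtain r where r: "reg x r" "near x (\<lambda>y. dehom x d F y = r y * h y)" unfolding eq J_def by blast
  have "eventually (\<lambda>y. dehom x d G y = r y * ?t y) cof"
  proof -
    have 1: "eventually (\<lambda>y. dehom x d F y = dehom x d G y * g y) cof" "eventually (\<lambda>y. dehom x d F y = r y * h y) cof"
      using \<open>near x (\<lambda>y. dehom x d F y = dehom x d G y * g y)\<close> r(2) by (auto simp: near_def)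
    show ?thesis using 1 gev gn by eventually_elim auto
  qed
  then have "dehom x d G x = r x * ?t x"
    using reg_eventually_eq[OF reg_dehom[OF x *(2)] reg_mult[OF r(1) reg_uniformizer(1)[OF x]]] by simp
  then show False using *(3) reg_uniformizer(2)[OF x] by simp
qed

section \<open>Orders of rational functions\<close>

lemma reg_power_int:
  assumes "reg x g" "g x \<noteq> 0" shows "reg x (\<lambda>y. g y powi m)"
  by (cases m rule: int_cases2) (use assms in \<open>auto simp: power_int_minus intro!: reg_power reg_inverse\<close>)

text \<open>A version of \<open>has_order\<close> with one fixed uniformizer and a generic identity
  in place of a neighbourhood. The value of \<open>h\<close> at \<open>x\<close> itself is left free
  in both.\<close>

definition has_ord :: "'k point \<Rightarrow> ('k point \<Rightarrow> 'k) \<Rightarrow> int \<Rightarrow> bool" where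
  "has_ord x h m \<longleftrightarrow> x \<in> C \<and> (\<exists>u. reg x u \<and> u x \<noteq> 0 \<and> eventually (\<lambda>y. h y = uniformizer x y powi m * u y) cof)"

lemma has_ordE:
  assumes "has_ord x h m"
  obtains u where "x \<in> C" "reg x u" "u x \<noteq> 0" "eventually (\<lambda>y. h y = uniformizer x y powi m * u y) cof" "eventually (\<lambda>y. u y \<noteq> 0) cof"
  using assms reg_eventually_nonzero unfolding has_ord_def by blast

lemma has_ordI: "x \<in> C \<Longrightarrow> reg x u \<Longrightarrow> u x \<noteq> 0 \<Longrightarrow> eventually (\<lambda>y. h y = uniformizer x y powi m * u y) cof \<Longrightarrow> has_ord x h m"
  unfolding has_ord_def by blast

text \<open>Any parameter \<open>t\<close> is \<open>g\<close> times the fixed uniformizer, and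
  applying a derivation that is nonzero on \<open>t\<close> shows \<open>g x \<noteq> 0\<close>; its
  power is absorbed into the unit.\<close>

lemma has_order_iff:
  assumes x: "x \<in> C" shows "has_order N C x h m \<longleftrightarrow> has_ord x h m"
proof
  assume "has_order N C x h m"
  then obtain W t u where W: "openin (zariski N C) W" "x \<in> W"
    and t: "regular_on N C W t" "t x = 0" "\<exists>D\<in>tangent_space N C x. D t \<noteq> 0"
    and u: "regular_on N C W u" "u x \<noteq> 0" and h: "\<forall>y\<in>W - {x}. h y = (t y powi m) * u y"
    unfolding has_order_def by blast
  have rt: "reg x t" and ru: "reg x u" using t(1) u(1) W(2) regular_on_imp_reg by auto
  obtain g where g: "reg x g" "near x (\<lambda>y. t y = uniformizer x y * g y)" using uniformizer_generates[OF uniformizer[OF x] rt t(2)] by blast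
  obtain D where D: "D \<in> tangent_space N C x" "D t \<noteq> 0" using t(3) by blast
  have "D t = D (\<lambda>y. uniformizer x y * g y)" using tangent_spaceD(4)[OF D(1) x rt reg_mult[OF reg_uniformizer(1)[OF x] g(1)] g(2)] .
  also have "\<dots> = g x * D (uniformizer x)" using tangent_spaceD(3)[OF D(1) x reg_uniformizer(1)[OF x] g(1)] reg_uniformizer(2)[OF x] by simp
  finally have gx: "g x \<noteq> 0" using D(2) by auto
  have "eventually (\<lambda>y. t y = uniformizer x y * g y) cof" using g(2) by (simp add: near_def)
  then have "eventually (\<lambda>y. h y = uniformizer x y powi m * (g y powi m * u y)) cof"
    using openin_eventually[OF W] eventually_cof_neq[of x] by eventually_elim (use h in \<open>auto simp: power_int_mult_distrib\<close>)
  then show "has_ord x h m" using g(1) gx ru u(2) x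
    by (intro has_ordI[of x "\<lambda>y. g y powi m * u y"] reg_mult reg_power_int) auto
next
  assume "has_ord x h m"
  then obtain u where u: "reg x u" "u x \<noteq> 0" "eventually (\<lambda>y. h y = uniformizer x y powi m * u y) cof" by (rule has_ordE)
  let ?W = "{y \<in> C. reg y (uniformizer x) \<and> reg y u \<and> (y = x \<or> h y = uniformizer x y powi m * u y)}"
  have "eventually (\<lambda>y. y = x \<or> h y = uniformizer x y powi m * u y) cof" using u(3) by eventually_elim simp
  then have W: "openin (zariski N C) ?W"
    using reg_eventually_reg[OF reg_uniformizer(1)[OF x]] reg_eventually_reg[OF u(1)] u reg_uniformizer(1)[OF x] x
    by (intro openin_cofinite[of x] eventually_conj) auto
  have "regular_on N C ?W (uniformizer x)" "regular_on N C ?W u" using W by (auto simp: regular_on_iff)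
  then show "has_order N C x h m"
    unfolding has_order_def using W x u reg_uniformizer[OF x] uniformizer[OF x]
    by (intro exI[of _ ?W] exI[of _ "uniformizer x"] exI[of _ u]) (auto simp: local_param_def)
qed

lemma has_ord_le:
  assumes "has_ord x h m" "has_ord x h n" shows "n \<le> m"
proof (rule ccontr)
  assume "\<not> n \<le> m"
  \<comment> \<open>The two factorisations differ by a positive power of the uniformizer, so that
    the unit \<open>u\<close> would vanish at \<open>x\<close>.\<close>
  then obtain l where l: "n = m + int (Suc l)" using zless_iff_Suc_zadd[of m n] by auto
  obtain u where x: "x \<in> C" and u: "reg x u" "u x \<noteq> 0" "eventually (\<lambda>y. h y = uniformizer x y powi m * u y) cof" using assms(1) by (rule has_ordE)
  obtain v where v: "reg x v" "v x \<noteq> 0" "eventually (\<lambda>y. h y = uniformizer x y powi n * v y) cof" using assms(2) by (rule has_ordE)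
  have "eventually (\<lambda>y. u y = uniformizer x y ^ Suc l * v y) cof"
    using u(3) v(3) reg_uniformizer(3)[OF x]
  proof eventually_elim
    case (elim y)
    then have "uniformizer x y powi m * u y = uniformizer x y powi m * (uniformizer x y powi int (Suc l) * v y)"
      unfolding l by (simp only: power_int_add mult.assoc simp_thms)
    moreover have "uniformizer x y powi m \<noteq> 0" using elim(3) by simp
    ultimately have "u y = uniformizer x y powi int (Suc l) * v y" by (metis mult_left_cancel)
    then show ?case by (simp only: power_int_of_nat)
  qed
  then have "u x = uniformizer x x ^ Suc l * v x"
    using x u v by (intro reg_eventually_eq[of x u "\<lambda>y. uniformizer x y ^ Suc l * v y"] reg_mult reg_power reg_uniformizer)
  then show False using u(2) reg_uniformizer(2)[OF x] by simp
qed

lemma has_ord_unique: "has_ord x h m \<Longrightarrow> has_ord x h n \<Longrightarrow> m = n"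
  using has_ord_le[of x h m n] has_ord_le[of x h n m] by auto

lemma has_ord_cong: "has_ord x h m \<Longrightarrow> eventually (\<lambda>y. h y = h' y) cof \<Longrightarrow> has_ord x h' m"
proof -
  assume "has_ord x h m" and e: "eventually (\<lambda>y. h y = h' y) cof"
  then obtain u where *: "x \<in> C" "reg x u" "u x \<noteq> 0" "eventually (\<lambda>y. h y = uniformizer x y powi m * u y) cof"
    unfolding has_ord_def by blast
  have "eventually (\<lambda>y. h' y = uniformizer x y powi m * u y) cof" using e *(4) by eventually_elim simp
  then show ?thesis using * has_ordI by blast
qed

lemma has_ord_mult:
  assumes "has_ord x f m" "has_ord x g n" shows "has_ord x (\<lambda>y. f y * g y) (m + n)"
proof -
  obtain u where x: "x \<in> C" and u: "reg x u" "u x \<noteq> 0" "eventually (\<lambda>y. f y = uniformizer x y powi m * u y) cof" using assms(1) by (rule has_ordE)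
  obtain v where v: "reg x v" "v x \<noteq> 0" "eventually (\<lambda>y. g y = uniformizer x y powi n * v y) cof" using assms(2) by (rule has_ordE)
  have "eventually (\<lambda>y. f y * g y = uniformizer x y powi (m + n) * (u y * v y)) cof"
    using u(3) v(3) reg_uniformizer(3)[OF x] by eventually_elim (simp add: power_int_add)
  then show ?thesis using x u v by (intro has_ordI[of x "\<lambda>y. u y * v y"] reg_mult) auto
qed

lemma has_ord_inverse:
  assumes "has_ord x f m" shows "has_ord x (\<lambda>y. inverse (f y)) (- m)"
proof -
  obtain u where x: "x \<in> C" and u: "reg x u" "u x \<noteq> 0" "eventually (\<lambda>y. f y = uniformizer x y powi m * u y) cof" using assms(1) by (rule has_ordE)
  have "eventually (\<lambda>y. inverse (f y) = uniformizer x y powi (- m) * inverse (u y)) cof"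
    using u(3) by eventually_elim (simp add: power_int_minus)
  then show ?thesis using x u by (intro has_ordI[of x "\<lambda>y. inverse (u y)"] reg_inverse) auto
qed

lemma has_ord_reg:
  assumes "reg x f" "eventually (\<lambda>y. f y \<noteq> 0) cof"
  obtains n where "has_ord x f (int n)" "n > 0 \<longleftrightarrow> f x = 0"
proof -
  have x: "x \<in> C" using assms reg_C by blast
  obtain n u where *: "reg x u" "u x \<noteq> 0" "near x (\<lambda>y. f y = uniformizer x y ^ n * u y)" using unit_factorization[OF assms] by blast
  have "has_ord x f (int n)" using * x by (intro has_ordI[of x u]) (auto simp: near_def)
  moreover have "n > 0 \<longleftrightarrow> f x = 0" using * reg_uniformizer(2)[OF x] by (auto simp: near_def)
  ultimately show thesis using that by blast
qed

lemma has_ord_zero: "reg x f \<Longrightarrow> f x \<noteq> 0 \<Longrightarrow> has_ord x f 0"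
  using reg_C by (intro has_ordI[of x f]) auto

definition rational_fun :: "('k point \<Rightarrow> 'k) \<Rightarrow> bool" where
  "rational_fun f \<longleftrightarrow> eventually (\<lambda>x. reg x f) cof"

lemma rational_fun_reg: "reg x f \<Longrightarrow> rational_fun f"
  unfolding rational_fun_def by (rule reg_eventually_reg)

lemma rational_fun_reg_iff: "rational_fun f \<longleftrightarrow> (\<exists>x. reg x f)"
  using rational_fun_reg eventually_cof_obtain unfolding rational_fun_def by blast

text \<open>A single representation by forms, found at one point, is dehomogenised in the chart of
  any other point \<open>x\<close>, where numerator and denominator are regular.\<close>

lemma rational_fun_has_ord:
  assumes "rational_fun f" "eventually (\<lambda>y. f y \<noteq> 0) cof" "x \<in> C"
  shows "\<exists>m. has_ord x f m"
proof -
  obtain z where "reg z f" using assms(1) rational_fun_reg_iff by blast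
  then obtain d F G where *: "F \<in> forms N d" "G \<in> forms N d" "G (rep z) \<noteq> 0" "f z = F (rep z) / G (rep z)"
    "eventually (\<lambda>y. f y = F (rep y) / G (rep y)) cof" "eventually (\<lambda>y. G (rep y) \<noteq> 0) cof" by (rule regE)
  have i: "eventually (\<lambda>y. rep y (chart_index x) \<noteq> 0) cof" using chart_index_eventually[OF assms(3)] by (simp add: near_def)
  have e: "eventually (\<lambda>y. f y = dehom x d F y * inverse (dehom x d G y)) cof"
    using *(5) i by eventually_elim (simp add: dehom_def field_simps)
  have "eventually (\<lambda>y. dehom x d G y \<noteq> 0) cof" using *(6) i by eventually_elim (simp add: dehom_def)
  then obtain n where n: "has_ord x (dehom x d G) (int n)" using has_ord_reg[OF reg_dehom[OF assms(3) *(2)]] by blast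
  have "eventually (\<lambda>y. dehom x d F y \<noteq> 0) cof" using assms(2) e by eventually_elim auto
  then obtain m where m: "has_ord x (dehom x d F) (int m)" using has_ord_reg[OF reg_dehom[OF assms(3) *(1)]] by blast
  have "has_ord x (\<lambda>y. dehom x d F y * inverse (dehom x d G y)) (int m + - int n)"
    using m n by (intro has_ord_mult has_ord_inverse)
  then have "has_ord x f (int m + - int n)" by (rule has_ord_cong) (use e in \<open>auto elim: eventually_mono\<close>)
  then show ?thesis by blast
qed

definition ord_at :: "'k point \<Rightarrow> ('k point \<Rightarrow> 'k) \<Rightarrow> int" where
  "ord_at x f = (THE m. has_ord x f m)"

lemma ord_at_eq: "has_ord x f m \<Longrightarrow> ord_at x f = m"
  unfolding ord_at_def using has_ord_unique by blast

lemma finite_support_ord_at: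
  assumes "rational_fun f" "eventually (\<lambda>y. f y \<noteq> 0) cof" shows "finite {x \<in> C. ord_at x f \<noteq> 0}"
proof -
  have "eventually (\<lambda>x. ord_at x f = 0) cof"
    using assms unfolding rational_fun_def by eventually_elim (simp add: ord_at_eq has_ord_zero)
  then show ?thesis by (simp add: eventually_cof)
qed

end

section \<open>Dimension\<close>

context vector_space
begin

text \<open>The finite \<open>B\<close> excludes an infinite basis, for which \<open>card\<close>
  and thus \<open>dim\<close> would be 0.\<close>

lemma dim_insert_le:
  assumes "V \<subseteq> span (insert g W)" "finite B" "W \<subseteq> span B"
  shows "dim V \<le> dim W + 1"
proof -
  obtain A where A: "A \<subseteq> W" "independent A" "W \<subseteq> span A" "card A = dim W" using basis_exists by metis
  have "A \<subseteq> span B" using A(1) assms(3) by blast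
  then have fA: "finite A" using independent_span_bound[OF assms(2) A(2)] by blast
  obtain A' where A': "A' \<subseteq> V" "independent A'" "V \<subseteq> span A'" "card A' = dim V" using basis_exists by metis
  have "span (insert g W) \<subseteq> span (insert g A)"
    using A(3) by (intro span_minimal) (auto intro: span_base span_superset[THEN subsetD] simp: subset_iff span_insert_0 dest: span_mono[of A "insert g A", THEN subsetD, OF subset_insertI])
  then have "A' \<subseteq> span (insert g A)" using A'(1) assms(1) by blast
  then have "card A' \<le> card (insert g A)" using independent_span_bound[of "insert g A" A'] A'(2) fA by blast
  then show ?thesis using A(4) A'(4) fA by (simp add: card_insert_if split: if_splits)
qed

lemma dim_strict_le:
  assumes "W \<subseteq> V" "v \<in> V" "v \<notin> span W" "finite B" "V \<subseteq> span B"
  shows "dim W + 1 \<le> dim V"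
proof -
  obtain A where A: "A \<subseteq> W" "independent A" "W \<subseteq> span A" "card A = dim W" using basis_exists by metis
  have fA: "finite A" using independent_span_bound[OF assms(4) A(2)] A(1) assms(1,5) by blast
  obtain A' where A': "A' \<subseteq> V" "independent A'" "V \<subseteq> span A'" "card A' = dim V" using basis_exists by metis
  have fA': "finite A'" using independent_span_bound[OF assms(4) A'(2)] A'(1) assms(5) by blast
  have v: "v \<notin> span A" using assms(3) A(1) span_mono by blast
  then have "independent (insert v A)" using A(2) by (simp add: independent_insert)
  moreover have "insert v A \<subseteq> span A'" using A(1) A'(3) assms(1,2) by blast
  ultimately have "card (insert v A) \<le> card A'" using independent_span_bound[OF fA'] by blast
  moreover have "v \<notin> A" using v span_base by blast
  ultimately show ?thesis using A(4) A'(4) fA by simp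
qed

lemma dim_le_card_spanning:
  assumes "finite B" "V \<subseteq> span B"
  shows "dim V \<le> card B"
proof -
  obtain A where A: "A \<subseteq> V" "independent A" "V \<subseteq> span A" "card A = dim V" using basis_exists by metis
  then show ?thesis using independent_span_bound[OF assms(1) A(2)] assms(2) by auto
qed

end

context curve
begin

section \<open>Constants, counting of forms and degrees of divisors\<close>

section \<open>Global regular functions\<close>

lemma point_of_vector:
  assumes "v \<noteq> 0" "\<forall>i>N. v i = 0"
  obtains x where "x \<in> proj_space N" "v \<in> x"
proof -
  have "v = fscale 1 v" by simp
  then have "v \<in> {fscale c v | c. c \<noteq> 0}" using one_neq_zero by blast
  then show thesis using assms that unfolding proj_space_def by blast
qed

lemma form_identity:
  assumes "F \<in> forms N d" "G \<in> forms N d" "y \<in> C" "reg y f" "eventually (\<lambda>y. G (rep y) * f y = F (rep y)) cof"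
  shows "G (rep y) * f y = F (rep y)"
proof -
  have "eventually (\<lambda>z. dehom y d G z * f z = dehom y d F z) cof"
    using assms(5) by eventually_elim (simp add: dehom_def)
  then have "dehom y d G y * f y = dehom y d F y"
    using assms reg_dehom by (intro reg_eventually_eq[of y "\<lambda>z. dehom y d G z * f z" "dehom y d F"] reg_mult) auto
  then show ?thesis using chart_index(2)[OF assms(3)] by (simp add: dehom_def)
qed

text \<open>The forms \<open>G\<close> for which \<open>G f\<close> is again a form make up a graded
  ideal without common zeros: off the curve some form vanishing on \<open>C\<close> is nonzero, and
  at a point of \<open>C\<close> the local denominator of \<open>f\<close> is. By the
  Nullstellensatz the ideal is full in some degree \<open>d\<close>.\<close>

lemma global_regular_denominators:
  assumes "\<And>x. x \<in> C \<Longrightarrow> reg x f"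
  obtains d where "\<And>G. G \<in> forms N d \<Longrightarrow> \<exists>F\<in>forms N d. \<forall>y\<in>C. G (rep y) * f y = F (rep y)"
proof -
  define J where "J d = {G \<in> forms N d. \<exists>F\<in>forms N d. \<forall>y\<in>C. G (rep y) * f y = F (rep y)}" for d
  have JI: "G \<in> J d" if "G \<in> forms N d" "F \<in> forms N d" "\<And>y. y \<in> C \<Longrightarrow> G (rep y) * f y = F (rep y)" for G F d
    using that unfolding J_def by blast
  have J: "graded_ideal N J"
    unfolding graded_ideal_def
  proof (intro conjI allI impI)
    fix d
    show "J d \<subseteq> forms N d" by (auto simp: J_def)
    show "fn.subspace (J d)"
    proof (rule fn.subspaceI)
      show "0 \<in> J d" by (rule JI[OF forms_zero forms_zero]) simp
    next
      fix F G assume "F \<in> J d" "G \<in> J d"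
      then obtain F' G' where *: "F \<in> forms N d" "F' \<in> forms N d" "\<forall>y\<in>C. F (rep y) * f y = F' (rep y)"
        "G \<in> forms N d" "G' \<in> forms N d" "\<forall>y\<in>C. G (rep y) * f y = G' (rep y)" unfolding J_def by blast
      show "F + G \<in> J d" by (rule JI[OF forms_add[OF *(1,4)] forms_add[OF *(2,5)]]) (use * in \<open>simp add: distrib_right\<close>)
    next
      fix c F assume "F \<in> J d"
      then obtain F' where *: "F \<in> forms N d" "F' \<in> forms N d" "\<forall>y\<in>C. F (rep y) * f y = F' (rep y)" unfolding J_def by blast
      show "fscale c F \<in> J d" by (rule JI[OF forms_scale[OF *(1), of c] forms_scale[OF *(2), of c]]) (use * in \<open>simp add: fscale_def mult.assoc\<close>)
    qed
  next
    fix d e and F G :: "'k vec \<Rightarrow> 'k" assume F: "F \<in> J d" and G: "G \<in> forms N e"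
    then obtain F' where *: "F \<in> forms N d" "F' \<in> forms N d" "\<forall>y\<in>C. F (rep y) * f y = F' (rep y)" unfolding J_def by blast
    show "G * F \<in> J (e + d)" by (rule JI[OF forms_mult[OF G *(1)] forms_mult[OF G *(2)]]) (use * in \<open>simp add: mult.assoc\<close>)
  qed
  have "\<exists>d. J d = forms N d"
  proof (rule ccontr)
    assume "\<nexists>d. J d = forms N d"
    then have "\<And>d. J d \<noteq> forms N d" by blast
    then obtain v where v: "v \<noteq> 0" "\<forall>i>N. v i = 0" "\<And>d F. F \<in> J d \<Longrightarrow> F v = 0" by (rule projective_nullstellensatz[OF J]) blast
    obtain x where x: "x \<in> proj_space N" "v \<in> x" using point_of_vector v by blast
    obtain c where c: "c \<noteq> 0" "v = fscale c (rep x)" using point_mem[OF x] by metis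
    have zero: "F (rep x) = 0" if "F \<in> J d" for F d
    proof -
      have "F \<in> forms N d" using that J by (auto simp: graded_ideal_def)
      then show ?thesis using v(3)[OF that] forms_homog[of F N d c "rep x"] c by simp
    qed
    have xC: "x \<in> C"
    proof (rule ccontr)
      assume "x \<notin> C"
      then obtain d F where F: "F \<in> forms N d" "F (rep x) \<noteq> 0" "\<forall>y\<in>C. F (rep y) = 0"
        using closedin_C x(1) unfolding closedin_zariski_proj by blast
      have "F \<in> J d" by (rule JI[OF F(1) forms_zero]) (use F(3) in simp)
      then show False using zero F(2) by blast
    qed
    obtain d F G where *: "F \<in> forms N d" "G \<in> forms N d" "G (rep x) \<noteq> 0" "f x = F (rep x) / G (rep x)"
      "eventually (\<lambda>y. f y = F (rep y) / G (rep y)) cof" "eventually (\<lambda>y. G (rep y) \<noteq> 0) cof"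
      using assms[OF xC] by (rule regE)
    have "eventually (\<lambda>y. G (rep y) * f y = F (rep y)) cof" using *(5,6) by eventually_elim simp
    then have "G \<in> J d" using form_identity[OF *(1,2) _ assms] by (intro JI[OF *(2,1)]) blast
    then show False using zero *(3) by blast
  qed
  then show thesis using that unfolding J_def by blast
qed

text \<open>For a suitable form \<open>G\<close> all \<open>G f\<^sup>n\<close> are forms of the same degree, so that they are linearly dependent
  and \<open>f\<close> satisfies a polynomial equation.\<close>

lemma global_regular_const:
  assumes "\<And>x. x \<in> C \<Longrightarrow> reg x f"
  obtains c where "\<And>x. x \<in> C \<Longrightarrow> f x = c"
proof -
  obtain d where d: "\<And>G. G \<in> forms N d \<Longrightarrow> \<exists>F\<in>forms N d. \<forall>y\<in>C. G (rep y) * f y = F (rep y)"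
    using global_regular_denominators assms by blast
  obtain x0 where x0: "x0 \<in> C" using C_nonempty by blast
  define G :: "'k vec \<Rightarrow> 'k" where "G = coord (chart_index x0) ^ d"
  have G: "G \<in> forms N d" "G (rep x0) \<noteq> 0" unfolding G_def using chart_index_form[OF x0] chart_index(2)[OF x0] by (auto simp: fun_power_apply)
  have "\<exists>F\<in>forms N d. \<forall>y\<in>C. G (rep y) * f y ^ n = F (rep y)" for n
  proof (induction n)
    case (Suc n)
    then obtain F where F: "F \<in> forms N d" "\<forall>y\<in>C. G (rep y) * f y ^ n = F (rep y)" by blast
    obtain F' where F': "F' \<in> forms N d" "\<forall>y\<in>C. F (rep y) * f y = F' (rep y)" using d[OF F(1)] by blast
    have "\<forall>y\<in>C. G (rep y) * f y ^ Suc n = F' (rep y)"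
    proof
      fix y assume y: "y \<in> C"
      have "G (rep y) * f y ^ Suc n = (G (rep y) * f y ^ n) * f y" by simp
      also have "\<dots> = F' (rep y)" using F(2) F'(2) y by simp
      finally show "G (rep y) * f y ^ Suc n = F' (rep y)" .
    qed
    then show ?case using F'(1) by blast
  qed (use G in auto)
  then obtain F where F: "\<And>n. F n \<in> forms N d" "\<And>n y. y \<in> C \<Longrightarrow> G (rep y) * f y ^ n = F n (rep y)" by metis
  define B where "B = (mon N ` exps N d :: ('k vec \<Rightarrow> 'k) set)"
  have "finite B" unfolding B_def using finite_exps by blast
  moreover have "F n \<in> fn.span B" for n using F(1) unfolding B_def forms_eq_span[symmetric] .
  ultimately obtain b where b: "(\<Sum>l\<le>card B. fscale (b l) (F l)) = 0" "\<exists>l\<le>card B. b l \<noteq> 0"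
    using dependent_sequence[of B F "card B"] by auto
  define p where "p = (\<Sum>a\<le>card B. monom (b a) a)"
  have cp: "coeff p a = (if a \<le> card B then b a else 0)" for a unfolding p_def by (simp add: coeff_sum)
  have p0: "p \<noteq> 0" using b(2) cp by (metis coeff_0)
  have "eventually (\<lambda>y. poly p (f y) = 0) cof"
    using form_eventually_nonzero[OF G(1) x0 G(2)] eventually_cof_C
  proof eventually_elim
    case (elim y)
    have "G (rep y) * poly p (f y) = (\<Sum>a\<le>card B. b a * (G (rep y) * f y ^ a))"
      unfolding p_def by (simp add: poly_sum poly_monom sum_distrib_left algebra_simps)
    also have "\<dots> = (\<Sum>a\<le>card B. fscale (b a) (F a)) (rep y)"
      using F(2)[OF elim(2)] by (simp add: fun_sum_apply fscale_def)
    also have "\<dots> = 0" unfolding b(1) by simp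
    finally show ?case using elim by simp
  qed
  moreover have "finite {r. poly p r = 0}" using p0 by (rule poly_roots_finite)
  \<comment> \<open>Generically \<open>f\<close> takes one of the finitely many roots of
    \<open>p\<close> as its value, so \<open>f - r\<close> cannot be generically nonzero for every
    \<open>r\<close>. Being regular, it is then generically zero for some \<open>r\<close>.\<close>
  ultimately have "\<exists>r. \<not> eventually (\<lambda>y. f y - r \<noteq> 0) cof"
  proof (rule_tac ccontr)
    assume ev: "eventually (\<lambda>y. poly p (f y) = 0) cof" and fin: "finite {r. poly p r = 0}"
    assume "\<nexists>r. \<not> eventually (\<lambda>y. f y - r \<noteq> 0) cof"
    then have "eventually (\<lambda>y. \<forall>r\<in>{r. poly p r = 0}. f y - r \<noteq> 0) cof" using fin by (intro eventually_ball_finite) auto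
    then have "eventually (\<lambda>_. False) cof" using ev by eventually_elim auto
    then show False using cof_neq_bot by (simp add: trivial_limit_def)
  qed
  then obtain r where r: "\<not> eventually (\<lambda>y. f y - r \<noteq> 0) cof" by blast
  have "reg x0 (\<lambda>y. f y - r)" using assms x0 by (intro reg_diff reg_const) auto
  then have "eventually (\<lambda>y. f y - r = 0) cof" using reg_zero_or_nonzero r by blast
  then have "eventually (\<lambda>y. f y = r) cof" by simp
  then have "f x = r" if "x \<in> C" for x
    using reg_eventually_eq[OF assms[OF that] reg_const[OF that]] by blast
  then show thesis using that by blast
qed

text \<open>The function \<open>h\<close> is meaningful only generically. Its regular extensions at
  the various points have well-determined values there, which form a global regular function; this
  is constant.\<close>

lemma regular_extension:
  assumes "\<And>x. x \<in> C \<Longrightarrow> \<exists>g. reg x g \<and> eventually (\<lambda>y. h y = g y) cof"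
  obtains c where "\<And>x g. reg x g \<Longrightarrow> eventually (\<lambda>y. h y = g y) cof \<Longrightarrow> g x = c" "eventually (\<lambda>y. h y = c) cof"
proof -
  obtain g where g: "\<And>x. x \<in> C \<Longrightarrow> reg x (g x)" "\<And>x. x \<in> C \<Longrightarrow> eventually (\<lambda>y. h y = g x y) cof" using assms by metis
  define f where "f x = g x x" for x
  obtain x0 where x0: "x0 \<in> C" using C_nonempty by blast
  have uniq: "g' x = f x" if "reg x g'" "eventually (\<lambda>y. h y = g' y) cof" for x g'
  proof -
    have x: "x \<in> C" using that reg_C by blast
    have "eventually (\<lambda>y. g' y = g x y) cof" using that(2) g(2)[OF x] by eventually_elim simp
    then show ?thesis unfolding f_def using reg_eventually_eq[OF that(1) g(1)[OF x]] by blast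
  qed
  have "eventually (\<lambda>y. f y = g x0 y) cof"
    using reg_eventually_reg[OF g(1)[OF x0]] by eventually_elim (use uniq g(2)[OF x0] in auto)
  then have fh: "eventually (\<lambda>y. f y = h y) cof" using g(2)[OF x0] by eventually_elim simp
  have "reg x f" if "x \<in> C" for x
  proof (rule reg_cong[OF g(1)[OF that]])
    show "g x x = f x" by (simp add: f_def)
    show "eventually (\<lambda>y. g x y = f y) cof" using fh g(2)[OF that] by eventually_elim simp
  qed
  then obtain c where c: "\<And>x. x \<in> C \<Longrightarrow> f x = c" using global_regular_const by blast
  have "eventually (\<lambda>y. h y = c) cof" using fh eventually_cof_C by eventually_elim (use c in auto)
  then show thesis using that uniq c reg_C by metis
qed

section \<open>Principal divisors have degree zero\<close>

text \<open>Order at least \<open>n\<close>, in a form that admits the zero function as well, so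
  that the functions satisfying it form a vector space.\<close>

definition vanishes_to :: "'k point \<Rightarrow> nat \<Rightarrow> ('k point \<Rightarrow> 'k) \<Rightarrow> bool" where
  "vanishes_to x n h \<longleftrightarrow> (\<exists>u. reg x u \<and> eventually (\<lambda>y. h y = uniformizer x y ^ n * u y) cof)"

lemma vanishes_to_mult: "vanishes_to x n f \<Longrightarrow> vanishes_to x m g \<Longrightarrow> vanishes_to x (n + m) (\<lambda>y. f y * g y)"
proof -
  assume "vanishes_to x n f" "vanishes_to x m g"
  then obtain u v where *: "reg x u" "eventually (\<lambda>y. f y = uniformizer x y ^ n * u y) cof"
    "reg x v" "eventually (\<lambda>y. g y = uniformizer x y ^ m * v y) cof" unfolding vanishes_to_def by blast
  have "eventually (\<lambda>y. f y * g y = uniformizer x y ^ (n + m) * (u y * v y)) cof"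
    using *(2,4) by eventually_elim (simp add: power_add)
  then show ?thesis unfolding vanishes_to_def using * reg_mult by blast
qed

lemma vanishes_to_add: "vanishes_to x n f \<Longrightarrow> vanishes_to x n g \<Longrightarrow> vanishes_to x n (\<lambda>y. f y + g y)"
proof -
  assume "vanishes_to x n f" "vanishes_to x n g"
  then obtain u v where *: "reg x u" "eventually (\<lambda>y. f y = uniformizer x y ^ n * u y) cof"
    "reg x v" "eventually (\<lambda>y. g y = uniformizer x y ^ n * v y) cof" unfolding vanishes_to_def by blast
  have "eventually (\<lambda>y. f y + g y = uniformizer x y ^ n * (u y + v y)) cof"
    using *(2,4) by eventually_elim (simp add: algebra_simps)
  then show ?thesis unfolding vanishes_to_def using * reg_add by blast
qed

lemma vanishes_to_reg: "reg x f \<Longrightarrow> vanishes_to x 0 f"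
  unfolding vanishes_to_def by auto

lemma vanishes_to_scale: "vanishes_to x n f \<Longrightarrow> vanishes_to x n (\<lambda>y. c * f y)"
  using vanishes_to_mult[OF vanishes_to_reg[OF reg_const[of x c]], of n f] reg_C unfolding vanishes_to_def by fastforce

lemma vanishes_to_zero: "reg x f \<Longrightarrow> f x = 0 \<Longrightarrow> vanishes_to x 1 f"
proof -
  assume f: "reg x f" "f x = 0"
  have "local_param x (uniformizer x)" using f reg_C uniformizer by blast
  then obtain g where "reg x g" "near x (\<lambda>y. f y = uniformizer x y * g y)" by (rule uniformizer_generates[OF _ f])
  then show ?thesis unfolding vanishes_to_def near_def by (intro exI[of _ g]) simp
qed

text \<open>Identifies forms with the same values on the curve. With the empty divisor,
  \<open>forms_vanishing m\<close> is the degree \<open>m\<close> piece of the homogeneous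
  coordinate ring of \<open>C\<close>.\<close>

definition res :: "('k vec \<Rightarrow> 'k) \<Rightarrow> 'k point \<Rightarrow> 'k" where
  "res F = (\<lambda>y. if y \<in> C then F (rep y) else 0)"

definition forms_vanishing :: "nat \<Rightarrow> 'k point multiset \<Rightarrow> ('k point \<Rightarrow> 'k) set" where
  "forms_vanishing m D = {res F | F. F \<in> forms N m \<and> (\<forall>x\<in>C. vanishes_to x (count D x) (dehom x m F))}"

lemma res_add: "res (F + G) = res F + res G" and res_scale: "res (fscale c F) = fscale c (res F)"
  by (auto simp: res_def fun_eq_iff fscale_def)

lemma forms_vanishingI: "F \<in> forms N m \<Longrightarrow> (\<And>x. x \<in> C \<Longrightarrow> vanishes_to x (count D x) (dehom x m F)) \<Longrightarrow> res F \<in> forms_vanishing m D"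
  unfolding forms_vanishing_def by blast

lemma dehom_add: "dehom x d (F + G) = (\<lambda>y. dehom x d F y + dehom x d G y)"
  and dehom_scale: "dehom x d (fscale c F) = (\<lambda>y. c * dehom x d F y)"
  and dehom_mult: "dehom x (d + e) (F * G) = (\<lambda>y. dehom x d F y * dehom x e G y)"
  by (auto simp: dehom_def fscale_def add_divide_distrib power_add)

lemma vanishes_to_res:
  assumes "res F = res G" "vanishes_to x n (dehom x d F)" shows "vanishes_to x n (dehom x d G)"
proof -
  obtain u where u: "reg x u" "eventually (\<lambda>y. dehom x d F y = uniformizer x y ^ n * u y) cof" using assms(2) unfolding vanishes_to_def by blast
  have "eventually (\<lambda>y. dehom x d G y = uniformizer x y ^ n * u y) cof"
    using u(2) eventually_cof_C
  proof eventually_elim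
    case (elim y)
    have "res F y = res G y" using assms(1) by simp
    then show ?case using elim by (simp add: res_def dehom_def)
  qed
  then show ?thesis unfolding vanishes_to_def using u by blast
qed

lemma subspace_forms_vanishing: "fn.subspace (forms_vanishing m D)"
proof (rule fn.subspaceI)
  have "vanishes_to x n (dehom x m 0)" if "x \<in> C" for x n
    unfolding vanishes_to_def using reg_const[OF that, of 0] by (intro exI[of _ "\<lambda>_. 0"]) (simp add: dehom_def)
  then have "res 0 \<in> forms_vanishing m D" by (intro forms_vanishingI forms_zero)
  moreover have "res 0 = 0" by (simp add: res_def fun_eq_iff)
  ultimately show "0 \<in> forms_vanishing m D" by metis
next
  fix f g assume "f \<in> forms_vanishing m D" "g \<in> forms_vanishing m D"
  then obtain F G where *: "f = res F" "g = res G" "F \<in> forms N m" "G \<in> forms N m"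
    "\<And>x. x \<in> C \<Longrightarrow> vanishes_to x (count D x) (dehom x m F)" "\<And>x. x \<in> C \<Longrightarrow> vanishes_to x (count D x) (dehom x m G)"
    unfolding forms_vanishing_def by blast
  have "res (F + G) \<in> forms_vanishing m D"
    by (rule forms_vanishingI[OF forms_add[OF *(3,4)]]) (unfold dehom_add, intro vanishes_to_add *, assumption+)
  then show "f + g \<in> forms_vanishing m D" unfolding * res_add .
next
  fix c f assume "f \<in> forms_vanishing m D"
  then obtain F where *: "f = res F" "F \<in> forms N m" "\<And>x. x \<in> C \<Longrightarrow> vanishes_to x (count D x) (dehom x m F)"
    unfolding forms_vanishing_def by blast
  have "res (fscale c F) \<in> forms_vanishing m D"
    by (rule forms_vanishingI[OF forms_scale[OF *(2)]]) (unfold dehom_scale, intro vanishes_to_scale *)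
  then show "fscale c f \<in> forms_vanishing m D" unfolding * res_scale .
qed

lemma forms_vanishing_finite_dim: "\<exists>B. finite B \<and> forms_vanishing m D \<subseteq> fn.span B"
proof -
  have "res F \<in> fn.span (res ` mon N ` exps N m)" if "F \<in> forms N m" for F
    using that
  proof (rule forms_induct[where P = "\<lambda>F. res F \<in> fn.span (res ` mon N ` exps N m)"])
    have "res 0 = 0" by (simp add: res_def fun_eq_iff)
    then show "res 0 \<in> fn.span (res ` mon N ` exps N m)" using fn.span_zero by metis
  next
    fix c a G assume a: "a \<in> exps N m" and G: "res G \<in> fn.span (res ` mon N ` exps N m)"
    have "res (mon N a) \<in> fn.span (res ` mon N ` exps N m)" using a by (intro fn.span_base imageI)
    then show "res (fscale c (mon N a) + G) \<in> fn.span (res ` mon N ` exps N m)"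
      unfolding res_add res_scale by (rule fn.span_add[OF fn.span_scale G])
  qed
  then have "forms_vanishing m D \<subseteq> fn.span (res ` mon N ` exps N m)" unfolding forms_vanishing_def by blast
  moreover have "finite (res ` mon N ` exps N m)" using finite_exps by (intro finite_imageI)
  ultimately show ?thesis by (intro exI conjI)
qed

lemma forms_vanishing_add_subset:
  assumes "x \<in> C" shows "forms_vanishing m (add_mset x D) \<subseteq> forms_vanishing m D"
proof
  fix f assume "f \<in> forms_vanishing m (add_mset x D)"
  then obtain F where *: "f = res F" "F \<in> forms N m" "\<And>z. z \<in> C \<Longrightarrow> vanishes_to z (count (add_mset x D) z) (dehom z m F)"
    unfolding forms_vanishing_def by blast
  have "vanishes_to z (count D z) (dehom z m F)" if z: "z \<in> C" for z
  proof (cases "z = x")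
    case True
    have "vanishes_to x (Suc (count D x)) (dehom x m F)" using *(3)[OF z] True by simp
    then obtain u where u: "reg x u" "eventually (\<lambda>y. dehom x m F y = uniformizer x y ^ Suc (count D x) * u y) cof" unfolding vanishes_to_def by blast
    have "eventually (\<lambda>y. dehom x m F y = uniformizer x y ^ count D x * (uniformizer x y * u y)) cof"
      using u(2) by eventually_elim (simp add: algebra_simps)
    then show ?thesis unfolding True vanishes_to_def using reg_mult[OF reg_uniformizer(1)[OF assms] u(1)] by blast
  qed (use *(3)[OF z] in auto)
  then show "f \<in> forms_vanishing m D" unfolding *(1) by (intro forms_vanishingI *(2))
qed

lemma vanishes_to_Suc:
  assumes "reg x u" "eventually (\<lambda>y. h y = uniformizer x y ^ n * u y) cof"
  shows "vanishes_to x (Suc n) h \<longleftrightarrow> u x = 0"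
proof
  have x: "x \<in> C" using assms reg_C by blast
  assume "vanishes_to x (Suc n) h"
  then obtain v where v: "reg x v" "eventually (\<lambda>y. h y = uniformizer x y ^ Suc n * v y) cof" unfolding vanishes_to_def by blast
  have "eventually (\<lambda>y. u y = uniformizer x y * v y) cof"
    using v(2) assms(2) reg_uniformizer(3)[OF x] by eventually_elim auto
  then have "u x = uniformizer x x * v x"
    using reg_eventually_eq[OF assms(1) reg_mult[OF reg_uniformizer(1)[OF x] v(1)]] by blast
  then show "u x = 0" using reg_uniformizer(2)[OF x] by simp
next
  assume "u x = 0"
  then obtain w where w: "reg x w" "eventually (\<lambda>y. u y = uniformizer x y ^ 1 * w y) cof" using vanishes_to_zero[OF assms(1)] unfolding vanishes_to_def by blast
  have "eventually (\<lambda>y. h y = uniformizer x y ^ Suc n * w y) cof" using w(2) assms(2) by eventually_elim (simp add: algebra_simps)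
  then show "vanishes_to x (Suc n) h" unfolding vanishes_to_def using w(1) by blast
qed

text \<open>One more point imposes one linear condition, namely that the leading coefficient at
  \<open>x\<close> vanishes.\<close>

lemma dim_forms_vanishing_add:
  assumes x: "x \<in> C" shows "fn.dim (forms_vanishing m D) \<le> fn.dim (forms_vanishing m (add_mset x D)) + 1"
proof -
  obtain B where B: "finite B" "forms_vanishing m (add_mset x D) \<subseteq> fn.span B" using forms_vanishing_finite_dim by blast
  have "\<exists>g. forms_vanishing m D \<subseteq> fn.span (insert g (forms_vanishing m (add_mset x D)))"
  proof (cases "forms_vanishing m D \<subseteq> forms_vanishing m (add_mset x D)")
    case True
    then show ?thesis using fn.span_superset by blast
  next
    case False
    then obtain g where g: "g \<in> forms_vanishing m D" "g \<notin> forms_vanishing m (add_mset x D)" by blast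
    obtain G where G: "g = res G" "G \<in> forms N m" "\<And>z. z \<in> C \<Longrightarrow> vanishes_to z (count D z) (dehom z m G)"
      using g(1) unfolding forms_vanishing_def by blast
    obtain v where v: "reg x v" "eventually (\<lambda>y. dehom x m G y = uniformizer x y ^ count D x * v y) cof" using G(3)[OF x] unfolding vanishes_to_def by blast
    have vx: "v x \<noteq> 0"
    proof
      assume "v x = 0"
      then have "vanishes_to x (Suc (count D x)) (dehom x m G)" using vanishes_to_Suc[OF v] by blast
      then have "vanishes_to z (count (add_mset x D) z) (dehom z m G)" if "z \<in> C" for z using G(3)[OF that] by auto
      then show False using g(2) forms_vanishingI[OF G(2)] unfolding G(1) by blast
    qed
    have "f \<in> fn.span (insert g (forms_vanishing m (add_mset x D)))" if f: "f \<in> forms_vanishing m D" for f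
    proof -
      obtain F where F: "f = res F" "F \<in> forms N m" "\<And>z. z \<in> C \<Longrightarrow> vanishes_to z (count D z) (dehom z m F)"
        using f unfolding forms_vanishing_def by blast
      obtain u where u: "reg x u" "eventually (\<lambda>y. dehom x m F y = uniformizer x y ^ count D x * u y) cof" using F(3)[OF x] unfolding vanishes_to_def by blast
      \<comment> \<open>Chosen so that the leading coefficient \<open>u + c v\<close> of
        \<open>F + c G\<close> vanishes at \<open>x\<close>.\<close>
      define c where "c = - (u x / v x)"
      have r: "reg x (\<lambda>y. u y + c * v y)" using u(1) v(1) reg_const[OF x, of c] by (intro reg_add reg_mult)
      have "eventually (\<lambda>y. dehom x m (F + fscale c G) y = uniformizer x y ^ count D x * (u y + c * v y)) cof"
        using u(2) v(2) unfolding dehom_add dehom_scale by eventually_elim (simp add: algebra_simps)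
      then have "vanishes_to x (Suc (count D x)) (dehom x m (F + fscale c G))"
        using vanishes_to_Suc[OF r] vx by (simp add: c_def)
      moreover have "vanishes_to z (count D z) (dehom z m (F + fscale c G))" if "z \<in> C" for z
        unfolding dehom_add dehom_scale using F(3)[OF that] G(3)[OF that] by (intro vanishes_to_add vanishes_to_scale)
      ultimately have "vanishes_to z (count (add_mset x D) z) (dehom z m (F + fscale c G))" if "z \<in> C" for z
        using that by auto
      then have "res (F + fscale c G) \<in> forms_vanishing m (add_mset x D)" using F(2) G(2) by (intro forms_vanishingI forms_add forms_scale)
      then have "res (F + fscale c G) - fscale c g \<in> fn.span (insert g (forms_vanishing m (add_mset x D)))"
        by (intro fn.span_diff fn.span_scale fn.span_base) auto
      moreover have "res (F + fscale c G) - fscale c g = f" by (simp add: F(1) G(1) res_add res_scale)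
      ultimately show ?thesis by simp
    qed
    then show ?thesis by blast
  qed
  then show ?thesis using fn.dim_insert_le B by blast
qed

lemma dim_forms_vanishing_upper:
  assumes "set_mset D \<subseteq> C" shows "fn.dim (forms_vanishing m {#}) \<le> size D + fn.dim (forms_vanishing m D)"
  using assms
proof (induction D)
  case (add x D)
  then show ?case using dim_forms_vanishing_add[of x m D] by auto
qed simp

text \<open>A product with one factor for each point \<open>y\<close> of the divisor. For
  \<open>y\<close> other than \<open>x\<close> it is a linear form through \<open>y\<close> that
  avoids \<open>x\<close>; for \<open>y = x\<close> it is the numerator of the uniformizer, which
  has order exactly one at \<open>x\<close>.\<close>

lemma form_exact_order:
  assumes x: "x \<in> C" and D: "set_mset D \<subseteq> C"
  shows "\<exists>d F u. F \<in> forms N d \<and> (\<forall>z\<in>C. vanishes_to z (count D z) (dehom z d F)) \<and>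
     reg x u \<and> u x \<noteq> 0 \<and> eventually (\<lambda>y. dehom x d F y = uniformizer x y ^ count D x * u y) cof"
  using D
proof (induction D)
  case empty
  have "dehom z 0 1 = (\<lambda>_. 1)" for z by (simp add: dehom_def)
  then have b: "\<forall>z\<in>C. vanishes_to z (count {#} z) (dehom z 0 1)"
    and e: "eventually (\<lambda>y. dehom x 0 1 y = uniformizer x y ^ count {#} x * 1) cof"
    using reg_const[of _ 1] vanishes_to_reg by simp_all
  show ?case by (intro exI conjI) (rule forms_one b reg_const[OF x] one_neq_zero e)+
next
  case (add y D)
  then obtain d F u where IH: "F \<in> forms N d" "\<And>z. z \<in> C \<Longrightarrow> vanishes_to z (count D z) (dehom z d F)"
     "reg x u" "u x \<noteq> 0" "eventually (\<lambda>y. dehom x d F y = uniformizer x y ^ count D x * u y) cof" by auto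
  have y: "y \<in> C" using add by simp
  have "\<exists>e A w. A \<in> forms N e \<and> dehom y e A y = 0 \<and> reg x w \<and> w x \<noteq> 0 \<and> 
     eventually (\<lambda>z. dehom x e A z = uniformizer x z ^ (if x = y then 1 else 0) * w z) cof"
  proof (cases "x = y")
    case True
    obtain e A G where *: "A \<in> forms N e" "G \<in> forms N e" "dehom x e G x \<noteq> 0" "near x (\<lambda>y. uniformizer x y = dehom x e A y / dehom x e G y)"
      using reg_uniformizer(1)[OF x] by (rule reg_dehomE)
    have Gnz: "eventually (\<lambda>y. dehom x e G y \<noteq> 0) cof" using reg_eventually_nonzero[OF reg_dehom[OF x *(2)] *(3)] .
    have "eventually (\<lambda>y. uniformizer x y = dehom x e A y / dehom x e G y) cof" using *(4) by (simp add: near_def)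
    then have "eventually (\<lambda>z. dehom x e A z = uniformizer x z ^ 1 * dehom x e G z) cof" using Gnz by eventually_elim simp
    moreover have "dehom x e A x = 0" using *(3,4) reg_uniformizer(2)[OF x] by (simp add: near_def)
    ultimately show ?thesis using * reg_dehom[OF x *(2)] True by auto
  next
    case False
    obtain A where A: "A \<in> forms N 1" "A (rep y) = 0" "A (rep x) \<noteq> 0"
      using points_separated_by_form[OF C_proj[OF y] C_proj[OF x]] False by metis
    have "dehom x 1 A x \<noteq> 0" "dehom y 1 A y = 0" using A chart_index(2)[OF x] by (auto simp: dehom_def)
    then show ?thesis using A(1) reg_dehom[OF x A(1)] False by (intro exI[of _ 1] exI[of _ A] exI[of _ "dehom x 1 A"]) auto
  qed
  then obtain e A w where A: "A \<in> forms N e" "dehom y e A y = 0" "reg x w" "w x \<noteq> 0"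
     "eventually (\<lambda>z. dehom x e A z = uniformizer x z ^ (if x = y then 1 else 0) * w z) cof" by blast
  have v: "vanishes_to z (count (add_mset y D) z) (dehom z (d + e) (F * A))" if z: "z \<in> C" for z
  proof (cases "z = y")
    case True
    have "vanishes_to y 1 (dehom y e A)" using reg_dehom[OF y A(1)] A(2) by (rule vanishes_to_zero)
    then show ?thesis unfolding dehom_mult True using vanishes_to_mult[OF IH(2)[OF y], of 1] by simp
  next
    case False
    then show ?thesis unfolding dehom_mult using vanishes_to_mult[OF IH(2)[OF z] vanishes_to_reg[OF reg_dehom[OF z A(1)]]] by simp
  qed
  have ev: "eventually (\<lambda>z. dehom x (d + e) (F * A) z = uniformizer x z ^ count (add_mset y D) x * (u z * w z)) cof"
    using IH(5) A(5) unfolding dehom_mult by eventually_elim (auto simp: power_add)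
  have nz: "u x * w x \<noteq> 0" using IH(4) A(4) by simp
  show ?case by (intro exI conjI ballI) (rule forms_mult[OF IH(1) A(1)] v reg_mult[OF IH(3) A(3)] nz ev | assumption)+
qed

text \<open>The form of exact order lies in the larger space but not in the smaller one. Multiplying
  it by powers of a coordinate that is nonzero at \<open>x\<close> produces such a form in every
  higher degree.\<close>

lemma dim_forms_vanishing_strict:
  assumes x: "x \<in> C" and D: "set_mset D \<subseteq> C"
  obtains m0 where "\<And>m. m \<ge> m0 \<Longrightarrow> fn.dim (forms_vanishing m (add_mset x D)) + 1 \<le> fn.dim (forms_vanishing m D)"
proof -
  obtain d F u where F: "F \<in> forms N d" "\<And>z. z \<in> C \<Longrightarrow> vanishes_to z (count D z) (dehom z d F)"
     "reg x u" "u x \<noteq> 0" "eventually (\<lambda>y. dehom x d F y = uniformizer x y ^ count D x * u y) cof"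
    using form_exact_order[OF x D] by blast
  have "fn.dim (forms_vanishing m (add_mset x D)) + 1 \<le> fn.dim (forms_vanishing m D)" if m: "m \<ge> d" for m
  proof -
    define A :: "'k vec \<Rightarrow> 'k" where "A = coord (chart_index x) ^ (m - d)"
    have A: "A \<in> forms N (m - d)" unfolding A_def using chart_index_form[OF x] .
    have FA: "F * A \<in> forms N m" using forms_mult[OF F(1) A] m by simp
    have dm: "dehom z m (F * A) = (\<lambda>y. dehom z d F y * dehom z (m - d) A y)" for z
      using dehom_mult[of z d "m - d" F A] m by simp
    have 1: "vanishes_to z (count D z) (dehom z m (F * A))" if z: "z \<in> C" for z
      unfolding dm using vanishes_to_mult[OF F(2)[OF z] vanishes_to_reg[OF reg_dehom[OF z A]]] by simp
    have "eventually (\<lambda>y. dehom x m (F * A) y = uniformizer x y ^ count D x * u y) cof"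
      using F(5) chart_index_eventually[OF x, unfolded near_def, THEN conjunct2] unfolding dm
      by eventually_elim (simp add: dehom_def A_def fun_power_apply)
    then have "\<not> vanishes_to x (Suc (count D x)) (dehom x m (F * A))" using vanishes_to_Suc[OF F(3)] F(4) by blast
    then have no: "\<not> vanishes_to x (count (add_mset x D) x) (dehom x m (F * A))" by simp
    have "res (F * A) \<notin> forms_vanishing m (add_mset x D)"
    proof
      assume "res (F * A) \<in> forms_vanishing m (add_mset x D)"
      then obtain G where "res (F * A) = res G" "vanishes_to x (count (add_mset x D) x) (dehom x m G)"
        unfolding forms_vanishing_def using x by blast
      then show False using no vanishes_to_res[of G "F * A"] by metis
    qed
    moreover have "res (F * A) \<in> forms_vanishing m D" using FA 1 by (rule forms_vanishingI)
    moreover have "fn.span (forms_vanishing m (add_mset x D)) = forms_vanishing m (add_mset x D)" using subspace_forms_vanishing by (simp add: fn.span_eq_iff)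
    moreover obtain B where "finite B" "forms_vanishing m D \<subseteq> fn.span B" using forms_vanishing_finite_dim by blast
    ultimately show ?thesis using fn.dim_strict_le[OF forms_vanishing_add_subset[OF x]] by metis
  qed
  then show thesis using that by blast
qed

lemma dim_forms_vanishing_lower:
  assumes "set_mset D \<subseteq> C" shows "\<exists>m0. \<forall>m\<ge>m0. size D + fn.dim (forms_vanishing m D) \<le> fn.dim (forms_vanishing m {#})"
  using assms
proof (induction D)
  case (add x D)
  then obtain m0 where m0: "\<forall>m\<ge>m0. size D + fn.dim (forms_vanishing m D) \<le> fn.dim (forms_vanishing m {#})" by auto
  obtain m1 where m1: "\<And>m. m \<ge> m1 \<Longrightarrow> fn.dim (forms_vanishing m (add_mset x D)) + 1 \<le> fn.dim (forms_vanishing m D)"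
    using dim_forms_vanishing_strict[of x D] add by auto
  have "size (add_mset x D) + fn.dim (forms_vanishing m (add_mset x D)) \<le> fn.dim (forms_vanishing m {#})" if "m \<ge> max m0 m1" for m
    using m0[rule_format, of m] m1[of m] that by simp
  then show ?case by blast
qed simp

end

context curve
begin

text \<open>If \<open>P\<close> of degree \<open>m < j e\<close> vanished on \<open>j\<close> times
  the divisor of \<open>F\<close>, then \<open>P A / F ^ j\<close> would be regular everywhere for
  every form \<open>A\<close> of degree \<open>j e - m\<close>, hence constant. Letting
  \<open>A\<close> vanish at some point makes the constant 0, and so \<open>P\<close> vanishes on
  the curve.\<close>

lemma dim_forms_vanishing_empty_divisor:
  assumes F: "F \<in> forms N e" "y0 \<in> C" "F (rep y0) \<noteq> 0"
    and D: "set_mset D \<subseteq> C" "\<And>x. x \<in> C \<Longrightarrow> has_ord x (dehom x e F) (int (count D x))" and m: "m < j * e"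
  shows "fn.dim (forms_vanishing m (repeat_mset j D)) = 0"
proof -
  have "f = 0" if f: "f \<in> forms_vanishing m (repeat_mset j D)" for f
  proof -
    obtain P where P: "f = res P" "P \<in> forms N m" "\<And>z. z \<in> C \<Longrightarrow> vanishes_to z (j * count D z) (dehom z m P)"
      using f unfolding forms_vanishing_def by auto
    obtain x0 where x0: "x0 \<in> C" "x0 \<noteq> y0" using infinite_C infinite_remove[of C y0] by (metis Diff_iff ex_in_conv finite.emptyI insertCI)
    obtain A1 where A1: "A1 \<in> forms N 1" "A1 (rep x0) = 0" "A1 (rep y0) \<noteq> 0"
      using points_separated_by_form[OF C_proj[OF x0(1)] C_proj[OF F(2)] x0(2)] by blast
    \<comment> \<open>The degree \<open>j e - m\<close> is positive, which leaves room for one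
      linear factor vanishing at \<open>x0\<close>. The remaining factors keep \<open>A\<close>
      nonzero at \<open>y0\<close>, so that it can be cancelled generically.\<close>
    define A :: "'k vec \<Rightarrow> 'k" where "A = A1 * coord (chart_index y0) ^ (j * e - m - 1)"
    have deg: "1 + (j * e - m - 1) = j * e - m" "m + (j * e - m) = j * e" using m by auto
    have A: "A \<in> forms N (j * e - m)" unfolding A_def using forms_mult[OF A1(1) chart_index_form[OF F(2), of "j * e - m - 1"]] deg by simp
    have A0: "A (rep x0) = 0" "A (rep y0) \<noteq> 0" unfolding A_def using A1 chart_index(2)[OF F(2)] by (auto simp: fun_power_apply)
    have Fnz: "eventually (\<lambda>y. F (rep y) \<noteq> 0) cof" using form_eventually_nonzero F by blast
    define h where "h = (\<lambda>y. P (rep y) * A (rep y) / F (rep y) ^ j)"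
    have ext: "\<exists>u w. reg x u \<and> reg x w \<and> w x \<noteq> 0 \<and> eventually (\<lambda>y. h y = u y * dehom x (j * e - m) A y / w y ^ j) cof" if x: "x \<in> C" for x
    proof -
      obtain u where u: "reg x u" "eventually (\<lambda>y. dehom x m P y = uniformizer x y ^ (j * count D x) * u y) cof"
        using P(3)[OF x] unfolding vanishes_to_def by blast
      obtain w where w: "reg x w" "w x \<noteq> 0" "eventually (\<lambda>y. dehom x e F y = uniformizer x y powi int (count D x) * w y) cof"
        using D(2)[OF x] by (rule has_ordE)
      have "eventually (\<lambda>y. h y = u y * dehom x (j * e - m) A y / w y ^ j) cof"
        using u(2) w(3) reg_eventually_nonzero[OF w(1,2)] Fnz chart_index_eventually[OF x, unfolded near_def, THEN conjunct2] reg_uniformizer(3)[OF x]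
      proof eventually_elim
        case (elim y)
        let ?l = "rep y (chart_index x)"
        have p: "P (rep y) = ?l ^ m * (uniformizer x y ^ (j * count D x) * u y)" using elim(1,5) by (simp add: dehom_def field_simps)
        have q: "F (rep y) = ?l ^ e * (uniformizer x y ^ count D x * w y)" using elim(2,5) by (simp add: dehom_def field_simps)
        have q': "F (rep y) ^ j = ?l ^ (j * e) * (uniformizer x y ^ (j * count D x) * w y ^ j)"
          unfolding q by (simp add: power_mult_distrib power_mult mult.commute flip: power_mult)
        have l: "?l ^ (j * e) = ?l ^ m * ?l ^ (j * e - m)" by (subst power_add[symmetric]) (simp add: deg)
        have t: "uniformizer x y ^ (j * count D x) \<noteq> 0" using elim(6) by simp
        have gen: "(a * (t * b)) * c / ((a * k) * (t * v)) = b * (c / k) / v"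
          if "t \<noteq> 0" "a \<noteq> 0" "k \<noteq> 0" "v \<noteq> 0" for a b c k t v :: 'k
          using that by (simp add: field_simps)
        show ?case unfolding h_def p q' l dehom_def by (rule gen[OF t]) (use elim(3,5) in simp_all)
      qed
      then show ?thesis using u(1) w(1,2) by blast
    qed
    have "\<exists>g. reg x g \<and> eventually (\<lambda>y. h y = g y) cof" if x: "x \<in> C" for x
    proof -
      obtain u w where *: "reg x u" "reg x w" "w x \<noteq> 0" "eventually (\<lambda>y. h y = u y * dehom x (j * e - m) A y / w y ^ j) cof"
        using ext[OF x] by blast
      have "reg x (\<lambda>y. u y * dehom x (j * e - m) A y / w y ^ j)"
        using * reg_dehom[OF x A] by (intro reg_divide reg_mult reg_power) auto
      then show ?thesis using *(4) by blast
    qed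
    then obtain c where c: "\<And>x g. reg x g \<Longrightarrow> eventually (\<lambda>y. h y = g y) cof \<Longrightarrow> g x = c" "eventually (\<lambda>y. h y = c) cof"
      using regular_extension[of h] by blast
    obtain u w where *: "reg x0 u" "reg x0 w" "w x0 \<noteq> 0" "eventually (\<lambda>y. h y = u y * dehom x0 (j * e - m) A y / w y ^ j) cof"
      using ext[OF x0(1)] by blast
    have "reg x0 (\<lambda>y. u y * dehom x0 (j * e - m) A y / w y ^ j)"
      using * reg_dehom[OF x0(1) A] by (intro reg_divide reg_mult reg_power) auto
    from c(1)[OF this *(4)] have c0: "c = 0" using A0 by (simp add: dehom_def)
    have "eventually (\<lambda>y. P (rep y) = 0) cof"
      using c(2) Fnz form_eventually_nonzero[OF A F(2) A0(2)]
    proof eventually_elim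
      case (elim y)
      then show ?case by (simp add: h_def c0)
    qed
    then show ?thesis using form_eventually_zero[OF P(2)] unfolding P(1) res_def by (auto simp: fun_eq_iff)
  qed
  then have "forms_vanishing m (repeat_mset j D) \<subseteq> fn.span {}" by auto
  then show ?thesis using fn.dim_le_card_spanning[of "{}"] by simp
qed

text \<open>Multiplication by \<open>G\<close> is linear, and injective on restrictions to the curve
  because \<open>G\<close> is generically nonzero there.\<close>

lemma dim_multiple_le:
  assumes G: "G \<in> forms N e" "y0 \<in> C" "G (rep y0) \<noteq> 0"
    and D: "set_mset D \<subseteq> C" "\<And>x. x \<in> C \<Longrightarrow> has_ord x (dehom x e G) (int (count D x))"
  shows "fn.dim (forms_vanishing m {#}) \<le> fn.dim (forms_vanishing (e + m) D)"
proof -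
  interpret vs: vector_space_pair "fscale :: 'k \<Rightarrow> ('k point \<Rightarrow> 'k) \<Rightarrow> ('k point \<Rightarrow> 'k)" "fscale :: 'k \<Rightarrow> ('k point \<Rightarrow> 'k) \<Rightarrow> ('k point \<Rightarrow> 'k)"
    by unfold_locales
  define \<mu> where "\<mu> = (\<lambda>f :: 'k point \<Rightarrow> 'k. \<lambda>y. G (rep y) * f y)"
  have lin: "Vector_Spaces.linear fscale fscale \<mu>"
    by (rule Vector_Spaces.linear_iff[THEN iffD2])
       (auto simp: \<mu>_def fscale_def fun_eq_iff algebra_simps fn.vector_space_axioms)
  have sub: "\<mu> f \<in> forms_vanishing (e + m) D" if f: "f \<in> forms_vanishing m {#}" for f
  proof -
    obtain F where F: "f = res F" "F \<in> forms N m" using f unfolding forms_vanishing_def by blast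
    have "vanishes_to x (count D x) (dehom x (e + m) (G * F))" if x: "x \<in> C" for x
    proof -
      have "vanishes_to x (count D x) (dehom x e G)" using D(2)[OF x] unfolding has_ord_def vanishes_to_def by (auto simp: power_int_of_nat)
      then show ?thesis unfolding dehom_mult using vanishes_to_mult[OF _ vanishes_to_reg[OF reg_dehom[OF x F(2)]]] by fastforce
    qed
    then have "res (G * F) \<in> forms_vanishing (e + m) D" using forms_mult[OF G(1) F(2)] by (intro forms_vanishingI)
    moreover have "res (G * F) = \<mu> f" by (auto simp: res_def \<mu>_def F(1))
    ultimately show ?thesis by simp
  qed
  have inj: "inj_on \<mu> (forms_vanishing m {#})"
  proof (rule inj_onI)
    fix f g assume fg: "f \<in> forms_vanishing m {#}" "g \<in> forms_vanishing m {#}" "\<mu> f = \<mu> g"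
    then have "f - g \<in> forms_vanishing m {#}" using subspace_forms_vanishing fn.subspace_diff by blast
    then obtain F where F: "f - g = res F" "F \<in> forms N m" unfolding forms_vanishing_def by blast
    have "\<mu> (f - g) = 0" using fg(3) by (auto simp: \<mu>_def fun_eq_iff algebra_simps)
    then have z: "G (rep y) * res F y = 0" for y unfolding F(1) \<mu>_def by (metis zero_fun_apply)
    have "eventually (\<lambda>y. F (rep y) = 0) cof"
      using form_eventually_nonzero[OF G] eventually_cof_C
    proof eventually_elim
      case (elim y) then show ?case using z[of y] by (simp add: res_def)
    qed
    then have "res F = 0" using form_eventually_zero[OF F(2)] by (auto simp: res_def fun_eq_iff)
    then show "f = g" using F(1) by simp
  qed
  obtain B where B: "B \<subseteq> forms_vanishing m {#}" "fn.independent B" "forms_vanishing m {#} \<subseteq> fn.span B" "card B = fn.dim (forms_vanishing m {#})"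
    using fn.basis_exists by metis
  have "fn.span B \<subseteq> forms_vanishing m {#}" using B(1) subspace_forms_vanishing fn.span_minimal by blast
  then have inj': "inj_on \<mu> (fn.span B)" using inj inj_on_subset by blast
  have ind: "fn.independent (\<mu> ` B)" using vs.linear_independent_injective_image[OF lin B(2) inj'] .
  obtain T where T: "finite T" "forms_vanishing (e + m) D \<subseteq> fn.span T" using forms_vanishing_finite_dim by blast
  obtain B' where B': "B' \<subseteq> forms_vanishing (e + m) D" "fn.independent B'" "forms_vanishing (e + m) D \<subseteq> fn.span B'" "card B' = fn.dim (forms_vanishing (e + m) D)"
    using fn.basis_exists by metis
  have "finite B'" using fn.independent_span_bound[OF T(1) B'(2)] B'(1) T(2) by blast
  moreover have "\<mu> ` B \<subseteq> fn.span B'" using sub B(1) B'(3) by blast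
  ultimately have "card (\<mu> ` B) \<le> card B'" using fn.independent_span_bound ind by blast
  moreover have "card (\<mu> ` B) = card B" using inj B(1) by (intro card_image) (rule inj_on_subset)
  ultimately show ?thesis using B(4) B'(4) by simp
qed

text \<open>Let \<open>S\<^sub>m(D)\<close> be the space of forms of degree \<open>m\<close> vanishing on \<open>D\<close>. Multiplication by \<open>G\<^sup>j\<close> and
  the vanishing of \<open>S\<^sub>m(jD)\<close> for \<open>m < je\<close>, where \<open>D\<close> is the divisor of \<open>F\<close>, give
  \<open>j deg E \<le> dim S\<^sub>m\<^sub>+\<^sub>j\<^sub>e\<close> up to a constant and \<open>dim S\<^sub>m \<le> j deg D\<close>; then let \<open>j\<close> tend to infinity.\<close>

lemma degree_form_le:
  assumes F: "F \<in> forms N e" "y0 \<in> C" "F (rep y0) \<noteq> 0"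
    and D: "set_mset D \<subseteq> C" "\<And>x. x \<in> C \<Longrightarrow> has_ord x (dehom x e F) (int (count D x))"
    and G: "G \<in> forms N e" "z0 \<in> C" "G (rep z0) \<noteq> 0"
    and E: "set_mset E \<subseteq> C" "\<And>x. x \<in> C \<Longrightarrow> has_ord x (dehom x e G) (int (count E x))"
    and e: "e \<ge> 1"
  shows "size E \<le> size D"
proof (rule ccontr)
  assume "\<not> ?thesis"
  then have less: "size D + 1 \<le> size E" by simp
  obtain m0 where m0: "\<forall>m\<ge>m0. size E + fn.dim (forms_vanishing m E) \<le> fn.dim (forms_vanishing m {#})" using dim_forms_vanishing_lower[OF E(1)] by blast
  have lower: "j * size E \<le> fn.dim (forms_vanishing (m0 + j * e) {#})" for j
  proof (induction j)
    case (Suc j)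
    have "fn.dim (forms_vanishing (m0 + j * e) {#}) \<le> fn.dim (forms_vanishing (e + (m0 + j * e)) E)" by (rule dim_multiple_le[OF G E])
    moreover have "size E + fn.dim (forms_vanishing (e + (m0 + j * e)) E) \<le> fn.dim (forms_vanishing (e + (m0 + j * e)) {#})"
      using m0 by simp
    ultimately show ?case using Suc by (simp add: algebra_simps)
  qed simp
  have upper: "fn.dim (forms_vanishing m {#}) \<le> j * size D" if "m < j * e" for m j
  proof -
    have "set_mset (repeat_mset j D) \<subseteq> C" 
    proof
      fix x assume "x \<in># repeat_mset j D"
      then have "j * count D x > 0" by (simp only: count_greater_zero_iff[symmetric] count_repeat_mset)
      then show "x \<in> C" using D(1) by auto
    qed
    then show ?thesis using dim_forms_vanishing_upper[of "repeat_mset j D" m] dim_forms_vanishing_empty_divisor[OF F D that] by simp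
  qed
  \<comment> \<open>The bounds combine to
    \<open>j (size D + 1) \<le> j (size E) \<le> (j + m0 + 1) (size D)\<close>, that is,
    \<open>j \<le> (m0 + 1) (size D)\<close>; \<open>j\<close> is one more than that.\<close>
  define j where "j = (m0 + 1) * size D + 1"
  have "m0 + j * e < (j + (m0 + 1)) * e"
  proof -
    have "(m0 + 1) * 1 \<le> (m0 + 1) * e" using e by (intro mult_le_mono2)
    then show ?thesis by (simp add: algebra_simps)
  qed
  then have "j * size E \<le> (j + (m0 + 1)) * size D" using lower[of j] upper[of "m0 + j * e" "j + (m0 + 1)"] by linarith
  moreover have "j * (size D + 1) \<le> j * size E" using less by (intro mult_le_mono) auto
  ultimately have "j \<le> (m0 + 1) * size D" by (simp add: algebra_simps)
  then show False by (simp add: j_def)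
qed

lemma form_divisor:
  assumes F: "F \<in> forms N e" "y0 \<in> C" "F (rep y0) \<noteq> 0"
  obtains D where "set_mset D \<subseteq> C" "\<And>x. x \<in> C \<Longrightarrow> has_ord x (dehom x e F) (int (count D x))"
proof -
  have Fnz: "eventually (\<lambda>y. F (rep y) \<noteq> 0) cof" using form_eventually_nonzero F by blast
  have "\<exists>n. has_ord x (dehom x e F) (int n) \<and> (n > 0 \<longleftrightarrow> dehom x e F x = 0)" if x: "x \<in> C" for x
  proof -
    have "eventually (\<lambda>y. dehom x e F y \<noteq> 0) cof"
      using Fnz chart_index_eventually[OF x, unfolded near_def, THEN conjunct2] by eventually_elim (simp add: dehom_def)
    then show ?thesis using has_ord_reg[OF reg_dehom[OF x F(1)]] by metis
  qed
  then obtain n where n: "\<And>x. x \<in> C \<Longrightarrow> has_ord x (dehom x e F) (int (n x))" "\<And>x. x \<in> C \<Longrightarrow> n x > 0 \<longleftrightarrow> dehom x e F x = 0"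
    by metis
  define D where "D = Abs_multiset (\<lambda>x. if x \<in> C then n x else 0)"
  have "{x. 0 < (if x \<in> C then n x else 0)} \<subseteq> {x \<in> C. \<not> F (rep x) \<noteq> 0}"
    using n(2) chart_index(2) by (auto simp: dehom_def split: if_splits)
  moreover have "finite {x \<in> C. \<not> F (rep x) \<noteq> 0}" using Fnz unfolding eventually_cof .
  ultimately have "finite {x. 0 < (if x \<in> C then n x else 0)}" by (rule finite_subset)
  then have c: "count D = (\<lambda>x. if x \<in> C then n x else 0)" unfolding D_def by (intro count_Abs_multiset) 
  have "set_mset D \<subseteq> C"
  proof
    fix x assume "x \<in># D"
    then have "count D x > 0" by simp
    then show "x \<in> C" unfolding c by (simp split: if_splits)
  qed
  then show thesis using that n(1) c by simp
qed

text \<open>A rational function is a quotient of two forms of the same degree, and by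
  \<open>degree_form_le\<close> in both directions their divisors have the same size.\<close>

theorem principal_divisor_degree:
  assumes "rational_fun f" "eventually (\<lambda>y. f y \<noteq> 0) cof"
  shows "(\<Sum>x\<in>{x \<in> C. ord_at x f \<noteq> 0}. ord_at x f) = 0"
proof -
  obtain z where z: "reg z f" using assms(1) rational_fun_reg_iff by blast
  then have zC: "z \<in> C" by (rule reg_C)
  obtain d F0 G0 where *: "F0 \<in> forms N d" "G0 \<in> forms N d" "G0 (rep z) \<noteq> 0" "f z = F0 (rep z) / G0 (rep z)"
    "eventually (\<lambda>y. f y = F0 (rep y) / G0 (rep y)) cof" "eventually (\<lambda>y. G0 (rep y) \<noteq> 0) cof"
    using z by (rule regE)
  have cf: "coord (chart_index z) \<in> forms N 1" using forms_coord chart_index(1)[OF zC] .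
  \<comment> \<open>The common coordinate factor leaves the quotient unchanged and makes the degree
    positive, as \<open>degree_form_le\<close> demands.\<close>
  define F :: "'k vec \<Rightarrow> 'k" where "F = coord (chart_index z) * F0"
  define G :: "'k vec \<Rightarrow> 'k" where "G = coord (chart_index z) * G0"
  define e where "e = 1 + d"
  have F: "F \<in> forms N e" and G: "G \<in> forms N e" unfolding F_def G_def e_def using forms_mult cf *(1,2) by blast+
  have lz: "eventually (\<lambda>y. rep y (chart_index z) \<noteq> 0) cof" using chart_index_eventually[OF zC] by (simp add: near_def)
  have f: "eventually (\<lambda>y. f y = F (rep y) / G (rep y)) cof" using *(5) lz by eventually_elim (simp add: F_def G_def)
  have Gnz: "eventually (\<lambda>y. G (rep y) \<noteq> 0) cof" using *(6) lz by eventually_elim (simp add: G_def)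
  have Fnz: "eventually (\<lambda>y. F (rep y) \<noteq> 0) cof" using f assms(2) by eventually_elim auto
  obtain y0 where y0: "y0 \<in> C" "F (rep y0) \<noteq> 0" using eventually_cof_obtain[OF Fnz] by blast
  obtain z0 where z0: "z0 \<in> C" "G (rep z0) \<noteq> 0" using eventually_cof_obtain[OF Gnz] by blast
  obtain D where D: "set_mset D \<subseteq> C" "\<And>x. x \<in> C \<Longrightarrow> has_ord x (dehom x e F) (int (count D x))"
    using form_divisor[OF F y0] by blast
  obtain E where E: "set_mset E \<subseteq> C" "\<And>x. x \<in> C \<Longrightarrow> has_ord x (dehom x e G) (int (count E x))"
    using form_divisor[OF G z0] by blast
  have "e \<ge> 1" by (simp add: e_def)
  then have size: "size D = size E"
    using degree_form_le[OF F y0 D G z0 E] degree_form_le[OF G z0 E F y0 D] by simp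
  have ord: "ord_at x f = int (count D x) - int (count E x)" if x: "x \<in> C" for x
  proof -
    have "has_ord x (\<lambda>y. dehom x e F y * inverse (dehom x e G y)) (int (count D x) + - int (count E x))"
      using D(2)[OF x] E(2)[OF x] by (intro has_ord_mult has_ord_inverse)
    moreover have "eventually (\<lambda>y. dehom x e F y * inverse (dehom x e G y) = f y) cof"
      using f chart_index_eventually[OF x, unfolded near_def, THEN conjunct2] by eventually_elim (simp add: dehom_def field_simps)
    ultimately have "has_ord x f (int (count D x) + - int (count E x))" by (rule has_ord_cong)
    then show ?thesis using ord_at_eq by simp
  qed
  have sub: "{x \<in> C. ord_at x f \<noteq> 0} \<subseteq> set_mset D \<union> set_mset E" using ord by (auto simp: not_in_iff)
  have "(\<Sum>x\<in>{x \<in> C. ord_at x f \<noteq> 0}. ord_at x f) = (\<Sum>x\<in>set_mset D \<union> set_mset E. ord_at x f)"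
    using sub D(1) E(1) by (intro sum.mono_neutral_left) auto
  also have "\<dots> = (\<Sum>x\<in>set_mset D \<union> set_mset E. int (count D x) - int (count E x))"
    using D(1) E(1) ord by (intro sum.cong) auto
  also have "\<dots> = int (\<Sum>x\<in>set_mset D \<union> set_mset E. count D x) - int (\<Sum>x\<in>set_mset D \<union> set_mset E. count E x)"
    by (simp add: sum_subtractf)
  also have "(\<Sum>x\<in>set_mset D \<union> set_mset E. count D x) = size D"
    unfolding size_multiset_overloaded_eq by (intro sum.mono_neutral_right) (auto simp: not_in_iff)
  also have "(\<Sum>x\<in>set_mset D \<union> set_mset E. count E x) = size E"
    unfolding size_multiset_overloaded_eq by (intro sum.mono_neutral_right) (auto simp: not_in_iff)
  finally show ?thesis using size by simp
qed

end

section \<open>Vector bundles through frames and germs of sections\<close>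

section \<open>Bases of fibres\<close>

definition lcomb :: "nat \<Rightarrow> (nat \<Rightarrow> 'k::field) \<Rightarrow> (nat \<Rightarrow> 'k vec) \<Rightarrow> 'k vec" where
  "lcomb n c e = (\<Sum>i<n. fscale (c i) (e i))"

lemma lcomb_cong: "(\<And>i. i < n \<Longrightarrow> c i = c' i) \<Longrightarrow> (\<And>i. i < n \<Longrightarrow> e i = e' i) \<Longrightarrow> lcomb n c e = lcomb n c' e'"
  unfolding lcomb_def by (rule sum.cong) auto

lemma lcomb_add: "lcomb n (\<lambda>i. c i + c' i) e = lcomb n c e + lcomb n c' e"
  by (simp add: lcomb_def fn.scale_left_distrib sum.distrib)

lemma lcomb_diff: "lcomb n (\<lambda>i. c i - c' i) e = lcomb n c e - lcomb n c' e"
  by (simp add: lcomb_def fn.scale_left_diff_distrib sum_subtractf)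

lemma lcomb_scale: "lcomb n (\<lambda>i. a * c i) e = fscale a (lcomb n c e)"
  by (simp add: lcomb_def fn.scale_sum_right)

lemma lcomb_zero: "lcomb n (\<lambda>i. 0) e = 0"
  by (simp add: lcomb_def)

lemma lcomb_single: "j < n \<Longrightarrow> lcomb n (\<lambda>i. if i = j then a else 0) e = fscale a (e j)"
proof -
  assume j: "j < n"
  have "lcomb n (\<lambda>i. if i = j then a else 0) e = (\<Sum>i<n. if i = j then fscale a (e i) else 0)"
    unfolding lcomb_def by (rule sum.cong) auto
  then show ?thesis using j by simp
qed

lemma lcomb_lcomb: "lcomb n c (\<lambda>j. lcomb m (\<lambda>i. A i j) e) = lcomb m (\<lambda>i. \<Sum>j<n. c j * A i j) e"
proof -
  have "lcomb n c (\<lambda>j. lcomb m (\<lambda>i. A i j) e) = (\<Sum>j<n. \<Sum>i<m. fscale (c j * A i j) (e i))"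
    by (simp add: lcomb_def fn.scale_sum_right)
  also have "\<dots> = lcomb m (\<lambda>i. \<Sum>j<n. c j * A i j) e"
    by (subst sum.swap) (simp add: lcomb_def fn.scale_sum_left)
  finally show ?thesis .
qed

lemma lcomb_split: "lcomb (m + l) c e = lcomb m c e + lcomb l (\<lambda>i. c (m + i)) (\<lambda>i. e (m + i))"
proof -
  have "{..<m + l} = {..<m} \<union> (\<lambda>i. m + i) ` {..<l}"
  proof (intro equalityI subsetI)
    fix i assume "i \<in> {..<m + l}"
    then show "i \<in> {..<m} \<union> (\<lambda>i. m + i) ` {..<l}" by (cases "i < m") (auto simp: image_iff intro!: bexI[of _ "i - m"])
  qed auto
  then have "lcomb (m + l) c e = (\<Sum>i<m. fscale (c i) (e i)) + (\<Sum>i\<in>(\<lambda>i. m + i) ` {..<l}. fscale (c i) (e i))"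
    unfolding lcomb_def by (simp only:) (rule sum.union_disjoint, auto)
  then show ?thesis by (simp add: sum.reindex lcomb_def inj_on_def)
qed

text \<open>An ordered basis indexed by the first \<open>n\<close> naturals;
  \<open>fbasis_iff_span\<close> identifies it with the three fibre conditions in
  \<open>frame\<close>. Values of \<open>e\<close> from \<open>n\<close> on are arbitrary.\<close>

definition fbasis :: "nat \<Rightarrow> (nat \<Rightarrow> 'k::field vec) \<Rightarrow> 'k vec set \<Rightarrow> bool" where
  "fbasis n e S \<longleftrightarrow> (\<forall>v. v \<in> S \<longleftrightarrow> (\<exists>c. v = lcomb n c e)) \<and> (\<forall>c. lcomb n c e = 0 \<longrightarrow> (\<forall>i<n. c i = 0))"

definition coords :: "nat \<Rightarrow> (nat \<Rightarrow> 'k::field vec) \<Rightarrow> 'k vec \<Rightarrow> nat \<Rightarrow> 'k" where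
  "coords n e v = (SOME c. v = lcomb n c e)"

lemma fbasis_mem: "fbasis n e S \<Longrightarrow> lcomb n c e \<in> S"
  by (auto simp: fbasis_def)

lemma fbasis_elem: "fbasis n e S \<Longrightarrow> i < n \<Longrightarrow> e i \<in> S"
  using fbasis_mem[of n e S "\<lambda>j. if j = i then 1 else 0"] by (simp add: lcomb_single)

lemma fbasis_unique: "fbasis n e S \<Longrightarrow> lcomb n c e = lcomb n c' e \<Longrightarrow> i < n \<Longrightarrow> c i = c' i"
proof -
  assume *: "fbasis n e S" "lcomb n c e = lcomb n c' e" "i < n"
  have "lcomb n (\<lambda>i. c i - c' i) e = 0" using *(2) by (simp add: lcomb_diff)
  then have "c i - c' i = 0" using *(1,3) unfolding fbasis_def by blast
  then show ?thesis by simp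
qed

lemma fbasis_coords: "fbasis n e S \<Longrightarrow> v \<in> S \<Longrightarrow> lcomb n (coords n e v) e = v"
proof -
  assume "fbasis n e S" "v \<in> S"
  then have "\<exists>c. v = lcomb n c e" by (auto simp: fbasis_def)
  then have "v = lcomb n (coords n e v) e" unfolding coords_def by (rule someI_ex)
  then show ?thesis by simp
qed

lemma coords_lcomb: "fbasis n e S \<Longrightarrow> i < n \<Longrightarrow> coords n e (lcomb n c e) i = c i"
  using fbasis_unique[of n e S "coords n e (lcomb n c e)" c i] fbasis_coords fbasis_mem by metis

lemma fbasis_subspace:
  assumes "fbasis n e S"
  shows "0 \<in> S" "v \<in> S \<Longrightarrow> w \<in> S \<Longrightarrow> v + w \<in> S" "v \<in> S \<Longrightarrow> fscale a v \<in> S"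
  using fbasis_mem[OF assms, of "\<lambda>_. 0"] fbasis_mem[OF assms, of "\<lambda>i. coords n e v i + coords n e w i"]
    fbasis_mem[OF assms, of "\<lambda>i. a * coords n e v i"] fbasis_coords[OF assms]
  by (simp_all add: lcomb_zero lcomb_add lcomb_scale)

lemma fbasis_iff_span:
  fixes e :: "nat \<Rightarrow> 'k::field vec"
  shows "fbasis n e S \<longleftrightarrow> inj_on e {..<n} \<and> fn.independent (e ` {..<n}) \<and> fn.span (e ` {..<n}) = S"
proof
  assume b: "fbasis n e S"
  have inj: "inj_on e {..<n}"
  proof (rule inj_onI)
    fix i j assume ij: "i \<in> {..<n}" "j \<in> {..<n}" "e i = e j"
    have "lcomb n (\<lambda>l. if l = i then 1 else 0) e = lcomb n (\<lambda>l. if l = j then 1 else 0) e"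
      using ij by (simp add: lcomb_single)
    from fbasis_unique[OF b this, of i] show "i = j" using ij by (simp split: if_splits)
  qed
  have reindex: "(\<Sum>v\<in>e ` {..<n}. fscale (u v) v) = lcomb n (\<lambda>i. u (e i)) e" for u
    unfolding lcomb_def by (subst sum.reindex[OF inj]) simp
  have "fn.independent (e ` {..<n})"
  proof
    assume "fn.dependent (e ` {..<n})"
    then obtain u where u: "\<exists>v\<in>e ` {..<n}. u v \<noteq> 0" "(\<Sum>v\<in>e ` {..<n}. fscale (u v) v) = 0"
      using fn.dependent_finite[of "e ` {..<n}"] by auto
    then show False using b unfolding reindex fbasis_def by blast
  qed
  moreover have "fn.span (e ` {..<n}) = S"
  proof
    show "fn.span (e ` {..<n}) \<subseteq> S"
      using fbasis_elem[OF b] fbasis_subspace[OF b] by (intro fn.span_minimal fn.subspaceI) auto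
    show "S \<subseteq> fn.span (e ` {..<n})"
    proof
      fix v assume "v \<in> S"
      then have "v = lcomb n (coords n e v) e" using fbasis_coords[OF b] by simp
      moreover have "lcomb n (coords n e v) e \<in> fn.span (e ` {..<n})"
        unfolding lcomb_def by (intro fn.span_sum fn.span_scale fn.span_base imageI) auto
      ultimately show "v \<in> fn.span (e ` {..<n})" by simp
    qed
  qed
  ultimately show "inj_on e {..<n} \<and> fn.independent (e ` {..<n}) \<and> fn.span (e ` {..<n}) = S" using inj by blast
next
  assume *: "inj_on e {..<n} \<and> fn.independent (e ` {..<n}) \<and> fn.span (e ` {..<n}) = S"
  then have inj: "inj_on e {..<n}" by blast
  have reindex: "(\<Sum>v\<in>e ` {..<n}. fscale (u v) v) = lcomb n (\<lambda>i. u (e i)) e" for u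
    unfolding lcomb_def by (subst sum.reindex[OF inj]) simp
  have "c i = 0" if "lcomb n c e = 0" "i < n" for c i
  proof (rule ccontr)
    assume ci: "c i \<noteq> 0"
    define u where "u v = c (the_inv_into {..<n} e v)" for v
    have u: "u (e j) = c j" if "j < n" for j using the_inv_into_f_f[OF inj] that by (simp add: u_def)
    have "(\<Sum>v\<in>e ` {..<n}. fscale (u v) v) = lcomb n c e" unfolding reindex by (rule lcomb_cong) (auto simp: u)
    moreover have "\<exists>v\<in>e ` {..<n}. u v \<noteq> 0" using ci u[OF that(2)] that(2) by force
    ultimately have "fn.dependent (e ` {..<n})" using that
      by (subst fn.dependent_finite) (auto intro!: exI[of _ u])
    then show False using * by blast
  qed
  moreover have "v \<in> S \<longleftrightarrow> (\<exists>c. v = lcomb n c e)" for v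
  proof
    assume "v \<in> S"
    then have "v \<in> fn.span (e ` {..<n})" using * by blast
    then obtain u where "v = (\<Sum>v\<in>e ` {..<n}. fscale (u v) v)" by (auto simp: fn.span_finite)
    then show "\<exists>c. v = lcomb n c e" unfolding reindex by blast
  next
    assume "\<exists>c. v = lcomb n c e"
    then obtain c where "v = lcomb n c e" by blast
    moreover have "lcomb n c e \<in> fn.span (e ` {..<n})"
      unfolding lcomb_def by (intro fn.span_sum fn.span_scale fn.span_base imageI) auto
    ultimately have "v \<in> fn.span (e ` {..<n})" by simp
    then show "v \<in> S" using * by blast
  qed
  ultimately show "fbasis n e S" unfolding fbasis_def by blast
qed

lemma fbasis_card:
  assumes "fbasis n e S" "fbasis m f S" shows "n = m"
proof -
  have 1: "card (e ` {..<n}) = n" "card (f ` {..<m}) = m" "fn.independent (e ` {..<n})" "fn.independent (f ` {..<m})"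
    "fn.span (e ` {..<n}) = S" "fn.span (f ` {..<m}) = S"
    using assms unfolding fbasis_iff_span by (auto simp: card_image)
  have "card (e ` {..<n}) = fn.dim S" "card (f ` {..<m}) = fn.dim S"
    using fn.dim_span_eq_card_independent[OF 1(3)] fn.dim_span_eq_card_independent[OF 1(4)] 1(5,6) by auto
  then show ?thesis using 1 by simp
qed

section \<open>Germs of sections and frames\<close>

context curve
begin

lemma near_near: "near x P \<Longrightarrow> near x (\<lambda>z. near z P)"
  unfolding near_def by (auto elim: eventually_mono)

lemma near_openI: "x \<in> C \<Longrightarrow> near x P \<Longrightarrow> openin (zariski N C) {y \<in> C. P y}"
  using openin_cofinite by (auto simp: near_def)

lemma near_inC: "x \<in> C \<Longrightarrow> near x (\<lambda>z. z \<in> C)"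
  by (simp add: near_def eventually_cof_C)

lemma open_near: "openin (zariski N C) U \<Longrightarrow> x \<in> U \<Longrightarrow> near x (\<lambda>y. y \<in> U)"
  using openin_eventually by (auto simp: near_def)

lemma near_reg: "reg x f \<Longrightarrow> near x (\<lambda>z. reg z f)"
  using reg_eventually_reg by (simp add: near_def)

lemma near_reg_all: "(\<And>i. i < n \<Longrightarrow> reg x (f i)) \<Longrightarrow> near x (\<lambda>z. \<forall>i<(n::nat). reg z (f i))"
proof -
  assume "\<And>i. i < n \<Longrightarrow> reg x (f i)"
  then have "near x (\<lambda>z. \<forall>i\<in>{..<n}. reg z (f i))" by (intro near_ball near_reg) auto
  then show ?thesis by (rule near_mono) auto
qed

text \<open>Regularity of the germ of \<open>s\<close> at \<open>x\<close>. The function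
  \<open>s\<close> may be anything away from a neighbourhood, whereas \<open>sections\<close>
  insists on the value 0 outside the open set.\<close>

definition reg_section :: "'k vbundle \<Rightarrow> 'k point \<Rightarrow> ('k point \<Rightarrow> 'k vec) \<Rightarrow> bool" where
  "reg_section E x s \<longleftrightarrow> (\<exists>U. openin (zariski N C) U \<and> x \<in> U \<and> restrict_section U s \<in> sections E U)"

text \<open>The clauses of \<open>vector_bundle\<close> other than local triviality. New bundles are
  first shown to satisfy these, and frames are constructed afterwards.\<close>

definition bundle_sheaf :: "'k vbundle \<Rightarrow> bool" where
  "bundle_sheaf E \<longleftrightarrow>
     (\<forall>x. x \<notin> C \<longrightarrow> fibre E x = {}) \<and>
     (\<forall>U. \<not> openin (zariski N C) U \<longrightarrow> sections E U = {}) \<and>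
     (\<forall>U. \<forall>s\<in>sections E U. (\<forall>x\<in>U. s x \<in> fibre E x) \<and> (\<forall>x. x \<notin> U \<longrightarrow> s x = 0)) \<and>
     (\<forall>U W s. openin (zariski N C) U \<and> openin (zariski N C) W \<and> W \<subseteq> U \<and> s \<in> sections E U
        \<longrightarrow> restrict_section W s \<in> sections E W) \<and>
     (\<forall>U s. openin (zariski N C) U \<and> (\<forall>x. x \<notin> U \<longrightarrow> s x = 0) \<and>
        (\<forall>x\<in>U. \<exists>W. openin (zariski N C) W \<and> x \<in> W \<and> W \<subseteq> U \<and> restrict_section W s \<in> sections E W)
        \<longrightarrow> s \<in> sections E U)"

lemma vector_bundle_bundle_sheaf:
  "vector_bundle N C n E \<longleftrightarrow> bundle_sheaf E \<and> (\<forall>x\<in>C. \<exists>U e. x \<in> U \<and> frame N C n E U e)"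
  unfolding vector_bundle_def bundle_sheaf_def by (simp only: conj_assoc)

lemma bundle_sheafD:
  assumes "bundle_sheaf E"
  shows "x \<notin> C \<Longrightarrow> fibre E x = {}"
    and "\<not> openin (zariski N C) U \<Longrightarrow> sections E U = {}"
    and "s \<in> sections E U \<Longrightarrow> x \<in> U \<Longrightarrow> s x \<in> fibre E x"
    and "s \<in> sections E U \<Longrightarrow> x \<notin> U \<Longrightarrow> s x = 0"
    and "openin (zariski N C) U \<Longrightarrow> openin (zariski N C) W \<Longrightarrow> W \<subseteq> U \<Longrightarrow> s \<in> sections E U \<Longrightarrow> restrict_section W s \<in> sections E W"
    and "openin (zariski N C) U \<Longrightarrow> (\<And>x. x \<notin> U \<Longrightarrow> s x = 0) \<Longrightarrow>
        (\<And>x. x \<in> U \<Longrightarrow> \<exists>W. openin (zariski N C) W \<and> x \<in> W \<and> W \<subseteq> U \<and> restrict_section W s \<in> sections E W)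
        \<Longrightarrow> s \<in> sections E U"
proof -
  note * = assms[unfolded bundle_sheaf_def]
  show "x \<notin> C \<Longrightarrow> fibre E x = {}" using conjunct1[OF *] by simp
  show "\<not> openin (zariski N C) U \<Longrightarrow> sections E U = {}" using conjunct1[OF conjunct2[OF *]] by simp
  show "s \<in> sections E U \<Longrightarrow> x \<in> U \<Longrightarrow> s x \<in> fibre E x" "s \<in> sections E U \<Longrightarrow> x \<notin> U \<Longrightarrow> s x = 0"
    using conjunct1[OF conjunct2[OF conjunct2[OF *]]] by blast+
  show "openin (zariski N C) U \<Longrightarrow> openin (zariski N C) W \<Longrightarrow> W \<subseteq> U \<Longrightarrow> s \<in> sections E U \<Longrightarrow> restrict_section W s \<in> sections E W"
    using conjunct1[OF conjunct2[OF conjunct2[OF conjunct2[OF *]]]] by simp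
  show "openin (zariski N C) U \<Longrightarrow> (\<And>x. x \<notin> U \<Longrightarrow> s x = 0) \<Longrightarrow>
        (\<And>x. x \<in> U \<Longrightarrow> \<exists>W. openin (zariski N C) W \<and> x \<in> W \<and> W \<subseteq> U \<and> restrict_section W s \<in> sections E W)
        \<Longrightarrow> s \<in> sections E U"
    using conjunct2[OF conjunct2[OF conjunct2[OF conjunct2[OF *]]]] by simp
qed

lemma reg_section_C: "reg_section E x s \<Longrightarrow> x \<in> C"
  unfolding reg_section_def using openin_sub_C by blast

lemma reg_section_fibre: "bundle_sheaf E \<Longrightarrow> reg_section E x s \<Longrightarrow> s x \<in> fibre E x"
  unfolding reg_section_def using bundle_sheafD(3)[of E "restrict_section _ s" _ x] by (fastforce simp: restrict_section_def)

lemma reg_section_near: "reg_section E x s \<Longrightarrow> near x (\<lambda>z. reg_section E z s)"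
proof -
  assume "reg_section E x s"
  then obtain U where U: "openin (zariski N C) U" "x \<in> U" "restrict_section U s \<in> sections E U" unfolding reg_section_def by blast
  show ?thesis by (rule near_mono[OF open_near[OF U(1,2)]]) (use U in \<open>auto simp: reg_section_def\<close>)
qed

lemma reg_section_cong:
  assumes E: "bundle_sheaf E" and s: "reg_section E x s" "near x (\<lambda>z. s z = s' z)" shows "reg_section E x s'"
proof -
  obtain U where U: "openin (zariski N C) U" "x \<in> U" "restrict_section U s \<in> sections E U" using s(1) unfolding reg_section_def by blast
  have x: "x \<in> C" using s(1) reg_section_C by blast
  define W where "W = {y \<in> C. y \<in> U \<and> s y = s' y}"
  have W: "openin (zariski N C) W" unfolding W_def using near_openI[OF x near_conj[OF open_near[OF U(1,2)] s(2)]] .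
  then have "restrict_section W (restrict_section U s) \<in> sections E W"
    using bundle_sheafD(5)[OF E U(1) _ _ U(3)] by (auto simp: W_def)
  moreover have "restrict_section W (restrict_section U s) = restrict_section W s'"
    by (auto simp: restrict_section_def W_def)
  moreover have "x \<in> W" using U(2) s(2) x by (auto simp: W_def near_def)
  ultimately show ?thesis using W unfolding reg_section_def by metis
qed

text \<open>Restriction and gluing reduce sections over open sets to germs, and all later arguments
  on bundles use germs.\<close>

lemma sections_iff:
  assumes E: "bundle_sheaf E" and U: "openin (zariski N C) U"
  shows "s \<in> sections E U \<longleftrightarrow> (\<forall>x. x \<notin> U \<longrightarrow> s x = 0) \<and> (\<forall>x\<in>U. reg_section E x s)"
proof
  assume s: "s \<in> sections E U"
  then have z: "\<forall>x. x \<notin> U \<longrightarrow> s x = 0" using bundle_sheafD(4)[OF E] by blast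
  then have "restrict_section U s = s" by (auto simp: restrict_section_def)
  then have "\<forall>x\<in>U. reg_section E x s" unfolding reg_section_def using U s by metis
  then show "(\<forall>x. x \<notin> U \<longrightarrow> s x = 0) \<and> (\<forall>x\<in>U. reg_section E x s)" using z by blast
next
  assume s: "(\<forall>x. x \<notin> U \<longrightarrow> s x = 0) \<and> (\<forall>x\<in>U. reg_section E x s)"
  have "\<exists>W. openin (zariski N C) W \<and> x \<in> W \<and> W \<subseteq> U \<and> restrict_section W s \<in> sections E W" if x: "x \<in> U" for x
  proof -
    obtain W where W: "openin (zariski N C) W" "x \<in> W" "restrict_section W s \<in> sections E W" using s x unfolding reg_section_def by blast
    have WU: "openin (zariski N C) (W \<inter> U)" using W U by blast
    then have "restrict_section (W \<inter> U) (restrict_section W s) \<in> sections E (W \<inter> U)"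
      using bundle_sheafD(5)[OF E W(1) _ _ W(3)] by blast
    moreover have "restrict_section (W \<inter> U) (restrict_section W s) = restrict_section (W \<inter> U) s"
      by (auto simp: restrict_section_def)
    ultimately show ?thesis using WU x W(2) by (intro exI[of _ "W \<inter> U"]) auto
  qed
  then show "s \<in> sections E U" using s by (intro bundle_sheafD(6)[OF E U]) blast+
qed

text \<open>A family is a frame over an open set if and only if it satisfies this condition at every point
  of the set.\<close>

definition frame_at :: "'k vbundle \<Rightarrow> nat \<Rightarrow> 'k point \<Rightarrow> (nat \<Rightarrow> 'k point \<Rightarrow> 'k vec) \<Rightarrow> bool" where
  "frame_at E n y e \<longleftrightarrow> fbasis n (\<lambda>i. e i y) (fibre E y) \<and>
     (\<forall>s. reg_section E y s \<longleftrightarrow> (\<exists>f. (\<forall>i<n. reg y (f i)) \<and> near y (\<lambda>z. s z = lcomb n (\<lambda>i. f i z) (\<lambda>i. e i z))))"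

lemma frame_at_fbasis: "frame_at E n y e \<Longrightarrow> fbasis n (\<lambda>i. e i y) (fibre E y)"
  by (simp add: frame_at_def)

lemma frame_at_reg_sectionI:
  assumes "frame_at E n y e" "\<And>i. i < n \<Longrightarrow> reg y (f i)" "near y (\<lambda>z. s z = lcomb n (\<lambda>i. f i z) (\<lambda>i. e i z))"
  shows "reg_section E y s"
proof -
  have "\<exists>f. (\<forall>i<n. reg y (f i)) \<and> near y (\<lambda>z. s z = lcomb n (\<lambda>i. f i z) (\<lambda>i. e i z))"
    using assms(2,3) by (intro exI[of _ f]) blast
  then show ?thesis using assms(1) unfolding frame_at_def by blast
qed

lemma frame_at_reg_sectionE:
  assumes "frame_at E n y e" "reg_section E y s"
  obtains f where "\<And>i. i < n \<Longrightarrow> reg y (f i)" "near y (\<lambda>z. s z = lcomb n (\<lambda>i. f i z) (\<lambda>i. e i z))"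
proof -
  have "\<exists>f. (\<forall>i<n. reg y (f i)) \<and> near y (\<lambda>z. s z = lcomb n (\<lambda>i. f i z) (\<lambda>i. e i z))"
    using assms unfolding frame_at_def by blast
  then show thesis using that by blast
qed

lemma frame_at_reg_section_frame:
  assumes "frame_at E n y e" "y \<in> C" "i < n" shows "reg_section E y (e i)"
  by (rule frame_at_reg_sectionI[OF assms(1), of "\<lambda>j _. if j = i then 1 else 0"])
     (use assms in \<open>auto simp: lcomb_single near_def intro: reg_const\<close>)

lemma frame_imp_frame_at:
  assumes E: "bundle_sheaf E" and f: "frame N C n E U e" and y: "y \<in> U"
  shows "frame_at E n y e"
proof -
  have U: "openin (zariski N C) U" using f by (simp add: frame_def)
  have sec: "sections E W = {restrict_section W (\<lambda>y. lcomb n (\<lambda>i. f i y) (\<lambda>i. e i y)) | f. \<forall>i<n. regular_on N C W (f i)}"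
    if "openin (zariski N C) W" "W \<subseteq> U" for W
    using f that unfolding frame_def lcomb_def by blast
  have "fbasis n (\<lambda>i. e i y) (fibre E y)" unfolding fbasis_iff_span using f y by (simp add: frame_def)
  moreover have "reg_section E y s \<longleftrightarrow> (\<exists>f. (\<forall>i<n. reg y (f i)) \<and> near y (\<lambda>z. s z = lcomb n (\<lambda>i. f i z) (\<lambda>i. e i z)))" for s
  proof
    assume "reg_section E y s"
    then obtain W where W: "openin (zariski N C) W" "y \<in> W" "restrict_section W s \<in> sections E W" unfolding reg_section_def by blast
    have WU: "openin (zariski N C) (W \<inter> U)" using W U by blast
    then have "restrict_section (W \<inter> U) (restrict_section W s) \<in> sections E (W \<inter> U)"
      using bundle_sheafD(5)[OF E W(1) _ _ W(3)] by blast
    then obtain f where f: "restrict_section (W \<inter> U) (restrict_section W s) = restrict_section (W \<inter> U) (\<lambda>y. lcomb n (\<lambda>i. f i y) (\<lambda>i. e i y))"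
      "\<forall>i<n. regular_on N C (W \<inter> U) (f i)" unfolding sec[OF WU Int_lower2] by blast
    have sz: "s z = lcomb n (\<lambda>i. f i z) (\<lambda>i. e i z)" if z: "z \<in> W \<inter> U" for z
      using fun_cong[OF f(1), of z] z by (simp add: restrict_section_def)
    have "near y (\<lambda>z. s z = lcomb n (\<lambda>i. f i z) (\<lambda>i. e i z))"
      by (rule near_mono[OF open_near[OF WU, of y]]) (use W y sz in auto)
    moreover have "\<forall>i<n. reg y (f i)" using f(2) W y regular_on_imp_reg by blast
    ultimately show "\<exists>f. (\<forall>i<n. reg y (f i)) \<and> near y (\<lambda>z. s z = lcomb n (\<lambda>i. f i z) (\<lambda>i. e i z))" by blast
  next
    assume "\<exists>f. (\<forall>i<n. reg y (f i)) \<and> near y (\<lambda>z. s z = lcomb n (\<lambda>i. f i z) (\<lambda>i. e i z))"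
    then obtain f where f: "\<And>i. i < n \<Longrightarrow> reg y (f i)" "near y (\<lambda>z. s z = lcomb n (\<lambda>i. f i z) (\<lambda>i. e i z))" by blast
    have yC: "y \<in> C" using U y openin_sub_C by blast
    define W where "W = {z \<in> C. (z \<in> U \<and> (\<forall>i<n. reg z (f i))) \<and> s z = lcomb n (\<lambda>i. f i z) (\<lambda>i. e i z)}"
    have n: "near y (\<lambda>z. (z \<in> U \<and> (\<forall>i<n. reg z (f i))) \<and> s z = lcomb n (\<lambda>i. f i z) (\<lambda>i. e i z))"
      by (rule near_conj[OF near_conj[OF open_near[OF U y] near_reg_all[OF f(1)]] f(2)])
    have W: "openin (zariski N C) W" unfolding W_def by (rule near_openI[OF yC n])
    have yW: "y \<in> W" using f y yC by (auto simp: W_def near_def)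
    have "restrict_section W s = restrict_section W (\<lambda>y. lcomb n (\<lambda>i. f i y) (\<lambda>i. e i y))"
      by (intro ext) (auto simp: restrict_section_def W_def)
    moreover have "\<forall>i<n. regular_on N C W (f i)" using W by (auto simp: regular_on_iff W_def)
    ultimately have "restrict_section W s \<in> sections E W" using sec[OF W] W_def by blast
    then show "reg_section E y s" unfolding reg_section_def using W yW by blast
  qed
  ultimately show ?thesis unfolding frame_at_def by blast
qed

text \<open>The coefficients of a section are determined pointwise by the bases. Near each point
  they agree with the regular coefficients provided there, so the local coefficients fit
  together.\<close>

lemma frame_at_imp_frame:
  assumes E: "bundle_sheaf E" and U: "openin (zariski N C) U" and p: "\<And>y. y \<in> U \<Longrightarrow> frame_at E n y e"
  shows "frame N C n E U e"
  unfolding frame_def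
proof (intro conjI ballI allI impI)
  fix y assume y: "y \<in> U"
  show "inj_on (\<lambda>i. e i y) {..<n}" "fn.independent ((\<lambda>i. e i y) ` {..<n})" "fn.span ((\<lambda>i. e i y) ` {..<n}) = fibre E y"
    using frame_at_fbasis[OF p[OF y]] unfolding fbasis_iff_span by blast+
next
  fix W assume W: "openin (zariski N C) W \<and> W \<subseteq> U"
  have "s \<in> sections E W \<longleftrightarrow> (\<exists>f. s = restrict_section W (\<lambda>y. lcomb n (\<lambda>i. f i y) (\<lambda>i. e i y)) \<and> (\<forall>i<n. regular_on N C W (f i)))" for s
  proof
    assume "s \<in> sections E W"
    then have s: "\<And>x. x \<notin> W \<Longrightarrow> s x = 0" "\<And>x. x \<in> W \<Longrightarrow> reg_section E x s" using sections_iff[OF E] W by blast+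
    define f where "f i y = coords n (\<lambda>i. e i y) (s y) i" for i y
    have eq: "s y = lcomb n (\<lambda>i. f i y) (\<lambda>i. e i y)" if "y \<in> W" for y
      unfolding f_def using fbasis_coords[OF frame_at_fbasis[OF p]] reg_section_fibre[OF E s(2)[OF that]] W that by (simp add: subset_iff)
    have "reg y (f i)" if y: "y \<in> W" and i: "i < n" for y i
    proof -
      obtain g where g: "\<And>i. i < n \<Longrightarrow> reg y (g i)" "near y (\<lambda>z. s z = lcomb n (\<lambda>i. g i z) (\<lambda>i. e i z))"
        using frame_at_reg_sectionE[OF p s(2)[OF y]] y W by blast
      have "near y (\<lambda>z. g i z = f i z)"
        by (rule near_mono[OF near_conj[OF g(2) open_near[of W y]]])
           (use W y i in \<open>auto simp: f_def subset_iff coords_lcomb[OF frame_at_fbasis[OF p]]\<close>)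
      then show ?thesis using reg_near_cong[OF g(1)[OF i]] by blast
    qed
    then have "\<forall>i<n. regular_on N C W (f i)" using W by (simp add: regular_on_iff)
    moreover have "s = restrict_section W (\<lambda>y. lcomb n (\<lambda>i. f i y) (\<lambda>i. e i y))"
      using eq s(1) by (auto simp: restrict_section_def)
    ultimately show "\<exists>f. s = restrict_section W (\<lambda>y. lcomb n (\<lambda>i. f i y) (\<lambda>i. e i y)) \<and> (\<forall>i<n. regular_on N C W (f i))" by blast
  next
    assume "\<exists>f. s = restrict_section W (\<lambda>y. lcomb n (\<lambda>i. f i y) (\<lambda>i. e i y)) \<and> (\<forall>i<n. regular_on N C W (f i))"
    then obtain f where f: "s = restrict_section W (\<lambda>y. lcomb n (\<lambda>i. f i y) (\<lambda>i. e i y))" "\<forall>i<n. regular_on N C W (f i)" by blast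
    have "reg_section E y s" if y: "y \<in> W" for y
    proof (rule frame_at_reg_sectionI[OF p])
      show "y \<in> U" using W y by blast
      show "reg y (f i)" if "i < n" for i using f(2) that y regular_on_imp_reg by blast
      show "near y (\<lambda>z. s z = lcomb n (\<lambda>i. f i z) (\<lambda>i. e i z))"
        by (rule near_mono[OF open_near[of W y]]) (use W y in \<open>auto simp: f(1) restrict_section_def\<close>)
    qed
    moreover have "\<forall>x. x \<notin> W \<longrightarrow> s x = 0" unfolding f(1) by (simp add: restrict_section_def)
    ultimately show "s \<in> sections E W" using sections_iff[OF E] W by blast
  qed
  then show "sections E W = {restrict_section W (\<lambda>y. \<Sum>i<n. fscale (f i y) (e i y)) | f. \<forall>i<n. regular_on N C W (f i)}"
    unfolding lcomb_def by blast
qed (use U in blast)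

text \<open>Required near \<open>x\<close> and not only at \<open>x\<close>, so that an open set
  carrying the frame is at hand.\<close>

definition local_frame :: "'k vbundle \<Rightarrow> nat \<Rightarrow> 'k point \<Rightarrow> (nat \<Rightarrow> 'k point \<Rightarrow> 'k vec) \<Rightarrow> bool" where
  "local_frame E n x e \<longleftrightarrow> near x (\<lambda>z. frame_at E n z e)"

lemma local_frame_frame_at: "local_frame E n x e \<Longrightarrow> frame_at E n x e"
  by (simp add: local_frame_def near_def)

lemma local_frame_frame: "bundle_sheaf E \<Longrightarrow> x \<in> C \<Longrightarrow> local_frame E n x e \<Longrightarrow> frame N C n E {y \<in> C. frame_at E n y e} e"
  by (rule frame_at_imp_frame) (auto simp: local_frame_def intro: near_openI)

lemma frame_local_frame: "bundle_sheaf E \<Longrightarrow> frame N C n E U e \<Longrightarrow> x \<in> U \<Longrightarrow> local_frame E n x e"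
  unfolding local_frame_def by (rule near_mono[OF open_near[of U]]) (auto intro: frame_imp_frame_at simp: frame_def)

lemma vector_bundle_iff: "vector_bundle N C n E \<longleftrightarrow> bundle_sheaf E \<and> (\<forall>x\<in>C. \<exists>e. local_frame E n x e)"
  unfolding vector_bundle_bundle_sheaf
proof (intro conj_cong refl ball_cong)
  fix x assume E: "bundle_sheaf E" and x: "x \<in> C"
  show "(\<exists>U e. x \<in> U \<and> frame N C n E U e) \<longleftrightarrow> (\<exists>e. local_frame E n x e)"
  proof
    assume "\<exists>e. local_frame E n x e"
    then obtain e where "local_frame E n x e" by blast
    then have "frame N C n E {y \<in> C. frame_at E n y e} e" "x \<in> {y \<in> C. frame_at E n y e}"
      using local_frame_frame[OF E x] local_frame_frame_at x by blast+
    then show "\<exists>U e. x \<in> U \<and> frame N C n E U e" by (intro exI conjI)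
  qed (use frame_local_frame[OF E] in blast)
qed

lemma reg_section_add:
  assumes "frame_at E n x e" "reg_section E x s" "reg_section E x s'" shows "reg_section E x (\<lambda>z. s z + s' z)"
proof -
  obtain f where f: "\<And>i. i < n \<Longrightarrow> reg x (f i)" "near x (\<lambda>z. s z = lcomb n (\<lambda>i. f i z) (\<lambda>i. e i z))"
    using frame_at_reg_sectionE[OF assms(1,2)] by blast
  obtain g where g: "\<And>i. i < n \<Longrightarrow> reg x (g i)" "near x (\<lambda>z. s' z = lcomb n (\<lambda>i. g i z) (\<lambda>i. e i z))"
    using frame_at_reg_sectionE[OF assms(1,3)] by blast
  show ?thesis
  proof (rule frame_at_reg_sectionI[OF assms(1)])
    show "near x (\<lambda>z. s z + s' z = lcomb n (\<lambda>i. f i z + g i z) (\<lambda>i. e i z))"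
      by (rule near_mono[OF near_conj[OF f(2) g(2)]]) (simp add: lcomb_add)
  qed (use f g in \<open>auto intro: reg_add\<close>)
qed

lemma reg_section_scale:
  assumes "frame_at E n x e" "reg_section E x s" "reg x g" shows "reg_section E x (\<lambda>z. fscale (g z) (s z))"
proof -
  obtain f where f: "\<And>i. i < n \<Longrightarrow> reg x (f i)" "near x (\<lambda>z. s z = lcomb n (\<lambda>i. f i z) (\<lambda>i. e i z))"
    using frame_at_reg_sectionE[OF assms(1,2)] by blast
  show ?thesis
  proof (rule frame_at_reg_sectionI[OF assms(1)])
    show "near x (\<lambda>z. fscale (g z) (s z) = lcomb n (\<lambda>i. g z * f i z) (\<lambda>i. e i z))"
      by (rule near_mono[OF f(2)]) (simp add: lcomb_scale)
  qed (use f assms(3) in \<open>auto intro: reg_mult\<close>)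
qed

lemma reg_coords:
  assumes "local_frame E n x e" "reg_section E x s" "i < n"
  shows "reg x (\<lambda>z. coords n (\<lambda>i. e i z) (s z) i)"
proof -
  obtain f where f: "\<And>i. i < n \<Longrightarrow> reg x (f i)" "near x (\<lambda>z. s z = lcomb n (\<lambda>i. f i z) (\<lambda>i. e i z))"
    using frame_at_reg_sectionE[OF local_frame_frame_at[OF assms(1)] assms(2)] by blast
  have "near x (\<lambda>z. f i z = coords n (\<lambda>i. e i z) (s z) i)"
    by (rule near_mono[OF near_conj[OF f(2) assms(1)[unfolded local_frame_def]]])
       (use assms(3) in \<open>auto simp: coords_lcomb[OF frame_at_fbasis]\<close>)
  then show ?thesis by (rule reg_near_cong[OF f(1)[OF assms(3)]])
qed

end

section \<open>Transition determinants and the degree\<close>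

text \<open>With \<open>f\<close> a local and \<open>e\<close> a generic frame, this is the function
  whose order \<open>det_order\<close> takes; with two local frames it is the transition function of
  the determinant line bundle.\<close>

definition transition_det :: "nat \<Rightarrow> (nat \<Rightarrow> 'k::field vec) \<Rightarrow> (nat \<Rightarrow> 'k vec) \<Rightarrow> 'k" where
  "transition_det n f e = det (mat n n (\<lambda>(i, j). coords n f (e j) i))"

lemma transition_det_mult:
  assumes f: "fbasis n f S" and g: "fbasis n g S" and e: "\<And>j. j < n \<Longrightarrow> e j \<in> S"
  shows "transition_det n f e = transition_det n f g * transition_det n g e"
proof -
  have "coords n f (e j) i = (\<Sum>k<n. coords n f (g k) i * coords n g (e j) k)" if "i < n" "j < n" for i j
  proof -
    have "e j = lcomb n (coords n g (e j)) g" using fbasis_coords[OF g e[OF that(2)]] by simp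
    also have "\<dots> = lcomb n (coords n g (e j)) (\<lambda>k. lcomb n (coords n f (g k)) f)"
      using fbasis_coords[OF f] fbasis_elem[OF g] by (intro lcomb_cong) simp_all
    also have "\<dots> = lcomb n (\<lambda>i. \<Sum>k<n. coords n g (e j) k * coords n f (g k) i) f" by (rule lcomb_lcomb)
    finally have "coords n f (e j) i = (\<Sum>k<n. coords n g (e j) k * coords n f (g k) i)"
      using coords_lcomb[OF f that(1), of "\<lambda>i. \<Sum>k<n. coords n g (e j) k * coords n f (g k) i"] by (simp only:)
    then show ?thesis by (simp only: mult.commute)
  qed
  then have "mat n n (\<lambda>(i, j). coords n f (e j) i) = mat n n (\<lambda>(i, j). coords n f (g j) i) * mat n n (\<lambda>(i, j). coords n g (e j) i)"
    by (intro eq_matI) (auto simp: scalar_prod_def atLeast0LessThan)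
  then show ?thesis unfolding transition_det_def by (simp add: det_mult[of _ n])
qed

lemma transition_det_self:
  assumes f: "fbasis n f S" shows "transition_det n f f = 1"
proof -
  have "coords n f (f j) i = (if i = j then 1 else 0)" if "i < n" "j < n" for i j
    using coords_lcomb[OF f that(1), of "\<lambda>l. if l = j then 1 else 0"] lcomb_single[OF that(2), of 1 f] by simp
  then have "mat n n (\<lambda>(i, j). coords n f (f j) i) = 1\<^sub>m n" by (intro eq_matI) auto
  then show ?thesis by (simp add: transition_det_def)
qed

lemma transition_det_nonzero: "fbasis n f S \<Longrightarrow> fbasis n e S \<Longrightarrow> transition_det n f e \<noteq> 0"
  using transition_det_mult[of n f S e f] transition_det_self[of n f S] fbasis_elem[of n f S] by auto

context curve
begin

text \<open>By the Leibniz formula the determinant is a polynomial in coordinates of regular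
  sections.\<close>

lemma reg_transition_det:
  assumes "local_frame E n x f" "\<And>j. j < n \<Longrightarrow> reg_section E x (e j)" "x \<in> C"
  shows "reg x (\<lambda>z. transition_det n (\<lambda>i. f i z) (\<lambda>j. e j z))"
proof -
  have "transition_det n (\<lambda>i. f i z) (\<lambda>j. e j z) =
     (\<Sum>p\<in>{p. p permutes {0..<n}}. signof p * (\<Prod>i\<in>{0..<n}. coords n (\<lambda>i. f i z) (e (p i) z) i))" for z
    unfolding transition_det_def by (subst det_def'[of _ n]) (auto intro!: sum.cong prod.cong simp: permutes_in_image)
  moreover have "reg x (\<lambda>z. \<Sum>p\<in>{p. p permutes {0..<n}}. signof p * (\<Prod>i\<in>{0..<n}. coords n (\<lambda>i. f i z) (e (p i) z) i))"
  proof (intro reg_sum reg_mult reg_prod reg_const assms(3))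
    fix p i assume "p \<in> {p. p permutes {0..<n}}" "i \<in> {0..<n}"
    then have "p i < n" "i < n" using permutes_in_image[of p "{0..<n}" i] by auto
    then show "reg x (\<lambda>z. coords n (\<lambda>i. f i z) (e (p i) z) i)" using reg_coords[OF assms(1) assms(2)] by blast
  qed
  ultimately show ?thesis by simp
qed

text \<open>A frame over some nonempty open set, hence a nonzero rational section of the determinant
  line bundle.\<close>

definition generic_frame :: "'k vbundle \<Rightarrow> nat \<Rightarrow> (nat \<Rightarrow> 'k point \<Rightarrow> 'k vec) \<Rightarrow> bool" where
  "generic_frame E n e \<longleftrightarrow> eventually (\<lambda>y. frame_at E n y e) cof"

lemma local_frame_generic_frame: "local_frame E n x e \<Longrightarrow> generic_frame E n e"
  by (simp add: local_frame_def generic_frame_def near_def)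

lemma generic_frame_local_frame: "generic_frame E n e \<Longrightarrow> eventually (\<lambda>y. local_frame E n y e) cof"
  unfolding generic_frame_def local_frame_def near_def by (auto elim: eventually_mono)

lemma generic_frame_reg_section:
  assumes "generic_frame E n e" shows "eventually (\<lambda>y. \<forall>j<n. reg_section E y (e j)) cof"
  using assms[unfolded generic_frame_def] eventually_cof_C by eventually_elim (auto intro: frame_at_reg_section_frame)

text \<open>Any local frame at \<open>x\<close> gives the same order, because the transition
  determinant between two of them is regular and nonzero at \<open>x\<close> and therefore of order
  0.\<close>

definition has_det_ord :: "'k vbundle \<Rightarrow> nat \<Rightarrow> (nat \<Rightarrow> 'k point \<Rightarrow> 'k vec) \<Rightarrow> 'k point \<Rightarrow> int \<Rightarrow> bool" where
  "has_det_ord E n e x m \<longleftrightarrow> (\<exists>f. local_frame E n x f \<and> has_ord x (\<lambda>z. transition_det n (\<lambda>i. f i z) (\<lambda>j. e j z)) m)"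

lemma transition_det_eventually_nonzero:
  assumes "generic_frame E n f" "generic_frame E n e" shows "eventually (\<lambda>z. transition_det n (\<lambda>i. f i z) (\<lambda>j. e j z) \<noteq> 0) cof"
  using assms[unfolded generic_frame_def] by eventually_elim (rule transition_det_nonzero[OF frame_at_fbasis frame_at_fbasis])

lemma rational_fun_transition_det:
  assumes "generic_frame E n f" "generic_frame E n e" shows "rational_fun (\<lambda>z. transition_det n (\<lambda>i. f i z) (\<lambda>j. e j z))"
proof -
  have "eventually (\<lambda>y. reg y (\<lambda>z. transition_det n (\<lambda>i. f i z) (\<lambda>j. e j z))) cof"
    using generic_frame_local_frame[OF assms(1)] generic_frame_reg_section[OF assms(2)] eventually_cof_C
    by eventually_elim (auto intro: reg_transition_det)
  then show ?thesis unfolding rational_fun_def .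
qed

lemma transition_det_mult_eventually:
  assumes "generic_frame E n f" "generic_frame E n g" "generic_frame E n e"
  shows "eventually (\<lambda>z. transition_det n (\<lambda>i. f i z) (\<lambda>j. e j z) = transition_det n (\<lambda>i. f i z) (\<lambda>j. g j z) * transition_det n (\<lambda>i. g i z) (\<lambda>j. e j z)) cof"
  using assms[unfolded generic_frame_def]
proof eventually_elim
  case (elim z)
  show ?case using fbasis_elem[OF frame_at_fbasis[OF elim(3)]]
    by (intro transition_det_mult[OF frame_at_fbasis[OF elim(1)] frame_at_fbasis[OF elim(2)]])
qed

lemma has_ord_transition_det_local_frame:
  assumes "local_frame E n x f" "local_frame E n x f'" "x \<in> C" shows "has_ord x (\<lambda>z. transition_det n (\<lambda>i. f i z) (\<lambda>j. f' j z)) 0"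
proof (rule has_ord_zero)
  show "reg x (\<lambda>z. transition_det n (\<lambda>i. f i z) (\<lambda>j. f' j z))"
    using assms by (intro reg_transition_det[OF assms(1)] frame_at_reg_section_frame[OF local_frame_frame_at]) auto
  show "transition_det n (\<lambda>i. f i x) (\<lambda>j. f' j x) \<noteq> 0"
    by (rule transition_det_nonzero[OF frame_at_fbasis[OF local_frame_frame_at[OF assms(1)]] frame_at_fbasis[OF local_frame_frame_at[OF assms(2)]]])
qed

lemma has_det_ord_local_frame:
  assumes "generic_frame E n e" "x \<in> C" "local_frame E n x f" "has_det_ord E n e x m"
  shows "has_ord x (\<lambda>z. transition_det n (\<lambda>i. f i z) (\<lambda>j. e j z)) m"
proof -
  obtain g where g: "local_frame E n x g" "has_ord x (\<lambda>z. transition_det n (\<lambda>i. g i z) (\<lambda>j. e j z)) m" using assms(4) unfolding has_det_ord_def by blast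
  have "has_ord x (\<lambda>z. transition_det n (\<lambda>i. f i z) (\<lambda>j. g j z) * transition_det n (\<lambda>i. g i z) (\<lambda>j. e j z)) (0 + m)"
    by (rule has_ord_mult[OF has_ord_transition_det_local_frame[OF assms(3) g(1) assms(2)] g(2)])
  then have "has_ord x (\<lambda>z. transition_det n (\<lambda>i. f i z) (\<lambda>j. e j z)) (0 + m)"
    by (rule has_ord_cong)
      (rule eventually_mono[OF transition_det_mult_eventually[OF local_frame_generic_frame[OF assms(3)] local_frame_generic_frame[OF g(1)] assms(1)]], rule sym)
  then show ?thesis by simp
qed

lemma has_det_ord_unique: "generic_frame E n e \<Longrightarrow> x \<in> C \<Longrightarrow> has_det_ord E n e x m \<Longrightarrow> has_det_ord E n e x m' \<Longrightarrow> m = m'"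
proof -
  assume *: "generic_frame E n e" "x \<in> C" "has_det_ord E n e x m" "has_det_ord E n e x m'"
  obtain f where f: "local_frame E n x f" using *(3) unfolding has_det_ord_def by blast
  show ?thesis using has_det_ord_local_frame[OF *(1,2) f *(3)] has_det_ord_local_frame[OF *(1,2) f *(4)] by (rule has_ord_unique)
qed

lemma has_det_ord_exists:
  assumes "vector_bundle N C n E" "generic_frame E n e" "x \<in> C" shows "\<exists>m. has_det_ord E n e x m"
proof -
  obtain f where f: "local_frame E n x f" using assms by (auto simp: vector_bundle_iff)
  then have "\<exists>m. has_ord x (\<lambda>z. transition_det n (\<lambda>i. f i z) (\<lambda>j. e j z)) m"
    using assms local_frame_generic_frame by (intro rational_fun_has_ord rational_fun_transition_det transition_det_eventually_nonzero) auto
  then show ?thesis using f unfolding has_det_ord_def by blast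
qed

definition det_ord :: "'k vbundle \<Rightarrow> nat \<Rightarrow> (nat \<Rightarrow> 'k point \<Rightarrow> 'k vec) \<Rightarrow> 'k point \<Rightarrow> int" where
  "det_ord E n e x = (THE m. has_det_ord E n e x m)"

lemma det_ord_eq: "generic_frame E n e \<Longrightarrow> x \<in> C \<Longrightarrow> has_det_ord E n e x m \<Longrightarrow> det_ord E n e x = m"
  unfolding det_ord_def using has_det_ord_unique by blast

lemma has_det_ord_det_ord: "vector_bundle N C n E \<Longrightarrow> generic_frame E n e \<Longrightarrow> x \<in> C \<Longrightarrow> has_det_ord E n e x (det_ord E n e x)"
  using has_det_ord_exists det_ord_eq by metis

text \<open>On the overlap of the two open sets the matrix in \<open>det_order\<close> is forced to
  be the coordinate matrix, since \<open>f\<close> is a basis of each fibre; so both descriptions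
  single out the same order.\<close>

lemma det_order_eq:
  assumes E: "vector_bundle N C n E" and U: "frame N C n E U e" "U \<noteq> {}" and x: "x \<in> C"
  shows "det_order N C n E U e x = det_ord E n e x"
proof -
  have ps: "bundle_sheaf E" using E by (simp add: vector_bundle_iff)
  obtain u where u: "u \<in> U" using U(2) by blast
  have g: "generic_frame E n e" using local_frame_generic_frame[OF frame_local_frame[OF ps U(1) u]] .
  have oU: "openin (zariski N C) U" using U(1) by (simp add: frame_def)
  have "(\<exists>W f A. frame N C n E W f \<and> x \<in> W \<and>
     (\<forall>y\<in>W \<inter> U. \<forall>j<n. e j y = (\<Sum>i<n. fscale (A y i j) (f i y))) \<and>
     has_order N C x (\<lambda>y. det (mat n n (\<lambda>(i, j). A y i j))) m) \<longleftrightarrow> has_det_ord E n e x m" (is "?L \<longleftrightarrow> _") for m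
  proof
    assume ?L
    then obtain W f A where *: "frame N C n E W f" "x \<in> W"
      "\<forall>y\<in>W \<inter> U. \<forall>j<n. e j y = lcomb n (\<lambda>i. A y i j) (\<lambda>i. f i y)"
      "has_order N C x (\<lambda>y. det (mat n n (\<lambda>(i, j). A y i j))) m" unfolding lcomb_def by blast
    have f: "local_frame E n x f" using frame_local_frame[OF ps *(1,2)] .
    have oW: "openin (zariski N C) W" using *(1) by (simp add: frame_def)
    have "eventually (\<lambda>y. det (mat n n (\<lambda>(i, j). A y i j)) = transition_det n (\<lambda>i. f i y) (\<lambda>j. e j y)) cof"
      using openin_eventually[OF oU u] openin_eventually[OF oW *(2)]
    proof eventually_elim
      case (elim y)
      have "mat n n (\<lambda>(i, j). A y i j) = mat n n (\<lambda>(i, j). coords n (\<lambda>i. f i y) (e j y) i)"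
        using *(3) elim coords_lcomb[OF frame_at_fbasis[OF frame_imp_frame_at[OF ps *(1) elim(2)]]] by (intro eq_matI) auto
      then show ?case by (simp add: transition_det_def)
    qed
    then have "has_ord x (\<lambda>y. transition_det n (\<lambda>i. f i y) (\<lambda>j. e j y)) m"
      by (rule has_ord_cong[OF *(4)[unfolded has_order_iff[OF x]]])
    then show "has_det_ord E n e x m" unfolding has_det_ord_def using f by blast
  next
    assume "has_det_ord E n e x m"
    then obtain f where f: "local_frame E n x f" "has_ord x (\<lambda>z. transition_det n (\<lambda>i. f i z) (\<lambda>j. e j z)) m" unfolding has_det_ord_def by blast
    let ?W = "{y \<in> C. frame_at E n y f}"
    have "frame N C n E ?W f" using local_frame_frame[OF ps x f(1)] .
    moreover have "x \<in> ?W" using local_frame_frame_at[OF f(1)] x by blast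
    moreover have "e j y = (\<Sum>i<n. fscale (coords n (\<lambda>i. f i y) (e j y) i) (f i y))" if "y \<in> ?W \<inter> U" "j < n" for y j
    proof -
      have "e j y \<in> fibre E y" using fbasis_elem[OF frame_at_fbasis[OF frame_imp_frame_at[OF ps U(1)]]] that by blast
      then have "lcomb n (coords n (\<lambda>i. f i y) (e j y)) (\<lambda>i. f i y) = e j y"
        using fbasis_coords[OF frame_at_fbasis] that by blast
      then show ?thesis unfolding lcomb_def by simp
    qed
    moreover have "has_order N C x (\<lambda>y. det (mat n n (\<lambda>(i, j). coords n (\<lambda>i. f i y) (e j y) i))) m"
      using f(2) has_order_iff[OF x] by (simp add: transition_det_def)
    ultimately show ?L
      by (intro exI[of _ ?W] exI[of _ f] exI[of _ "\<lambda>y i j. coords n (\<lambda>i. f i y) (e j y) i"]) blast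
  qed
  then show ?thesis unfolding det_order_def det_ord_def by simp
qed

lemma finite_det_ord:
  assumes "vector_bundle N C n E" "generic_frame E n e" shows "finite {x \<in> C. det_ord E n e x \<noteq> 0}"
proof -
  have "eventually (\<lambda>x. det_ord E n e x = 0) cof"
    using generic_frame_local_frame[OF assms(2)] eventually_cof_C
  proof eventually_elim
    case (elim x)
    then have "has_det_ord E n e x 0" unfolding has_det_ord_def using has_ord_transition_det_local_frame[OF elim(1,1,2)] by blast
    then show ?case by (rule det_ord_eq[OF assms(2) elim(2)])
  qed
  then show ?thesis by (simp add: eventually_cof)
qed

text \<open>Replacing one generic frame by another adds the divisor of the rational function
  \<open>h\<close> to the orders, and that divisor has degree 0.\<close>

lemma sum_det_ord_eq:
  assumes E: "vector_bundle N C n E" and e: "generic_frame E n e" and e': "generic_frame E n e'"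
  shows "(\<Sum>x\<in>{x \<in> C. det_ord E n e x \<noteq> 0}. det_ord E n e x) = (\<Sum>x\<in>{x \<in> C. det_ord E n e' x \<noteq> 0}. det_ord E n e' x)"
proof -
  define h where "h = (\<lambda>z. transition_det n (\<lambda>i. e i z) (\<lambda>j. e' j z))"
  have h: "rational_fun h" "eventually (\<lambda>z. h z \<noteq> 0) cof" unfolding h_def using rational_fun_transition_det transition_det_eventually_nonzero e e' by blast+
  have rel: "det_ord E n e' x = det_ord E n e x + ord_at x h" if x: "x \<in> C" for x
  proof -
    obtain f where f: "local_frame E n x f" "has_ord x (\<lambda>z. transition_det n (\<lambda>i. f i z) (\<lambda>j. e j z)) (det_ord E n e x)"
      using has_det_ord_det_ord[OF E e x] unfolding has_det_ord_def by blast
    obtain m where m: "has_ord x h m" using rational_fun_has_ord[OF h x] by blast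
    have "has_ord x (\<lambda>z. transition_det n (\<lambda>i. f i z) (\<lambda>j. e j z) * h z) (det_ord E n e x + m)" using has_ord_mult[OF f(2) m] .
    then have "has_ord x (\<lambda>z. transition_det n (\<lambda>i. f i z) (\<lambda>j. e' j z)) (det_ord E n e x + m)"
      by (rule has_ord_cong) (use transition_det_mult_eventually[OF local_frame_generic_frame[OF f(1)] e e'] in \<open>auto simp: h_def elim: eventually_mono\<close>)
    then have "has_det_ord E n e' x (det_ord E n e x + m)" using f(1) unfolding has_det_ord_def by blast
    then show ?thesis using det_ord_eq[OF e' x] ord_at_eq[OF m] by simp
  qed
  define A where "A = {x \<in> C. det_ord E n e x \<noteq> 0} \<union> {x \<in> C. det_ord E n e' x \<noteq> 0} \<union> {x \<in> C. ord_at x h \<noteq> 0}"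
  have A: "finite A" unfolding A_def using finite_det_ord[OF E e] finite_det_ord[OF E e'] finite_support_ord_at[OF h] by blast
  have "(\<Sum>x\<in>{x \<in> C. det_ord E n e' x \<noteq> 0}. det_ord E n e' x) = (\<Sum>x\<in>A. det_ord E n e' x)"
    using A by (intro sum.mono_neutral_left) (auto simp: A_def)
  also have "\<dots> = (\<Sum>x\<in>A. det_ord E n e x + ord_at x h)" using rel by (intro sum.cong) (auto simp: A_def)
  also have "\<dots> = (\<Sum>x\<in>A. det_ord E n e x) + (\<Sum>x\<in>A. ord_at x h)" by (rule sum.distrib)
  also have "(\<Sum>x\<in>A. det_ord E n e x) = (\<Sum>x\<in>{x \<in> C. det_ord E n e x \<noteq> 0}. det_ord E n e x)"
    using A by (intro sum.mono_neutral_right) (auto simp: A_def)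
  also have "(\<Sum>x\<in>A. ord_at x h) = (\<Sum>x\<in>{x \<in> C. ord_at x h \<noteq> 0}. ord_at x h)"
    using A by (intro sum.mono_neutral_right) (auto simp: A_def)
  also have "\<dots> = 0" using principal_divisor_degree[OF h] .
  finally show ?thesis by simp
qed

lemma degree_bundle_eq:
  assumes E: "vector_bundle N C n E" and e: "generic_frame E n e"
  shows "degree_bundle N C n E = (\<Sum>x\<in>{x \<in> C. det_ord E n e x \<noteq> 0}. det_ord E n e x)"
proof -
  have ps: "bundle_sheaf E" using E by (simp add: vector_bundle_iff)
  have sum: "(\<Sum>x \<in> {x \<in> C. det_order N C n E U f x \<noteq> 0}. det_order N C n E U f x)
      = (\<Sum>x\<in>{x \<in> C. det_ord E n e x \<noteq> 0}. det_ord E n e x)" if U: "U \<noteq> {}" "frame N C n E U f" for U f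
  proof -
    obtain u where u: "u \<in> U" using U(1) by blast
    have f: "generic_frame E n f" using local_frame_generic_frame[OF frame_local_frame[OF ps U(2) u]] .
    have "(\<Sum>x \<in> {x \<in> C. det_order N C n E U f x \<noteq> 0}. det_order N C n E U f x)
      = (\<Sum>x\<in>{x \<in> C. det_ord E n f x \<noteq> 0}. det_ord E n f x)"
      using det_order_eq[OF E U(2,1)] by (intro sum.cong) auto
    then show ?thesis using sum_det_ord_eq[OF E f e] by simp
  qed
  have "\<exists>U e'. U \<noteq> {} \<and> frame N C n E U e'"
  proof -
    obtain x where x: "x \<in> C" "local_frame E n x e" using eventually_cof_obtain[OF generic_frame_local_frame[OF e]] by blast
    then have "x \<in> {y \<in> C. frame_at E n y e}" using local_frame_frame_at by blast
    then have "{y \<in> C. frame_at E n y e} \<noteq> {}" by blast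
    moreover have "frame N C n E {y \<in> C. frame_at E n y e} e" using local_frame_frame[OF ps x] .
    ultimately show ?thesis by (intro exI conjI)
  qed
  then obtain U e' where U: "U \<noteq> {}" "frame N C n E U e'" by blast
  show ?thesis unfolding degree_bundle_def
  proof (rule the_equality)
    show "\<exists>U f. U \<noteq> {} \<and> frame N C n E U f \<and> (\<Sum>x\<in>{x \<in> C. det_ord E n e x \<noteq> 0}. det_ord E n e x)
        = (\<Sum>x \<in> {x \<in> C. det_order N C n E U f x \<noteq> 0}. det_order N C n E U f x)"
      using U sum[OF U] by (intro exI[of _ U] exI[of _ e']) simp
  qed (use sum in auto)
qed

lemma degree_bundle_sum:
  assumes "vector_bundle N C n E" "generic_frame E n e" "finite A" "A \<subseteq> C" "{x \<in> C. det_ord E n e x \<noteq> 0} \<subseteq> A"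
  shows "degree_bundle N C n E = (\<Sum>x\<in>A. det_ord E n e x)"
  unfolding degree_bundle_eq[OF assms(1,2)] using assms(3-5) by (intro sum.mono_neutral_left) blast+

end

section \<open>Exact sequences\<close>

definition linear_on :: "'k::field vec set \<Rightarrow> ('k vec \<Rightarrow> 'k vec) \<Rightarrow> bool" where
  "linear_on S p \<longleftrightarrow> (\<forall>v\<in>S. \<forall>w\<in>S. p (v + w) = p v + p w) \<and> (\<forall>v\<in>S. \<forall>a. p (fscale a v) = fscale a (p v))"

lemma subspace_lcomb: "fn.subspace S \<Longrightarrow> (\<And>i. i < n \<Longrightarrow> e i \<in> S) \<Longrightarrow> lcomb n c e \<in> S"
  unfolding lcomb_def by (intro fn.subspace_sum fn.subspace_scale) auto

lemma linear_on_lcomb: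
  assumes "linear_on S p" "fn.subspace S" "\<And>i. i < n \<Longrightarrow> e i \<in> S"
  shows "p (lcomb n c e) = lcomb n c (\<lambda>i. p (e i))"
  using assms(3)
proof (induction n)
  case 0
  have "p (fscale 0 0) = fscale 0 (p 0)" using assms(1) fn.subspace_0[OF assms(2)] unfolding linear_on_def by blast
  then have "p 0 = 0" by simp
  then show ?case by (simp only: lcomb_def lessThan_0 sum.empty)
next
  case (Suc n)
  have "lcomb n c e \<in> S" using Suc.prems by (intro subspace_lcomb assms(2)) auto
  moreover have "fscale (c n) (e n) \<in> S" using Suc.prems assms(2) fn.subspace_scale by blast
  ultimately have "p (lcomb n c e + fscale (c n) (e n)) = p (lcomb n c e) + fscale (c n) (p (e n))"
    using assms(1) Suc.prems[of n] unfolding linear_on_def by (metis lessI)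
  moreover have "p (lcomb n c e) = lcomb n c (\<lambda>i. p (e i))" using Suc by simp
  ultimately show ?case by (simp only: lcomb_def sum.lessThan_Suc)
qed

lemma fbasis_subspace': "fbasis n e S \<Longrightarrow> fn.subspace S"
  using fbasis_subspace by (intro fn.subspaceI) blast+

definition join_fam :: "nat \<Rightarrow> (nat \<Rightarrow> 'a) \<Rightarrow> (nat \<Rightarrow> 'a) \<Rightarrow> nat \<Rightarrow> 'a" where
  "join_fam m f g i = (if i < m then f i else g (i - m))"

lemma join_fam_apply: "join_fam m f g i z = join_fam m (\<lambda>i. f i z) (\<lambda>i. g i z) i"
  by (simp add: join_fam_def)

lemma lcomb_join_fam: "lcomb (m + l) c (join_fam m f g) = lcomb m c f + lcomb l (\<lambda>j. c (m + j)) g"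
  unfolding lcomb_split by (intro arg_cong2[where f = "(+)"] lcomb_cong) (auto simp: join_fam_def)

text \<open>The coordinates of \<open>p v\<close> determine the part of \<open>v\<close> along the
  lifts \<open>g\<close>; what is left lies in the kernel and is expanded in
  \<open>f\<close>.\<close>

lemma fbasis_exact:
  assumes p: "linear_on E p" and E: "fn.subspace E" and Q: "p ` E = Q" and F: "F = {v \<in> E. p v = 0}"
    and f: "fbasis m f F" and q: "fbasis l q Q" and g: "\<And>j. j < l \<Longrightarrow> g j \<in> E \<and> p (g j) = q j"
  shows "fbasis (m + l) (join_fam m f g) E"
proof -
  have fE: "f i \<in> E \<and> p (f i) = 0" if "i < m" for i using fbasis_elem[OF f that] F by blast
  have pg: "p (lcomb l b g) = lcomb l b q" for b
  proof -
    have "p (lcomb l b g) = lcomb l b (\<lambda>i. p (g i))" using g by (intro linear_on_lcomb[OF p E]) blast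
    also have "\<dots> = lcomb l b q" using g by (intro lcomb_cong) auto
    finally show ?thesis .
  qed
  have gE: "lcomb l b g \<in> E" for b using g by (intro subspace_lcomb[OF E]) blast
  have pF: "lcomb m a f \<in> E \<and> p (lcomb m a f) = 0" for a using fbasis_mem[OF f] F by blast
  have padd: "p (v + w) = p v + p w" if "v \<in> E" "w \<in> E" for v w using p that unfolding linear_on_def by blast
  have "v \<in> E \<longleftrightarrow> (\<exists>c. v = lcomb (m + l) c (join_fam m f g))" for v
  proof
    assume v: "v \<in> E"
    have "p v \<in> Q" using v Q by blast
    then have b: "lcomb l (coords l q (p v)) q = p v" using fbasis_coords[OF q] by blast
    let ?b = "coords l q (p v)"
    have vE: "v - lcomb l ?b g \<in> E" using E v gE by (rule fn.subspace_diff)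
    have "p v = p (v - lcomb l ?b g) + p (lcomb l ?b g)" using padd[OF vE gE, of ?b] by simp
    then have "p (v - lcomb l ?b g) = 0" unfolding pg b by simp
    then have "v - lcomb l ?b g \<in> F" using vE F by blast
    then have "lcomb m (coords m f (v - lcomb l ?b g)) f = v - lcomb l ?b g" using fbasis_coords[OF f] by blast
    let ?a = "coords m f (v - lcomb l ?b g)"
    have "lcomb (m + l) (join_fam m ?a ?b) (join_fam m f g) = lcomb m ?a f + lcomb l ?b g"
      unfolding lcomb_join_fam by (intro arg_cong2[where f = "(+)"] lcomb_cong) (auto simp: join_fam_def)
    also have "\<dots> = v" using \<open>lcomb m ?a f = v - lcomb l ?b g\<close> by simp
    finally show "\<exists>c. v = lcomb (m + l) c (join_fam m f g)" by metis
  next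
    assume "\<exists>c. v = lcomb (m + l) c (join_fam m f g)"
    then obtain c where c: "v = lcomb m c f + lcomb l (\<lambda>j. c (m + j)) g" unfolding lcomb_join_fam by blast
    show "v \<in> E" unfolding c using pF gE fn.subspace_add[OF E] by blast
  qed
  moreover have "c i = 0" if c: "lcomb (m + l) c (join_fam m f g) = 0" and i: "i < m + l" for c i
  proof -
    have z: "lcomb m c f + lcomb l (\<lambda>j. c (m + j)) g = 0" using c unfolding lcomb_join_fam .
    have "p (lcomb m c f + lcomb l (\<lambda>j. c (m + j)) g) = lcomb l (\<lambda>j. c (m + j)) q"
      using padd[OF _ gE] pF pg by simp
    moreover have "p 0 = 0" using pF[of "\<lambda>_. 0"] by (simp add: lcomb_zero)
    ultimately have "lcomb l (\<lambda>j. c (m + j)) q = 0" unfolding z by simp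
    then have l0: "c (m + j) = 0" if "j < l" for j using q that unfolding fbasis_def by blast
    then have "lcomb l (\<lambda>j. c (m + j)) g = lcomb l (\<lambda>_. 0) g" by (intro lcomb_cong) auto
    then have "lcomb m c f = 0" using z by (simp add: lcomb_zero)
    then have "c i = 0" if "i < m" for i using f that unfolding fbasis_def by blast
    then show ?thesis using l0[of "i - m"] i by (cases "i < m") auto
  qed
  ultimately show ?thesis unfolding fbasis_def by blast
qed

text \<open>In bases adapted to kernel and quotient the transition matrix is block triangular: the
  \<open>f'\<close> have no component along the lifts, and the lower right block is read off after
  applying \<open>p\<close>.\<close>

lemma transition_det_exact:
  assumes p: "linear_on E p" and E: "fn.subspace E" and Q: "p ` E = Q" and F: "F = {v \<in> E. p v = 0}"
    and f: "fbasis m f F" and q: "fbasis l q Q" and g: "\<And>j. j < l \<Longrightarrow> g j \<in> E \<and> p (g j) = q j"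
    and f': "fbasis m f' F" and q': "fbasis l q' Q" and g': "\<And>j. j < l \<Longrightarrow> g' j \<in> E \<and> p (g' j) = q' j"
  shows "transition_det (m + l) (join_fam m f g) (join_fam m f' g') = transition_det m f f' * transition_det l q q'"
proof -
  let ?B = "join_fam m f g"
  have B: "fbasis (m + l) ?B E" using fbasis_exact[OF p E Q F f q g] .
  have 1: "coords (m + l) ?B (f' j) i = (if i < m then coords m f (f' j) i else 0)" if "j < m" "i < m + l" for i j
  proof -
    let ?c = "\<lambda>i. if i < m then coords m f (f' j) i else 0"
    have "lcomb (m + l) ?c ?B = lcomb m (coords m f (f' j)) f + lcomb l (\<lambda>_. 0) g"
      unfolding lcomb_join_fam by (intro arg_cong2[where f = "(+)"] lcomb_cong) auto
    also have "\<dots> = f' j" using fbasis_coords[OF f fbasis_elem[OF f' that(1)]] by (simp add: lcomb_zero)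
    finally have "f' j = lcomb (m + l) ?c ?B" by simp
    then show ?thesis using coords_lcomb[OF B that(2), of ?c] by simp
  qed
  have 2: "coords (m + l) ?B (g' j) (m + i) = coords l q (q' j) i" if "j < l" "i < l" for i j
  proof -
    let ?c = "coords (m + l) ?B (g' j)"
    have gj: "g' j \<in> E" using g' that by blast
    have BE: "?B i \<in> E" if "i < m + l" for i using fbasis_elem[OF B that] .
    have "g' j = lcomb (m + l) ?c ?B" using fbasis_coords[OF B gj] by simp
    then have "q' j = p (lcomb (m + l) ?c ?B)" using g'[OF that(1)] by metis
    also have "\<dots> = lcomb (m + l) ?c (\<lambda>i. p (?B i))" using BE by (intro linear_on_lcomb[OF p E])
    also have "\<dots> = lcomb m ?c (\<lambda>i. p (?B i)) + lcomb l (\<lambda>i. ?c (m + i)) (\<lambda>i. p (?B (m + i)))" by (rule lcomb_split)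
    also have "lcomb m ?c (\<lambda>i. p (?B i)) = lcomb m ?c (\<lambda>i. 0)"
      using fbasis_elem[OF f] F by (intro lcomb_cong) (auto simp: join_fam_def)
    also have "\<dots> = 0" by (simp add: lcomb_def)
    also have "lcomb l (\<lambda>i. ?c (m + i)) (\<lambda>i. p (?B (m + i))) = lcomb l (\<lambda>i. ?c (m + i)) q"
      using g by (intro lcomb_cong) (auto simp: join_fam_def)
    finally have "q' j = lcomb l (\<lambda>i. ?c (m + i)) q" by simp
    then show ?thesis using coords_lcomb[OF q that(2), of "\<lambda>i. ?c (m + i)"] by simp
  qed
  let ?A1 = "mat m m (\<lambda>(i, j). coords m f (f' j) i)"
  let ?A2 = "mat m l (\<lambda>(i, j). coords (m + l) ?B (g' j) i)"
  let ?A4 = "mat l l (\<lambda>(i, j). coords l q (q' j) i)"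
  have "mat (m + l) (m + l) (\<lambda>(i, j). coords (m + l) ?B (join_fam m f' g' j) i) = four_block_mat ?A1 ?A2 (0\<^sub>m l m) ?A4"
  proof (rule eq_matI)
    fix i j assume "i < dim_row (four_block_mat ?A1 ?A2 (0\<^sub>m l m) ?A4)" "j < dim_col (four_block_mat ?A1 ?A2 (0\<^sub>m l m) ?A4)"
    then have ij: "i < m + l" "j < m + l" by auto
    show "mat (m + l) (m + l) (\<lambda>(i, j). coords (m + l) ?B (join_fam m f' g' j) i) $$ (i, j) = four_block_mat ?A1 ?A2 (0\<^sub>m l m) ?A4 $$ (i, j)"
    proof (cases "j < m")
      case True
      then show ?thesis using ij 1[OF True ij(1)] by (auto simp: join_fam_def)
    next
      case False
      then show ?thesis using ij 2[of "j - m" "i - m"] by (auto simp: join_fam_def)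
    qed
  qed auto
  then show ?thesis unfolding transition_det_def by (simp only:) (rule det_four_block_mat_lower_left_zero, auto)
qed

context curve
begin

text \<open>Adds the linear structure to \<open>bundle_sheaf\<close>. It can be verified for a
  preimage before that is known to be locally free, and then serves to construct frames.\<close>

definition module_sheaf :: "'k vbundle \<Rightarrow> bool" where
  "module_sheaf E \<longleftrightarrow> bundle_sheaf E \<and> (\<forall>x\<in>C. fn.subspace (fibre E x)) \<and>
     (\<forall>x\<in>C. reg_section E x (\<lambda>_. 0)) \<and>
     (\<forall>x s s'. reg_section E x s \<longrightarrow> reg_section E x s' \<longrightarrow> reg_section E x (\<lambda>z. s z + s' z)) \<and>
     (\<forall>x g s. reg x g \<longrightarrow> reg_section E x s \<longrightarrow> reg_section E x (\<lambda>z. fscale (g z) (s z)))"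

lemma module_sheafD:
  assumes "module_sheaf E"
  shows "bundle_sheaf E" "x \<in> C \<Longrightarrow> fn.subspace (fibre E x)" "x \<in> C \<Longrightarrow> reg_section E x (\<lambda>_. 0)"
    "reg_section E x s \<Longrightarrow> reg_section E x s' \<Longrightarrow> reg_section E x (\<lambda>z. s z + s' z)"
    "reg x g \<Longrightarrow> reg_section E x s \<Longrightarrow> reg_section E x (\<lambda>z. fscale (g z) (s z))"
  using assms unfolding module_sheaf_def by blast+

lemma vector_bundle_module_sheaf:
  assumes "vector_bundle N C n E" shows "module_sheaf E"
  unfolding module_sheaf_def
proof (intro conjI ballI allI impI)
  have ex: "\<exists>e. frame_at E n x e" if "x \<in> C" for x using assms that local_frame_frame_at unfolding vector_bundle_iff by blast
  show "bundle_sheaf E" using assms by (simp add: vector_bundle_iff)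
  fix x assume "x \<in> C"
  then obtain e where e: "frame_at E n x e" using ex by blast
  show "fn.subspace (fibre E x)" using fbasis_subspace'[OF frame_at_fbasis[OF e]] .
  show "reg_section E x (\<lambda>_. 0)"
    by (rule frame_at_reg_sectionI[OF e, of "\<lambda>_ _. 0"]) (use \<open>x \<in> C\<close> in \<open>auto simp only: lcomb_zero near_def simp_thms eventually_True intro: reg_const\<close>)
next
  have ex: "\<exists>e. frame_at E n x e" if "x \<in> C" for x using assms that local_frame_frame_at unfolding vector_bundle_iff by blast
  fix x s s' assume "reg_section E x s" "reg_section E x s'"
  then show "reg_section E x (\<lambda>z. s z + s' z)" using ex reg_section_C reg_section_add by blast
next
  have ex: "\<exists>e. frame_at E n x e" if "x \<in> C" for x using assms that local_frame_frame_at unfolding vector_bundle_iff by blast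
  fix x g s assume "reg x g" "reg_section E x s"
  then show "reg_section E x (\<lambda>z. fscale (g z) (s z))" using ex reg_section_C reg_section_scale by blast
qed

lemma module_sheaf_lcomb:
  assumes E: "module_sheaf E" and x: "x \<in> C" and s: "\<And>i. i < m \<Longrightarrow> reg_section E x (s i)" and f: "\<And>i. i < m \<Longrightarrow> reg x (f i)"
  shows "reg_section E x (\<lambda>z. lcomb m (\<lambda>i. f i z) (\<lambda>i. s i z))"
  using s f
proof (induction m)
  case 0
  have "(\<lambda>z. lcomb 0 (\<lambda>i. f i z) (\<lambda>i. s i z)) = (\<lambda>_. 0)" by (simp only: lcomb_def lessThan_0 sum.empty)
  then show ?case using module_sheafD(3)[OF E x] by (simp only:)
next
  case (Suc m)
  have "reg_section E x (\<lambda>z. lcomb m (\<lambda>i. f i z) (\<lambda>i. s i z) + fscale (f m z) (s m z))"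
    using Suc by (intro module_sheafD(4)[OF E] module_sheafD(5)[OF E]) auto
  then show ?case by (simp only: lcomb_def sum.lessThan_Suc)
qed

lemma module_sheaf_diff: "module_sheaf E \<Longrightarrow> reg_section E x s \<Longrightarrow> reg_section E x s' \<Longrightarrow> reg_section E x (\<lambda>z. s z - s' z)"
proof -
  assume *: "module_sheaf E" "reg_section E x s" "reg_section E x s'"
  have "reg_section E x (\<lambda>z. s z + fscale (- 1) (s' z))"
    using * reg_const[OF reg_section_C[OF *(2)]] by (intro module_sheafD(4)[OF *(1)] module_sheafD(5)[OF *(1)])
  moreover have "s z + fscale (- 1) (s' z) = s z - s' z" for z by (auto simp: fscale_def fun_eq_iff)
  ultimately show ?thesis by simp
qed

text \<open>A short exact sequence of \<open>F\<close>, \<open>E\<close> and \<open>Q\<close>. The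
  maps \<open>p y\<close> are arbitrary linear maps of fibres; that they form a morphism, surjective
  on germs, is expressed by the clauses on \<open>reg_section\<close>, and the last clause gives
  \<open>F\<close> the induced sections.\<close>

definition quot :: "'k vbundle \<Rightarrow> 'k vbundle \<Rightarrow> 'k vbundle \<Rightarrow> ('k point \<Rightarrow> 'k vec \<Rightarrow> 'k vec) \<Rightarrow> bool" where
  "quot F E Q p \<longleftrightarrow> module_sheaf E \<and>
     (\<forall>y\<in>C. linear_on (fibre E y) (p y) \<and> p y ` fibre E y = fibre Q y \<and> fibre F y = {v \<in> fibre E y. p y v = 0}) \<and>
     (\<forall>y s. reg_section E y s \<longrightarrow> reg_section Q y (\<lambda>z. p z (s z))) \<and>
     (\<forall>y q. reg_section Q y q \<longrightarrow> (\<exists>s. reg_section E y s \<and> near y (\<lambda>z. q z = p z (s z)))) \<and>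
     (\<forall>y s. reg_section F y s \<longleftrightarrow> reg_section E y s \<and> near y (\<lambda>z. s z \<in> fibre F z))"

lemma quotD:
  assumes "quot F E Q p"
  shows "module_sheaf E" "y \<in> C \<Longrightarrow> linear_on (fibre E y) (p y)" "y \<in> C \<Longrightarrow> p y ` fibre E y = fibre Q y"
    "y \<in> C \<Longrightarrow> fibre F y = {v \<in> fibre E y. p y v = 0}"
    "reg_section E y s \<Longrightarrow> reg_section Q y (\<lambda>z. p z (s z))"
    "reg_section Q y q \<Longrightarrow> \<exists>s. reg_section E y s \<and> near y (\<lambda>z. q z = p z (s z))"
    "reg_section F y s \<longleftrightarrow> reg_section E y s \<and> near y (\<lambda>z. s z \<in> fibre F z)"
  using assms unfolding quot_def by blast+

text \<open>The coefficients of the image of a section in \<open>Q\<close> are regular. Subtracting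
  the same combination of lifts leaves a section with values in \<open>F\<close>, to which the frame
  of \<open>F\<close> applies.\<close>

lemma frame_at_exact:
  assumes X: "quot F E Q p" and y: "y \<in> C" and f: "frame_at F m y f" and q: "frame_at Q l y q"
    and g: "\<And>j. j < l \<Longrightarrow> reg_section E y (g j)" "\<And>j. j < l \<Longrightarrow> near y (\<lambda>z. q j z = p z (g j z))"
  shows "frame_at E (m + l) y (join_fam m f g)"
proof -
  note E = quotD(1)[OF X]
  have ps: "bundle_sheaf E" using module_sheafD(1)[OF E] .
  have fE: "reg_section E y (f i)" if "i < m" for i using frame_at_reg_section_frame[OF f y that] quotD(7)[OF X] by blast
  have gy: "g j y \<in> fibre E y \<and> p y (g j y) = q j y" if "j < l" for j
    using reg_section_fibre[OF ps g(1)[OF that]] g(2)[OF that] by (simp add: near_def)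
  have nC: "near y (\<lambda>z. z \<in> C)" using near_inC[OF y] .
  have gall: "near y (\<lambda>z. \<forall>j\<in>{..<l}. reg_section E z (g j) \<and> q j z = p z (g j z))"
    using g reg_section_near by (intro near_ball near_conj) auto
  have "fbasis (m + l) (\<lambda>i. join_fam m f g i y) (fibre E y)"
    unfolding join_fam_apply[of m f g _ y] using gy
    by (intro fbasis_exact[OF quotD(2)[OF X y] module_sheafD(2)[OF E y] quotD(3)[OF X y] quotD(4)[OF X y] frame_at_fbasis[OF f] frame_at_fbasis[OF q]])
  moreover have "reg_section E y s \<longleftrightarrow> (\<exists>h. (\<forall>i<m+l. reg y (h i)) \<and> near y (\<lambda>z. s z = lcomb (m + l) (\<lambda>i. h i z) (\<lambda>i. join_fam m f g i z)))" for s
  proof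
    assume s: "reg_section E y s"
    obtain b where b: "\<And>j. j < l \<Longrightarrow> reg y (b j)" "near y (\<lambda>z. p z (s z) = lcomb l (\<lambda>j. b j z) (\<lambda>j. q j z))"
      using frame_at_reg_sectionE[OF q quotD(5)[OF X s]] by blast
    define s0 where "s0 = (\<lambda>z. s z - lcomb l (\<lambda>j. b j z) (\<lambda>j. g j z))"
    have s0: "reg_section E y s0" unfolding s0_def using g(1) b(1) by (intro module_sheaf_diff[OF E s] module_sheaf_lcomb[OF E y]) auto
    have "near y (\<lambda>z. s0 z \<in> fibre F z)"
    proof (rule near_mono[OF near_conj[OF near_conj[OF nC near_conj[OF reg_section_near[OF s] b(2)]] gall]])
      fix z assume z: "(z \<in> C \<and> reg_section E z s \<and> p z (s z) = lcomb l (\<lambda>j. b j z) (\<lambda>j. q j z)) \<and> (\<forall>j\<in>{..<l}. reg_section E z (g j) \<and> q j z = p z (g j z))"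
      then have zC: "z \<in> C" by blast
      have sub: "fn.subspace (fibre E z)" using module_sheafD(2)[OF E zC] .
      have gz: "g j z \<in> fibre E z" if "j < l" for j using z that reg_section_fibre[OF ps] by blast
      let ?w = "lcomb l (\<lambda>j. b j z) (\<lambda>j. g j z)"
      have w: "?w \<in> fibre E z" using gz by (intro subspace_lcomb[OF sub]) 
      have sz: "s z \<in> fibre E z" using z reg_section_fibre[OF ps] by blast
      have s0z: "s0 z \<in> fibre E z" unfolding s0_def using fn.subspace_diff[OF sub sz w] .
      have "p z ?w = lcomb l (\<lambda>j. b j z) (\<lambda>j. p z (g j z))" using gz by (intro linear_on_lcomb[OF quotD(2)[OF X zC] sub])
      also have "\<dots> = p z (s z)" using z by (auto intro: lcomb_cong)
      finally have "p z ?w = p z (s z)" .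
      moreover have "p z (s0 z + ?w) = p z (s0 z) + p z ?w" using quotD(2)[OF X zC] s0z w unfolding linear_on_def by blast
      ultimately have "p z (s0 z) = 0" by (simp add: s0_def)
      then show "s0 z \<in> fibre F z" using s0z quotD(4)[OF X zC] by blast
    qed
    then have "reg_section F y s0" using s0 quotD(7)[OF X] by blast
    then obtain a where a: "\<And>i. i < m \<Longrightarrow> reg y (a i)" "near y (\<lambda>z. s0 z = lcomb m (\<lambda>i. a i z) (\<lambda>i. f i z))"
      using frame_at_reg_sectionE[OF f] by blast
    have "near y (\<lambda>z. s z = lcomb (m + l) (\<lambda>i. join_fam m a b i z) (\<lambda>i. join_fam m f g i z))"
    proof (rule near_mono[OF a(2)])
      fix z assume "s0 z = lcomb m (\<lambda>i. a i z) (\<lambda>i. f i z)"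
      then have "s z = lcomb m (\<lambda>i. a i z) (\<lambda>i. f i z) + lcomb l (\<lambda>j. b j z) (\<lambda>j. g j z)" by (simp add: s0_def algebra_simps)
      also have "\<dots> = lcomb (m + l) (\<lambda>i. join_fam m a b i z) (\<lambda>i. join_fam m f g i z)"
        unfolding join_fam_apply lcomb_join_fam by (intro arg_cong2[where f = "(+)"] lcomb_cong) (auto simp: join_fam_def)
      finally show "s z = lcomb (m + l) (\<lambda>i. join_fam m a b i z) (\<lambda>i. join_fam m f g i z)" .
    qed
    moreover have "\<forall>i<m+l. reg y (join_fam m a b i)" using a(1) b(1) by (auto simp: join_fam_def)
    ultimately show "\<exists>h. (\<forall>i<m+l. reg y (h i)) \<and> near y (\<lambda>z. s z = lcomb (m + l) (\<lambda>i. h i z) (\<lambda>i. join_fam m f g i z))"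
      by (intro exI[of _ "join_fam m a b"]) blast
  next
    assume "\<exists>h. (\<forall>i<m+l. reg y (h i)) \<and> near y (\<lambda>z. s z = lcomb (m + l) (\<lambda>i. h i z) (\<lambda>i. join_fam m f g i z))"
    then obtain h where h: "\<And>i. i < m + l \<Longrightarrow> reg y (h i)" "near y (\<lambda>z. s z = lcomb (m + l) (\<lambda>i. h i z) (\<lambda>i. join_fam m f g i z))" by blast
    have "reg_section E y (\<lambda>z. lcomb (m + l) (\<lambda>i. h i z) (\<lambda>i. join_fam m f g i z))"
      using h(1) fE g(1) by (intro module_sheaf_lcomb[OF E y]) (auto simp: join_fam_def)
    then show "reg_section E y s" by (rule reg_section_cong[OF ps]) (rule near_mono[OF h(2)], rule sym)
  qed
  ultimately show ?thesis unfolding frame_at_def by blast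
qed

text \<open>Frames of \<open>F\<close> and \<open>Q\<close> together with regular lifts
  \<open>g\<close> of the latter to \<open>E\<close>, so that \<open>join_fam m f g\<close> is a
  frame of \<open>E\<close>.\<close>

definition adapted :: "'k vbundle \<Rightarrow> nat \<Rightarrow> 'k vbundle \<Rightarrow> nat \<Rightarrow> 'k vbundle \<Rightarrow> ('k point \<Rightarrow> 'k vec \<Rightarrow> 'k vec) \<Rightarrow> 'k point \<Rightarrow>
    (nat \<Rightarrow> 'k point \<Rightarrow> 'k vec) \<Rightarrow> (nat \<Rightarrow> 'k point \<Rightarrow> 'k vec) \<Rightarrow> (nat \<Rightarrow> 'k point \<Rightarrow> 'k vec) \<Rightarrow> bool" where
  "adapted F m Q l E p x f q g \<longleftrightarrow> local_frame F m x f \<and> local_frame Q l x q \<and>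
     near x (\<lambda>z. \<forall>j\<in>{..<l}. reg_section E z (g j) \<and> near z (\<lambda>w. q j w = p w (g j w)))"

lemma adapted_exists:
  assumes X: "quot F E Q p" and F: "\<exists>f. local_frame F m x f" and Q: "\<exists>q. local_frame Q l x q" and x: "x \<in> C"
  obtains f q g where "adapted F m Q l E p x f q g"
proof -
  obtain f where f: "local_frame F m x f" using F by blast
  obtain q where q: "local_frame Q l x q" using Q by blast
  have "\<forall>j. \<exists>g. j < l \<longrightarrow> reg_section E x g \<and> near x (\<lambda>z. q j z = p z (g z))"
    using quotD(6)[OF X] frame_at_reg_section_frame[OF local_frame_frame_at[OF q] x] by blast
  from choice[OF this] obtain g where g: "\<And>j. j < l \<Longrightarrow> reg_section E x (g j)" "\<And>j. j < l \<Longrightarrow> near x (\<lambda>z. q j z = p z (g j z))" by blast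
  have "near x (\<lambda>z. \<forall>j\<in>{..<l}. reg_section E z (g j) \<and> near z (\<lambda>w. q j w = p w (g j w)))"
    using g reg_section_near near_near by (intro near_ball near_conj) auto
  then show thesis using that f q unfolding adapted_def by blast
qed

lemma adapted_local_frame:
  assumes X: "quot F E Q p" and x: "x \<in> C" and a: "adapted F m Q l E p x f q g"
  shows "local_frame E (m + l) x (join_fam m f g)"
proof -
  have *: "near x (\<lambda>z. frame_at F m z f)" "near x (\<lambda>z. frame_at Q l z q)"
    "near x (\<lambda>z. \<forall>j\<in>{..<l}. reg_section E z (g j) \<and> near z (\<lambda>w. q j w = p w (g j w)))"
    using a unfolding adapted_def local_frame_def by blast+
  show ?thesis unfolding local_frame_def
    by (rule near_mono[OF near_conj[OF near_inC[OF x] near_conj[OF *(1) near_conj[OF *(2,3)]]]])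
       (rule frame_at_exact[OF X], auto)
qed

lemma vector_bundle_exact:
  assumes X: "quot F E Q p" and F: "vector_bundle N C m F" and Q: "vector_bundle N C l Q"
  shows "vector_bundle N C (m + l) E"
  unfolding vector_bundle_iff
proof (intro conjI ballI)
  show "bundle_sheaf E" using module_sheafD(1)[OF quotD(1)[OF X]] .
  fix x assume x: "x \<in> C"
  then obtain f q g where "adapted F m Q l E p x f q g"
    using adapted_exists[OF X _ _ x] F Q unfolding vector_bundle_iff by metis
  then show "\<exists>e. local_frame E (m + l) x e" using adapted_local_frame[OF X x] by blast
qed

lemma adapted_eventually:
  assumes "adapted F m Q l E p x f q g"
  shows "eventually (\<lambda>z. frame_at F m z f \<and> frame_at Q l z q \<and> (\<forall>j<l. reg_section E z (g j) \<and> p z (g j z) = q j z)) cof"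
proof -
  have "eventually (\<lambda>z. frame_at F m z f) cof" "eventually (\<lambda>z. frame_at Q l z q) cof"
    "eventually (\<lambda>z. \<forall>j\<in>{..<l}. reg_section E z (g j) \<and> near z (\<lambda>w. q j w = p w (g j w))) cof"
    using assms unfolding adapted_def local_frame_def near_def by blast+
  then show ?thesis by eventually_elim (auto simp: near_def)
qed

text \<open>Orders are computed from adapted frames, both for the generic frame and for the local
  frame at each point. By the block form the determinant is then the product of those of
  \<open>F\<close> and \<open>Q\<close>, so that its order is the sum.\<close>

theorem degree_exact:
  assumes X: "quot F E Q p" and F: "vector_bundle N C m F" and Q: "vector_bundle N C l Q"
  shows "degree_bundle N C (m + l) E = degree_bundle N C m F + degree_bundle N C l Q"
proof -
  note E = vector_bundle_exact[OF X F Q]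
  note ps = module_sheafD(1)[OF quotD(1)[OF X]]
  have ad: "\<exists>f q g. adapted F m Q l E p x f q g" if x: "x \<in> C" for x
    using adapted_exists[OF X _ _ x] F Q x unfolding vector_bundle_iff by metis
  obtain x0 where x0: "x0 \<in> C" using C_nonempty by blast
  then obtain f' q' g' where a': "adapted F m Q l E p x0 f' q' g'" using ad by blast
  have gf: "generic_frame F m f'" "generic_frame Q l q'" using a' local_frame_generic_frame unfolding adapted_def by blast+
  have ge: "generic_frame E (m + l) (join_fam m f' g')" using local_frame_generic_frame[OF adapted_local_frame[OF X x0 a']] .
  have dd: "det_ord E (m + l) (join_fam m f' g') x = det_ord F m f' x + det_ord Q l q' x" if x: "x \<in> C" for x
  proof -
    obtain f q g where a: "adapted F m Q l E p x f q g" using ad x by blast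
    then have fq: "local_frame F m x f" "local_frame Q l x q" by (auto simp: adapted_def)
    have 1: "has_ord x (\<lambda>z. transition_det m (\<lambda>i. f i z) (\<lambda>j. f' j z)) (det_ord F m f' x)"
      using has_det_ord_local_frame[OF gf(1) x fq(1) has_det_ord_det_ord[OF F gf(1) x]] .
    have 2: "has_ord x (\<lambda>z. transition_det l (\<lambda>i. q i z) (\<lambda>j. q' j z)) (det_ord Q l q' x)"
      using has_det_ord_local_frame[OF gf(2) x fq(2) has_det_ord_det_ord[OF Q gf(2) x]] .
    have ev: "eventually (\<lambda>z. transition_det m (\<lambda>i. f i z) (\<lambda>j. f' j z) * transition_det l (\<lambda>i. q i z) (\<lambda>j. q' j z)
       = transition_det (m + l) (\<lambda>i. join_fam m f g i z) (\<lambda>j. join_fam m f' g' j z)) cof"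
      using adapted_eventually[OF a] adapted_eventually[OF a'] eventually_cof_C
    proof eventually_elim
      case (elim z)
      have in1: "g j z \<in> fibre E z \<and> p z (g j z) = q j z" if "j < l" for j using elim(1) reg_section_fibre[OF ps] that by blast
      have in2: "g' j z \<in> fibre E z \<and> p z (g' j z) = q' j z" if "j < l" for j using elim(2) reg_section_fibre[OF ps] that by blast
      show ?case unfolding join_fam_apply[of m f g _ z] join_fam_apply[of m f' g' _ z]
        by (rule transition_det_exact[OF quotD(2)[OF X elim(3)] module_sheafD(2)[OF quotD(1)[OF X] elim(3)] quotD(3)[OF X elim(3)] quotD(4)[OF X elim(3)], symmetric])
           (use elim(1,2) in1 in2 in \<open>auto intro: frame_at_fbasis\<close>)
    qed
    have "has_ord x (\<lambda>z. transition_det (m + l) (\<lambda>i. join_fam m f g i z) (\<lambda>j. join_fam m f' g' j z)) (det_ord F m f' x + det_ord Q l q' x)"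
      by (rule has_ord_cong[OF has_ord_mult[OF 1 2] ev])
    then have "has_det_ord E (m + l) (join_fam m f' g') x (det_ord F m f' x + det_ord Q l q' x)"
      unfolding has_det_ord_def using adapted_local_frame[OF X x a] by blast
    then show ?thesis by (rule det_ord_eq[OF ge x])
  qed
  define A where "A = {x \<in> C. det_ord F m f' x \<noteq> 0} \<union> {x \<in> C. det_ord Q l q' x \<noteq> 0}"
  have A: "finite A" "A \<subseteq> C" unfolding A_def using finite_det_ord[OF F gf(1)] finite_det_ord[OF Q gf(2)] by auto
  have "degree_bundle N C (m + l) E = (\<Sum>x\<in>A. det_ord E (m + l) (join_fam m f' g') x)"
    using dd by (intro degree_bundle_sum[OF E ge A]) (auto simp: A_def)
  also have "\<dots> = (\<Sum>x\<in>A. det_ord F m f' x) + (\<Sum>x\<in>A. det_ord Q l q' x)"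
    using dd A(2) by (subst sum.distrib[symmetric]) (auto intro: sum.cong)
  also have "(\<Sum>x\<in>A. det_ord F m f' x) = degree_bundle N C m F"
    by (rule degree_bundle_sum[OF F gf(1) A, symmetric]) (auto simp: A_def)
  also have "(\<Sum>x\<in>A. det_ord Q l q' x) = degree_bundle N C l Q"
    by (rule degree_bundle_sum[OF Q gf(2) A, symmetric]) (auto simp: A_def)
  finally show ?thesis .
qed

end

lemma lcomb_exchange:
  assumes i: "i < n"
  shows "lcomb n c (e(i := lcomb n h e)) = lcomb n (\<lambda>j. if j = i then c i * h i else c j + c i * h j) e"
proof -
  have "lcomb n c (e(i := lcomb n h e)) = fscale (c i) (lcomb n h e) + (\<Sum>j\<in>{..<n} - {i}. fscale (c j) (e j))"
    unfolding lcomb_def by (subst sum.remove[of _ i]) (use i in \<open>auto intro: sum.cong\<close>)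
  also have "fscale (c i) (lcomb n h e) = fscale (c i * h i) (e i) + (\<Sum>j\<in>{..<n} - {i}. fscale (c i * h j) (e j))"
    unfolding lcomb_def by (subst sum.remove[of _ i]) (use i in \<open>auto simp: fn.scale_right_distrib fn.scale_sum_right\<close>)
  finally have "lcomb n c (e(i := lcomb n h e)) = fscale (c i * h i) (e i) +
      ((\<Sum>j\<in>{..<n} - {i}. fscale (c i * h j) (e j)) + (\<Sum>j\<in>{..<n} - {i}. fscale (c j) (e j)))" by (simp only: add.assoc)
  also have "(\<Sum>j\<in>{..<n} - {i}. fscale (c i * h j) (e j)) + (\<Sum>j\<in>{..<n} - {i}. fscale (c j) (e j))
      = (\<Sum>j\<in>{..<n} - {i}. fscale (if j = i then c i * h i else c j + c i * h j) (e j))"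
    by (subst sum.distrib[symmetric], rule sum.cong) (auto simp: fn.scale_left_distrib add.commute)
  also have "fscale (c i * h i) (e i) + \<dots> = lcomb n (\<lambda>j. if j = i then c i * h i else c j + c i * h j) e"
    unfolding lcomb_def by (subst sum.remove[of "{..<n}" i]) (use i in auto)
  finally show ?thesis .
qed

lemma lcomb_transpose:
  assumes "i < n" "k < n"
  shows "lcomb n c (\<lambda>j. e (Transposition.transpose i k j)) = lcomb n (\<lambda>j. c (Transposition.transpose i k j)) e"
  unfolding lcomb_def
  by (rule sum.reindex_bij_witness[of _ "Transposition.transpose i k" "Transposition.transpose i k"])
     (use assms in \<open>auto simp: Transposition.transpose_def\<close>)

lemma fbasis_range: "fbasis n e S \<Longrightarrow> S = range (\<lambda>c. lcomb n c e)"
  by (auto simp: fbasis_def)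

context curve
begin

text \<open>Two families of sections generate the same germs if each combination of one with regular
  coefficients is such a combination of the other. Exchange and transposition of frame members are
  both reduced to this.\<close>

lemma frame_at_transfer:
  assumes e: "frame_at E n y e"
    and there: "\<And>f. \<forall>i<n. reg y (f i) \<Longrightarrow> \<exists>f'. (\<forall>i<n. reg y (f' i)) \<and> near y (\<lambda>z. lcomb n (\<lambda>i. f i z) (\<lambda>i. e i z) = lcomb n (\<lambda>i. f' i z) (\<lambda>i. e' i z))"
    and hither: "\<And>f. \<forall>i<n. reg y (f i) \<Longrightarrow> \<exists>f'. (\<forall>i<n. reg y (f' i)) \<and> near y (\<lambda>z. lcomb n (\<lambda>i. f i z) (\<lambda>i. e' i z) = lcomb n (\<lambda>i. f' i z) (\<lambda>i. e i z))"
    and b: "fbasis n (\<lambda>i. e' i y) (fibre E y)"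
  shows "frame_at E n y e'"
  unfolding frame_at_def
proof (intro conjI allI b iffI)
  fix s assume "reg_section E y s"
  then obtain f where f: "\<And>i. i < n \<Longrightarrow> reg y (f i)" "near y (\<lambda>z. s z = lcomb n (\<lambda>i. f i z) (\<lambda>i. e i z))"
    using frame_at_reg_sectionE[OF e] by blast
  obtain f' where f': "\<forall>i<n. reg y (f' i)" "near y (\<lambda>z. lcomb n (\<lambda>i. f i z) (\<lambda>i. e i z) = lcomb n (\<lambda>i. f' i z) (\<lambda>i. e' i z))"
    using there[of f] f(1) by blast
  have "near y (\<lambda>z. s z = lcomb n (\<lambda>i. f' i z) (\<lambda>i. e' i z))"
    by (rule near_mono[OF near_conj[OF f(2) f'(2)]]) (metis)
  then show "\<exists>f. (\<forall>i<n. reg y (f i)) \<and> near y (\<lambda>z. s z = lcomb n (\<lambda>i. f i z) (\<lambda>i. e' i z))" using f'(1) by blast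
next
  fix s assume "\<exists>f. (\<forall>i<n. reg y (f i)) \<and> near y (\<lambda>z. s z = lcomb n (\<lambda>i. f i z) (\<lambda>i. e' i z))"
  then obtain f where f: "\<forall>i<n. reg y (f i)" "near y (\<lambda>z. s z = lcomb n (\<lambda>i. f i z) (\<lambda>i. e' i z))" by blast
  obtain f' where f': "\<forall>i<n. reg y (f' i)" "near y (\<lambda>z. lcomb n (\<lambda>i. f i z) (\<lambda>i. e' i z) = lcomb n (\<lambda>i. f' i z) (\<lambda>i. e i z))"
    using hither[of f] f(1) by blast
  have "near y (\<lambda>z. s z = lcomb n (\<lambda>i. f' i z) (\<lambda>i. e i z))"
    by (rule near_mono[OF near_conj[OF f(2) f'(2)]]) (metis)
  then show "reg_section E y s" using frame_at_reg_sectionI[OF e] f'(1) by blast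
qed

lemma fbasis_exchange:
  assumes e: "fbasis n e S" and i: "i < n" "h i \<noteq> 0"
  shows "fbasis n (e(i := lcomb n h e)) S"
proof -
  let ?e = "e(i := lcomb n h e)"
  have inv: "lcomb n c e = lcomb n (\<lambda>j. if j = i then c i / h i else c j - c i / h i * h j) ?e" for c
    unfolding lcomb_exchange[OF i(1)] using i by (intro lcomb_cong) auto
  have "c j = 0" if c: "lcomb n c ?e = 0" and j: "j < n" for c j
  proof -
    have *: "(if l = i then c i * h i else c l + c i * h l) = 0" if "l < n" for l
      using c e that unfolding lcomb_exchange[OF i(1)] fbasis_def by blast
    have "c i = 0" using *[OF i(1)] i(2) by simp
    then show ?thesis using *[OF j] by (cases "j = i") auto
  qed
  moreover have "v \<in> S \<longleftrightarrow> (\<exists>c. v = lcomb n c ?e)" for v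
  proof
    assume "v \<in> S"
    then show "\<exists>c. v = lcomb n c ?e" using e inv unfolding fbasis_def by metis
  next
    assume "\<exists>c. v = lcomb n c ?e"
    then show "v \<in> S" unfolding lcomb_exchange[OF i(1)] using fbasis_mem[OF e] by blast
  qed
  ultimately show ?thesis unfolding fbasis_def by blast
qed

lemma frame_at_exchange:
  assumes e: "frame_at E n y e" and h: "\<And>j. j < n \<Longrightarrow> reg y (h j)" and i: "i < n" "h i y \<noteq> 0"
    and s: "near y (\<lambda>z. s z = lcomb n (\<lambda>j. h j z) (\<lambda>j. e j z))"
  shows "frame_at E n y (e(i := s))"
proof (rule frame_at_transfer[OF e])
  have upd: "(\<lambda>j. (e(i := s)) j z) = (\<lambda>j. e j z)(i := s z)" for z by auto
  have hi: "near y (\<lambda>z. h i z \<noteq> 0)" using reg_eventually_nonzero[OF h[OF i(1)] i(2)] i(2) by (simp add: near_def)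
  have sy: "s y = lcomb n (\<lambda>j. h j y) (\<lambda>j. e j y)" using s by (simp add: near_def)
  show "fbasis n (\<lambda>j. (e(i := s)) j y) (fibre E y)"
    unfolding upd sy by (rule fbasis_exchange[OF frame_at_fbasis[OF e] i(1), where h = "\<lambda>j. h j y", OF i(2)])
  fix f assume f: "\<forall>j<n. reg y (f j)"
  let ?f1 = "\<lambda>j z. if j = i then f i z / h i z else f j z - f i z / h i z * h j z"
  have "near y (\<lambda>z. lcomb n (\<lambda>j. f j z) (\<lambda>j. e j z) = lcomb n (\<lambda>j. ?f1 j z) (\<lambda>j. (e(i := s)) j z))"
  proof (rule near_mono[OF near_conj[OF s hi]])
    fix z assume z: "s z = lcomb n (\<lambda>j. h j z) (\<lambda>j. e j z) \<and> h i z \<noteq> 0"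
    show "lcomb n (\<lambda>j. f j z) (\<lambda>j. e j z) = lcomb n (\<lambda>j. ?f1 j z) (\<lambda>j. (e(i := s)) j z)"
      unfolding upd conjunct1[OF z] lcomb_exchange[OF i(1)] using z by (intro lcomb_cong) auto
  qed
  moreover have "reg y (?f1 j)" if j: "j < n" for j
    using f h i j by (cases "j = i") (auto intro!: reg_divide reg_diff reg_mult)
  ultimately show "\<exists>f'. (\<forall>i<n. reg y (f' i)) \<and> near y (\<lambda>z. lcomb n (\<lambda>i. f i z) (\<lambda>i. e i z) = lcomb n (\<lambda>i. f' i z) (\<lambda>j. (e(i := s)) j z))"
    by (intro exI[of _ ?f1]) blast
  let ?f2 = "\<lambda>j z. if j = i then f i z * h i z else f j z + f i z * h j z"
  have "near y (\<lambda>z. lcomb n (\<lambda>j. f j z) (\<lambda>j. (e(i := s)) j z) = lcomb n (\<lambda>j. ?f2 j z) (\<lambda>j. e j z))"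
    by (rule near_mono[OF s]) (unfold upd, simp only: lcomb_exchange[OF i(1)])
  moreover have "reg y (?f2 j)" if j: "j < n" for j
    using f h i j by (cases "j = i") (auto intro!: reg_add reg_mult)
  ultimately show "\<exists>f'. (\<forall>i<n. reg y (f' i)) \<and> near y (\<lambda>z. lcomb n (\<lambda>i. f i z) (\<lambda>j. (e(i := s)) j z) = lcomb n (\<lambda>i. f' i z) (\<lambda>i. e i z))"
    by (intro exI[of _ ?f2]) blast
qed

lemma frame_at_transpose:
  assumes e: "frame_at E n y e" and ik: "i < n" "k < n"
  shows "frame_at E n y (\<lambda>j. e (Transposition.transpose i k j))"
proof (rule frame_at_transfer[OF e])
  let ?t = "Transposition.transpose i k"
  have t: "?t j < n" if "j < n" for j using that ik by (auto simp: Transposition.transpose_def)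
  have tt: "?t (?t j) = j" for j by simp
  have b: "fbasis n (\<lambda>j. e j y) (fibre E y)" using frame_at_fbasis[OF e] .
  show "fbasis n (\<lambda>j. e (?t j) y) (fibre E y)"
    unfolding fbasis_def lcomb_transpose[OF ik, where e = "\<lambda>j. e j y"]
  proof (intro conjI allI impI)
    fix v show "v \<in> fibre E y \<longleftrightarrow> (\<exists>c. v = lcomb n (\<lambda>j. c (?t j)) (\<lambda>j. e j y))"
    proof
      assume "v \<in> fibre E y"
      then obtain c where "v = lcomb n c (\<lambda>j. e j y)" using b unfolding fbasis_def by blast
      then have "v = lcomb n (\<lambda>j. (\<lambda>j. c (?t j)) (?t j)) (\<lambda>j. e j y)" by simp
      then show "\<exists>c. v = lcomb n (\<lambda>j. c (?t j)) (\<lambda>j. e j y)" by (rule exI[of "\<lambda>c. v = lcomb n (\<lambda>j. c (?t j)) (\<lambda>j. e j y)"])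
    qed (use fbasis_mem[OF b] in blast)
  next
    fix c j assume "lcomb n (\<lambda>j. c (?t j)) (\<lambda>j. e j y) = 0" "j < n"
    then have "c (?t (?t j)) = 0" using b t unfolding fbasis_def by blast
    then show "c j = 0" by simp
  qed
  fix f assume f: "\<forall>j<n. reg y (f j)"
  have r: "\<forall>j<n. reg y (f (?t j))" using f t by blast
  have "lcomb n (\<lambda>j. f j z) (\<lambda>j. e j z) = lcomb n (\<lambda>j. f (?t j) z) (\<lambda>j. e (?t j) z)" for z
    unfolding lcomb_transpose[OF ik, where e = "\<lambda>j. e j z"] by simp
  then show "\<exists>f'. (\<forall>i<n. reg y (f' i)) \<and> near y (\<lambda>z. lcomb n (\<lambda>i. f i z) (\<lambda>i. e i z) = lcomb n (\<lambda>i. f' i z) (\<lambda>j. e (?t j) z))"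
    using r by (intro exI[of _ "\<lambda>j. f (?t j)"]) (simp add: near_def)
  have "lcomb n (\<lambda>j. f j z) (\<lambda>j. e (?t j) z) = lcomb n (\<lambda>j. f (?t j) z) (\<lambda>j. e j z)" for z
    unfolding lcomb_transpose[OF ik, where e = "\<lambda>j. e j z"] by simp
  then show "\<exists>f'. (\<forall>i<n. reg y (f' i)) \<and> near y (\<lambda>z. lcomb n (\<lambda>i. f i z) (\<lambda>j. e (?t j) z) = lcomb n (\<lambda>i. f' i z) (\<lambda>i. e i z))"
    using r by (intro exI[of _ "\<lambda>j. f (?t j)"]) (simp add: near_def)
qed

text \<open>Steinitz exchange, applied to germs of sections.\<close>

lemma frame_extension:
  assumes e: "local_frame E n x e" and x: "x \<in> C"
    and f: "\<And>i. i < m \<Longrightarrow> reg_section E x (f i)" and ind: "fbasis m (\<lambda>i. f i x) F"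
  shows "m \<le> n \<and> (\<exists>g. local_frame E n x g \<and> (\<forall>i<m. g i = f i))"
proof -
  have "k \<le> m \<Longrightarrow> k \<le> n \<and> (\<exists>g. local_frame E n x g \<and> (\<forall>i<k. g i = f i))" for k
  proof (induction k)
    case 0 then show ?case using e by auto
  next
    case (Suc k)
    then obtain g where k: "k \<le> n" and g: "local_frame E n x g" "\<forall>i<k. g i = f i" by auto
    have km: "k < m" using Suc.prems by simp
    obtain h where h: "\<And>i. i < n \<Longrightarrow> reg x (h i)" "near x (\<lambda>z. f k z = lcomb n (\<lambda>i. h i z) (\<lambda>i. g i z))"
      using frame_at_reg_sectionE[OF local_frame_frame_at[OF g(1)] f[OF km]] by blast
    \<comment> \<open>Otherwise \<open>f k x\<close> would be a combination of the earlier
      \<open>g i x = f i x\<close>, against their independence at \<open>x\<close>.\<close>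
    have "\<exists>i<n. k \<le> i \<and> h i x \<noteq> 0"
    proof (rule ccontr)
      assume no: "\<not> ?thesis"
      let ?c = "\<lambda>i. if i < k then h i x else 0"
      have "f k x = lcomb n (\<lambda>i. h i x) (\<lambda>i. g i x)" using h(2) by (simp add: near_def)
      also have "\<dots> = lcomb n ?c (\<lambda>i. g i x)" using no by (intro lcomb_cong) auto
      also have "\<dots> = lcomb (k + (n - k)) ?c (\<lambda>i. g i x)" using k by simp
      also have "\<dots> = lcomb k ?c (\<lambda>i. g i x) + lcomb (n - k) (\<lambda>_. 0) (\<lambda>i. g (k + i) x)"
        unfolding lcomb_split by (intro arg_cong2[where f = "(+)"] lcomb_cong) auto
      also have "\<dots> = lcomb k ?c (\<lambda>i. f i x)" unfolding lcomb_zero add_0_right using g(2) by (intro lcomb_cong) auto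
      also have "\<dots> = lcomb k ?c (\<lambda>i. f i x) + lcomb (m - k) (\<lambda>_. 0) (\<lambda>i. f (k + i) x)" by (simp add: lcomb_zero)
      also have "\<dots> = lcomb (k + (m - k)) ?c (\<lambda>i. f i x)"
        unfolding lcomb_split by (intro arg_cong2[where f = "(+)"] lcomb_cong) auto
      also have "\<dots> = lcomb m ?c (\<lambda>i. f i x)" using km by simp
      finally have "lcomb m (\<lambda>i. if i = k then 1 else 0) (\<lambda>i. f i x) = lcomb m ?c (\<lambda>i. f i x)"
        using lcomb_single[OF km, of 1 "\<lambda>i. f i x"] by simp
      from fbasis_unique[OF ind this km] show False by simp
    qed
    then obtain i where i: "i < n" "k \<le> i" "h i x \<noteq> 0" by blast
    let ?t = "Transposition.transpose i k"
    \<comment> \<open>The new section replaces the member at place \<open>i\<close>; the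
      transposition then moves it to place \<open>k\<close> without disturbing the places below
      \<open>k\<close>, as \<open>k \<le> i\<close>.\<close>
    define g1 where "g1 = g(i := f k)"
    have hn: "near x (\<lambda>z. h i z \<noteq> 0)" using reg_eventually_nonzero[OF h(1)[OF i(1)] i(3)] i(3) by (simp add: near_def)
    have "local_frame E n x (\<lambda>j. g1 (?t j))"
      unfolding local_frame_def g1_def
    proof (rule near_mono[OF near_conj[OF near_conj[OF g(1)[unfolded local_frame_def] hn] near_conj[OF near_reg_all[OF h(1)] near_near[OF h(2)]]]])
      fix z assume z: "(frame_at E n z g \<and> h i z \<noteq> 0) \<and> (\<forall>j<n. reg z (h j)) \<and> near z (\<lambda>z. f k z = lcomb n (\<lambda>i. h i z) (\<lambda>i. g i z))"
      have "frame_at E n z (g(i := f k))" using z by (intro frame_at_exchange[of E n z g h i]) (use i in auto)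
      then show "frame_at E n z (\<lambda>j. (g(i := f k)) (?t j))" by (rule frame_at_transpose) (use i in auto)
    qed
    moreover have "g1 (?t j) = f j" if "j < Suc k" for j
      using that i g(2) by (auto simp: g1_def Transposition.transpose_def)
    moreover have "Suc k \<le> n" using i by simp
    ultimately show ?case by blast
  qed
  then show ?thesis by blast
qed

section \<open>Constructing bundles\<close>

text \<open>Sections are the functions satisfying \<open>R\<close> at every point of the open set,
  so that gluing is built in. The conditions \<open>germs\<close> say that \<open>R\<close> really
  is a property of germs and is open in the point.\<close>

definition germ_bundle :: "('k point \<Rightarrow> 'k vec set) \<Rightarrow> ('k point \<Rightarrow> ('k point \<Rightarrow> 'k vec) \<Rightarrow> bool) \<Rightarrow> 'k vbundle" where
  "germ_bundle Fb R = \<lparr>fibre = (\<lambda>x. if x \<in> C then Fb x else {}),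
     sections = (\<lambda>U. if openin (zariski N C) U then {s. (\<forall>x. x \<notin> U \<longrightarrow> s x = 0) \<and> (\<forall>x\<in>U. R x s)} else {})\<rparr>"

definition germs :: "('k point \<Rightarrow> 'k vec set) \<Rightarrow> ('k point \<Rightarrow> ('k point \<Rightarrow> 'k vec) \<Rightarrow> bool) \<Rightarrow> bool" where
  "germs Fb R \<longleftrightarrow> (\<forall>x s. R x s \<longrightarrow> x \<in> C \<and> s x \<in> Fb x \<and> near x (\<lambda>z. R z s)) \<and>
     (\<forall>x s s'. R x s \<longrightarrow> near x (\<lambda>z. s z = s' z) \<longrightarrow> R x s')"

lemma germsD:
  assumes "germs Fb R"
  shows "R x s \<Longrightarrow> x \<in> C" "R x s \<Longrightarrow> s x \<in> Fb x" "R x s \<Longrightarrow> near x (\<lambda>z. R z s)"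
    "R x s \<Longrightarrow> near x (\<lambda>z. s z = s' z) \<Longrightarrow> R x s'"
  using assms unfolding germs_def by blast+

lemma fibre_germ_bundle: "x \<in> C \<Longrightarrow> fibre (germ_bundle Fb R) x = Fb x"
  by (simp add: germ_bundle_def)

lemma near_restrict: "openin (zariski N C) U \<Longrightarrow> x \<in> U \<Longrightarrow> near x (\<lambda>z. s z = restrict_section U s z)"
  by (rule near_mono[OF open_near[of U]]) (auto simp: restrict_section_def)

lemma bundle_sheaf_germ_bundle:
  assumes R: "germs Fb R" shows "bundle_sheaf (germ_bundle Fb R)"
proof -
  have 1: "R x (restrict_section U s) \<longleftrightarrow> R x s" if "openin (zariski N C) U" "x \<in> U" for U x s
  proof
    assume "R x (restrict_section U s)"
    then show "R x s" by (rule germsD(4)[OF R]) (rule near_mono[OF near_restrict[OF that, of s]], rule sym)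
  next
    assume "R x s"
    then show "R x (restrict_section U s)" by (rule germsD(4)[OF R]) (rule near_restrict[OF that])
  qed
  show ?thesis unfolding bundle_sheaf_def
  proof (intro conjI allI impI ballI)
    fix U s x assume "s \<in> sections (germ_bundle Fb R) U"
    then have s: "openin (zariski N C) U" "\<forall>x. x \<notin> U \<longrightarrow> s x = 0" "\<forall>x\<in>U. R x s"
      by (auto simp: germ_bundle_def split: if_splits)
    show "x \<notin> U \<Longrightarrow> s x = 0" using s by blast
    show "s x \<in> fibre (germ_bundle Fb R) x" if "x \<in> U"
    proof -
      have "R x s" using s that by blast
      then show ?thesis using germsD(1,2)[OF R, of x s] by (simp add: fibre_germ_bundle)
    qed
  next
    fix U W s assume *: "openin (zariski N C) U \<and> openin (zariski N C) W \<and> W \<subseteq> U \<and> s \<in> sections (germ_bundle Fb R) U"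
    then have "R x (restrict_section W s)" if "x \<in> W" for x using 1[of W x s] that by (auto simp: germ_bundle_def)
    then show "restrict_section W s \<in> sections (germ_bundle Fb R) W" using * by (auto simp: germ_bundle_def restrict_section_def)
  next
    fix U s assume *: "openin (zariski N C) U \<and> (\<forall>x. x \<notin> U \<longrightarrow> s x = 0) \<and>
        (\<forall>x\<in>U. \<exists>W. openin (zariski N C) W \<and> x \<in> W \<and> W \<subseteq> U \<and> restrict_section W s \<in> sections (germ_bundle Fb R) W)"
    have "R x s" if x: "x \<in> U" for x
    proof -
      obtain W where "openin (zariski N C) W" "x \<in> W" "restrict_section W s \<in> sections (germ_bundle Fb R) W" using * x by blast
      then show ?thesis using 1[of W x s] by (auto simp: germ_bundle_def)
    qed
    then show "s \<in> sections (germ_bundle Fb R) U" using * by (auto simp: germ_bundle_def)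
  qed (auto simp: germ_bundle_def)
qed

lemma reg_section_germ_bundle:
  assumes R: "germs Fb R" shows "reg_section (germ_bundle Fb R) x s \<longleftrightarrow> R x s"
proof
  assume "reg_section (germ_bundle Fb R) x s"
  then obtain U where U: "openin (zariski N C) U" "x \<in> U" "restrict_section U s \<in> sections (germ_bundle Fb R) U" unfolding reg_section_def by blast
  then have "R x (restrict_section U s)" by (auto simp: germ_bundle_def)
  then show "R x s" by (rule germsD(4)[OF R]) (rule near_mono[OF near_restrict[OF U(1,2), of s]], rule sym)
next
  assume r: "R x s"
  let ?U = "{z \<in> C. R z s}"
  have U: "openin (zariski N C) ?U" using germsD(1,3)[OF R r] by (intro near_openI[of x]) auto
  have "R z (restrict_section ?U s)" if z: "z \<in> ?U" for z
  proof -
    have "R z s" using z by blast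
    then show ?thesis by (rule germsD(4)[OF R]) (rule near_restrict[OF U z])
  qed
  then have "restrict_section ?U s \<in> sections (germ_bundle Fb R) ?U" using U by (auto simp: germ_bundle_def restrict_section_def)
  then show "reg_section (germ_bundle Fb R) x s" unfolding reg_section_def using U r germsD(1)[OF R r] by blast
qed

section \<open>Subbundles and quotients\<close>

lemma subbundle_reg_section:
  assumes F: "bundle_sheaf F" and E: "bundle_sheaf E" and sub: "subbundle F E"
  shows "reg_section F y s \<longleftrightarrow> reg_section E y s \<and> near y (\<lambda>z. s z \<in> fibre F z)"
proof
  assume r: "reg_section F y s"
  then obtain U where "openin (zariski N C) U" "y \<in> U" "restrict_section U s \<in> sections F U" unfolding reg_section_def by blast
  moreover have "sections F U \<subseteq> sections E U" for U using sub unfolding subbundle_def by blast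
  ultimately have "reg_section E y s" unfolding reg_section_def by blast
  moreover have "near y (\<lambda>z. s z \<in> fibre F z)" by (rule near_mono[OF reg_section_near[OF r]]) (rule reg_section_fibre[OF F])
  ultimately show "reg_section E y s \<and> near y (\<lambda>z. s z \<in> fibre F z)" by blast
next
  assume r: "reg_section E y s \<and> near y (\<lambda>z. s z \<in> fibre F z)"
  then have y: "y \<in> C" using reg_section_C by blast
  let ?U = "{z \<in> C. reg_section E z s \<and> s z \<in> fibre F z}"
  have U: "openin (zariski N C) ?U" using r by (intro near_openI[OF y] near_conj reg_section_near) auto
  have yU: "y \<in> ?U" using r y by (auto simp: near_def)
  have "reg_section E z (restrict_section ?U s)" if z: "z \<in> ?U" for z
  proof -
    have "reg_section E z s" using z by blast
    then show ?thesis by (rule reg_section_cong[OF E]) (rule near_restrict[OF U z])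
  qed
  then have "restrict_section ?U s \<in> sections E ?U" using sections_iff[OF E U] by (auto simp: restrict_section_def)
  moreover have "restrict_section ?U s z \<in> fibre F z" if "z \<in> ?U" for z using that by (simp add: restrict_section_def)
  ultimately have "restrict_section ?U s \<in> sections F ?U" using assms(3) unfolding subbundle_def by blast
  then have "\<exists>W. openin (zariski N C) W \<and> y \<in> W \<and> restrict_section W s \<in> sections F W"
    using U yU by (intro exI[of _ ?U] conjI)
  then show "reg_section F y s" by (simp only: reg_section_def)
qed

text \<open>A frame of \<open>F\<close> consists of sections of \<open>E\<close> whose values at
  \<open>x\<close> stay independent, because the fibre of \<open>F\<close> is a subspace of that of
  \<open>E\<close>. Exchange extends it to a frame of \<open>E\<close> whose first \<open>m\<close>
  members are a frame of \<open>F\<close>.\<close>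

lemma subbundle_adapted_frame:
  assumes E: "vector_bundle N C n E" and F: "vector_bundle N C m F" and s: "subbundle F E" and x: "x \<in> C"
  shows "m \<le> n" "\<exists>g. local_frame E n x g \<and> local_frame F m x g"
proof -
  have ps: "bundle_sheaf E" "bundle_sheaf F" using E F by (auto simp: vector_bundle_iff)
  obtain e f where e: "local_frame E n x e" and f: "local_frame F m x f" using E F x unfolding vector_bundle_iff by blast
  have fE: "reg_section E x (f i)" if "i < m" for i
    using frame_at_reg_section_frame[OF local_frame_frame_at[OF f] x that] subbundle_reg_section[OF ps(2,1) s] by blast
  have *: "m \<le> n \<and> (\<exists>g. local_frame E n x g \<and> (\<forall>i<m. g i = f i))"
    using frame_extension[OF e x fE frame_at_fbasis[OF local_frame_frame_at[OF f]]] .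
  then show "m \<le> n" by blast
  obtain g where g: "local_frame E n x g" "\<forall>i<m. g i = f i" using * by blast
  have "local_frame F m x g" using f unfolding local_frame_def
  proof (rule near_mono)
    fix z assume p: "frame_at F m z f"
    have eq: "lcomb m c (\<lambda>i. g i w) = lcomb m c (\<lambda>i. f i w)" for c w using g(2) by (intro lcomb_cong) auto
    show "frame_at F m z g" using p unfolding frame_at_def fbasis_def eq .
  qed
  then show "\<exists>g. local_frame E n x g \<and> local_frame F m x g" using g(1) by blast
qed

text \<open>A common frame gives equal fibres, and a subbundle has the induced sections; so the two
  records coincide.\<close>

lemma subbundle_full_rank:
  assumes E: "vector_bundle N C n E" and F: "vector_bundle N C n F" and s: "subbundle F E"
  shows "F = E"
proof -
  have ps: "bundle_sheaf E" "bundle_sheaf F" using E F by (auto simp: vector_bundle_iff)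
  have fib: "fibre F x = fibre E x" for x
  proof (cases "x \<in> C")
    case True
    then obtain g where g: "local_frame E n x g" "local_frame F n x g" using subbundle_adapted_frame(2)[OF E F s] by blast
    show ?thesis using fbasis_range[OF frame_at_fbasis[OF local_frame_frame_at[OF g(1)]]] fbasis_range[OF frame_at_fbasis[OF local_frame_frame_at[OF g(2)]]] by simp
  next
    case False
    then show ?thesis using bundle_sheafD(1) ps by metis
  qed
  have "sections F U = sections E U" for U
  proof -
    have "sections F U = {s \<in> sections E U. \<forall>x\<in>U. s x \<in> fibre F x}" using s unfolding subbundle_def by blast
    then show ?thesis using fib bundle_sheafD(3)[OF ps(1)] by blast
  qed
  then show ?thesis using fib by (intro vbundle.equality ext) auto
qed

end

lemma lcomb_upper:
  assumes "m \<le> n"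
  shows "lcomb (n - m) c (\<lambda>j. e (m + j)) = lcomb n (\<lambda>i. if i < m then 0 else c (i - m)) e"
proof -
  have "lcomb n (\<lambda>i. if i < m then 0 else c (i - m)) e = lcomb (m + (n - m)) (\<lambda>i. if i < m then 0 else c (i - m)) e"
    using assms by simp
  also have "\<dots> = lcomb m (\<lambda>_. 0) e + lcomb (n - m) c (\<lambda>j. e (m + j))"
    unfolding lcomb_split by (intro arg_cong2[where f = "(+)"] lcomb_cong) auto
  finally show ?thesis by (simp add: lcomb_zero)
qed

lemma lcomb_lower:
  assumes "m \<le> n"
  shows "lcomb m c e = lcomb n (\<lambda>i. if i < m then c i else 0) e"
proof -
  have "lcomb n (\<lambda>i. if i < m then c i else 0) e = lcomb (m + (n - m)) (\<lambda>i. if i < m then c i else 0) e"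
    using assms by simp
  also have "\<dots> = lcomb m c e + lcomb (n - m) (\<lambda>_. 0) (\<lambda>j. e (m + j))"
    unfolding lcomb_split by (intro arg_cong2[where f = "(+)"] lcomb_cong) auto
  finally show ?thesis by (simp add: lcomb_zero)
qed

lemma coords_add: "fbasis n e S \<Longrightarrow> v \<in> S \<Longrightarrow> w \<in> S \<Longrightarrow> i < n \<Longrightarrow> coords n e (v + w) i = coords n e v i + coords n e w i"
  using coords_lcomb[of n e S i "\<lambda>i. coords n e v i + coords n e w i"] by (simp add: lcomb_add fbasis_coords)

lemma coords_scale: "fbasis n e S \<Longrightarrow> v \<in> S \<Longrightarrow> i < n \<Longrightarrow> coords n e (fscale a v) i = a * coords n e v i"
  using coords_lcomb[of n e S i "\<lambda>i. a * coords n e v i"] by (simp add: lcomb_scale fbasis_coords)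

lemma linear_on_split:
  assumes p: "linear_on E p" and g: "fbasis n g E" and f: "fbasis m g F" and mn: "m \<le> n" and F: "F = {v \<in> E. p v = 0}"
  shows "p (lcomb n c g) = lcomb (n - m) (\<lambda>j. c (m + j)) (\<lambda>j. p (g (m + j)))"
proof -
  have "p (lcomb n c g) = lcomb n c (\<lambda>i. p (g i))"
    using fbasis_elem[OF g] by (intro linear_on_lcomb[OF p fbasis_subspace'[OF g]])
  also have "\<dots> = lcomb (m + (n - m)) c (\<lambda>i. p (g i))" using mn by simp
  also have "\<dots> = lcomb m c (\<lambda>i. 0) + lcomb (n - m) (\<lambda>j. c (m + j)) (\<lambda>j. p (g (m + j)))"
    unfolding lcomb_split using fbasis_elem[OF f] F by (intro arg_cong2[where f = "(+)"] lcomb_cong) auto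
  finally show ?thesis by (simp add: lcomb_def)
qed

lemma fbasis_quotient:
  assumes p: "linear_on E p" and g: "fbasis n g E" and f: "fbasis m g F" and mn: "m \<le> n"
    and F: "F = {v \<in> E. p v = 0}" and Q: "p ` E = Q"
  shows "fbasis (n - m) (\<lambda>j. p (g (m + j))) Q"
proof -
  note split = linear_on_split[OF p g f mn F]
  have up: "lcomb (n - m) c (\<lambda>j. p (g (m + j))) = p (lcomb n (\<lambda>i. if i < m then 0 else c (i - m)) g)" for c
    unfolding split by (rule lcomb_cong) auto
  have "w \<in> Q \<longleftrightarrow> (\<exists>c. w = lcomb (n - m) c (\<lambda>j. p (g (m + j))))" for w
  proof
    assume "w \<in> Q"
    then obtain v where v: "v \<in> E" "w = p v" using Q by blast
    then have "w = p (lcomb n (coords n g v) g)" using fbasis_coords[OF g] by simp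
    then show "\<exists>c. w = lcomb (n - m) c (\<lambda>j. p (g (m + j)))" unfolding split by blast
  next
    assume "\<exists>c. w = lcomb (n - m) c (\<lambda>j. p (g (m + j)))"
    then show "w \<in> Q" unfolding up using Q fbasis_mem[OF g] by blast
  qed
  moreover have "c j = 0" if c: "lcomb (n - m) c (\<lambda>j. p (g (m + j))) = 0" and j: "j < n - m" for c j
  proof -
    let ?v = "lcomb n (\<lambda>i. if i < m then 0 else c (i - m)) g"
    have "?v \<in> F" using c fbasis_mem[OF g] F unfolding up by blast
    then have "?v = lcomb m (coords m g ?v) g" using fbasis_coords[OF f] by simp
    also have "\<dots> = lcomb n (\<lambda>i. if i < m then coords m g ?v i else 0) g" by (rule lcomb_lower[OF mn])
    finally have "(if m + j < m then 0 else c (m + j - m)) = (if m + j < m then coords m g ?v (m + j) else 0)"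
      by (rule fbasis_unique[OF g]) (use j in simp)
    then show ?thesis by simp
  qed
  ultimately show ?thesis unfolding fbasis_def by blast
qed

context curve
begin

text \<open>The quotient fibres are modelled as \<open>k^(n-m)\<close>: in a basis of
  \<open>E\<close> at \<open>y\<close> that begins with one of \<open>F\<close>, \<open>p y\<close>
  reads off the last \<open>n - m\<close> coordinates. These bases are chosen point by point without
  any regularity in \<open>y\<close>; the algebraic structure of \<open>Q\<close> comes from
  declaring the images of regular germs of \<open>E\<close> to be the regular ones.\<close>

theorem quotient_bundle:
  assumes E: "vector_bundle N C n E" and F: "vector_bundle N C m F" and sub: "subbundle F E"
  obtains Q p where "quot F E Q p" "vector_bundle N C (n - m) Q"
proof -
  have ps: "bundle_sheaf E" "bundle_sheaf F" using E F by (auto simp: vector_bundle_iff)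
  have sm: "module_sheaf E" using vector_bundle_module_sheaf[OF E] .
  have ad: "\<exists>g. local_frame E n x g \<and> local_frame F m x g" if "x \<in> C" for x using subbundle_adapted_frame(2)[OF E F sub that] .
  obtain x0 where "x0 \<in> C" using C_nonempty by blast
  then have mn: "m \<le> n" using subbundle_adapted_frame(1)[OF E F sub] by blast
  have "\<exists>b. fbasis n b (fibre E y) \<and> fbasis m b (fibre F y)" if y: "y \<in> C" for y
  proof -
    obtain g where g: "local_frame E n y g" "local_frame F m y g" using ad[OF y] by blast
    show ?thesis using frame_at_fbasis[OF local_frame_frame_at[OF g(1)]] frame_at_fbasis[OF local_frame_frame_at[OF g(2)]] by blast
  qed
  then obtain b where b: "\<And>y. y \<in> C \<Longrightarrow> fbasis n (b y) (fibre E y)" "\<And>y. y \<in> C \<Longrightarrow> fbasis m (b y) (fibre F y)" by metis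
  define p where "p y v = (\<lambda>j. if j < n - m then coords n (b y) v (m + j) else 0)" for y v
  define Qf where "Qf y = {v :: 'k vec. \<forall>j\<ge>n - m. v j = 0}" for y :: "'k point"
  define R where "R y q \<longleftrightarrow> (\<exists>s. reg_section E y s \<and> near y (\<lambda>z. q z = p z (s z)))" for y q
  have RI: "R y q" if "reg_section E y s" "near y (\<lambda>z. q z = p z (s z))" for y q s using that unfolding R_def by blast
  define Q where "Q = germ_bundle Qf R"
  have R: "germs Qf R"
    unfolding germs_def
  proof (intro conjI allI impI)
    fix y q assume "R y q"
    then obtain s where s: "reg_section E y s" "near y (\<lambda>z. q z = p z (s z))" unfolding R_def by blast
    show "y \<in> C" using reg_section_C[OF s(1)] .
    show "q y \<in> Qf y" using s(2) by (auto simp: near_def p_def Qf_def)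
    show "near y (\<lambda>z. R z q)"
      by (rule near_mono[OF near_conj[OF reg_section_near[OF s(1)] near_near[OF s(2)]]]) (rule RI, auto)
  next
    fix y q q' assume "R y q" and n: "near y (\<lambda>z. q z = q' z)"
    then obtain s where s: "reg_section E y s" "near y (\<lambda>z. q z = p z (s z))" unfolding R_def by blast
    show "R y q'" by (rule RI[OF s(1)], rule near_mono[OF near_conj[OF s(2) n]]) metis
  qed
  note rQ = reg_section_germ_bundle[OF R, folded Q_def]
  have psQ: "bundle_sheaf Q" unfolding Q_def by (rule bundle_sheaf_germ_bundle[OF R])
  have fQ: "fibre Q y = Qf y" if "y \<in> C" for y unfolding Q_def using that by (rule fibre_germ_bundle)
  have lin: "linear_on (fibre E y) (p y)" if y: "y \<in> C" for y
    unfolding linear_on_def p_def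
    by (intro conjI ballI allI ext) (auto simp: coords_add[OF b(1)[OF y]] coords_scale[OF b(1)[OF y]] fscale_def[where f = "\<lambda>j. if j < n - m then _ j else 0"])
  have img: "p y ` fibre E y = fibre Q y" if y: "y \<in> C" for y
  proof
    show "p y ` fibre E y \<subseteq> fibre Q y" unfolding fQ[OF y] by (auto simp: p_def Qf_def)
    show "fibre Q y \<subseteq> p y ` fibre E y"
    proof
      fix v assume "v \<in> fibre Q y"
      then have v: "\<forall>j\<ge>n - m. v j = 0" unfolding fQ[OF y] Qf_def by blast
      let ?u = "lcomb n (\<lambda>i. if i < m then 0 else v (i - m)) (b y)"
      have "p y ?u = v"
        unfolding p_def using v by (auto simp: coords_lcomb[OF b(1)[OF y]])
      then show "v \<in> p y ` fibre E y" using imageI[OF fbasis_mem[OF b(1)[OF y]], of "p y"] by metis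
    qed
  qed
  have ker: "fibre F y = {v \<in> fibre E y. p y v = 0}" if y: "y \<in> C" for y
  proof (intro equalityI subsetI)
    fix v assume v: "v \<in> fibre F y"
    then have vE: "v \<in> fibre E y" using sub unfolding subbundle_def by blast
    have veq: "lcomb n (\<lambda>i. if i < m then coords m (b y) v i else 0) (b y) = v"
      using fbasis_coords[OF b(2)[OF y] v] lcomb_lower[OF mn, of "coords m (b y) v" "b y"] by simp
    have "coords n (b y) v i = (if i < m then coords m (b y) v i else 0)" if "i < n" for i
      using coords_lcomb[OF b(1)[OF y] that, of "\<lambda>i. if i < m then coords m (b y) v i else 0"] unfolding veq .
    then have "p y v = 0" by (auto simp: p_def fun_eq_iff)
    then show "v \<in> {v \<in> fibre E y. p y v = 0}" using vE by blast
  next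
    fix v assume "v \<in> {v \<in> fibre E y. p y v = 0}"
    then have v: "v \<in> fibre E y" "p y v = 0" by auto
    have z: "coords n (b y) v i = 0" if "i < n" "\<not> i < m" for i
    proof -
      have "i - m < n - m" "m + (i - m) = i" using that by auto
      then show ?thesis using fun_cong[OF v(2), of "i - m"] by (simp add: p_def)
    qed
    have "v = lcomb n (coords n (b y) v) (b y)" using fbasis_coords[OF b(1)[OF y] v(1)] by simp
    also have "\<dots> = lcomb n (\<lambda>i. if i < m then coords n (b y) v i else 0) (b y)" using z by (intro lcomb_cong) auto
    also have "\<dots> = lcomb m (coords n (b y) v) (b y)" by (rule lcomb_lower[OF mn, symmetric])
    finally show "v \<in> fibre F y" using fbasis_mem[OF b(2)[OF y]] by metis
  qed
  have X: "quot F E Q p"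
    unfolding quot_def
  proof (intro conjI ballI allI impI)
    show "module_sheaf E" by (rule sm)
    show "linear_on (fibre E y) (p y)" "p y ` fibre E y = fibre Q y" "fibre F y = {v \<in> fibre E y. p y v = 0}" if "y \<in> C" for y
      using lin img ker that by blast+
    show "reg_section Q y (\<lambda>z. p z (s z))" if "reg_section E y s" for y s
      unfolding rQ by (rule RI[OF that]) (simp add: near_def)
    show "\<exists>s. reg_section E y s \<and> near y (\<lambda>z. q z = p z (s z))" if "reg_section Q y q" for y q using that unfolding rQ R_def .
    show "reg_section F y s \<longleftrightarrow> reg_section E y s \<and> near y (\<lambda>z. s z \<in> fibre F z)" for y s
      by (rule subbundle_reg_section[OF ps(2,1) sub])
  qed
  have "vector_bundle N C (n - m) Q"
    unfolding vector_bundle_iff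
  proof (intro conjI ballI psQ)
    fix x assume x: "x \<in> C"
    obtain g where g: "local_frame E n x g" "local_frame F m x g" using ad[OF x] by blast
    define q where "q j z = p z (g (m + j) z)" for j z
    have good: "near x (\<lambda>z. z \<in> C \<and> frame_at E n z g \<and> frame_at F m z g)"
      using near_conj[OF near_inC[OF x] near_conj[OF g[unfolded local_frame_def]]] .
    have split: "p z (lcomb n c (\<lambda>i. g i z)) = lcomb (n - m) (\<lambda>j. c (m + j)) (\<lambda>j. q j z)"
      if "z \<in> C \<and> frame_at E n z g \<and> frame_at F m z g" for z c
      unfolding q_def using that
      by (intro linear_on_split[OF lin _ _ mn ker, where g = "\<lambda>i. g i z"]) (auto intro: frame_at_fbasis)
    have "local_frame Q (n - m) x q"
      unfolding local_frame_def
    proof (rule near_mono[OF near_near[OF good]])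
      fix y assume n: "near y (\<lambda>z. z \<in> C \<and> frame_at E n z g \<and> frame_at F m z g)"
      then have y: "y \<in> C" "frame_at E n y g" "frame_at F m y g" by (auto simp: near_def)
      have "fbasis (n - m) (\<lambda>j. q j y) (fibre Q y)"
        unfolding q_def by (rule fbasis_quotient[OF lin[OF y(1)] frame_at_fbasis[OF y(2)] frame_at_fbasis[OF y(3)] mn ker[OF y(1)] img[OF y(1)]])
      moreover have "reg_section Q y s \<longleftrightarrow> (\<exists>h. (\<forall>i<n - m. reg y (h i)) \<and> near y (\<lambda>z. s z = lcomb (n - m) (\<lambda>i. h i z) (\<lambda>i. q i z)))" for s
      proof
        assume "reg_section Q y s"
        then obtain s' where s': "reg_section E y s'" "near y (\<lambda>z. s z = p z (s' z))" using quotD(6)[OF X] by blast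
        obtain h where h: "\<And>i. i < n \<Longrightarrow> reg y (h i)" "near y (\<lambda>z. s' z = lcomb n (\<lambda>i. h i z) (\<lambda>i. g i z))"
          using frame_at_reg_sectionE[OF y(2) s'(1)] by blast
        have "near y (\<lambda>z. s z = lcomb (n - m) (\<lambda>j. h (m + j) z) (\<lambda>j. q j z))"
        proof (rule near_mono[OF near_conj[OF n near_conj[OF s'(2) h(2)]]])
          fix z assume z: "(z \<in> C \<and> frame_at E n z g \<and> frame_at F m z g) \<and> s z = p z (s' z) \<and> s' z = lcomb n (\<lambda>i. h i z) (\<lambda>i. g i z)"
          then have "s z = p z (lcomb n (\<lambda>i. h i z) (\<lambda>i. g i z))" by simp
          then show "s z = lcomb (n - m) (\<lambda>j. h (m + j) z) (\<lambda>j. q j z)" unfolding split[OF conjunct1[OF z]] .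
        qed
        then show "\<exists>h. (\<forall>i<n - m. reg y (h i)) \<and> near y (\<lambda>z. s z = lcomb (n - m) (\<lambda>i. h i z) (\<lambda>i. q i z))"
          using h(1) by (intro exI[of _ "\<lambda>j. h (m + j)"]) auto
      next
        assume "\<exists>h. (\<forall>i<n - m. reg y (h i)) \<and> near y (\<lambda>z. s z = lcomb (n - m) (\<lambda>i. h i z) (\<lambda>i. q i z))"
        then obtain h where h: "\<And>i. i < n - m \<Longrightarrow> reg y (h i)" "near y (\<lambda>z. s z = lcomb (n - m) (\<lambda>i. h i z) (\<lambda>i. q i z))" by blast
        let ?s = "\<lambda>z. lcomb (n - m) (\<lambda>i. h i z) (\<lambda>i. g (m + i) z)"
        have s: "reg_section E y ?s" using h(1) frame_at_reg_section_frame[OF y(2,1)] by (intro module_sheaf_lcomb[OF sm y(1)]) auto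
        have "near y (\<lambda>z. s z = p z (?s z))"
        proof (rule near_mono[OF near_conj[OF n h(2)]])
          fix z assume z: "(z \<in> C \<and> frame_at E n z g \<and> frame_at F m z g) \<and> s z = lcomb (n - m) (\<lambda>i. h i z) (\<lambda>i. q i z)"
          have "p z (?s z) = lcomb (n - m) (\<lambda>i. h i z) (\<lambda>i. q i z)"
            unfolding lcomb_upper[OF mn, where e = "\<lambda>i. g i z"] split[OF conjunct1[OF z]] by (rule lcomb_cong) auto
          then show "s z = p z (?s z)" using z by simp
        qed
        then show "reg_section Q y s" unfolding rQ using RI[OF s] by blast
      qed
      ultimately show "frame_at Q (n - m) y q" unfolding frame_at_def by blast
    qed
    then show "\<exists>e. local_frame Q (n - m) x e" by blast
  qed
  then show thesis using that X by blast
qed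

text \<open>The preimage is an extension of \<open>G\<close> by \<open>F\<close>, with the germs of
  \<open>E\<close> that take values in it. Exactness alone supplies its frames and its rank.\<close>

theorem preimage_bundle:
  assumes X: "quot F E Q p" and Q: "bundle_sheaf Q" and G: "vector_bundle N C l G" and sub: "subbundle G Q"
    and F: "vector_bundle N C m F"
  obtains F' where "quot F F' G p" "subbundle F' E" "vector_bundle N C (m + l) F'"
proof -
  note E = quotD(1)[OF X]
  note ps = module_sheafD(1)[OF E]
  have psG: "bundle_sheaf G" and smG: "module_sheaf G" using G vector_bundle_module_sheaf by (auto simp: vector_bundle_iff)
  note rG = subbundle_reg_section[OF psG Q sub]
  define Fb where "Fb y = {v \<in> fibre E y. p y v \<in> fibre G y}" for y
  define R where "R y s \<longleftrightarrow> reg_section E y s \<and> near y (\<lambda>z. s z \<in> Fb z)" for y s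
  define F' where "F' = germ_bundle Fb R"
  have R: "germs Fb R"
    unfolding germs_def
  proof (intro conjI allI impI)
    fix y s assume r: "R y s"
    show "y \<in> C" using r reg_section_C unfolding R_def by blast
    show "s y \<in> Fb y" using r unfolding R_def near_def by blast
    show "near y (\<lambda>z. R z s)" unfolding R_def using r[unfolded R_def] by (intro near_conj reg_section_near near_near) auto
  next
    fix y s s' assume r: "R y s" and n: "near y (\<lambda>z. s z = s' z)"
    have "reg_section E y s'" using r n reg_section_cong[OF ps] unfolding R_def by blast
    moreover have "near y (\<lambda>z. s' z \<in> Fb z)"
      by (rule near_mono[OF near_conj[OF conjunct2[OF r[unfolded R_def]] n]]) metis
    ultimately show "R y s'" unfolding R_def by blast
  qed
  note rF' = reg_section_germ_bundle[OF R, folded F'_def]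
  have psF': "bundle_sheaf F'" unfolding F'_def by (rule bundle_sheaf_germ_bundle[OF R])
  have fF': "fibre F' y = Fb y" if "y \<in> C" for y unfolding F'_def using that by (rule fibre_germ_bundle)
  have subFb: "fn.subspace (Fb y)" if y: "y \<in> C" for y
  proof (rule fn.subspaceI)
    note l = quotD(2)[OF X y, unfolded linear_on_def] and sE = module_sheafD(2)[OF E y] and sG = module_sheafD(2)[OF smG y]
    have "p y (fscale 0 0) = fscale 0 (p y 0)" using l fn.subspace_0[OF sE] by blast
    then have "p y 0 = 0" by simp
    then show "0 \<in> Fb y" unfolding Fb_def using fn.subspace_0[OF sE] fn.subspace_0[OF sG] by simp
    show "v + w \<in> Fb y" if "v \<in> Fb y" "w \<in> Fb y" for v w
      using that l fn.subspace_add[OF sE] fn.subspace_add[OF sG] unfolding Fb_def by simp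
    show "fscale a v \<in> Fb y" if "v \<in> Fb y" for a v
      using that l fn.subspace_scale[OF sE] fn.subspace_scale[OF sG] unfolding Fb_def by simp
  qed
  have nC: "near y (\<lambda>z. z \<in> C)" if "reg_section E y s" for y s using near_inC reg_section_C that by blast
  have smF': "module_sheaf F'"
    unfolding module_sheaf_def
  proof (intro conjI ballI allI impI psF')
    show "fn.subspace (fibre F' x)" if "x \<in> C" for x using subFb fF' that by simp
    show "reg_section F' x (\<lambda>_. 0)" if "x \<in> C" for x
    proof -
      have "near x (\<lambda>z. 0 \<in> Fb z)" by (rule near_mono[OF near_inC[OF that]]) (rule fn.subspace_0[OF subFb])
      then show ?thesis unfolding rF' R_def using module_sheafD(3)[OF E that] by blast
    qed
    fix x s s' assume ss: "reg_section F' x s" "reg_section F' x s'"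
    then have *: "reg_section E x s" "near x (\<lambda>z. s z \<in> Fb z)" "reg_section E x s'" "near x (\<lambda>z. s' z \<in> Fb z)" unfolding rF' R_def by blast+
    have "near x (\<lambda>z. s z + s' z \<in> Fb z)"
      by (rule near_mono[OF near_conj[OF nC[OF *(1)] near_conj[OF *(2,4)]]]) (use fn.subspace_add[OF subFb] in blast)
    then show "reg_section F' x (\<lambda>z. s z + s' z)" unfolding rF' R_def using module_sheafD(4)[OF E *(1,3)] by blast
  next
    fix x g s assume g: "reg x g" and "reg_section F' x s"
    then have *: "reg_section E x s" "near x (\<lambda>z. s z \<in> Fb z)" unfolding rF' R_def by blast+
    have "near x (\<lambda>z. fscale (g z) (s z) \<in> Fb z)"
      by (rule near_mono[OF near_conj[OF nC[OF *(1)] *(2)]]) (use fn.subspace_scale[OF subFb] in blast)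
    then show "reg_section F' x (\<lambda>z. fscale (g z) (s z))" unfolding rF' R_def using module_sheafD(5)[OF E g *(1)] by blast
  qed
  have X': "quot F F' G p"
    unfolding quot_def
  proof (intro conjI ballI allI impI smF')
    fix y assume y: "y \<in> C"
    show "linear_on (fibre F' y) (p y)" using quotD(2)[OF X y] unfolding linear_on_def fF'[OF y] Fb_def by blast
    have GQ: "fibre G y \<subseteq> fibre Q y" using sub unfolding subbundle_def by blast
    have gen: "p y ` {v \<in> A. p y v \<in> B} = B" if "B \<subseteq> D" "p y ` A = D" for A B D using that by blast
    show "p y ` fibre F' y = fibre G y" unfolding fF'[OF y] Fb_def by (rule gen[OF GQ quotD(3)[OF X y]])
    have "0 \<in> fibre G y" using fn.subspace_0[OF module_sheafD(2)[OF smG y]] .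
    then show "fibre F y = {v \<in> fibre F' y. p y v = 0}" using quotD(4)[OF X y] unfolding fF'[OF y] Fb_def by auto
  next
    fix y s assume "reg_section F' y s"
    then have *: "reg_section E y s" "near y (\<lambda>z. s z \<in> Fb z)" unfolding rF' R_def by blast+
    have "near y (\<lambda>z. p z (s z) \<in> fibre G z)" by (rule near_mono[OF *(2)]) (simp add: Fb_def)
    then show "reg_section G y (\<lambda>z. p z (s z))" unfolding rG using quotD(5)[OF X *(1)] by blast
  next
    fix y q assume "reg_section G y q"
    then have *: "reg_section Q y q" "near y (\<lambda>z. q z \<in> fibre G z)" unfolding rG by blast+
    obtain s where s: "reg_section E y s" "near y (\<lambda>z. q z = p z (s z))" using quotD(6)[OF X *(1)] by blast
    have "near y (\<lambda>z. s z \<in> Fb z)"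
      by (rule near_mono[OF near_conj[OF reg_section_near[OF s(1)] near_conj[OF *(2) s(2)]]]) (auto simp: Fb_def reg_section_fibre[OF ps])
    then show "\<exists>s. reg_section F' y s \<and> near y (\<lambda>z. q z = p z (s z))" unfolding rF' R_def using s by blast
  next
    fix y s
    have "near y (\<lambda>z. s z \<in> Fb z)" if "reg_section E y s" "near y (\<lambda>z. s z \<in> fibre F z)"
    proof (rule near_mono[OF near_conj[OF nC[OF that(1)] that(2)]])
      fix z assume z: "z \<in> C \<and> s z \<in> fibre F z"
      then have "0 \<in> fibre G z" using fn.subspace_0[OF module_sheafD(2)[OF smG]] by blast
      then show "s z \<in> Fb z" using z quotD(4)[OF X, of z] unfolding Fb_def by auto
    qed
    then show "reg_section F y s \<longleftrightarrow> reg_section F' y s \<and> near y (\<lambda>z. s z \<in> fibre F z)"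
      unfolding rF' R_def quotD(7)[OF X] by blast
  qed
  moreover have "subbundle F' E"
    unfolding subbundle_def
  proof (intro conjI allI)
    show "fibre F' x \<subseteq> fibre E x" for x by (cases "x \<in> C") (auto simp: fF' Fb_def bundle_sheafD(1)[OF psF'])
    fix U show "sections F' U = {s \<in> sections E U. \<forall>x\<in>U. s x \<in> fibre F' x}"
    proof (cases "openin (zariski N C) U")
      case U: True
      have "s \<in> sections F' U \<longleftrightarrow> s \<in> sections E U \<and> (\<forall>x\<in>U. s x \<in> fibre F' x)" for s
      proof
        assume "s \<in> sections F' U"
        then have s: "\<forall>x. x \<notin> U \<longrightarrow> s x = 0" "\<forall>x\<in>U. reg_section F' x s" using sections_iff[OF psF' U] by blast+
        then show "s \<in> sections E U \<and> (\<forall>x\<in>U. s x \<in> fibre F' x)"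
          unfolding sections_iff[OF ps U] using reg_section_fibre[OF psF'] rF' R_def by blast
      next
        assume s: "s \<in> sections E U \<and> (\<forall>x\<in>U. s x \<in> fibre F' x)"
        have "reg_section F' x s" if x: "x \<in> U" for x
        proof -
          have "near x (\<lambda>z. s z \<in> Fb z)"
            by (rule near_mono[OF open_near[OF U x]]) (use s fF' openin_sub_C[OF U] in auto)
          then show ?thesis unfolding rF' R_def using s sections_iff[OF ps U] x by blast
        qed
        then show "s \<in> sections F' U" unfolding sections_iff[OF psF' U] using s sections_iff[OF ps U] by blast
      qed
      then show ?thesis by blast
    next
      case False
      then show ?thesis using bundle_sheafD(2)[OF ps] bundle_sheafD(2)[OF psF'] by blast
    qed
  qed
  moreover have "vector_bundle N C (m + l) F'" using vector_bundle_exact[OF X' F G] .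
  ultimately show thesis using that by blast
qed

end

section \<open>Line subbundles generated by sections\<close>

lemma lcomb_1: "lcomb 1 c e = fscale (c 0) (e 0)"
  by (simp add: lcomb_def)

lemma fbasis_1: "v \<noteq> 0 \<Longrightarrow> fbasis 1 (\<lambda>_. v) S \<longleftrightarrow> (\<forall>w. w \<in> S \<longleftrightarrow> (\<exists>c. w = fscale c v))"
  unfolding fbasis_def lcomb_1 by (auto simp: fn.scale_eq_0_iff)

lemma fbasis_zero: "fbasis n e S \<Longrightarrow> lcomb n c e = 0 \<Longrightarrow> i < n \<Longrightarrow> c i = 0"
  by (simp add: fbasis_def)

context curve
begin

lemma near_eq: "reg x f \<Longrightarrow> reg x g \<Longrightarrow> eventually (\<lambda>y. f y = g y) cof \<Longrightarrow> near x (\<lambda>y. f y = g y)"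
  using reg_eventually_eq by (simp add: near_def)

lemma vanishes_to_le: "vanishes_to x n h \<Longrightarrow> m \<le> n \<Longrightarrow> vanishes_to x m h"
proof -
  assume "vanishes_to x n h" and mn: "m \<le> n"
  then obtain u where u: "reg x u" "eventually (\<lambda>y. h y = uniformizer x y ^ n * u y) cof" unfolding vanishes_to_def by blast
  have "eventually (\<lambda>y. h y = uniformizer x y ^ m * (uniformizer x y ^ (n - m) * u y)) cof"
    using u(2) by eventually_elim (simp add: mn flip: mult.assoc power_add)
  moreover have "reg x (\<lambda>y. uniformizer x y ^ (n - m) * u y)" using u(1) reg_C by (intro reg_mult reg_power reg_uniformizer) auto
  ultimately show ?thesis unfolding vanishes_to_def by blast
qed

lemma near_lcomb_nonzero:
  assumes e: "local_frame E n x e" and u: "\<And>i. i < n \<Longrightarrow> reg x (u i)" and i: "i < n" "u i x \<noteq> 0"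
    and s: "near x (\<lambda>z. s z = lcomb n (\<lambda>i. u i z) (\<lambda>i. e i z))"
  shows "near x (\<lambda>z. s z \<noteq> 0)"
proof -
  have ui: "near x (\<lambda>z. u i z \<noteq> 0)" using reg_eventually_nonzero[OF u[OF i(1)] i(2)] i(2) by (simp add: near_def)
  show ?thesis
  proof (rule near_mono[OF near_conj[OF e[unfolded local_frame_def] near_conj[OF ui s]]])
    fix z assume z: "frame_at E n z e \<and> u i z \<noteq> 0 \<and> s z = lcomb n (\<lambda>i. u i z) (\<lambda>i. e i z)"
    show "s z \<noteq> 0"
    proof
      assume "s z = 0"
      then have "u i z = 0" using z fbasis_zero[OF frame_at_fbasis[of E n z e], of "\<lambda>i. u i z" i] i(1) by simp
      then show False using z by blast
    qed
  qed
qed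

lemma reg_section_nonzero_coeff:
  assumes "bundle_sheaf E" "local_frame E n x e" "reg_section E x s" "s x \<noteq> 0"
  obtains u i where "\<And>i. i < n \<Longrightarrow> reg x (u i)" "near x (\<lambda>z. s z = lcomb n (\<lambda>i. u i z) (\<lambda>i. e i z))" "i < n" "u i x \<noteq> 0"
proof -
  obtain u where u: "\<And>i. i < n \<Longrightarrow> reg x (u i)" "near x (\<lambda>z. s z = lcomb n (\<lambda>i. u i z) (\<lambda>i. e i z))"
    using frame_at_reg_sectionE[OF local_frame_frame_at[OF assms(2)] assms(3)] by blast
  have "\<exists>i<n. u i x \<noteq> 0"
  proof (rule ccontr)
    assume "\<not> ?thesis"
    then have "lcomb n (\<lambda>i. u i x) (\<lambda>i. e i x) = lcomb n (\<lambda>_. 0) (\<lambda>i. e i x)" by (intro lcomb_cong) auto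
    then show False using u(2) assms(4) by (simp add: near_def lcomb_zero)
  qed
  then show thesis using that u by blast
qed

text \<open>A coefficient of \<open>s'\<close> that is nonzero at \<open>y\<close> serves as
  denominator: the quotient of the coefficients of \<open>t\<close> and \<open>s'\<close> at that
  place is regular at \<open>y\<close> and is generically the factor of proportionality.\<close>

lemma proportional_sections:
  assumes E: "vector_bundle N C n E" and s': "reg_section E y s'" "s' y \<noteq> 0" "eventually (\<lambda>z. \<exists>c. s' z = fscale c (s z)) cof"
    and t: "reg_section E y t" "eventually (\<lambda>z. \<exists>c. t z = fscale c (s z)) cof"
  obtains k where "reg y k" "near y (\<lambda>z. t z = fscale (k z) (s' z))"
proof -
  have y: "y \<in> C" using s'(1) reg_section_C by blast
  have ps: "bundle_sheaf E" using E by (simp add: vector_bundle_iff)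
  obtain e where e: "local_frame E n y e" using E y by (auto simp: vector_bundle_iff)
  obtain u i where u: "\<And>i. i < n \<Longrightarrow> reg y (u i)" "near y (\<lambda>z. s' z = lcomb n (\<lambda>i. u i z) (\<lambda>i. e i z))" and i: "i < n" "u i y \<noteq> 0"
    by (rule reg_section_nonzero_coeff[OF ps e s'(1,2)]) (rule that)
  obtain g where g: "\<And>i. i < n \<Longrightarrow> reg y (g i)" "near y (\<lambda>z. t z = lcomb n (\<lambda>i. g i z) (\<lambda>i. e i z))"
    using frame_at_reg_sectionE[OF local_frame_frame_at[OF e] t(1)] by blast
  define k where "k = (\<lambda>z. g i z / u i z)"
  have k: "reg y k" unfolding k_def using g(1) u(1) i by (intro reg_divide) auto
  have nz: "near y (\<lambda>z. s' z \<noteq> 0)" by (rule near_lcomb_nonzero[OF e _ i u(2)]) (rule u(1))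
  have ev: "eventually (\<lambda>z. \<forall>j\<in>{..<n}. g j z = k z * u j z) cof"
    using s'(3) t(2) u(2)[unfolded near_def, THEN conjunct2] g(2)[unfolded near_def, THEN conjunct2]
      e[unfolded local_frame_def near_def, THEN conjunct2] reg_eventually_nonzero[OF u(1)[OF i(1)] i(2)]
      nz[unfolded near_def, THEN conjunct2]
  proof eventually_elim
    case (elim z)
    obtain c c' where c: "s' z = fscale c (s z)" "t z = fscale c' (s z)" using elim(1,2) by blast
    have "c \<noteq> 0" using c(1) elim(7) by auto
    then have "t z = fscale (c' / c) (s' z)" using c by simp
    then have "lcomb n (\<lambda>i. g i z) (\<lambda>i. e i z) = fscale (c' / c) (lcomb n (\<lambda>j. u j z) (\<lambda>i. e i z))"
      using elim(3,4) by (simp only:)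
    also have "\<dots> = lcomb n (\<lambda>j. c' / c * u j z) (\<lambda>i. e i z)" by (rule lcomb_scale[symmetric])
    finally have "lcomb n (\<lambda>i. g i z) (\<lambda>i. e i z) = lcomb n (\<lambda>j. c' / c * u j z) (\<lambda>i. e i z)" .
    then have *: "g j z = c' / c * u j z" if "j < n" for j using fbasis_unique[OF frame_at_fbasis[OF elim(5)]] that by blast
    then have "k z = c' / c" using i elim(6) by (simp add: k_def)
    then show ?case using * by simp
  qed
  have "near y (\<lambda>z. \<forall>j\<in>{..<n}. g j z = k z * u j z)"
  proof (rule near_ball)
    fix j assume j: "j \<in> {..<n}"
    have "eventually (\<lambda>z. g j z = k z * u j z) cof" using ev by eventually_elim (use j in blast)
    then show "near y (\<lambda>z. g j z = k z * u j z)" using g(1) u(1) k j by (intro near_eq reg_mult) auto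
  qed simp
  then have "near y (\<lambda>z. t z = fscale (k z) (s' z))"
    by (rule near_mono[OF near_conj[OF _ near_conj[OF u(2) g(2)]]])
       (auto simp: lcomb_scale[symmetric] intro!: lcomb_cong)
  then show thesis using that k by blast
qed

lemma section_eventually_nonzero:
  assumes E: "vector_bundle N C n E" and s: "\<And>x. x \<in> C \<Longrightarrow> reg_section E x s" and y: "y \<in> C" "s y \<noteq> 0"
  shows "eventually (\<lambda>z. s z \<noteq> 0) cof"
proof -
  have ps: "bundle_sheaf E" using E by (simp add: vector_bundle_iff)
  obtain e where e: "local_frame E n y e" using E y by (auto simp: vector_bundle_iff)
  obtain u i where u: "\<And>i. i < n \<Longrightarrow> reg y (u i)" "near y (\<lambda>z. s z = lcomb n (\<lambda>i. u i z) (\<lambda>i. e i z))" and i: "i < n" "u i y \<noteq> 0"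
    by (rule reg_section_nonzero_coeff[OF ps e s[OF y(1)] y(2)]) (rule that)
  have "near y (\<lambda>z. s z \<noteq> 0)" by (rule near_lcomb_nonzero[OF e _ i u(2)]) (rule u(1))
  then show ?thesis by (simp add: near_def)
qed

text \<open>The coefficients of \<open>s\<close> in a frame are divided by the highest power of the
  uniformizer that divides all of them. At least one quotient is then nonzero at \<open>x\<close>,
  and the exponent is positive if \<open>s\<close> vanishes there.\<close>

lemma section_local_generator:
  assumes E: "vector_bundle N C n E" and s: "reg_section E x s" "eventually (\<lambda>z. s z \<noteq> 0) cof"
  obtains m s' where "reg_section E x s'" "s' x \<noteq> 0" "near x (\<lambda>z. s z = fscale (uniformizer x z ^ m) (s' z))" "s x = 0 \<Longrightarrow> m > 0"
    "near x (\<lambda>z. s' z \<noteq> 0)"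
proof -
  have x: "x \<in> C" using s(1) reg_section_C by blast
  obtain e where e: "local_frame E n x e" using E x by (auto simp: vector_bundle_iff)
  obtain h where h: "\<And>i. i < n \<Longrightarrow> reg x (h i)" "near x (\<lambda>z. s z = lcomb n (\<lambda>i. h i z) (\<lambda>i. e i z))"
    using frame_at_reg_sectionE[OF local_frame_frame_at[OF e] s(1)] by blast
  have "\<exists>i<n. eventually (\<lambda>z. h i z \<noteq> 0) cof"
  proof (rule ccontr)
    assume "\<not> ?thesis"
    then have "\<forall>i\<in>{..<n}. eventually (\<lambda>z. h i z = 0) cof" using reg_zero_or_nonzero h(1) by blast
    then have "eventually (\<lambda>z. \<forall>i\<in>{..<n}. h i z = 0) cof" by (simp add: eventually_ball_finite)
    then have "eventually (\<lambda>_. False) cof" using h(2)[unfolded near_def, THEN conjunct2] s(2)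
    proof eventually_elim
      case (elim z)
      then have "s z = lcomb n (\<lambda>_. 0) (\<lambda>i. e i z)" by (auto intro!: lcomb_cong)
      then show ?case using elim(3) by (simp add: lcomb_zero)
    qed
    then show False using cof_neq_bot by (simp add: trivial_limit_def)
  qed
  then obtain i0 where i0: "i0 < n" "eventually (\<lambda>z. h i0 z \<noteq> 0) cof" by blast
  obtain k w where w: "reg x w" "w x \<noteq> 0" "near x (\<lambda>y. h i0 y = uniformizer x y ^ k * w y)"
    using unit_factorization[OF h(1)[OF i0(1)] i0(2)] by blast
  have nov: "\<not> vanishes_to x (Suc k) (h i0)" using vanishes_to_Suc[OF w(1), of "h i0" k] w(2,3) by (simp add: near_def)
  \<comment> \<open>Bounded by the order \<open>k\<close> of a coefficient that is generically
    nonzero; it contains 0 because all coefficients are regular.\<close>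
  define M where "M = {k. \<forall>i<n. vanishes_to x k (h i)}"
  have "M \<subseteq> {..k}"
  proof
    fix j assume "j \<in> M"
    then have "vanishes_to x j (h i0)" using i0 by (simp add: M_def)
    then have "\<not> Suc k \<le> j" using nov vanishes_to_le by blast
    then show "j \<in> {..k}" by simp
  qed
  then have fM: "finite M" using finite_subset by blast
  have "0 \<in> M" unfolding M_def using h(1) vanishes_to_reg by simp
  define m where "m = Max M"
  have "m \<in> M" unfolding m_def using fM \<open>0 \<in> M\<close> by (intro Max_in) auto
  have "Suc m \<notin> M" unfolding m_def using Max_ge[OF fM, of "Suc (Max M)"] by auto
  have "\<forall>i. \<exists>u. i < n \<longrightarrow> reg x u \<and> eventually (\<lambda>y. h i y = uniformizer x y ^ m * u y) cof"
    using \<open>m \<in> M\<close> unfolding M_def vanishes_to_def by blast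
  from choice[OF this] obtain u where u: "\<And>i. i < n \<Longrightarrow> reg x (u i)" "\<And>i. i < n \<Longrightarrow> eventually (\<lambda>y. h i y = uniformizer x y ^ m * u i y) cof" by blast
  have "\<exists>i<n. u i x \<noteq> 0" using \<open>Suc m \<notin> M\<close> vanishes_to_Suc u unfolding M_def by blast
  then obtain i where i: "i < n" "u i x \<noteq> 0" by blast
  define s' where "s' = (\<lambda>z. lcomb n (\<lambda>i. u i z) (\<lambda>i. e i z))"
  have s'n: "near x (\<lambda>z. s' z = lcomb n (\<lambda>i. u i z) (\<lambda>i. e i z))" by (simp add: s'_def near_def)
  have r: "reg_section E x s'" using frame_at_reg_sectionI[OF local_frame_frame_at[OF e] u(1) s'n] .
  have nz: "near x (\<lambda>z. s' z \<noteq> 0)" by (rule near_lcomb_nonzero[OF e _ i s'n]) (rule u(1))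
  have "near x (\<lambda>z. \<forall>i\<in>{..<n}. h i z = uniformizer x z ^ m * u i z)"
    using h(1) u x by (intro near_ball near_eq reg_mult reg_power reg_uniformizer) auto
  then have eq: "near x (\<lambda>z. s z = fscale (uniformizer x z ^ m) (s' z))"
    by (rule near_mono[OF near_conj[OF _ h(2)]]) (auto simp: s'_def lcomb_scale[symmetric] intro!: lcomb_cong)
  have "m > 0" if "s x = 0"
  proof (rule ccontr)
    assume "\<not> m > 0"
    then have "s x = s' x" using eq by (simp add: near_def)
    then show False using that nz by (simp add: near_def)
  qed
  moreover have "s' x \<noteq> 0" using nz by (simp add: near_def)
  ultimately show thesis using that r nz eq by blast
qed

text \<open>The germs of \<open>L\<close> are the regular sections of \<open>E\<close> which are generically proportional to \<open>s\<close>.\<close>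

theorem line_subbundle:
  assumes E: "vector_bundle N C n E" and s: "s \<in> H0 C E" "s \<noteq> 0"
  obtains L where "vector_bundle N C 1 L" "subbundle L E"
    "\<And>Z. finite Z \<Longrightarrow> Z \<subseteq> C \<Longrightarrow> (\<And>x. x \<in> Z \<Longrightarrow> s x = 0) \<Longrightarrow> int (card Z) \<le> degree_bundle N C 1 L"
proof -
  have ps: "bundle_sheaf E" using E by (simp add: vector_bundle_iff)
  have sm: "module_sheaf E" using vector_bundle_module_sheaf[OF E] .
  have openC: "openin (zariski N C) C" by (simp add: openin_zariski)
  have rs: "reg_section E x s" if "x \<in> C" for x using s(1) that unfolding sections_iff[OF ps openC] by blast
  have "\<exists>y\<in>C. s y \<noteq> 0"
  proof (rule ccontr)
    assume "\<not> ?thesis"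
    then have "s x = 0" for x using s(1) unfolding sections_iff[OF ps openC] by blast
    then show False using s(2) by (simp add: fun_eq_iff)
  qed
  then have snz: "eventually (\<lambda>z. s z \<noteq> 0) cof" using section_eventually_nonzero[OF E rs] by blast
  define R where "R y t \<longleftrightarrow> reg_section E y t \<and> eventually (\<lambda>z. \<exists>c. t z = fscale c (s z)) cof" for y t
  \<comment> \<open>The fibre is the set of values of germs in \<open>R\<close> and not the line
    spanned by \<open>s y\<close>, which would degenerate at the zeros of \<open>s\<close>.\<close>
  define Lf where "Lf y = {v. \<exists>t. R y t \<and> t y = v}" for y
  define L where "L = germ_bundle Lf R"
  have R: "germs Lf R"
    unfolding germs_def
  proof (intro conjI allI impI)
    fix y t assume r: "R y t"
    show "y \<in> C" using r reg_section_C unfolding R_def by blast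
    show "t y \<in> Lf y" using r unfolding Lf_def by blast
    show "near y (\<lambda>z. R z t)"
      by (rule near_mono[OF reg_section_near[OF conjunct1[OF r[unfolded R_def]]]]) (use r in \<open>simp add: R_def\<close>)
  next
    fix y t t' assume r: "R y t" and n: "near y (\<lambda>z. t z = t' z)"
    have "eventually (\<lambda>z. \<exists>c. t' z = fscale c (s z)) cof"
      using r[unfolded R_def, THEN conjunct2] n[unfolded near_def, THEN conjunct2] by eventually_elim metis
    then show "R y t'" unfolding R_def using reg_section_cong[OF ps _ n] r unfolding R_def by blast
  qed
  note rL = reg_section_germ_bundle[OF R, folded L_def]
  have psL: "bundle_sheaf L" unfolding L_def by (rule bundle_sheaf_germ_bundle[OF R])
  have fL: "fibre L y = Lf y" if "y \<in> C" for y unfolding L_def using that by (rule fibre_germ_bundle)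
  have pfrL: "frame_at L 1 y (\<lambda>_. s')" if s': "R y s'" "s' y \<noteq> 0" for y s'
  proof -
    have y: "y \<in> C" using germsD(1)[OF R s'(1)] .
    note s'' = s'(1)[unfolded R_def]
    have K: "\<exists>k. reg y k \<and> near y (\<lambda>z. t z = fscale (k z) (s' z))" if "R y t" for t
    proof -
      have t: "reg_section E y t" "eventually (\<lambda>z. \<exists>c. t z = fscale c (s z)) cof" using that unfolding R_def by blast+
      obtain k where "reg y k" "near y (\<lambda>z. t z = fscale (k z) (s' z))"
        by (rule proportional_sections[OF E conjunct1[OF s''] s'(2) conjunct2[OF s''] t])
      then show ?thesis by blast
    qed
    have K': "R y t" if k: "reg y k" "near y (\<lambda>z. t z = fscale (k z) (s' z))" for t k
    proof -
      have "reg_section E y (\<lambda>z. fscale (k z) (s' z))" using module_sheafD(5)[OF sm k(1)] s'' by blast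
      then have "reg_section E y t" by (rule reg_section_cong[OF ps]) (rule near_mono[OF k(2)], rule sym)
      moreover have "eventually (\<lambda>z. \<exists>c. t z = fscale c (s z)) cof"
        using k(2)[unfolded near_def, THEN conjunct2] conjunct2[OF s'']
      proof eventually_elim
        case (elim z)
        then obtain c where "s' z = fscale c (s z)" by blast
        then have "t z = fscale (k z * c) (s z)" using elim by simp
        then show ?case by blast
      qed
      ultimately show ?thesis unfolding R_def by blast
    qed
    have "v \<in> Lf y \<longleftrightarrow> (\<exists>c. v = fscale c (s' y))" for v
    proof
      assume "v \<in> Lf y"
      then obtain t where t: "R y t" "t y = v" unfolding Lf_def by blast
      obtain k where "near y (\<lambda>z. t z = fscale (k z) (s' z))" using K[OF t(1)] by blast
      then show "\<exists>c. v = fscale c (s' y)" using t(2) by (auto simp: near_def)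
    next
      assume "\<exists>c. v = fscale c (s' y)"
      then obtain c where c: "v = fscale c (s' y)" by blast
      have "R y (\<lambda>z. fscale c (s' z))" by (rule K'[OF reg_const[OF y, of c]]) (simp add: near_def)
      then show "v \<in> Lf y" unfolding Lf_def c by blast
    qed
    then have "fbasis 1 (\<lambda>_. s' y) (fibre L y)" unfolding fbasis_1[OF s'(2)] fL[OF y] by blast
    moreover have "reg_section L y t \<longleftrightarrow> (\<exists>f. (\<forall>i<1::nat. reg y (f i)) \<and> near y (\<lambda>z. t z = lcomb 1 (\<lambda>i. f i z) (\<lambda>_. s' z)))" for t
      unfolding rL lcomb_1
    proof
      assume "R y t"
      then obtain k where "reg y k" "near y (\<lambda>z. t z = fscale (k z) (s' z))" using K by blast
      then show "\<exists>f. (\<forall>i<1::nat. reg y (f i)) \<and> near y (\<lambda>z. t z = fscale (f 0 z) (s' z))"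
        by (intro exI[of _ "\<lambda>_. k"]) simp
    next
      assume "\<exists>f. (\<forall>i<1::nat. reg y (f i)) \<and> near y (\<lambda>z. t z = fscale (f 0 z) (s' z))"
      then obtain f where "\<forall>i<1::nat. reg y (f i)" "near y (\<lambda>z. t z = fscale (f 0 z) (s' z))" by blast
      then show "R y t" using K'[of "f 0" t] by simp
    qed
    ultimately show ?thesis unfolding frame_at_def by blast
  qed
  have Rs: "R y s" if "y \<in> C" for y
  proof -
    have "\<exists>c. s z = fscale c (s z)" for z by (rule exI[of _ 1]) simp
    then show ?thesis unfolding R_def using rs[OF that] by simp
  qed
  have loc: "\<exists>m s'. R x s' \<and> near x (\<lambda>z. s z = fscale (uniformizer x z ^ m) (s' z)) \<and> (s x = 0 \<longrightarrow> m > 0) \<and> local_frame L 1 x (\<lambda>_. s')"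
    if x: "x \<in> C" for x
  proof -
    obtain m s' where s': "reg_section E x s'" "s' x \<noteq> 0" "near x (\<lambda>z. s z = fscale (uniformizer x z ^ m) (s' z))" "s x = 0 \<Longrightarrow> m > 0"
      "near x (\<lambda>z. s' z \<noteq> 0)" by (rule section_local_generator[OF E rs[OF x] snz]) (rule that)
    have "eventually (\<lambda>z. \<exists>c. s' z = fscale c (s z)) cof"
      using s'(3)[unfolded near_def, THEN conjunct2] reg_uniformizer(3)[OF x]
    proof eventually_elim
      case (elim z)
      then have "s' z = fscale (inverse (uniformizer x z ^ m)) (s z)" by simp
      then show ?case by blast
    qed
    then have r: "R x s'" unfolding R_def using s'(1) by blast
    have "local_frame L 1 x (\<lambda>_. s')"
      unfolding local_frame_def by (rule near_mono[OF near_conj[OF germsD(3)[OF R r] s'(5)]]) (use pfrL in blast)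
    then show ?thesis using r s' by blast
  qed
  have vbL: "vector_bundle N C 1 L" unfolding vector_bundle_iff using psL loc by blast
  have g: "generic_frame L 1 (\<lambda>_. s)" unfolding generic_frame_def using snz eventually_cof_C by eventually_elim (use pfrL Rs in blast)
  have subL: "subbundle L E"
    unfolding subbundle_def
  proof (intro conjI allI)
    show "fibre L x \<subseteq> fibre E x" for x
    proof (cases "x \<in> C")
      case True
      then show ?thesis unfolding fL[OF True] Lf_def R_def using reg_section_fibre[OF ps] by blast
    qed (use bundle_sheafD(1)[OF psL] in simp)
    fix U show "sections L U = {t \<in> sections E U. \<forall>x\<in>U. t x \<in> fibre L x}"
    \<comment> \<open>For nonempty \<open>U\<close> generic proportionality to \<open>s\<close>
      follows from the fibre condition at the points of \<open>U\<close>. Over the empty set there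
      are no such points, and both sides consist of the zero section.\<close>
    proof (cases "openin (zariski N C) U \<and> U \<noteq> {}")
      case U: True
      then have oU: "openin (zariski N C) U" by blast
      have "t \<in> sections L U \<longleftrightarrow> t \<in> sections E U \<and> (\<forall>x\<in>U. t x \<in> fibre L x)" for t
      proof
        assume "t \<in> sections L U"
        then have t: "\<forall>x. x \<notin> U \<longrightarrow> t x = 0" "\<forall>x\<in>U. reg_section L x t" using sections_iff[OF psL oU] by blast+
        then show "t \<in> sections E U \<and> (\<forall>x\<in>U. t x \<in> fibre L x)"
          unfolding sections_iff[OF ps oU] using reg_section_fibre[OF psL] rL R_def by blast
      next
        assume t: "t \<in> sections E U \<and> (\<forall>x\<in>U. t x \<in> fibre L x)"
        obtain u where u: "u \<in> U" using U by blast
        have "eventually (\<lambda>z. \<exists>c. t z = fscale c (s z)) cof"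
          using g[unfolded generic_frame_def] openin_eventually[OF oU u]
        proof eventually_elim
          case (elim z)
          then have "t z = lcomb 1 (coords 1 (\<lambda>_. s z) (t z)) (\<lambda>_. s z)" using fbasis_coords[OF frame_at_fbasis[OF elim(1)]] t by simp
          then show ?case unfolding lcomb_1 by blast
        qed
        then have "\<forall>x\<in>U. reg_section L x t" unfolding rL R_def using t sections_iff[OF ps oU] by blast
        then show "t \<in> sections L U" unfolding sections_iff[OF psL oU] using t sections_iff[OF ps oU] by blast
      qed
      then show ?thesis by blast
    next
      case False
      show ?thesis
      proof (cases "openin (zariski N C) U")
        case True
        then have "U = {}" using False by blast
        then show ?thesis using sections_iff[OF psL True] sections_iff[OF ps True] by auto
      qed (use bundle_sheafD(2)[OF ps] bundle_sheafD(2)[OF psL] in blast)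
    qed
  qed
  \<comment> \<open>The order of \<open>s\<close> as a rational section of \<open>L\<close> is the
    exponent \<open>m\<close> of the uniformizer; it is never negative and at least 1 at every zero.
    The sum of these orders, which is the degree of \<open>L\<close>, is thus at least the number of
    zeros.\<close>
  have dd: "det_ord L 1 (\<lambda>_. s) x \<ge> 0 \<and> (s x = 0 \<longrightarrow> det_ord L 1 (\<lambda>_. s) x \<ge> 1)" if x: "x \<in> C" for x
  proof -
    obtain m s' where s': "R x s'" "near x (\<lambda>z. s z = fscale (uniformizer x z ^ m) (s' z))" "s x = 0 \<longrightarrow> m > 0" "local_frame L 1 x (\<lambda>_. s')"
      using loc[OF x] by blast
    have "has_ord x (\<lambda>z. uniformizer x z ^ m) (int m)"
      by (rule has_ordI[OF x reg_const[OF x, of 1]]) auto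
    moreover have "eventually (\<lambda>z. uniformizer x z ^ m = transition_det 1 (\<lambda>_. s' z) (\<lambda>_. s z)) cof"
      using s'(2)[unfolded near_def, THEN conjunct2] s'(4)[unfolded local_frame_def near_def, THEN conjunct2]
    proof eventually_elim
      case (elim z)
      have "coords 1 (\<lambda>_. s' z) (s z) 0 = uniformizer x z ^ m"
        using coords_lcomb[OF frame_at_fbasis[OF elim(2)], of 0 "\<lambda>_. uniformizer x z ^ m"] elim(1) by (simp add: lcomb_def)
      then show ?case unfolding transition_det_def by (subst det_single) auto
    qed
    ultimately have "has_ord x (\<lambda>z. transition_det 1 (\<lambda>_. s' z) (\<lambda>_. s z)) (int m)" by (rule has_ord_cong)
    then have "has_det_ord L 1 (\<lambda>_. s) x (int m)" unfolding has_det_ord_def using s'(4) by (intro exI[of _ "\<lambda>_. s'"]) simp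
    then have "det_ord L 1 (\<lambda>_. s) x = int m" by (rule det_ord_eq[OF g x])
    then show ?thesis using s'(3) by auto
  qed
  have "int (card Z) \<le> degree_bundle N C 1 L" if Z: "finite Z" "Z \<subseteq> C" "\<And>x. x \<in> Z \<Longrightarrow> s x = 0" for Z
  proof -
    let ?A = "Z \<union> {x \<in> C. det_ord L 1 (\<lambda>_. s) x \<noteq> 0}"
    have A: "finite ?A" "?A \<subseteq> C" using Z finite_det_ord[OF vbL g] by auto
    have "int (card Z) = (\<Sum>x\<in>Z. 1)" by simp
    also have "\<dots> \<le> (\<Sum>x\<in>Z. det_ord L 1 (\<lambda>_. s) x)" using dd Z by (intro sum_mono) auto
    also have "\<dots> \<le> (\<Sum>x\<in>?A. det_ord L 1 (\<lambda>_. s) x)" using dd A by (intro sum_mono2) auto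
    also have "\<dots> = degree_bundle N C 1 L" by (rule degree_bundle_sum[OF vbL g A, symmetric]) auto
    finally show ?thesis .
  qed
  then show thesis using that vbL subL by blast
qed

end

section \<open>Semistability and spaces of sections\<close>

section \<open>Sections of semistable bundles\<close>

context vector_space
begin

text \<open>Each functional costs at most one vector, chosen outside its kernel. A statement on
  spanning sets is used because it yields finite dimension together with the bound.\<close>

lemma spanning_set_of_functionals:
  fixes \<phi> :: "nat \<Rightarrow> 'b \<Rightarrow> 'a"
  assumes "subspace V"
    and "\<And>i v w. i < M \<Longrightarrow> v \<in> V \<Longrightarrow> w \<in> V \<Longrightarrow> \<phi> i (v + w) = \<phi> i v + \<phi> i w"
    and "\<And>i a v. i < M \<Longrightarrow> v \<in> V \<Longrightarrow> \<phi> i (scale a v) = a * \<phi> i v"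
    and "\<And>v. v \<in> V \<Longrightarrow> (\<And>i. i < M \<Longrightarrow> \<phi> i v = 0) \<Longrightarrow> v \<in> K"
  shows "\<exists>B. finite B \<and> card B \<le> M \<and> V \<subseteq> span (K \<union> B)"
  using assms
proof (induction M arbitrary: V)
  case 0
  then have "V \<subseteq> span (K \<union> {})" using span_superset by auto
  then show ?case by (intro exI[of _ "{}"]) simp
next
  case (Suc M)
  define W where "W = {v \<in> V. \<phi> M v = 0}"
  have scale0: "\<phi> M 0 = 0" using Suc.prems(3)[of M 0 0] subspace_0[OF Suc.prems(1)] by simp
  have W: "subspace W"
    using Suc.prems(1-3) scale0 unfolding W_def by (auto simp: subspace_def)
  have "\<exists>B. finite B \<and> card B \<le> M \<and> W \<subseteq> span (K \<union> B)"
  proof (rule Suc.IH[OF W])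
    show "v \<in> K" if "v \<in> W" "\<And>i. i < M \<Longrightarrow> \<phi> i v = 0" for v
      using that Suc.prems(4)[of v] unfolding W_def by (auto simp: less_Suc_eq)
  qed (use Suc.prems(2,3) in \<open>auto simp: W_def\<close>)
  then obtain B where B: "finite B" "card B \<le> M" "W \<subseteq> span (K \<union> B)" by blast
  show ?case
  proof (cases "V \<subseteq> W")
    case True then show ?thesis using B by (intro exI[of _ B]) auto
  next
    case False
    then obtain g where g: "g \<in> V" "\<phi> M g \<noteq> 0" unfolding W_def by blast
    have "V \<subseteq> span (K \<union> insert g B)"
    proof
      fix v assume v: "v \<in> V"
      let ?c = "\<phi> M v / \<phi> M g"
      have cg: "scale (- ?c) g \<in> V" using Suc.prems(1) g subspace_scale by blast
      have "\<phi> M (v + scale (- ?c) g) = \<phi> M v + \<phi> M (scale (- ?c) g)" using Suc.prems(2) v cg by blast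
      also have "\<phi> M (scale (- ?c) g) = - ?c * \<phi> M g" using Suc.prems(3) g(1) by blast
      also have "\<phi> M v + - ?c * \<phi> M g = 0" using g(2) by simp
      finally have "v + scale (- ?c) g \<in> W" using v cg Suc.prems(1) subspace_add unfolding W_def by blast
      then have "v + scale (- ?c) g \<in> span (K \<union> insert g B)" using B(3) span_mono[of "K \<union> B" "K \<union> insert g B"] by blast
      moreover have "scale ?c g \<in> span (K \<union> insert g B)" by (intro span_scale span_base) simp
      ultimately have "(v + scale (- ?c) g) + scale ?c g \<in> span (K \<union> insert g B)" by (rule span_add)
      then show "v \<in> span (K \<union> insert g B)" by simp
    qed
    moreover have "card (insert g B) \<le> Suc M" using B by (simp add: card_insert_if)
    ultimately show ?thesis using B(1) by (intro exI[of _ "insert g B"] conjI) simp_all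
  qed
qed

end

context curve
begin

lemma H0_iff: "bundle_sheaf E \<Longrightarrow> s \<in> H0 C E \<longleftrightarrow> (\<forall>x. x \<notin> C \<longrightarrow> s x = 0) \<and> (\<forall>x\<in>C. reg_section E x s)"
  by (rule sections_iff) (simp_all add: openin_zariski)

lemma subspace_H0:
  assumes "module_sheaf E" shows "fn2.subspace (H0 C E)"
proof (rule fn2.subspaceI)
  note ps = module_sheafD(1)[OF assms]
  have "(0 :: 'k point \<Rightarrow> 'k vec) = (\<lambda>_. 0)" by (simp add: fun_eq_iff)
  then show "0 \<in> H0 C E" unfolding H0_iff[OF ps] using module_sheafD(3)[OF assms] by auto
  show "s + t \<in> H0 C E" if "s \<in> H0 C E" "t \<in> H0 C E" for s t
  proof -
    have "s + t = (\<lambda>x. s x + t x)" by (simp add: fun_eq_iff)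
    then show ?thesis using that module_sheafD(4)[OF assms] unfolding H0_iff[OF ps] by auto
  qed
  show "fscale2 c s \<in> H0 C E" if "s \<in> H0 C E" for c s
    using that module_sheafD(5)[OF assms reg_const] unfolding H0_iff[OF ps] fscale2_def by auto
qed

text \<open>A nonzero section with these zeros would generate a line subbundle of degree at least
  \<open>card Z\<close>, above the slope of \<open>E\<close>. The case \<open>L = E\<close>, where
  \<open>semistable\<close> makes no claim, has rank 1 and equal slopes.\<close>

lemma semistable_section_zero:
  assumes E: "semistable N C n E" and n: "n \<ge> 1" and Z: "finite Z" "Z \<subseteq> C"
    and slope: "slope (degree_bundle N C n E) n < of_nat (card Z)"
    and s: "s \<in> H0 C E" "\<And>x. x \<in> Z \<Longrightarrow> s x = 0"
  shows "s = 0"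
proof (rule ccontr)
  assume "s \<noteq> 0"
  have vb: "vector_bundle N C n E" using E by (simp add: semistable_def)
  obtain L where L: "vector_bundle N C 1 L" "subbundle L E"
    "\<And>Z. finite Z \<Longrightarrow> Z \<subseteq> C \<Longrightarrow> (\<And>x. x \<in> Z \<Longrightarrow> s x = 0) \<Longrightarrow> int (card Z) \<le> degree_bundle N C 1 L"
    using line_subbundle[OF vb s(1) \<open>s \<noteq> 0\<close>] by blast
  have d: "int (card Z) \<le> degree_bundle N C 1 L" using L(3) Z s(2) by blast
  have "slope (degree_bundle N C 1 L) 1 \<le> slope (degree_bundle N C n E) n"
  proof (cases "L = E")
    case True
    obtain x where "x \<in> C" using C_nonempty by blast
    then obtain e f where "local_frame E n x e" "local_frame E 1 x f" using vb L(1) True unfolding vector_bundle_iff by blast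
    then have "n = 1" using fbasis_card frame_at_fbasis local_frame_frame_at by blast
    then show ?thesis using True by simp
  next
    case False
    then show ?thesis using E L(1,2) unfolding semistable_def by blast
  qed
  moreover have "(of_nat (card Z) :: rat) \<le> slope (degree_bundle N C 1 L) 1"
  proof -
    have "(of_int (int (card Z)) :: rat) \<le> of_int (degree_bundle N C 1 L)" using d by (simp only: of_int_le_iff)
    then show ?thesis by (simp add: slope_def)
  qed
  ultimately show False using slope by linarith
qed

text \<open>Evaluation at \<open>P\<close> points is injective on sections, and each value has
  \<open>n\<close> coordinates. The functional with index \<open>i\<close> is coordinate
  \<open>i mod n\<close> at point number \<open>i div n\<close>. A large \<open>P\<close> gives
  finite dimension, and \<open>P = 1\<close> the bound by the rank.\<close>

lemma semistable_H0_span: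
  assumes E: "semistable N C n E" and n: "n \<ge> 1" and slope: "slope (degree_bundle N C n E) n < of_nat P"
  shows "\<exists>B. finite B \<and> card B \<le> P * n \<and> H0 C E \<subseteq> fn2.span B"
proof -
  have vb: "vector_bundle N C n E" using E by (simp add: semistable_def)
  have sm: "module_sheaf E" using vector_bundle_module_sheaf[OF vb] .
  note ps = module_sheafD(1)[OF sm]
  obtain Z where Z: "finite Z" "card Z = P" "Z \<subseteq> C" using infinite_arbitrarily_large[OF infinite_C] by blast
  obtain xs where xs: "set xs = Z" "length xs = P" using finite_distinct_list[OF Z(1)] Z(2) distinct_card by metis
  have "\<exists>b. fbasis n b (fibre E x)" if "x \<in> C" for x
    using vb that frame_at_fbasis[OF local_frame_frame_at] unfolding vector_bundle_iff by blast
  then obtain b where b: "\<And>x. x \<in> C \<Longrightarrow> fbasis n (b x) (fibre E x)" by metis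
  have fib: "s x \<in> fibre E x" if "s \<in> H0 C E" "x \<in> C" for s x using that reg_section_fibre[OF ps] unfolding H0_iff[OF ps] by blast
  have idx: "xs ! (i div n) \<in> C" "i mod n < n" if "i < P * n" for i
  proof -
    have "i div n < P" using that by (simp add: less_mult_imp_div_less)
    then show "xs ! (i div n) \<in> C" using xs Z(3) nth_mem by blast
    show "i mod n < n" using n by simp
  qed
  have "\<exists>B. finite B \<and> card B \<le> P * n \<and> H0 C E \<subseteq> fn2.span ({0} \<union> B)"
  proof (rule fn2.spanning_set_of_functionals[where \<phi> = "\<lambda>i s. coords n (b (xs ! (i div n))) (s (xs ! (i div n))) (i mod n)"])
    show "fn2.subspace (H0 C E)" by (rule subspace_H0[OF sm])
    show "coords n (b (xs ! (i div n))) ((v + w) (xs ! (i div n))) (i mod n) =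
       coords n (b (xs ! (i div n))) (v (xs ! (i div n))) (i mod n) + coords n (b (xs ! (i div n))) (w (xs ! (i div n))) (i mod n)"
      if "i < P * n" "v \<in> H0 C E" "w \<in> H0 C E" for i v w
      using coords_add[OF b fib fib] idx that by simp
    show "coords n (b (xs ! (i div n))) (fscale2 a v (xs ! (i div n))) (i mod n) = a * coords n (b (xs ! (i div n))) (v (xs ! (i div n))) (i mod n)"
      if "i < P * n" "v \<in> H0 C E" for i a v
      unfolding fscale2_def using coords_scale[OF b fib] idx that by simp
    fix s assume s: "s \<in> H0 C E" and z: "\<And>i. i < P * n \<Longrightarrow> coords n (b (xs ! (i div n))) (s (xs ! (i div n))) (i mod n) = 0"
    have "s x = 0" if x: "x \<in> Z" for x
    proof -
      obtain k where k: "k < P" "xs ! k = x" using x xs by (metis in_set_conv_nth)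
      have "coords n (b x) (s x) j = 0" if j: "j < n" for j
      proof -
        have "k * n + j < P * n"
        proof -
          have "k * n + j < k * n + n" using j by simp
          also have "\<dots> = Suc k * n" by simp
          also have "\<dots> \<le> P * n" using k(1) by (intro mult_le_mono1) simp
          finally show ?thesis .
        qed
        moreover have "(k * n + j) div n = k" "(k * n + j) mod n = j" using j by auto
        ultimately show ?thesis using z[of "k * n + j"] k(2) by simp
      qed
      then have "lcomb n (coords n (b x) (s x)) (b x) = lcomb n (\<lambda>_. 0) (b x)" by (intro lcomb_cong) auto
      moreover have "x \<in> C" using x Z(3) by blast
      ultimately show ?thesis using fbasis_coords[OF b fib[OF s]] by (simp add: lcomb_zero)
    qed
    then show "s \<in> {0}" using semistable_section_zero[OF E n Z(1,3) _ s] slope Z(2) by simp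
  qed
  then show ?thesis by (simp add: fn2.span_insert_0)
qed

lemma H0_finite_dim:
  assumes "semistable N C n E" "n \<ge> 1" shows "\<exists>B. finite B \<and> H0 C E \<subseteq> fn2.span B"
proof -
  obtain P :: nat where "slope (degree_bundle N C n E) n < of_nat P" using reals_Archimedean2 by blast
  then show ?thesis using semistable_H0_span[OF assms] by blast
qed

lemma h0_le_rank:
  assumes "semistable N C n E" "n \<ge> 1" "slope (degree_bundle N C n E) n < 1" shows "h0 C E \<le> n"
proof -
  obtain B where "finite B" "card B \<le> 1 * n" "H0 C E \<subseteq> fn2.span B"
    using semistable_H0_span[OF assms(1,2), of 1] assms(3) by auto
  then show ?thesis unfolding h0_def using fn2.dim_le_card_spanning[of B "H0 C E"] by simp
qed

section \<open>Semistable quotients\<close>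

lemma slope_less_iff: "n \<ge> 1 \<Longrightarrow> m \<ge> 1 \<Longrightarrow> slope d n < slope e m \<longleftrightarrow> d * int m < e * int n"
proof -
  assume "n \<ge> 1" "m \<ge> 1"
  then have "slope d n < slope e m \<longleftrightarrow> (of_int d * of_nat m :: rat) < of_int e * of_nat n"
    by (simp add: slope_def divide_less_eq less_divide_eq mult.commute)
  also have "\<dots> \<longleftrightarrow> (of_int (d * int m) :: rat) < of_int (e * int n)" by simp
  finally show ?thesis by (simp only: of_int_less_iff)
qed

text \<open>Let \<open>F\<close> be of maximal rank among the subbundles whose slope exceeds that of \<open>E\<close>. The preimage in \<open>E\<close> of a
  destabilising subbundle of \<open>E/F\<close> would also have larger slope than \<open>E\<close>.\<close>

theorem semistable_quotient:
  assumes E: "vector_bundle N C n E" and ns: "\<not> semistable N C n E"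
  obtains F Q p m where "vector_bundle N C m F" "subbundle F E" "quot F E Q p" "1 \<le> m" "m < n" "semistable N C (n - m) Q"
    "degree_bundle N C n E = degree_bundle N C m F + degree_bundle N C (n - m) Q"
    "slope (degree_bundle N C (n - m) Q) (n - m) < slope (degree_bundle N C n E) n"
proof -
  let ?d = "degree_bundle N C n E"
  have ps: "bundle_sheaf E" using E by (simp add: vector_bundle_iff)
  have rank: "m < n" if "vector_bundle N C m F" "subbundle F E" "F \<noteq> E" for m F
  proof -
    obtain x where "x \<in> C" using C_nonempty by blast
    then have "m \<le> n" using subbundle_adapted_frame(1)[OF E that(1,2)] by blast
    moreover have "m \<noteq> n" using subbundle_full_rank[OF E] that by blast
    ultimately show ?thesis by simp
  qed
  \<comment> \<open>The slope condition is multiplied out, so that it becomes an inequality of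
    integers.\<close>
  define P where "P m \<longleftrightarrow> 1 \<le> m \<and> m < n \<and> (\<exists>F. vector_bundle N C m F \<and> subbundle F E \<and>
     ?d * int m < degree_bundle N C m F * int n)" for m
  have "\<exists>m. P m"
  proof -
    obtain m F where *: "m \<ge> 1" "vector_bundle N C m F" "subbundle F E" "F \<noteq> E" "\<not> slope (degree_bundle N C m F) m \<le> slope ?d n"
      using ns E unfolding semistable_def by blast
    have "m < n" using rank * by blast
    then have "?d * int m < degree_bundle N C m F * int n" using * slope_less_iff[of n m ?d] by (simp add: not_le)
    then show ?thesis using * \<open>m < n\<close> unfolding P_def by blast
  qed
  then obtain m0 where "P m0" by blast
  then have "\<exists>m. P m \<and> (\<forall>y. P y \<longrightarrow> y \<le> m)"
    by (rule ex_has_greatest_nat[where b = n]) (auto simp: P_def)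
  then obtain m where m: "P m" "\<And>y. P y \<Longrightarrow> y \<le> m" by blast
  then obtain F where F: "vector_bundle N C m F" "subbundle F E" "?d * int m < degree_bundle N C m F * int n" "1 \<le> m" "m < n"
    unfolding P_def by blast
  obtain Q p where Q: "quot F E Q p" "vector_bundle N C (n - m) Q" using quotient_bundle[OF E F(1,2)] by blast
  have psQ: "bundle_sheaf Q" using Q(2) by (simp add: vector_bundle_iff)
  have deg: "?d = degree_bundle N C m F + degree_bundle N C (n - m) Q"
    using degree_exact[OF Q(1) F(1) Q(2)] F(5) by simp
  let ?dF = "degree_bundle N C m F" and ?dQ = "degree_bundle N C (n - m) Q"
  have nm: "int (n - m) = int n - int m" using F(5) by simp
  have "semistable N C (n - m) Q"
    unfolding semistable_def
  proof (intro conjI allI impI Q(2))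
    fix l G assume G: "l \<ge> 1 \<and> vector_bundle N C l G \<and> subbundle G Q \<and> G \<noteq> Q"
    show "slope (degree_bundle N C l G) l \<le> slope ?dQ (n - m)"
    proof (rule ccontr)
      assume "\<not> ?thesis"
      then have less: "?dQ * int l < degree_bundle N C l G * int (n - m)"
        using slope_less_iff[of "n - m" l ?dQ "degree_bundle N C l G"] G F(5) by (simp add: not_le)
      have "l < n - m"
      proof -
        obtain x where "x \<in> C" using C_nonempty by blast
        then have "l \<le> n - m" using subbundle_adapted_frame(1)[OF Q(2)] G by blast
        moreover have "l \<noteq> n - m" using subbundle_full_rank[OF Q(2)] G by blast
        ultimately show ?thesis by simp
      qed
      obtain F' where F': "quot F F' G p" "subbundle F' E" "vector_bundle N C (m + l) F'"
        using preimage_bundle[OF Q(1) psQ _ _ F(1)] G by blast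
      let ?dG = "degree_bundle N C l G"
      have d': "degree_bundle N C (m + l) F' = ?dF + ?dG" using degree_exact[OF F'(1) F(1)] G by blast
      have "?d * int (m + l) < (?dF + ?dG) * int n"
      proof -
        have 1: "?dQ * int m < ?dF * (int n - int m)" using F(3) unfolding deg by (simp add: algebra_simps)
        have 2: "?dQ * int l < ?dG * (int n - int m)" using less unfolding nm .
        have pos: "int n - int m > 0" using F(5) by simp
        \<comment> \<open>Write \<open>x\<close> for the excess \<open>dF (n - m) - dQ m\<close> of
          \<open>F\<close> over \<open>Q\<close> and \<open>y\<close> for the excess
          \<open>dG (n - m) - dQ l\<close> of \<open>G\<close> over \<open>Q\<close>. The right-hand
          side is \<open>x (n - m - l) + n y\<close>, and both summands are positive because
          \<open>l < n - m\<close>.\<close>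
        have key: "(int n - int m) * ((?dF + ?dG) * int n - (?dF + ?dQ) * (int m + int l))
           = (int n - int m) * ((?dF * (int n - int m) - ?dQ * int m)) + (int n) * (?dG * (int n - int m) - ?dQ * int l)
             + (?dQ * int m - ?dF * (int n - int m)) * int l"
          by (simp add: algebra_simps)
        have "(int n - int m) * ((?dF + ?dG) * int n - (?dF + ?dQ) * (int m + int l)) > 0"
        proof -
          have a: "?dF * (int n - int m) - ?dQ * int m > 0" using 1 by simp
          have b: "int n * (?dG * (int n - int m) - ?dQ * int l) > 0" using 2 F(5) by (intro mult_pos_pos) auto
          have "int l < int n - int m" using \<open>l < n - m\<close> by simp
          then have c: "(?dF * (int n - int m) - ?dQ * int m) * (int n - int m - int l) > 0" using a by (intro mult_pos_pos) auto
          show ?thesis unfolding key using b c by (simp add: algebra_simps)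
        qed
        then have "(?dF + ?dG) * int n - (?dF + ?dQ) * (int m + int l) > 0" using pos by (simp add: zero_less_mult_iff)
        then show ?thesis unfolding deg by simp
      qed
      then have "P (m + l)" unfolding P_def using F'(2,3) d' F(4) \<open>l < n - m\<close> by auto
      then show False using m(2) G by fastforce
    qed
  qed
  moreover have "slope ?dQ (n - m) < slope ?d n"
  proof -
    have "?dQ * int n < ?d * int (n - m)" using F(3) unfolding nm deg by (simp add: algebra_simps)
    then show ?thesis using slope_less_iff[of "n - m" n ?dQ ?d] F(5) by simp
  qed
  ultimately show thesis using that F Q deg by blast
qed

text \<open>Applying \<open>p\<close> sends \<open>V\<close> to sections of \<open>Q\<close> with
  kernel \<open>V \<inter> H0 C F\<close>. The coordinates of the image in a basis of
  \<open>H0 C Q\<close> are the functionals that bound the codimension of this kernel.\<close>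

lemma dim_sections_le:
  assumes X: "quot F E Q p" and psF: "bundle_sheaf F" and psQ: "bundle_sheaf Q"
    and V: "fn2.subspace V" "V \<subseteq> H0 C E" and fin: "finite B" "H0 C Q \<subseteq> fn2.span B" and finV: "finite D" "V \<subseteq> fn2.span D"
  shows "fn2.dim V \<le> fn2.dim (V \<inter> H0 C F) + h0 C Q"
proof -
  note ps = module_sheafD(1)[OF quotD(1)[OF X]]
  define T where "T s = (\<lambda>x. if x \<in> C then p x (s x) else 0)" for s :: "'k point \<Rightarrow> 'k vec"
  have fib: "s x \<in> fibre E x" if "s \<in> V" "x \<in> C" for s x
    using that V(2) reg_section_fibre[OF ps] H0_iff[OF ps] by blast
  have T: "T s \<in> H0 C Q" if s: "s \<in> V" for s
  proof -
    have "reg_section Q x (T s)" if x: "x \<in> C" for x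
    proof -
      have "reg_section E x s" using s V(2) x H0_iff[OF ps] by blast
      from quotD(5)[OF X this] show ?thesis
        by (rule reg_section_cong[OF psQ]) (rule near_mono[OF near_inC[OF x]], simp add: T_def)
    qed
    then show ?thesis unfolding H0_iff[OF psQ] by (simp add: T_def)
  qed
  have Tadd: "T (s + t) = T s + T t" if "s \<in> V" "t \<in> V" for s t
    using quotD(2)[OF X] fib[OF that(1)] fib[OF that(2)] unfolding linear_on_def T_def by (auto simp: fun_eq_iff)
  have Tscale: "T (fscale2 c s) = fscale2 c (T s)" if "s \<in> V" for s c
    using quotD(2)[OF X] fib[OF that] unfolding linear_on_def T_def fscale2_def by (auto simp: fun_eq_iff)
  obtain B' where B': "B' \<subseteq> H0 C Q" "fn2.independent B'" "H0 C Q \<subseteq> fn2.span B'" "card B' = fn2.dim (H0 C Q)"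
    using fn2.basis_exists by metis
  have fB': "finite B'" using fn2.independent_span_bound[OF fin(1) B'(2)] B'(1) fin(2) by blast
  obtain bs where bs: "set bs = B'" "distinct bs" using finite_distinct_list[OF fB'] by blast
  have lbs: "length bs = h0 C Q" using bs B'(4) distinct_card by (metis h0_def)
  have TB: "T s \<in> fn2.span B'" if "s \<in> V" for s using T[OF that] B'(3) by blast
  have "\<exists>A. finite A \<and> card A \<le> h0 C Q \<and> V \<subseteq> fn2.span (V \<inter> H0 C F \<union> A)"
  proof (rule fn2.spanning_set_of_functionals[where \<phi> = "\<lambda>i s. fn2.representation B' (T s) (bs ! i)"])
    show "fn2.subspace V" by (rule V(1))
    show "fn2.representation B' (T (v + w)) (bs ! i) = fn2.representation B' (T v) (bs ! i) + fn2.representation B' (T w) (bs ! i)"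
      if "v \<in> V" "w \<in> V" for i v w
      unfolding Tadd[OF that] using fn2.representation_add[OF B'(2) TB[OF that(1)] TB[OF that(2)]] fn2.representation_add[OF B'(2) TB[OF that(2)] TB[OF that(1)]] by simp
    show "fn2.representation B' (T (fscale2 a v)) (bs ! i) = a * fn2.representation B' (T v) (bs ! i)" if "v \<in> V" for i a v
      unfolding Tscale[OF that] using fn2.representation_scale[OF B'(2) TB[OF that]] by simp
    fix v assume v: "v \<in> V" and z: "\<And>i. i < h0 C Q \<Longrightarrow> fn2.representation B' (T v) (bs ! i) = 0"
    have "fn2.representation B' (T v) b = 0" if "b \<in> B'" for b
      using z that bs(1) lbs by (metis in_set_conv_nth)
    then have "(\<Sum>b\<in>B'. fscale2 (fn2.representation B' (T v) b) b) = 0" by simp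
    moreover have "(\<Sum>b\<in>B'. fscale2 (fn2.representation B' (T v) b) b) = T v"
      by (rule fn2.sum_representation_eq[OF B'(2) TB[OF v] fB']) simp
    ultimately have T0: "T v = 0" by simp
    have "p x (v x) = 0" if "x \<in> C" for x using fun_cong[OF T0, of x] that by (simp add: T_def)
    then have vF: "v x \<in> fibre F x" if "x \<in> C" for x using quotD(4)[OF X that] fib[OF v that] that by simp
    have "v \<in> H0 C E" using v V(2) by blast
    then have vH: "(\<forall>x. x \<notin> C \<longrightarrow> v x = 0) \<and> (\<forall>x\<in>C. reg_section E x v)" unfolding H0_iff[OF ps] .
    have "reg_section F x v" if x: "x \<in> C" for x
    proof -
      have "near x (\<lambda>z. v z \<in> fibre F z)" by (rule near_mono[OF near_inC[OF x]]) (rule vF)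
      moreover have "reg_section E x v" using vH x by simp
      ultimately show ?thesis using quotD(7)[OF X] by simp
    qed
    moreover have "v x = 0" if "x \<notin> C" for x using vH that by simp
    ultimately have "v \<in> H0 C F" using iffD2[OF H0_iff[OF psF]] by simp
    then show "v \<in> V \<inter> H0 C F" using v by simp
  qed
  then obtain A where A: "finite A" "card A \<le> h0 C Q" "V \<subseteq> fn2.span (V \<inter> H0 C F \<union> A)" by blast
  obtain A' where A': "A' \<subseteq> V \<inter> H0 C F" "fn2.independent A'" "V \<inter> H0 C F \<subseteq> fn2.span A'" "card A' = fn2.dim (V \<inter> H0 C F)"
    using fn2.basis_exists by metis
  have fA': "finite A'" using fn2.independent_span_bound[OF finV(1) A'(2)] A'(1) finV(2) by blast
  have "V \<inter> H0 C F \<union> A \<subseteq> fn2.span (A' \<union> A)"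
    using A'(3) fn2.span_mono[of A' "A' \<union> A"] fn2.span_superset[of "A' \<union> A"] by blast
  then have "fn2.span (V \<inter> H0 C F \<union> A) \<subseteq> fn2.span (A' \<union> A)" by (rule fn2.span_minimal) (rule fn2.subspace_span)
  then have "fn2.dim V \<le> card (A' \<union> A)" using A(1,3) fA' by (intro fn2.dim_le_card_spanning) auto
  also have "\<dots> \<le> card A' + card A" by (rule card_Un_le)
  finally show ?thesis using A(2) A'(4) by simp
qed

end

section \<open>From coherent systems to semistable bundles and the final estimate\<close>

section \<open>Coherent systems\<close>

context curve
begin

text \<open>The last conclusion is \<open>k / n \<le> h0 C Q / l\<close> with denominators cleared.
  It holds for \<open>Q = E / F\<close> because \<open>F\<close> carries a share of the sections
  smaller than its share of the rank.\<close>

lemma alpha_semistable_dominated: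
  assumes ss: "alpha_semistable N C \<alpha> (n, d, k) (E, V)" and \<alpha>: "\<alpha> > 0" and k: "k \<ge> 1"
  obtains Q l where "semistable N C l Q" "1 \<le> l" "slope (degree_bundle N C l Q) l \<le> slope d n" "k * l \<le> h0 C Q * n"
proof -
  have cs: "n \<ge> 1" "vector_bundle N C n E" "degree_bundle N C n E = d" "fn2.subspace V" "V \<subseteq> H0 C E" "fn2.dim V = k"
    using ss unfolding alpha_semistable_def coherent_system_def by auto
  show thesis
  proof (cases "semistable N C n E")
    case True
    obtain B where B: "finite B" "H0 C E \<subseteq> fn2.span B" using H0_finite_dim[OF True cs(1)] by blast
    obtain B' where B': "B' \<subseteq> H0 C E" "fn2.independent B'" "H0 C E \<subseteq> fn2.span B'" "card B' = fn2.dim (H0 C E)"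
      using fn2.basis_exists by metis
    have "finite B'" using fn2.independent_span_bound[OF B(1) B'(2)] B'(1) B(2) by blast
    then have "fn2.dim V \<le> card B'" using cs(5) B'(3) by (intro fn2.dim_le_card_spanning) auto
    then have "k \<le> h0 C E" using cs(6) B'(4) by (simp add: h0_def)
    then show thesis using True cs(1,3) by (intro that[of n E]) auto
  next
    case False
    obtain F Q p m where FQ: "vector_bundle N C m F" "subbundle F E" "quot F E Q p" "1 \<le> m" "m < n" "semistable N C (n - m) Q"
      "degree_bundle N C n E = degree_bundle N C m F + degree_bundle N C (n - m) Q"
      "slope (degree_bundle N C (n - m) Q) (n - m) < slope (degree_bundle N C n E) n"
      using semistable_quotient[OF cs(2) False] by metis
    let ?W = "V \<inter> H0 C F" and ?dF = "degree_bundle N C m F" and ?dQ = "degree_bundle N C (n - m) Q"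
    define w where "w = fn2.dim ?W"
    have psF: "bundle_sheaf F" using FQ(1) by (simp add: vector_bundle_iff)
    have vbQ: "vector_bundle N C (n - m) Q" using FQ(6) by (simp add: semistable_def)
    have psQ: "bundle_sheaf Q" using vbQ by (simp add: vector_bundle_iff)
    have nm: "n - m \<ge> 1" using FQ(5) by simp
    obtain D where D: "D \<subseteq> V" "fn2.independent D" "V \<subseteq> fn2.span D" "card D = fn2.dim V"
      using fn2.basis_exists by metis
    \<comment> \<open>Its cardinality is \<open>k \<ge> 1\<close>, while an infinite set has
      \<open>card\<close> 0.\<close>
    have fD: "finite D" using D(4) cs(6) k by (intro card_ge_0_finite) simp
    obtain B where B: "finite B" "H0 C Q \<subseteq> fn2.span B" using H0_finite_dim[OF FQ(6) nm] by blast
    have kle: "k \<le> w + h0 C Q"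
      using dim_sections_le[OF FQ(3) psF psQ cs(4,5) B fD D(3)] cs(6) by (simp add: w_def)
    have "F \<noteq> E"
    proof
      assume "F = E"
      obtain x where x: "x \<in> C" using C_nonempty by blast
      obtain e f where "local_frame E n x e" "local_frame F m x f" using cs(2) FQ(1) x unfolding vector_bundle_iff by blast
      then have "n = m" using fbasis_card frame_at_fbasis local_frame_frame_at \<open>F = E\<close> by blast
      then show False using FQ(5) by simp
    qed
    moreover have "fn2.subspace ?W" using cs(4) subspace_H0[OF vector_bundle_module_sheaf[OF FQ(1)]] by (rule fn2.subspace_inter)
    ultimately have "proper_subsystem N C (m, ?dF, w) (F, ?W) (E, V)"
      unfolding proper_subsystem_def coherent_system_def using FQ(1,2,4) by (simp add: w_def)
    then have sl: "alpha_slope \<alpha> (m, ?dF, w) \<le> alpha_slope \<alpha> (n, d, k)" using ss unfolding alpha_semistable_def by blast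
    have "slope ?dQ (n - m) < slope d n" using FQ(8) cs(3) by simp
    then have "?dQ * int n < d * int (n - m)" using slope_less_iff[of "n - m" n ?dQ d] nm cs(1) by simp
    then have "d * int m < ?dF * int n" using FQ(5,7) cs(3) by (simp add: algebra_simps)
    then have "real_of_int (d * int m) < real_of_int (?dF * int n)" by (simp only: of_int_less_iff)
    then have "real_of_int d / real n < real_of_int ?dF / real m"
      using FQ(4) cs(1) by (simp add: divide_less_eq less_divide_eq mult.commute)
    \<comment> \<open>Subtracting the strict inequality for the degree parts from the one for the
      \<alpha>-slopes leaves a strict inequality in the opposite direction for the section
      parts.\<close>
    then have "\<alpha> * (real w / real m) < \<alpha> * (real k / real n)" using sl unfolding alpha_slope_def by simp
    then have "real w / real m < real k / real n" using \<alpha> by (simp only: mult_less_cancel_left_pos)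
    then have "real w * real n < real k * real m"
      using FQ(4) cs(1) by (simp add: divide_less_eq less_divide_eq mult.commute)
    then have "real (w * n) < real (k * m)" by simp
    then have wn: "w * n < k * m" by (simp only: of_nat_less_iff)
    have "k * n \<le> w * n + h0 C Q * n" using mult_le_mono1[OF kle, of n] by (simp add: distrib_right)
    then have "k * n \<le> k * m + h0 C Q * n" using wn by simp
    then have "k * (n - m) \<le> h0 C Q * n" by (simp add: diff_mult_distrib2)
    then show thesis using that[OF FQ(6) nm] FQ(8) cs(3) by simp
  qed
qed

end

text \<open>All slopes \<open>a i\<close> are positive and consecutive pieces agree at the
  breakpoints, so the bound is increasing. The claim also names an interval that contains \<nu>,
  since the bound for bundles is stated interval by interval.\<close>

lemma piecewise_linear_bound:
  fixes \<delta> a b :: "nat \<Rightarrow> rat"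
  assumes "\<delta> 1 = 1" and "\<And>i. 1 \<le> i \<Longrightarrow> i + 1 \<le> r \<Longrightarrow> \<delta> i < \<delta> (i + 1)"
    and "0 < a 1" and "\<And>i. 1 \<le> i \<Longrightarrow> i + 1 \<le> r - 1 \<Longrightarrow> a i < a (i + 1)" and "a 1 + b 1 = 1"
    and "\<And>i. 1 \<le> i \<Longrightarrow> i \<le> r - 2 \<Longrightarrow> a i * \<delta> (i + 1) + b i = a (i + 1) * \<delta> (i + 1) + b (i + 1)"
    and "1 \<le> i" "i \<le> r - 1" "\<delta> i \<le> \<mu>" "\<mu> \<le> \<delta> (i + 1)"
  shows "0 < a i \<and> 1 \<le> a i * \<mu> + b i \<and>
    (\<forall>\<nu>. 1 \<le> \<nu> \<and> \<nu> \<le> \<mu> \<longrightarrow> (\<exists>j. 1 \<le> j \<and> j \<le> i \<and> \<delta> j \<le> \<nu> \<and> \<nu> \<le> \<delta> (j + 1) \<and> a j * \<nu> + b j \<le> a i * \<mu> + b i))"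
  using assms(7-10)
proof (induction i arbitrary: \<mu> rule: dec_induct)
  case base
  have le: "a 1 * \<nu> + b 1 \<le> a 1 * \<mu> + b 1" if "\<nu> \<le> \<mu>" for \<nu>
    using mult_left_mono[OF that, of "a 1"] assms(3) by simp
  have "1 \<le> \<mu>" using base assms(1) by simp
  then have "1 \<le> a 1 * \<mu> + b 1" using le[of 1] assms(5) by simp
  moreover have "\<exists>j. 1 \<le> j \<and> j \<le> 1 \<and> \<delta> j \<le> \<nu> \<and> \<nu> \<le> \<delta> (j + 1) \<and> a j * \<nu> + b j \<le> a 1 * \<mu> + b 1"
    if "1 \<le> \<nu>" "\<nu> \<le> \<mu>" for \<nu>
    using le[OF that(2)] that base assms(1) by (intro exI[of _ 1]) simp
  ultimately show ?case using assms(3) by blast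
next
  case (step i)
  have si: "Suc i = i + 1" by simp
  have i: "1 \<le> i" "i + 1 \<le> r - 1" using step by auto
  have "\<delta> i < \<delta> (i + 1)" using assms(2)[of i] i by simp
  \<comment> \<open>The induction hypothesis is taken at the breakpoint
    \<open>\<delta> (i + 1)\<close>, which is the right end of the old interval and the left end of
    the new one.\<close>
  then have IH: "0 < a i" "1 \<le> a i * \<delta> (i + 1) + b i"
    "\<And>\<nu>. 1 \<le> \<nu> \<Longrightarrow> \<nu> \<le> \<delta> (i + 1) \<Longrightarrow>
      \<exists>j. 1 \<le> j \<and> j \<le> i \<and> \<delta> j \<le> \<nu> \<and> \<nu> \<le> \<delta> (j + 1) \<and> a j * \<nu> + b j \<le> a i * \<delta> (i + 1) + b i"
    using step.IH[of "\<delta> (i + 1)"] i by auto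
  have pos: "0 < a (i + 1)" using IH(1) assms(4)[OF i] by simp
  have eq: "a i * \<delta> (i + 1) + b i = a (i + 1) * \<delta> (i + 1) + b (i + 1)" using i by (intro assms(6)) simp_all
  have le: "a (i + 1) * \<nu> + b (i + 1) \<le> a (i + 1) * \<mu> + b (i + 1)" if "\<nu> \<le> \<mu>" for \<nu>
    using mult_left_mono[OF that, of "a (i + 1)"] pos by simp
  have \<mu>: "\<delta> (i + 1) \<le> \<mu>" "\<mu> \<le> \<delta> (i + 1 + 1)" using step.prems by simp_all
  have up: "a i * \<delta> (i + 1) + b i \<le> a (i + 1) * \<mu> + b (i + 1)" unfolding eq by (rule le[OF \<mu>(1)])
  have "\<exists>j. 1 \<le> j \<and> j \<le> i + 1 \<and> \<delta> j \<le> \<nu> \<and> \<nu> \<le> \<delta> (j + 1) \<and> a j * \<nu> + b j \<le> a (i + 1) * \<mu> + b (i + 1)"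
    if \<nu>: "1 \<le> \<nu>" "\<nu> \<le> \<mu>" for \<nu>
  proof (cases "\<nu> \<le> \<delta> (i + 1)")
    case True
    then obtain j where j: "1 \<le> j" "j \<le> i" "\<delta> j \<le> \<nu>" "\<nu> \<le> \<delta> (j + 1)" "a j * \<nu> + b j \<le> a i * \<delta> (i + 1) + b i"
      using IH(3)[OF \<nu>(1)] by blast
    then have "a j * \<nu> + b j \<le> a (i + 1) * \<mu> + b (i + 1)" using up by linarith
    then show ?thesis using j by (intro exI[of _ j]) simp
  next
    case False
    then show ?thesis using le[OF \<nu>(2)] \<nu> \<mu> by (intro exI[of _ "i + 1"]) simp
  qed
  moreover have "1 \<le> a (i + 1) * \<mu> + b (i + 1)" using IH(2) up by linarith
  ultimately show ?case using pos unfolding si by blast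
qed

theorem theorem3p1:
  fixes C :: "'k::alg_closed_field point set" and N r :: nat
    and \<delta> a b :: "nat \<Rightarrow> rat"
  assumes curve: "smooth_projective_curve N C"
    and genus: "genus N C \<ge> 2"
    and r: "r \<ge> 2"
    and i: "\<delta> 1 = 1" "\<And>i. 1 \<le> i \<Longrightarrow> i + 1 \<le> r \<Longrightarrow> \<delta> i < \<delta> (i + 1)"
    and ii: "0 < a 1" "\<And>i. 1 \<le> i \<Longrightarrow> i + 1 \<le> r - 1 \<Longrightarrow> a i < a (i + 1)"
    and iii: "a 1 + b 1 = 1"
    and iv: "\<And>i. 1 \<le> i \<Longrightarrow> i \<le> r - 2 \<Longrightarrow>
               a i * \<delta> (i + 1) + b i = a (i + 1) * \<delta> (i + 1) + b (i + 1)"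
    and bundles: "\<And>E n d k i. n \<ge> 1 \<Longrightarrow> semistable N C n E \<Longrightarrow> degree_bundle N C n E = d \<Longrightarrow>
               h0 C E = k \<Longrightarrow> k \<ge> 1 \<Longrightarrow> 1 \<le> i \<Longrightarrow> i \<le> r - 1 \<Longrightarrow>
               \<delta> i \<le> slope d n \<Longrightarrow> slope d n \<le> \<delta> (i + 1) \<Longrightarrow>
               of_nat k \<le> (a i * slope d n + b i) * of_nat n"
  shows "\<forall>E V n d k. coherent_system N C (n, d, k) (E, V) \<and> k \<ge> 1 \<and>
           (\<exists>\<alpha>>0. alpha_semistable N C \<alpha> (n, d, k) (E, V)) \<longrightarrow>
           (\<forall>i. 1 \<le> i \<and> i \<le> r - 1 \<longrightarrow> \<delta> i \<le> slope d n \<and> slope d n \<le> \<delta> (i + 1) \<longrightarrow>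
              of_nat k \<le> (a i * slope d n + b i) * of_nat n)"
proof (intro allI impI)
  fix E V n d k i
  assume *: "coherent_system N C (n, d, k) (E, V) \<and> k \<ge> 1 \<and> (\<exists>\<alpha>>0. alpha_semistable N C \<alpha> (n, d, k) (E, V))"
    and i': "1 \<le> i \<and> i \<le> r - 1" and \<mu>: "\<delta> i \<le> slope d n \<and> slope d n \<le> \<delta> (i + 1)"
  interpret curve N C by unfold_locales (rule curve)
  let ?v = "a i * slope d n + b i"
  have n: "n \<ge> 1" using * by (simp add: coherent_system_def)
  obtain \<alpha> where \<alpha>: "\<alpha> > 0" "alpha_semistable N C \<alpha> (n, d, k) (E, V)" using * by blast
  have k: "k \<ge> 1" using * by blast
  obtain Q l where Q: "semistable N C l Q" "1 \<le> l" "slope (degree_bundle N C l Q) l \<le> slope d n" "k * l \<le> h0 C Q * n"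
    using alpha_semistable_dominated[OF \<alpha>(2,1) k] by blast
  let ?\<nu> = "slope (degree_bundle N C l Q) l"
  have pl: "1 \<le> ?v" "\<And>\<nu>. 1 \<le> \<nu> \<Longrightarrow> \<nu> \<le> slope d n \<Longrightarrow>
      \<exists>j. 1 \<le> j \<and> j \<le> i \<and> \<delta> j \<le> \<nu> \<and> \<nu> \<le> \<delta> (j + 1) \<and> a j * \<nu> + b j \<le> ?v"
    using piecewise_linear_bound[of \<delta> r a b i "slope d n", OF i ii iii iv] i' \<mu> by auto
  have "of_nat (h0 C Q) \<le> ?v * of_nat l"
  proof (cases "?\<nu> < 1")
    case True
    then have "h0 C Q \<le> l" using h0_le_rank[OF Q(1,2)] by blast
    then have "(of_nat (h0 C Q) :: rat) \<le> 1 * of_nat l" by simp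
    also have "\<dots> \<le> ?v * of_nat l" using pl(1) by (intro mult_right_mono) simp_all
    finally show ?thesis .
  next
    case False
    then obtain j where j: "1 \<le> j" "j \<le> i" "\<delta> j \<le> ?\<nu>" "?\<nu> \<le> \<delta> (j + 1)" "a j * ?\<nu> + b j \<le> ?v"
      using pl(2)[of ?\<nu>] Q(3) by (auto simp: not_less)
    \<comment> \<open>The hypothesis on bundles requires a section of \<open>Q\<close>; there is one
      because \<open>k * l\<close> is positive and at most \<open>h0 C Q * n\<close>.\<close>
    have "0 < k * l" using k Q(2) by simp
    then have "h0 C Q \<ge> 1" using Q(4) by (cases "h0 C Q") simp_all
    moreover have "j \<le> r - 1" using j(2) i' by simp
    ultimately have "of_nat (h0 C Q) \<le> (a j * ?\<nu> + b j) * of_nat l"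
      by (intro bundles[OF Q(2,1) refl refl _ j(1) _ j(3,4)])
    also have "\<dots> \<le> ?v * of_nat l" using j(5) by (intro mult_right_mono) simp_all
    finally show ?thesis .
  qed
  \<comment> \<open>Combined with \<open>k * l \<le> h0 C Q * n\<close>, this gives the claim
    multiplied by the positive rank \<open>l\<close> of \<open>Q\<close>.\<close>
  then have "of_nat (h0 C Q) * of_nat n \<le> ?v * of_nat l * of_nat n" by (intro mult_right_mono) simp_all
  moreover have "(of_nat (k * l) :: rat) \<le> of_nat (h0 C Q * n)" using Q(4) by (simp only: of_nat_le_iff)
  ultimately have "of_nat k * of_nat l \<le> ?v * of_nat n * of_nat l" by (simp add: ac_simps)
  then show "of_nat k \<le> ?v * of_nat n" using Q(2) by simp
qed

end
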